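(* Let $m,\beta_0,\beta_\infty>0$ and let $\omega=\mathtt{p}^*\omega_\Sigma+\sqrt{-1}\partial\bar\partial f(s)$ be a momentum-constructed conical Kähler metric on $X=\mathbb{P}(L\oplus\mathcal{O})$ in the Kähler class $2\pi(\mathsf{C}+mS_\infty)$, with cone angles $2\pi\beta_0$ and $2\pi\beta_\infty$ along $S_0$ and $S_\infty$. Let $\mathtt{h}=1+f'(s)$ be the real holomorphy potential of $w\frac{\partial}{\partial w}$ with respect to $\omega$. Then all the integrals in $$\mathcal{F}_{\log;\beta_0,\beta_\infty}\left(w\tfrac{\partial}{\partial w},\omega\right)=-\int_X\mathtt{h}\,c_2(\omega)+\frac{\lambda_0(\omega)}{2(2\pi)^2}\int_X\mathtt{h}\,\omega^2+\frac{\beta_0-1}{\pi}\left(\int_{S_0}\mathtt{h}\,\omega-\frac{\int_{S_0}\omega}{\int_X\omega^2}\int_X\mathtt{h}\,\omega^2\right)+\frac{\beta_\infty-1}{(m+1)\pi}\left(\int_{S_\infty}\mathtt{h}\,\omega-\frac{\int_{S_\infty}\omega}{\int_X\omega^2}\int_X\mathtt{h}\,\omega^2\right)$$ are well-defined and finite, and $$\mathcal{F}_{\log;\beta_0,\beta_\infty}\left(w\tfrac{\partial}{\partial w},\omega\right)=-\frac{1}{2(2\pi)^2}\int_{X\smallsetminus(S_0\cup S_\infty)}\mathtt{h}\left(\lambda(\omega)-\lambda_1(\omega)\right)\omega^2 .$$ In particular, if $\omega$ is a momentum-constructed conical higher cscK metric (i.e. $\lambda(\omega)$ is constant on $X\smallsetminus(S_0\cup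 S_\infty)$), then $\mathcal{F}_{\log;\beta_0,\beta_\infty}\left(w\tfrac{\partial}{\partial w},\omega\right)=0$.
   Context: Surface. $\Sigma$ is a compact Riemann surface of genus $2$ with a Kähler metric $\omega_\Sigma$ with $\mathrm{Ric}(\omega_\Sigma)=-2\omega_\Sigma$ (so $\int_\Sigma\omega_\Sigma=2\pi$); $L\to\Sigma$ is a holomorphic line bundle of degree $-1$ with a Hermitian metric $h$ of curvature form $-\omega_\Sigma$ (so $\sqrt{-1}\partial\bar\partial\ln h=\omega_\Sigma$ locally). $X=\mathbb{P}(L\oplus\mathcal{O})$ with projection $\mathtt{p}:X\to\Sigma$, $\mathsf{C}$ is a fibre, $S_0=\mathbb{P}(\{0\}\oplus\mathcal{O})$, $S_\infty=\mathbb{P}(L\oplus\{0\})$. On $X\smallsetminus(S_0\cup S_\infty)$, $s=\ln|w|^2+\ln h(z)$ with $z$ a local coordinate on $\Sigma$ and $w$ a fibre coordinate of $L$. Momentum-constructed conical metric. $\omega=\mathtt{p}^*\omega_\Sigma+\sqrt{-1}\partial\bar\partial f(s)$ with $f:\mathbb{R}\to\mathbb{R}$ smooth, strictly convex, $\lim_{s\to-\infty}f'(s)=0$, $\lim_{s\to\infty}f'(s)=m$ (class $2\pi(\mathsf{C}+mS_\infty)$), whose momentum profile $\phi(\gamma)=f''(s)$, $\gamma=1+f'(s)$, is smooth on $[1,m+1]$, positive on $(1,m+1)$, with $\phi(1)=\phi(m+1)=0$, $\phi'(1)=\beta_0$, $\phi'(m+1)=-\beta_\infty$ (these boundary conditions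 encode the cone angles). The function $\mathtt{h}=1+f'(s)$ extends continuously to $X$, with value $1$ on $S_0$ and $m+1$ on $S_\infty$. Curvature. On $X\smallsetminus(S_0\cup S_\infty)$, with $H$ the Hermitian matrix of $\omega$ and $\Theta(\omega)=\bar\partial(H^{-1}\partial H)$, the higher scalar curvature $\lambda(\omega)$ is defined by $\det\left(\frac{\sqrt{-1}}{2\pi}\Theta(\omega)\right)=\frac{\lambda(\omega)}{2(2\pi)^2}\omega^2$, and $\lambda_1(\omega)=\int_{X\smallsetminus(S_0\cup S_\infty)}\lambda(\omega)\omega^2\big/\int_{X\smallsetminus(S_0\cup S_\infty)}\omega^2$. The top Chern current on $X$ is $$c_2(\omega)=\frac{\lambda(\omega)}{2(2\pi)^2}\omega^2+\frac{\beta_0-1}{\pi}\,\omega\wedge[S_0]+\frac{\beta_\infty-1}{(m+1)\pi}\,\omega\wedge[S_\infty],$$ and $\lambda_0(\omega)=2(2\pi)^2\int_Xc_2(\omega)\big/\int_X\omega^2$. Here $[S_0],[S_\infty]$ are currents of integration and the wedge products are Bedford–Taylor products: near $S_0$, $\omega=\mathtt{p}^*\omega_\Sigma+\sqrt{-1}\partial\bar\partial f(s)$ with $f(s)$ extending continuously across $S_0$, and $\omega\wedge[S_0]=\mathtt{p}^*\omega_\Sigma\wedge[S_0]+\sqrt{-1}\partial\bar\partial\left(f(s)[S_0]\right)$; near $S_\infty$, $\omega=(m+1)\mathtt{p}^*\omega_\Sigma+\sqrt{-1}\partial\bar\partial(f(s)-ms)$ with $f(s)-ms$ extending continuously across $S_\infty$,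 and $\omega\wedge[S_\infty]=(m+1)\mathtt{p}^*\omega_\Sigma\wedge[S_\infty]+\sqrt{-1}\partial\bar\partial\left((f(s)-ms)[S_\infty]\right)$. These are measures, and $\int_{S_0}\varphi\,\omega:=(\omega\wedge[S_0])(\varphi)$, $\int_{S_\infty}\varphi\,\omega:=(\omega\wedge[S_\infty])(\varphi)$, also for merely continuous $\varphi$ such as $\mathtt{h}$. Integrals $\int_X\varphi\,\omega^2$ are over $X\smallsetminus(S_0\cup S_\infty)$. *)

theory Defs
  imports "HOL-Analysis.Analysis" "HOL-Homology.Homology"
begin

section \<open>Smooth functions and Wirtinger derivatives\<close>

primrec Ck_on :: "nat \<Rightarrow> 'e::euclidean_space set \<Rightarrow> ('e \<Rightarrow> real) \<Rightarrow> bool" where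
  "Ck_on 0 S F \<longleftrightarrow> continuous_on S F"
| "Ck_on (Suc k) S F \<longleftrightarrow>
     (\<forall>x\<in>S. F differentiable (at x)) \<and>
     (\<forall>v. Ck_on k S (\<lambda>x. frechet_derivative F (at x) v))"

text \<open>Used for open \<open>S\<close> only.\<close>

definition smooth_on :: "'e::euclidean_space set \<Rightarrow> ('e \<Rightarrow> real) \<Rightarrow> bool" where
  "smooth_on S F \<longleftrightarrow> (\<forall>k. Ck_on k S F)"

text \<open>Smoothness on a closed interval, with one-sided derivatives at the end points.\<close>

definition smooth_on_Icc :: "real \<Rightarrow> real \<Rightarrow> (real \<Rightarrow> real) \<Rightarrow> bool" where
  "smooth_on_Icc a b F \<longleftrightarrow>
     (\<exists>D :: nat \<Rightarrow> real \<Rightarrow> real. D 0 = F \<and>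
        (\<forall>k. \<forall>x\<in>{a..b}. (D k has_real_derivative D (Suc k) x) (at x within {a..b})))"

text \<open>
  The derivatives \<open>\<partial>/\<partial>z\<close> and \<open>\<partial>/\<partial>z\<close>-bar, where \<open>z = x + \<i>y\<close> is the coordinate whose real
  directions \<open>\<partial>/\<partial>x\<close> and \<open>\<partial>/\<partial>y\<close> are \<open>e\<close> and \<open>e'\<close>.
\<close>

definition wirtinger ::
  "'e::real_normed_vector \<Rightarrow> 'e \<Rightarrow> ('e \<Rightarrow> complex) \<Rightarrow> 'e \<Rightarrow> complex" where
  "wirtinger e e' F x =
     (frechet_derivative F (at x) e - \<i> * frechet_derivative F (at x) e') / 2"

definition wirtinger_bar ::
  "'e::real_normed_vector \<Rightarrow> 'e \<Rightarrow> ('e \<Rightarrow> complex) \<Rightarrow> 'e \<Rightarrow> complex" where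
  "wirtinger_bar e e' F x =
     (frechet_derivative F (at x) e + \<i> * frechet_derivative F (at x) e') / 2"

text \<open>The coefficient of \<open>\<i>\<partial>\<partial>\<close>-bar \<open>u\<close> with respect to \<open>\<i> dz \<and> d\<close>\<open>z\<close>-bar, for real \<open>u\<close>.\<close>

definition ddbar1 :: "(complex \<Rightarrow> real) \<Rightarrow> complex \<Rightarrow> real" where
  "ddbar1 u y = Re (wirtinger 1 \<i> (wirtinger_bar 1 \<i> (\<lambda>y. complex_of_real (u y))) y)"

text \<open>
  On \<open>complex \<times> complex\<close> the two coordinates are indexed by the type \<open>2\<close>, so that the
  library's matrices over \<open>complex\<close> can be used.
\<close>

definition coord_dir :: "2 \<Rightarrow> complex \<Rightarrow> complex \<times> complex" where
  "coord_dir j c = (if j = 1 then (c, 0) else (0, c))"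

definition pd :: "2 \<Rightarrow> (complex \<times> complex \<Rightarrow> complex) \<Rightarrow> complex \<times> complex \<Rightarrow> complex" where
  "pd j = wirtinger (coord_dir j 1) (coord_dir j \<i>)"

definition pdbar :: "2 \<Rightarrow> (complex \<times> complex \<Rightarrow> complex) \<Rightarrow> complex \<times> complex \<Rightarrow> complex" where
  "pdbar j = wirtinger_bar (coord_dir j 1) (coord_dir j \<i>)"

text \<open>
  A (1,1)-form in two variables is given by its coefficients \<open>a $ k $ l\<close> with respect to
  \<open>dz\<^sub>k \<and> d\<close>\<open>z\<close>-bar\<open>\<^sub>l\<close>.  The wedge product of two such forms is given by its coefficient with
  respect to \<open>dz\<^sub>1 \<and> d\<close>\<open>z\<close>-bar\<open>\<^sub>1 \<and> dz\<^sub>2 \<and> d\<close>\<open>z\<close>-bar\<open>\<^sub>2\<close>.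
\<close>

definition wedge11 :: "complex^2^2 \<Rightarrow> complex^2^2 \<Rightarrow> complex" where
  "wedge11 a b = a$1$1 * b$2$2 + a$2$2 * b$1$1 - a$1$2 * b$2$1 - a$2$1 * b$1$2"


section \<open>Integration of a density given in charts\<close>

definition borel_in :: "'p topology \<Rightarrow> 'p set set" where
  "borel_in X = sigma_sets (topspace X) {U. openin X U}"

text \<open>
  The measure on \<open>X\<close> which in the chart \<open>ch i\<close> (with domain \<open>dm i\<close>) has the density
  \<open>\<rho> i\<close> (a function on \<open>X\<close>) with respect to Lebesgue measure.
\<close>

definition is_density_measure ::
  "'p topology \<Rightarrow> 'i set \<Rightarrow> ('i \<Rightarrow> 'p set) \<Rightarrow> ('i \<Rightarrow> 'p \<Rightarrow> 'e::euclidean_space) \<Rightarrow>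
   ('i \<Rightarrow> 'p \<Rightarrow> real) \<Rightarrow> 'p measure \<Rightarrow> bool" where
  "is_density_measure X I dm ch \<rho> M \<longleftrightarrow>
     space M = topspace X \<and> sets M = borel_in X \<and>
     (\<forall>i\<in>I. \<forall>B\<in>sets M. B \<subseteq> dm i \<longrightarrow>
        emeasure M B =
          (\<integral>\<^sup>+ y \<in> ch i ` B. ennreal (\<rho> i (inv_into (dm i) (ch i) y)) \<partial>lborel))"


section \<open>Riemann surfaces and holomorphic line bundles\<close>

type_synonym 'a chart = "'a set \<times> ('a \<Rightarrow> complex)"
type_synonym ('a, 'l) triv = "'a set \<times> ('l \<Rightarrow> complex)"

definition riemann_surface_atlas :: "'a::topological_space chart set \<Rightarrow> bool" where
  "riemann_surface_atlas RS \<longleftrightarrow>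
     (\<Union>(V, c)\<in>RS. V) = UNIV \<and>
     (\<forall>(V, c)\<in>RS. open V \<and> open (c ` V) \<and> homeomorphism V (c ` V) c (inv_into V c)) \<and>
     (\<forall>(V, c)\<in>RS. \<forall>(V', c')\<in>RS. (c' \<circ> inv_into V c) holomorphic_on c ` (V \<inter> V'))"

definition compact_riemann_surface :: "'a::t2_space chart set \<Rightarrow> bool" where
  "compact_riemann_surface RS \<longleftrightarrow>
     riemann_surface_atlas RS \<and> compact (UNIV :: 'a set) \<and> connected (UNIV :: 'a set)"

definition has_genus :: "'a::topological_space itself \<Rightarrow> nat \<Rightarrow> bool" where
  "has_genus _ g \<longleftrightarrow>
     homology_group 1 (euclidean :: 'a topology) \<cong> free_Abelian_group {..<2 * g}"

definition smooth_fun_on :: "'a chart set \<Rightarrow> 'a set \<Rightarrow> ('a \<Rightarrow> real) \<Rightarrow> bool" where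
  "smooth_fun_on RS W u \<longleftrightarrow>
     (\<forall>(V, c)\<in>RS. smooth_on (c ` (V \<inter> W)) (\<lambda>y. u (inv_into V c y)))"

definition holomorphic_fun_on :: "'a chart set \<Rightarrow> 'a set \<Rightarrow> ('a \<Rightarrow> complex) \<Rightarrow> bool" where
  "holomorphic_fun_on RS W u \<longleftrightarrow>
     (\<forall>(V, c)\<in>RS. (\<lambda>y. u (inv_into V c y)) holomorphic_on c ` (V \<inter> W))"

text \<open>
  A trivialization \<open>(U, t)\<close> of the bundle \<open>pr\<close> consists of an open set \<open>U\<close> and a fibre
  coordinate \<open>t\<close>, used over \<open>U\<close> only.  Complex structure, topology and the vector space
  structure of the fibres of the total space are those transported by the trivializations.
\<close>

definition holomorphic_line_bundle ::
  "'a::topological_space chart set \<Rightarrow> ('l \<Rightarrow> 'a) \<Rightarrow> ('a, 'l) triv set \<Rightarrow> bool" where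
  "holomorphic_line_bundle RS pr TL \<longleftrightarrow>
     (\<Union>(U, t)\<in>TL. U) = UNIV \<and>
     (\<forall>(U, t)\<in>TL. open U \<and> (\<forall>p\<in>U. bij_betw t {v. pr v = p} UNIV)) \<and>
     (\<forall>(U, t)\<in>TL. \<forall>(U', t')\<in>TL. \<exists>g.
        holomorphic_fun_on RS (U \<inter> U') g \<and> (\<forall>p\<in>U \<inter> U'. g p \<noteq> 0) \<and>
        (\<forall>v. pr v \<in> U \<inter> U' \<longrightarrow> t' v = g (pr v) * t v))"

text \<open>
  \<open>kform C p\<close> is the coefficient at \<open>p\<close> of the Kaehler form of the base with respect to
  \<open>\<i> dz \<and> d\<close>\<open>z\<close>-bar, \<open>z\<close> being the coordinate of the chart \<open>C\<close>.
\<close>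

record ('a, 'l) polarized_surface =
  charts :: "'a chart set"
  kform :: "'a chart \<Rightarrow> 'a \<Rightarrow> real"
  pr :: "'l \<Rightarrow> 'a"
  trivs :: "('a, 'l) triv set"

definition kaehler_form :: "'a chart set \<Rightarrow> ('a chart \<Rightarrow> 'a \<Rightarrow> real) \<Rightarrow> bool" where
  "kaehler_form RS k \<longleftrightarrow>
     (\<forall>C\<in>RS. (\<forall>p\<in>fst C. k C p > 0) \<and>
        smooth_on (snd C ` fst C) (\<lambda>y. k C (inv_into (fst C) (snd C) y))) \<and>
     (\<forall>C\<in>RS. \<forall>C'\<in>RS. \<forall>p\<in>fst C \<inter> fst C'.
        k C p = k C' p * (cmod (deriv (snd C' \<circ> inv_into (fst C) (snd C)) (snd C p)))\<^sup>2)"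

text \<open>
  Coefficient of \<open>Ric = - \<i>\<partial>\<partial>\<close>-bar \<open>ln k\<close>, again with respect to \<open>\<i> dz \<and> d\<close>\<open>z\<close>-bar.
\<close>

definition ricci_form :: "('a chart \<Rightarrow> 'a \<Rightarrow> real) \<Rightarrow> 'a chart \<Rightarrow> 'a \<Rightarrow> real" where
  "ricci_form k C p =
     - ddbar1 (\<lambda>y. ln (k C (inv_into (fst C) (snd C) y))) (snd C p)"

text \<open>The factor 2 below comes from \<open>\<i> dz \<and> d\<close>\<open>z\<close>-bar \<open>= 2 dx \<and> dy\<close>.\<close>

definition is_area_measure ::
  "('a::topological_space, 'l) polarized_surface \<Rightarrow> 'a measure \<Rightarrow> bool" where
  "is_area_measure E M \<longleftrightarrow>
     is_density_measure euclidean (charts E) fst snd (\<lambda>C p. 2 * kform E C p) M"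

definition area_measure ::
  "('a::topological_space, 'l) polarized_surface \<Rightarrow> 'a measure" where
  "area_measure E = (THE M. is_area_measure E M)"

text \<open>
  The integral over the base of the real (1,1)-form with coefficients \<open>a C p\<close> (with respect to
  \<open>\<i> dz \<and> d\<close>\<open>z\<close>-bar): the form is \<open>r\<close> times the Kaehler form for a function \<open>r\<close>,
  which is integrated against the area measure.
\<close>

definition base_integral ::
  "('a::topological_space, 'l) polarized_surface \<Rightarrow> ('a chart \<Rightarrow> 'a \<Rightarrow> real) \<Rightarrow> real" where
  "base_integral E a =
     (LINT p | area_measure E. (THE r. \<forall>C\<in>charts E. p \<in> fst C \<longrightarrow> a C p = r * kform E C p))"

definition ddbar_form :: "('a \<Rightarrow> real) \<Rightarrow> 'a chart \<Rightarrow> 'a \<Rightarrow> real" where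
  "ddbar_form u C p = ddbar1 (\<lambda>y. u (inv_into (fst C) (snd C) y)) (snd C p)"

text \<open>
  A Hermitian metric is given by its squared norm \<open>hn\<close> on the total space; \<open>local_metric\<close> is
  its local weight, so that \<open>hn v = local_metric E hn T (pr v) * |t v|\<^sup>2\<close>.
\<close>

definition local_metric ::
  "('a, 'l) polarized_surface \<Rightarrow> ('l \<Rightarrow> real) \<Rightarrow> ('a, 'l) triv \<Rightarrow> 'a \<Rightarrow> real" where
  "local_metric E hn T p = hn (THE v. pr E v = p \<and> snd T v = 1)"

definition hermitian_metric ::
  "('a, 'l) polarized_surface \<Rightarrow> ('l \<Rightarrow> real) \<Rightarrow> bool" where
  "hermitian_metric E hn \<longleftrightarrow>
     (\<forall>T\<in>trivs E.
        (\<forall>p\<in>fst T. local_metric E hn T p > 0) \<and>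
        smooth_fun_on (charts E) (fst T) (local_metric E hn T) \<and>
        (\<forall>v. pr E v \<in> fst T \<longrightarrow>
           hn v = local_metric E hn T (pr E v) * (cmod (snd T v))\<^sup>2))"

text \<open>The curvature form \<open>- \<i>\<partial>\<partial>\<close>-bar \<open>ln h\<close>; it does not depend on the trivialization.\<close>

definition curvature_form ::
  "('a, 'l) polarized_surface \<Rightarrow> ('l \<Rightarrow> real) \<Rightarrow> 'a chart \<Rightarrow> 'a \<Rightarrow> real" where
  "curvature_form E hn C p =
     (THE k. \<forall>T\<in>trivs E. p \<in> fst T \<longrightarrow>
        k = - ddbar_form (\<lambda>q. ln (local_metric E hn T q)) C p)"

definition has_degree ::
  "('a::topological_space, 'l) polarized_surface \<Rightarrow> int \<Rightarrow> bool" where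
  "has_degree E d \<longleftrightarrow>
     (\<forall>hn. hermitian_metric E hn \<longrightarrow>
        base_integral E (curvature_form E hn) / (2 * pi) = of_int d)"


section \<open>The ruled surface \<open>P(L \<oplus> O)\<close>\<close>

definition fibre_scale :: "('a, 'l) polarized_surface \<Rightarrow> complex \<Rightarrow> 'l \<Rightarrow> 'l" where
  "fibre_scale E \<mu> v =
     (THE v'. pr E v' = pr E v \<and>
        (\<forall>(U, t)\<in>trivs E. pr E v \<in> U \<longrightarrow> t v' = \<mu> * t v))"

definition is_zero_vec :: "('a, 'l) polarized_surface \<Rightarrow> 'l \<Rightarrow> bool" where
  "is_zero_vec E v \<longleftrightarrow> fibre_scale E 0 v = v"

text \<open>
  A point of \<open>P(L \<oplus> O)\<close> is a complex line in a fibre of \<open>L \<oplus> O\<close>, i.e. the set of multiples of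
  some \<open>(v, k) \<noteq> 0\<close>.
\<close>

type_synonym 'l pt = "('l \<times> complex) set"

definition span_line :: "('a, 'l) polarized_surface \<Rightarrow> 'l \<Rightarrow> complex \<Rightarrow> 'l pt" where
  "span_line E v k = {(fibre_scale E \<mu> v, \<mu> * k) | \<mu>. True}"

definition X_set :: "('a, 'l) polarized_surface \<Rightarrow> 'l pt set" where
  "X_set E = {span_line E v k | v k. \<not> (is_zero_vec E v \<and> k = 0)}"

definition S_zero :: "('a, 'l) polarized_surface \<Rightarrow> 'l pt set" where
  "S_zero E = {span_line E v k | v k. is_zero_vec E v \<and> k \<noteq> 0}"

definition S_inf :: "('a, 'l) polarized_surface \<Rightarrow> 'l pt set" where
  "S_inf E = {span_line E v 0 | v. \<not> is_zero_vec E v}"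

definition X_reg :: "('a, 'l) polarized_surface \<Rightarrow> 'l pt set" where
  "X_reg E = X_set E - (S_zero E \<union> S_inf E)"

definition X_proj :: "('a, 'l) polarized_surface \<Rightarrow> 'l pt \<Rightarrow> 'a" where
  "X_proj E x = (THE p. \<forall>(v, k)\<in>x. pr E v = p)"

text \<open>
  Charts of \<open>X\<close> are indexed by a chart \<open>(V, c)\<close> of the base, a trivialization \<open>(U, t)\<close> and a flag.
  With \<open>z = c \<circ> pr\<close>, the line spanned by \<open>(v, k)\<close> has the coordinates \<open>(z, t v / k)\<close> if the flag
  is \<open>False\<close> (a neighbourhood of \<open>S_zero\<close>) and \<open>(z, k / t v)\<close> if it is \<open>True\<close> (a neighbourhood
  of \<open>S_inf\<close>).
\<close>

type_synonym ('a, 'l) chart_index = "'a chart \<times> ('a, 'l) triv \<times> bool"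

definition X_index :: "('a, 'l) polarized_surface \<Rightarrow> ('a, 'l) chart_index set" where
  "X_index E = charts E \<times> trivs E \<times> UNIV"

fun X_dom :: "('a, 'l) polarized_surface \<Rightarrow> ('a, 'l) chart_index \<Rightarrow> 'l pt set" where
  "X_dom E ((V, c), (U, t), False) = {span_line E v k | v k. pr E v \<in> V \<inter> U \<and> k \<noteq> 0}"
| "X_dom E ((V, c), (U, t), True) =
     {span_line E v k | v k. pr E v \<in> V \<inter> U \<and> \<not> is_zero_vec E v}"

fun X_chart ::
  "('a, 'l) polarized_surface \<Rightarrow> ('a, 'l) chart_index \<Rightarrow> 'l pt \<Rightarrow> complex \<times> complex" where
  "X_chart E ((V, c), (U, t), False) x =
     (THE y. \<forall>(v, k)\<in>x. k \<noteq> 0 \<longrightarrow> y = (c (pr E v), t v / k))"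
| "X_chart E ((V, c), (U, t), True) x =
     (THE y. \<forall>(v, k)\<in>x. t v \<noteq> 0 \<longrightarrow> y = (c (pr E v), k / t v))"

definition X_top :: "('a, 'l) polarized_surface \<Rightarrow> 'l pt topology" where
  "X_top E =
     topology (\<lambda>W. W \<subseteq> X_set E \<and>
       (\<forall>i\<in>X_index E. open (X_chart E i ` (W \<inter> X_dom E i))))"

definition X_smooth :: "('a, 'l) polarized_surface \<Rightarrow> ('l pt \<Rightarrow> real) \<Rightarrow> bool" where
  "X_smooth E \<psi> \<longleftrightarrow>
     (\<forall>i\<in>X_index E. smooth_on (X_chart E i ` X_dom E i)
        (\<lambda>y. \<psi> (inv_into (X_dom E i) (X_chart E i) y)))"

text \<open>Continuous extension to all of \<open>X\<close> of a function defined on \<open>X_reg\<close>.\<close>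

definition cont_ext ::
  "('a, 'l) polarized_surface \<Rightarrow> ('l pt \<Rightarrow> real) \<Rightarrow> 'l pt \<Rightarrow> real" where
  "cont_ext E u x =
     (if x \<in> X_reg E then u x else Lim (atin_within (X_top E) x (X_reg E)) u)"

text \<open>The inverses of the isomorphisms of \<open>S_zero\<close> and \<open>S_inf\<close> with the base.\<close>

definition sec_zero :: "('a, 'l) polarized_surface \<Rightarrow> 'a \<Rightarrow> 'l pt" where
  "sec_zero E = inv_into (S_zero E) (X_proj E)"

definition sec_inf :: "('a, 'l) polarized_surface \<Rightarrow> 'a \<Rightarrow> 'l pt" where
  "sec_inf E = inv_into (S_inf E) (X_proj E)"


section \<open>The momentum construction and its curvature\<close>

text \<open>
  On \<open>X_reg\<close> the point with fibre coordinate \<open>w\<close> is the line spanned by \<open>(v, 1)\<close> with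
  \<open>w = t v \<noteq> 0\<close>, so \<open>ln |w|\<^sup>2 + ln h(z)\<close> is the logarithm of the squared norm of \<open>v\<close>.
\<close>

definition s_fun :: "('a, 'l) polarized_surface \<Rightarrow> ('l \<Rightarrow> real) \<Rightarrow> 'l pt \<Rightarrow> real" where
  "s_fun E hn x = (THE r. \<forall>v. (v, 1) \<in> x \<longrightarrow> r = ln (hn v))"

text \<open>The charts \<open>(z, w)\<close> restricted to \<open>X_reg\<close>.\<close>

type_synonym ('a, 'l) reg_index = "'a chart \<times> ('a, 'l) triv"

definition R_dom :: "('a, 'l) polarized_surface \<Rightarrow> ('a, 'l) reg_index \<Rightarrow> 'l pt set" where
  "R_dom E j = X_dom E (fst j, snd j, False) \<inter> X_reg E"

definition R_chart ::
  "('a, 'l) polarized_surface \<Rightarrow> ('a, 'l) reg_index \<Rightarrow> 'l pt \<Rightarrow> complex \<times> complex" where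
  "R_chart E j = X_chart E (fst j, snd j, False)"

text \<open>
  \<open>omega_coeff\<close> are the coefficients of the pull-back of the Kaehler form plus
  \<open>\<i>\<partial>\<partial>\<close>-bar \<open>f(s)\<close> with respect to \<open>\<i> dz\<^sub>k \<and> d\<close>\<open>z\<close>-bar\<open>\<^sub>l\<close>.
\<close>

definition omega_coeff ::
  "('a, 'l) polarized_surface \<Rightarrow> ('l \<Rightarrow> real) \<Rightarrow> (real \<Rightarrow> real) \<Rightarrow> ('a, 'l) reg_index \<Rightarrow>
   complex \<times> complex \<Rightarrow> complex^2^2" where
  "omega_coeff E hn f j y =
     (\<chi> k l. (if k = 1 \<and> l = 1
               then complex_of_real
                 (kform E (fst j) (inv_into (fst (fst j)) (snd (fst j)) (fst y))) else 0)
            + pd k (pdbar l (\<lambda>y'. complex_of_real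
                 (f (s_fun E hn (inv_into (R_dom E j) (R_chart E j) y'))))) y)"

text \<open>
  For \<open>H\<^sup>-\<^sup>1 \<partial>H\<close> to transform as a connection form under changes of coordinates, the Hermitian
  matrix must have the entries \<open>H $ a $ b = \<langle>\<partial>\<^sub>b, \<partial>\<^sub>a\<rangle>\<close>; this is the transpose of
  \<open>omega_coeff\<close>.
\<close>

definition herm_mat ::
  "('a, 'l) polarized_surface \<Rightarrow> ('l \<Rightarrow> real) \<Rightarrow> (real \<Rightarrow> real) \<Rightarrow> ('a, 'l) reg_index \<Rightarrow>
   complex \<times> complex \<Rightarrow> complex^2^2" where
  "herm_mat E hn f j y = transpose (omega_coeff E hn f j y)"

text \<open>The \<open>dz\<^sub>k\<close>-component of \<open>H\<^sup>-\<^sup>1 \<partial>H\<close>.\<close>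

definition conn_mat ::
  "('a, 'l) polarized_surface \<Rightarrow> ('l \<Rightarrow> real) \<Rightarrow> (real \<Rightarrow> real) \<Rightarrow> ('a, 'l) reg_index \<Rightarrow> 2 \<Rightarrow>
   complex \<times> complex \<Rightarrow> complex^2^2" where
  "conn_mat E hn f j k y =
     matrix_inv (herm_mat E hn f j y) **
     (\<chi> a b. pd k (\<lambda>y'. herm_mat E hn f j y' $ a $ b) y)"

text \<open>
  Coefficients of the entry \<open>(a, b)\<close> of \<open>\<Theta> = \<partial>\<close>-bar\<open>(H\<^sup>-\<^sup>1 \<partial>H)\<close>; the sign comes from
  reordering \<open>d\<close>\<open>z\<close>-bar\<open>\<^sub>l \<and> dz\<^sub>k\<close>.
\<close>

definition curv_mat ::
  "('a, 'l) polarized_surface \<Rightarrow> ('l \<Rightarrow> real) \<Rightarrow> (real \<Rightarrow> real) \<Rightarrow> ('a, 'l) reg_index \<Rightarrow> 2 \<Rightarrow> 2 \<Rightarrow>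
   complex \<times> complex \<Rightarrow> complex^2^2" where
  "curv_mat E hn f j a b y =
     (\<chi> k l. - pdbar l (\<lambda>y'. conn_mat E hn f j k y' $ a $ b) y)"

text \<open>
  Coefficient of \<open>det (\<i>/(2\<pi>) \<Theta>)\<close> (with respect to
  \<open>dz\<^sub>1 \<and> d\<close>\<open>z\<close>-bar\<open>\<^sub>1 \<and> dz\<^sub>2 \<and> d\<close>\<open>z\<close>-bar\<open>\<^sub>2\<close>, as for \<open>omega_sq\<close>).
\<close>

definition chern_top ::
  "('a, 'l) polarized_surface \<Rightarrow> ('l \<Rightarrow> real) \<Rightarrow> (real \<Rightarrow> real) \<Rightarrow> ('a, 'l) reg_index \<Rightarrow>
   complex \<times> complex \<Rightarrow> complex" where
  "chern_top E hn f j y =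
     (\<i> / (2 * of_real pi))\<^sup>2 *
     (wedge11 (curv_mat E hn f j 1 1 y) (curv_mat E hn f j 2 2 y)
      - wedge11 (curv_mat E hn f j 1 2 y) (curv_mat E hn f j 2 1 y))"

definition omega_sq ::
  "('a, 'l) polarized_surface \<Rightarrow> ('l \<Rightarrow> real) \<Rightarrow> (real \<Rightarrow> real) \<Rightarrow> ('a, 'l) reg_index \<Rightarrow>
   complex \<times> complex \<Rightarrow> complex" where
  "omega_sq E hn f j y =
     \<i>\<^sup>2 * wedge11 (omega_coeff E hn f j y) (omega_coeff E hn f j y)"

definition is_higher_scalar_curvature ::
  "('a, 'l) polarized_surface \<Rightarrow> ('l \<Rightarrow> real) \<Rightarrow> (real \<Rightarrow> real) \<Rightarrow> 'l pt \<Rightarrow> real \<Rightarrow> bool" where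
  "is_higher_scalar_curvature E hn f x l \<longleftrightarrow>
     (\<forall>j\<in>charts E \<times> trivs E. x \<in> R_dom E j \<longrightarrow>
        chern_top E hn f j (R_chart E j x) =
        of_real (l / (2 * (2 * pi)\<^sup>2)) * omega_sq E hn f j (R_chart E j x))"

definition higher_scal ::
  "('a, 'l) polarized_surface \<Rightarrow> ('l \<Rightarrow> real) \<Rightarrow> (real \<Rightarrow> real) \<Rightarrow> 'l pt \<Rightarrow> real" where
  "higher_scal E hn f x = (THE l. is_higher_scalar_curvature E hn f x l)"

text \<open>
  The measure \<open>\<omega>\<^sup>2\<close> on \<open>X_reg\<close>.  Since
  \<open>dz\<^sub>1 \<and> d\<close>\<open>z\<close>-bar\<open>\<^sub>1 \<and> dz\<^sub>2 \<and> d\<close>\<open>z\<close>-bar\<open>\<^sub>2 = (-2\<i>)\<^sup>2 dx\<^sub>1 \<and> dy\<^sub>1 \<and> dx\<^sub>2 \<and> dy\<^sub>2\<close>, its density with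
  respect to Lebesgue measure is \<open>-4\<close> times the coefficient \<open>omega_sq\<close>.
\<close>

definition is_omega_sq_measure ::
  "('a, 'l) polarized_surface \<Rightarrow> ('l \<Rightarrow> real) \<Rightarrow> (real \<Rightarrow> real) \<Rightarrow> 'l pt measure \<Rightarrow> bool" where
  "is_omega_sq_measure E hn f M \<longleftrightarrow>
     is_density_measure (subtopology (X_top E) (X_reg E)) (charts E \<times> trivs E)
       (R_dom E) (R_chart E) (\<lambda>j x. - 4 * Re (omega_sq E hn f j (R_chart E j x))) M"

definition omega_sq_measure ::
  "('a, 'l) polarized_surface \<Rightarrow> ('l \<Rightarrow> real) \<Rightarrow> (real \<Rightarrow> real) \<Rightarrow> 'l pt measure" where
  "omega_sq_measure E hn f = (THE M. is_omega_sq_measure E hn f M)"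

definition lambda_one ::
  "('a, 'l) polarized_surface \<Rightarrow> ('l \<Rightarrow> real) \<Rightarrow> (real \<Rightarrow> real) \<Rightarrow> real" where
  "lambda_one E hn f =
     (LINT x | omega_sq_measure E hn f. higher_scal E hn f x) /
     (LINT x | omega_sq_measure E hn f. 1)"

text \<open>The holomorphy potential \<open>1 + f'(s)\<close> of \<open>w \<partial>/\<partial>w\<close>.\<close>

definition hpot ::
  "('a, 'l) polarized_surface \<Rightarrow> ('l \<Rightarrow> real) \<Rightarrow> (real \<Rightarrow> real) \<Rightarrow> 'l pt \<Rightarrow> real" where
  "hpot E hn f = cont_ext E (\<lambda>x. 1 + deriv f (s_fun E hn x))"

text \<open>
  \<open>\<beta>\<^sub>0\<close> and \<open>\<beta>\<^sub>\<infinity>\<close> enter through the boundary behaviour of the momentum profile \<open>\<phi>\<close>; the limits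
  of \<open>f'\<close> say that the metric lies in the class \<open>2\<pi>(C + m S_inf)\<close>.
\<close>

definition momentum_conical ::
  "real \<Rightarrow> real \<Rightarrow> real \<Rightarrow> (real \<Rightarrow> real) \<Rightarrow> bool" where
  "momentum_conical m \<beta>0 \<beta>inf f \<longleftrightarrow>
     smooth_on UNIV f \<and>
     (\<forall>a b t. a \<noteq> b \<and> 0 < t \<and> t < 1 \<longrightarrow>
        f ((1 - t) * a + t * b) < (1 - t) * f a + t * f b) \<and>
     (deriv f \<longlongrightarrow> 0) at_bot \<and> (deriv f \<longlongrightarrow> m) at_top \<and>
     (\<exists>\<phi>. (\<forall>r. \<phi> (1 + deriv f r) = deriv (deriv f) r) \<and>
        smooth_on_Icc 1 (m + 1) \<phi> \<and>
        (\<forall>\<gamma>. 1 < \<gamma> \<and> \<gamma> < m + 1 \<longrightarrow> \<phi> \<gamma> > 0) \<and>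
        \<phi> 1 = 0 \<and> \<phi> (m + 1) = 0 \<and>
        (\<phi> has_real_derivative \<beta>0) (at 1 within {1..m + 1}) \<and>
        (\<phi> has_real_derivative - \<beta>inf) (at (m + 1) within {1..m + 1}))"


section \<open>The wedge products with the currents of integration\<close>

text \<open>
  The currents \<open>\<omega> \<and> [S_zero]\<close> and \<open>\<omega> \<and> [S_inf]\<close> evaluated at a smooth function \<open>\<psi>\<close> on \<open>X\<close>.  With
  \<open>u\<close> the continuous extension of \<open>f(s)\<close>, the pairing of \<open>\<psi>\<close> with \<open>\<i>\<partial>\<partial>\<close>-bar\<open>(u [S_zero])\<close> is
  the integral of \<open>u \<i>\<partial>\<partial>\<close>-bar\<open>\<psi>\<close> over \<open>S_zero\<close>; likewise for \<open>S_inf\<close> and \<open>f(s) - m s\<close>.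
\<close>

definition wedge_S_zero ::
  "('a::topological_space, 'l) polarized_surface \<Rightarrow> ('l \<Rightarrow> real) \<Rightarrow> (real \<Rightarrow> real) \<Rightarrow>
   ('l pt \<Rightarrow> real) \<Rightarrow> real" where
  "wedge_S_zero E hn f \<psi> =
     base_integral E (\<lambda>C p. \<psi> (sec_zero E p) * kform E C p) +
     base_integral E (\<lambda>C p.
       cont_ext E (\<lambda>x. f (s_fun E hn x)) (sec_zero E p) *
       ddbar_form (\<lambda>q. \<psi> (sec_zero E q)) C p)"

definition wedge_S_inf ::
  "('a::topological_space, 'l) polarized_surface \<Rightarrow> ('l \<Rightarrow> real) \<Rightarrow> real \<Rightarrow> (real \<Rightarrow> real) \<Rightarrow>
   ('l pt \<Rightarrow> real) \<Rightarrow> real" where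
  "wedge_S_inf E hn m f \<psi> =
     (m + 1) * base_integral E (\<lambda>C p. \<psi> (sec_inf E p) * kform E C p) +
     base_integral E (\<lambda>C p.
       cont_ext E (\<lambda>x. f (s_fun E hn x) - m * s_fun E hn x) (sec_inf E p) *
       ddbar_form (\<lambda>q. \<psi> (sec_inf E q)) C p)"

text \<open>
  A current of this kind is a measure if it is the integration against a finite Borel measure
  on \<open>X\<close>; this measure is used to evaluate it at merely continuous functions.
\<close>

definition represents_current ::
  "('a, 'l) polarized_surface \<Rightarrow> (('l pt \<Rightarrow> real) \<Rightarrow> real) \<Rightarrow> 'l pt measure \<Rightarrow> bool" where
  "represents_current E \<tau> M \<longleftrightarrow>
     finite_measure M \<and> space M = X_set E \<and> sets M = borel_in (X_top E) \<and>
     (\<forall>\<psi>. X_smooth E \<psi> \<longrightarrow> integrable M \<psi> \<and> integral\<^sup>L M \<psi> = \<tau> \<psi>)"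

definition current_measure ::
  "('a, 'l) polarized_surface \<Rightarrow> (('l pt \<Rightarrow> real) \<Rightarrow> real) \<Rightarrow> 'l pt measure" where
  "current_measure E \<tau> = (THE M. represents_current E \<tau> M)"

definition S_zero_measure ::
  "('a::topological_space, 'l) polarized_surface \<Rightarrow> ('l \<Rightarrow> real) \<Rightarrow> (real \<Rightarrow> real) \<Rightarrow>
   'l pt measure" where
  "S_zero_measure E hn f = current_measure E (wedge_S_zero E hn f)"

definition S_inf_measure ::
  "('a::topological_space, 'l) polarized_surface \<Rightarrow> ('l \<Rightarrow> real) \<Rightarrow> real \<Rightarrow> (real \<Rightarrow> real) \<Rightarrow>
   'l pt measure" where
  "S_inf_measure E hn m f = current_measure E (wedge_S_inf E hn m f)"


section \<open>The top Chern current and the log Futaki invariant\<close>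

text \<open>\<open>c2_current E hn m \<beta>0 \<beta>inf f \<psi>\<close> is the integral of \<open>\<psi> c\<^sub>2(\<omega>)\<close> over \<open>X\<close>.\<close>

definition c2_current ::
  "('a::topological_space, 'l) polarized_surface \<Rightarrow> ('l \<Rightarrow> real) \<Rightarrow> real \<Rightarrow> real \<Rightarrow> real \<Rightarrow>
   (real \<Rightarrow> real) \<Rightarrow> ('l pt \<Rightarrow> real) \<Rightarrow> real" where
  "c2_current E hn m \<beta>0 \<beta>inf f \<psi> =
     (LINT x | omega_sq_measure E hn f. \<psi> x * (higher_scal E hn f x / (2 * (2 * pi)\<^sup>2))) +
     (\<beta>0 - 1) / pi * (LINT x | S_zero_measure E hn f. \<psi> x) +
     (\<beta>inf - 1) / ((m + 1) * pi) * (LINT x | S_inf_measure E hn m f. \<psi> x)"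

definition lambda_zero ::
  "('a::topological_space, 'l) polarized_surface \<Rightarrow> ('l \<Rightarrow> real) \<Rightarrow> real \<Rightarrow> real \<Rightarrow> real \<Rightarrow>
   (real \<Rightarrow> real) \<Rightarrow> real" where
  "lambda_zero E hn m \<beta>0 \<beta>inf f =
     2 * (2 * pi)\<^sup>2 * c2_current E hn m \<beta>0 \<beta>inf f (\<lambda>_. 1) /
     (LINT x | omega_sq_measure E hn f. 1)"

definition log_futaki ::
  "('a::topological_space, 'l) polarized_surface \<Rightarrow> ('l \<Rightarrow> real) \<Rightarrow> real \<Rightarrow> real \<Rightarrow> real \<Rightarrow>
   (real \<Rightarrow> real) \<Rightarrow> real" where
  "log_futaki E hn m \<beta>0 \<beta>inf f =
     (let vol = omega_sq_measure E hn f;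
          M0 = S_zero_measure E hn f;
          Minf = S_inf_measure E hn m f;
          h = hpot E hn f
      in - c2_current E hn m \<beta>0 \<beta>inf f h
         + lambda_zero E hn m \<beta>0 \<beta>inf f / (2 * (2 * pi)\<^sup>2) * (LINT x | vol. h x)
         + (\<beta>0 - 1) / pi *
             ((LINT x | M0. h x) - (LINT x | M0. 1) / (LINT x | vol. 1) * (LINT x | vol. h x))
         + (\<beta>inf - 1) / ((m + 1) * pi) *
             ((LINT x | Minf. h x) - (LINT x | Minf. 1) / (LINT x | vol. 1) * (LINT x | vol. h x)))"


section \<open>The standing assumptions on the base and the bundle\<close>

definition genus_two_setup ::
  "('a::t2_space, 'l) polarized_surface \<Rightarrow> ('l \<Rightarrow> real) \<Rightarrow> bool" where
  "genus_two_setup E hn \<longleftrightarrow>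
     compact_riemann_surface (charts E) \<and> has_genus TYPE('a) 2 \<and>
     kaehler_form (charts E) (kform E) \<and>
     (\<forall>C\<in>charts E. \<forall>p\<in>fst C. ricci_form (kform E) C p = - 2 * kform E C p) \<and>
     holomorphic_line_bundle (charts E) (pr E) (trivs E) \<and> has_degree E (- 1) \<and>
     hermitian_metric E hn \<and>
     (\<forall>C\<in>charts E. \<forall>p\<in>fst C. curvature_form E hn C p = - kform E C p)"

end

theory Submission
  imports Defs "HOL-Complex_Analysis.Cauchy_Integral_Formula"
begin

text \<open>
  The divisor terms of the top Chern current cancel the explicit divisor terms of the invariant, in
  \<open>\<integral> h c\<^sub>2\<close> as well as in \<open>\<lambda>\<^sub>0\<close>, so the identity is formal as soon as all the integrals exist; the
  work lies in their existence. With the coframe \<open>(dz, a dz + dw/w)\<close>, \<open>a = \<partial> ln h\<close>, the metric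
  becomes \<open>diag(\<gamma>K, \<phi>)\<close>, and the higher scalar curvature comes out as a function of \<open>s\<close> that is
  continuous in \<open>\<gamma>\<close> on the compact interval \<open>[1, m + 1]\<close>, hence bounded. The volume is finite because
  in the coordinate \<open>\<zeta> = ln w\<close> the fibre integral is that of \<open>\<gamma>\<phi>\<close>, the derivative of \<open>\<gamma>\<^sup>2/2\<close>.
  Since \<open>f''\<close> is comparable to \<open>f'\<close> near minus infinity, \<open>f(s)\<close> has a finite limit there, and
  likewise \<open>f(s) - ms\<close> at infinity; the continuous extensions are therefore constant along the two
  sections, the \<open>\<partial>\<partial>bar\<close> terms of the currents integrate to zero, and the currents are the
  push-forwards of multiples of the area measure of the base.
\<close>

section \<open>Smooth functions\<close>

text \<open>Measures, curvature, currents and extensions are introduced by definite descriptions, so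
  nothing can be evaluated before existence and uniqueness are settled; this shapes most of the
  development. A measure given by densities must agree on overlaps of arbitrary charts and
  trivializations. The measure of a current is prescribed on smooth functions only, so its
  uniqueness calls for enough bump functions on the ruled surface. The curvature must be controlled
  up to the two sections, where the factor \<open>\<phi>\<close> of the volume density tends to 0.
  The point is that \<open>\<phi>\<close> also divides the numerator of the curvature; after
  division by \<open>\<gamma> * \<phi>\<close> only the profile, its derivatives and negative powers
  of \<open>\<gamma>\<close>, which exceeds 1, are left. The equation
  \<open>Ric = -2 \<omega>\<close> enters there as the constant 2 next to
  \<open>2 * \<phi> / \<gamma>\<close>. On the base everything is normalised by the degree: it fixes
  the total area as 2 pi. A nonzero value of a measure or of a Bochner integral also certifies
  finiteness or integrability, since the default value is 0.\<close>

lemma Ck_on_SucI: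
  assumes "\<And>x. x \<in> S \<Longrightarrow> (F has_derivative F' x) (at x)"
    and "\<And>v. Ck_on k S (\<lambda>x. F' x v)"
    and cong: "\<And>G H. (\<And>x. x \<in> S \<Longrightarrow> G x = H x) \<Longrightarrow> Ck_on k S G \<Longrightarrow> Ck_on k S H"
  shows "Ck_on (Suc k) S F"
proof -
  have "Ck_on k S (\<lambda>x. frechet_derivative F (at x) v)" for v
    by (rule cong[OF _ assms(2)[of v]]) (metis assms(1) frechet_derivative_at)
  moreover have "\<forall>x\<in>S. F differentiable (at x)"
    using assms(1) by (auto simp: differentiable_def)
  ultimately show ?thesis by simp
qed

lemma frechet_derivative_cong_open:
  assumes "open S" "x \<in> S" "\<And>y. y \<in> S \<Longrightarrow> F y = G y"
  shows "frechet_derivative F (at x) = frechet_derivative G (at x)"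
proof -
  have "(F has_derivative D) (at x) \<longleftrightarrow> (G has_derivative D) (at x)" for D
    using assms by (metis has_derivative_transform_within_open)
  then show ?thesis by (simp add: frechet_derivative_def)
qed

text \<open>Holds because \<open>S\<close> is open: a Frechet derivative at a point of
  \<open>S\<close> depends only on values nearby, so equality on \<open>S\<close> passes to the
  derivatives of every order.\<close>

lemma Ck_on_cong:
  assumes "open S" "\<And>x. x \<in> S \<Longrightarrow> F x = G x" "Ck_on k S F"
  shows "Ck_on k S G"
  using assms(2,3)
proof (induction k arbitrary: F G)
  case 0
  then show ?case by (simp cong: continuous_on_cong)
next
  case (Suc k)
  have "G differentiable (at x)" if "x \<in> S" for x
    using Suc.prems that assms(1) unfolding differentiable_def
    by (metis Ck_on.simps(2) differentiable_def has_derivative_transform_within_open)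
  moreover have "Ck_on k S (\<lambda>x. frechet_derivative G (at x) v)" for v
    by (rule Suc.IH[of "\<lambda>x. frechet_derivative F (at x) v"])
      (use Suc.prems frechet_derivative_cong_open[OF assms(1), of _ F G] in auto)
  ultimately show ?case by simp
qed

text \<open>The recursion for \<open>Ck_on\<close> refers to \<open>frechet_derivative\<close>; this
  form lets a formula \<open>F'\<close> stand in for it, which is how the closure rules for sums,
  products and compositions are obtained.\<close>

lemma Ck_on_Suc_derivI:
  assumes "open S" "\<And>x. x \<in> S \<Longrightarrow> (F has_derivative F' x) (at x)"
    "\<And>v. Ck_on k S (\<lambda>x. F' x v)"
  shows "Ck_on (Suc k) S F"
  using Ck_on_SucI[OF assms(2,3)] Ck_on_cong[OF assms(1)] by blast

lemma Ck_on_subset: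
  assumes "Ck_on k S F" "T \<subseteq> S"
  shows "Ck_on k T F"
  using assms by (induction k arbitrary: F) (auto intro: continuous_on_subset)

lemma Ck_on_Suc_has_derivative:
  assumes "Ck_on (Suc k) S F" "x \<in> S"
  shows "(F has_derivative frechet_derivative F (at x)) (at x)"
  using assms frechet_derivative_works by auto

lemma Ck_on_Suc_imp:
  "Ck_on (Suc k) S F \<Longrightarrow> Ck_on k S F"
proof (induction k arbitrary: F)
  case 0
  then have "F differentiable_on S"
    by (auto simp: differentiable_on_def intro: differentiable_at_withinI)
  then show ?case using differentiable_imp_continuous_on by auto
next
  case (Suc k)
  then have 1: "\<forall>x\<in>S. F differentiable (at x)" and
    2: "\<And>v. Ck_on (Suc k) S (\<lambda>x. frechet_derivative F (at x) v)"
    using Ck_on.simps(2)[of "Suc k" S F] by blast+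
  show ?case
    unfolding Ck_on.simps(2)[of k] using 1 Suc.IH[OF 2] by blast
qed

lemma Ck_on_continuous: "Ck_on k S F \<Longrightarrow> continuous_on S F"
  by (induction k) (auto dest: Ck_on_Suc_imp simp del: Ck_on.simps(2))

lemma Ck_on_const [simp]: "Ck_on k S (\<lambda>_. c)"
  by (induction k arbitrary: c) auto

lemma Ck_on_linear:
  assumes "bounded_linear L"
  shows "Ck_on k S L"
proof (cases k)
  case 0
  then show ?thesis using assms by (simp add: linear_continuous_on)
next
  case (Suc n)
  have "(L has_derivative L) (at x)" for x
    using assms by (rule bounded_linear_imp_has_derivative)
  then have "frechet_derivative L (at x) = L" "L differentiable (at x)" for x
    by (metis frechet_derivative_at, auto simp: differentiable_def)
  then show ?thesis using Suc by simp
qed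

lemma Ck_on_add:
  assumes "open S" "Ck_on k S F" "Ck_on k S G"
  shows "Ck_on k S (\<lambda>x. F x + G x)"
  using assms(2,3)
proof (induction k arbitrary: F G)
  case (Suc k)
  show ?case
    by (rule Ck_on_Suc_derivI[OF assms(1)],
        rule has_derivative_add[OF Ck_on_Suc_has_derivative[OF Suc.prems(1)]
          Ck_on_Suc_has_derivative[OF Suc.prems(2)]], assumption, assumption)
      (use Suc in auto)
qed (auto intro: continuous_intros)

lemma Ck_on_mult:
  assumes "open S" "Ck_on k S F" "Ck_on k S G"
  shows "Ck_on k S (\<lambda>x. F x * G x)"
  using assms(2,3)
proof (induction k arbitrary: F G)
  case (Suc k)
  show ?case
    by (rule Ck_on_Suc_derivI[OF assms(1)],
        rule has_derivative_mult[OF Ck_on_Suc_has_derivative[OF Suc.prems(1)]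
          Ck_on_Suc_has_derivative[OF Suc.prems(2)]], assumption, assumption)
      (use Suc.prems in \<open>auto intro!: Ck_on_add[OF assms(1)] Suc.IH
        dest!: Ck_on_Suc_imp[of k S F] Ck_on_Suc_imp[of k S G] simp del: Ck_on.simps(2),
        auto\<close>)
qed (auto intro: continuous_intros)

lemma Ck_on_sum:
  assumes "open S" "\<And>i. i \<in> I \<Longrightarrow> Ck_on k S (F i)"
  shows "Ck_on k S (\<lambda>x. \<Sum>i\<in>I. F i x)"
  using assms(2)
  by (induction I rule: infinite_finite_induct) (auto intro: Ck_on_add[OF assms(1)])

text \<open>By the chain rule a directional derivative of the composite is a sum over the basis of
  products: a derivative of a coordinate of \<open>P\<close> times a partial derivative of
  \<open>F\<close> taken along \<open>P\<close>. The second factor is again a composite, one order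
  lower, so the induction closes.\<close>

lemma Ck_on_compose:
  fixes F :: "'f::euclidean_space \<Rightarrow> real" and P :: "'e::euclidean_space \<Rightarrow> 'f"
  assumes "open S" "Ck_on k T F" "\<And>b. b \<in> Basis \<Longrightarrow> Ck_on k S (\<lambda>x. P x \<bullet> b)"
    and "P ` S \<subseteq> T"
  shows "Ck_on k S (\<lambda>x. F (P x))"
  using assms(2,3)
proof (induction k arbitrary: F)
  case 0
  then have "continuous_on S P"
    by (auto simp: continuous_on_componentwise[of S P])
  then show ?case using 0 assms(4) by (auto intro: continuous_on_compose2[of T F S P])
next
  case (Suc k)
  define P' where "P' x v = (\<Sum>b\<in>Basis. frechet_derivative (\<lambda>x. P x \<bullet> b) (at x) v *\<^sub>R b)" for x v
  have P': "(P has_derivative P' x) (at x)" if "x \<in> S" for x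
    unfolding has_derivative_componentwise_within[of P]
    by (auto simp: P'_def inner_sum_left inner_Basis if_distrib cong: if_cong)
      (use Ck_on_Suc_has_derivative[OF Suc.prems(2) that] in \<open>simp add: inner_commute\<close>)
  have F': "(F has_derivative frechet_derivative F (at (P x))) (at (P x))" if "x \<in> S" for x
    using Ck_on_Suc_has_derivative[OF Suc.prems(1)] assms(4) that by blast
  have lin: "frechet_derivative F (at (P x)) (P' x v) =
     (\<Sum>b\<in>Basis. frechet_derivative (\<lambda>x. P x \<bullet> b) (at x) v * frechet_derivative F (at (P x)) b)"
    if "x \<in> S" for x v
  proof -
    interpret bounded_linear "frechet_derivative F (at (P x))"
      using F'[OF that] has_derivative_bounded_linear by blast
    show ?thesis by (simp add: P'_def sum scaleR)
  qed
  show ?case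
  proof (rule Ck_on_Suc_derivI[OF assms(1)])
    show "((\<lambda>x. F (P x)) has_derivative (\<lambda>v. frechet_derivative F (at (P x)) (P' x v))) (at x)"
      if "x \<in> S" for x
      using has_derivative_compose[OF P'[OF that] F'[OF that]] .
    fix v
    have "Ck_on k S (\<lambda>x. \<Sum>b\<in>Basis. frechet_derivative (\<lambda>x. P x \<bullet> b) (at x) v
             * frechet_derivative F (at (P x)) b)"
    proof (intro Ck_on_sum[OF assms(1)] Ck_on_mult[OF assms(1)])
      fix b :: 'f assume b: "b \<in> Basis"
      show "Ck_on k S (\<lambda>x. frechet_derivative (\<lambda>x. P x \<bullet> b) (at x) v)"
        using Suc.prems(2)[OF b] by simp
      show "Ck_on k S (\<lambda>x. frechet_derivative F (at (P x)) b)"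
      proof (rule Suc.IH)
        show "Ck_on k T (\<lambda>x. frechet_derivative F (at x) b)"
          using Suc.prems(1) by simp
        show "Ck_on k S (\<lambda>x. P x \<bullet> b')" if "b' \<in> Basis" for b'
          using Ck_on_Suc_imp[OF Suc.prems(2)[OF that]] .
      qed
    qed
    then show "Ck_on k S (\<lambda>x. frechet_derivative F (at (P x)) (P' x v))"
      by (rule Ck_on_cong[OF assms(1), rotated]) (simp add: lin)
  qed
qed

lemma smooth_on_cong:
  "open S \<Longrightarrow> (\<And>x. x \<in> S \<Longrightarrow> F x = G x) \<Longrightarrow> smooth_on S F \<Longrightarrow> smooth_on S G"
  unfolding smooth_on_def using Ck_on_cong by blast

lemma smooth_on_subset: "smooth_on S F \<Longrightarrow> T \<subseteq> S \<Longrightarrow> smooth_on T F"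
  unfolding smooth_on_def using Ck_on_subset by blast

lemma smooth_on_Ck: "smooth_on S F \<Longrightarrow> Ck_on k S F"
  by (simp only: smooth_on_def)

lemma smooth_on_const [simp]: "smooth_on S (\<lambda>_. c)"
  by (simp add: smooth_on_def)

lemma smooth_on_linear: "bounded_linear L \<Longrightarrow> smooth_on S L"
  by (simp add: smooth_on_def Ck_on_linear)

lemma smooth_on_add:
  "open S \<Longrightarrow> smooth_on S F \<Longrightarrow> smooth_on S G \<Longrightarrow> smooth_on S (\<lambda>x. F x + G x)"
  by (simp add: smooth_on_def Ck_on_add)

lemma smooth_on_mult:
  "open S \<Longrightarrow> smooth_on S F \<Longrightarrow> smooth_on S G \<Longrightarrow> smooth_on S (\<lambda>x. F x * G x)"
  by (simp add: smooth_on_def Ck_on_mult)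

lemma smooth_on_diff:
  assumes "open S" "smooth_on S F" "smooth_on S G"
  shows "smooth_on S (\<lambda>x. F x - G x)"
  using smooth_on_add[OF assms(1,2) smooth_on_mult[OF assms(1) smooth_on_const[of S "-1"] assms(3)]]
  by simp

lemma smooth_on_compose:
  fixes P :: "'e::euclidean_space \<Rightarrow> 'f::euclidean_space"
  assumes "open S" "smooth_on T F" "\<And>b. b \<in> Basis \<Longrightarrow> smooth_on S (\<lambda>x. P x \<bullet> b)" "P ` S \<subseteq> T"
  shows "smooth_on S (\<lambda>x. F (P x))"
  unfolding smooth_on_def
proof
  fix k
  have "Ck_on k T F" using assms(2) unfolding smooth_on_def by simp
  moreover have "Ck_on k S (\<lambda>x. P x \<bullet> b)" if "b \<in> Basis" for b
    using assms(3)[OF that] unfolding smooth_on_def by (rule spec)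
  ultimately show "Ck_on k S (\<lambda>x. F (P x))"
    by (rule Ck_on_compose[OF assms(1) _ _ assms(4)])
qed

lemma smooth_on_continuous: "smooth_on S F \<Longrightarrow> continuous_on S F"
  by (auto simp: smooth_on_def intro: Ck_on_continuous)

lemma smooth_on_has_derivative:
  assumes "smooth_on S F" "x \<in> S"
  shows "(F has_derivative frechet_derivative F (at x)) (at x)"
  using assms Ck_on_Suc_has_derivative unfolding smooth_on_def by blast

lemma smooth_on_frechet:
  assumes "smooth_on S F"
  shows "smooth_on S (\<lambda>x. frechet_derivative F (at x) v)"
  using assms unfolding smooth_on_def by (metis Ck_on.simps(2))

text \<open>Handing over the whole sequence of derivatives makes the induction on the order uniform
  in \<open>n\<close>; \<open>exp\<close> and \<open>bump\<close> are shown to be smooth in this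
  way.\<close>

lemma Ck_on_real_chain:
  fixes D :: "nat \<Rightarrow> real \<Rightarrow> real"
  assumes "open T" "\<And>n x. x \<in> T \<Longrightarrow> (D n has_real_derivative D (Suc n) x) (at x)"
  shows "Ck_on k T (D n)"
proof (induction k arbitrary: n)
  case 0
  then show ?case
    by (simp, intro continuous_at_imp_continuous_on) (use assms(2) DERIV_isCont in blast)
next
  case (Suc k)
  show ?case
  proof (rule Ck_on_Suc_derivI[OF assms(1)])
    show "(D n has_derivative (\<lambda>v. D (Suc n) x * v)) (at x)" if "x \<in> T" for x
      using assms(2)[OF that, of n] by (simp add: has_field_derivative_def)
    show "Ck_on k T (\<lambda>x. D (Suc n) x * v)" for v
      by (intro Ck_on_mult[OF assms(1)] Suc.IH Ck_on_const)
  qed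
qed

lemma smooth_on_real_chain:
  fixes D :: "nat \<Rightarrow> real \<Rightarrow> real"
  assumes "open T" "\<And>n x. x \<in> T \<Longrightarrow> (D n has_real_derivative D (Suc n) x) (at x)"
  shows "smooth_on T (D n)"
  unfolding smooth_on_def using Ck_on_real_chain[of T D, OF assms(1)] assms(2) by blast

lemma smooth_on_compose_real:
  fixes G :: "real \<Rightarrow> real"
  assumes "open S" "smooth_on T G" "smooth_on S F" "F ` S \<subseteq> T"
  shows "smooth_on S (\<lambda>x. G (F x))"
  by (rule smooth_on_compose[OF assms(1,2) _ assms(4)]) (use assms(3) in simp)

lemma smooth_on_exp: "smooth_on UNIV (exp :: real \<Rightarrow> real)"
  by (rule smooth_on_real_chain[of UNIV "\<lambda>_. exp"]) auto

text \<open>The derivative of the inverse is a polynomial in the inverse itself, so the induction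
  hypothesis applies to the derivative.\<close>

lemma smooth_on_inverse_real: "smooth_on (- {0}) (inverse :: real \<Rightarrow> real)"
proof -
  have "Ck_on k (- {0}) (inverse :: real \<Rightarrow> real)" for k
  proof (induction k)
    case 0
    then show ?case by (auto intro!: continuous_intros)
  next
    case (Suc k)
    have "Ck_on k (- {0}) (\<lambda>x::real. - 1 * (inverse x * v * inverse x))" for v
      by (intro Ck_on_mult Ck_on_const Suc.IH) auto
    moreover have "(inverse has_derivative (\<lambda>v. - 1 * (inverse x * v * inverse x))) (at x)"
      if "x \<in> - {0}" for x :: real
      using has_derivative_inverse'[of x UNIV] that by simp
    ultimately show ?case by (intro Ck_on_Suc_derivI) auto
  qed
  then show ?thesis by (simp add: smooth_on_def)
qed

lemma smooth_on_ln: "smooth_on {0<..} (ln :: real \<Rightarrow> real)"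
proof -
  have "Ck_on k {0<..} (ln :: real \<Rightarrow> real)" for k
  proof (cases k)
    case 0
    then show ?thesis by (auto intro!: continuous_intros)
  next
    case (Suc n)
    have "Ck_on n {0<..} (\<lambda>x::real. inverse x * v)" for v
      by (intro Ck_on_mult Ck_on_const Ck_on_subset[OF smooth_on_Ck[OF smooth_on_inverse_real]])
        auto
    moreover have "(ln has_derivative (\<lambda>v. inverse x * v)) (at x)" if "x \<in> {0<..}" for x :: real
      using DERIV_ln[of x] that by (simp add: has_field_derivative_def)
    ultimately show ?thesis
      unfolding Suc by (intro Ck_on_Suc_derivI) auto
  qed
  then show ?thesis by (simp add: smooth_on_def)
qed

text \<open>The classical argument with the second difference
  \<open>F (x + h u + h v) - F (x + h u) - F (x + h v) + F x\<close>, which is symmetric in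
  \<open>u\<close> and \<open>v\<close>. The result is what makes the two Wirtinger derivatives
  commute.\<close>

lemma Schwarz_symmetry:
  fixes F :: "'e::euclidean_space \<Rightarrow> real"
  assumes S: "open S" "x \<in> S" and F: "smooth_on S F"
  shows "frechet_derivative (\<lambda>y. frechet_derivative F (at y) u) (at x) v =
         frechet_derivative (\<lambda>y. frechet_derivative F (at y) v) (at x) u"
proof -
  define Du where "Du w y = frechet_derivative F (at y) w" for w y
  \<comment> \<open>In this proof the name stands for a mixed second derivative, first along
    \<open>w\<close> and then along \<open>w'\<close>; it has nothing to do with momentum
    profiles.\<close>
  define profile_deriv where "profile_deriv w w' y = frechet_derivative (Du w) (at y) w'" for w w' y
  obtain r where r: "r > 0" "ball x r \<subseteq> S" using S openE by blast
  have along: "((\<lambda>t. G (a + t *\<^sub>R w)) has_real_derivative frechet_derivative G (at (a + t *\<^sub>R w))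
      w) (at t)"
    if "smooth_on S G" "a + t *\<^sub>R w \<in> S" for G a w t
  proof -
    have 1: "((\<lambda>t. a + t *\<^sub>R w) has_derivative (\<lambda>t. t *\<^sub>R w)) (at t)"
      by (auto intro!: derivative_eq_intros)
    note G = smooth_on_has_derivative[OF that]
    have "((\<lambda>t. G (a + t *\<^sub>R w)) has_derivative (\<lambda>t'. frechet_derivative G (at (a + t *\<^sub>R w))
        (t' *\<^sub>R w))) (at t)"
      using has_derivative_compose[OF 1 G] .
    moreover have "frechet_derivative G (at (a + t *\<^sub>R w)) (t' *\<^sub>R w) =
        frechet_derivative G (at (a + t *\<^sub>R w)) w * t'" for t'
      using bounded_linear.linear[OF has_derivative_bounded_linear[OF G]]
        by (simp add: linear_scale)
    ultimately show ?thesis by (simp add: has_field_derivative_def)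
  qed
  have dist_eq: "dist x (x + a + b) = norm (a + b)" for a b
  proof -
    have "x - (x + a + b) = - (a + b)" by simp
    then show ?thesis by (simp only: dist_norm norm_minus_cancel)
  qed
  have inS: "x + s *\<^sub>R w + t *\<^sub>R w' \<in> S"
    if "0 \<le> s" "s \<le> h" "0 \<le> t" "t \<le> h" "h * (norm w + norm w') < r" for s t h w w'
  proof -
    have "norm (s *\<^sub>R w + t *\<^sub>R w') \<le> s * norm w + t * norm w'"
      using that by (metis abs_of_nonneg norm_scaleR norm_triangle_ineq)
    also have "\<dots> \<le> h * (norm w + norm w')"
      using that by (simp add: distrib_left add_mono mult_right_mono)
    finally have "x + s *\<^sub>R w + t *\<^sub>R w' \<in> ball x r"
      unfolding mem_ball dist_eq using that by linarith
    then show ?thesis using r by blast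
  qed
  \<comment> \<open>One mean value in direction \<open>w\<close> and a second one in direction
    \<open>w'\<close> turn the second difference into \<open>h * h\<close> times a mixed derivative
    at an intermediate point.\<close>
  have key: "\<exists>\<xi>. dist x \<xi> \<le> h * (norm w + norm w') \<and>
      F (x + h *\<^sub>R w + h *\<^sub>R w') - F (x + h *\<^sub>R w) - F (x + h *\<^sub>R w') + F x =
          h * h * profile_deriv w w' \<xi>"
    if h: "h > 0" "h * (norm w + norm w') < r" for h w w'
  proof -
    define \<phi> where "\<phi> s = F (x + h *\<^sub>R w' + s *\<^sub>R w) - F (x + s *\<^sub>R w)" for s
    have d1: "(\<phi> has_real_derivative (Du w (x + h *\<^sub>R w' + s *\<^sub>R w) - Du w (x + s *\<^sub>R w))) (at s)"
      if "0 \<le> s" "s \<le> h" for s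
      unfolding \<phi>_def[abs_def] Du_def
      using inS[of s h h w w'] inS[of s h 0 w w'] that h
      by (intro derivative_intros along F) (auto simp: algebra_simps)
    from MVT2[of 0 h \<phi>, OF h(1) d1]
    obtain s where s: "0 < s" "s < h"
      "\<phi> h - \<phi> 0 = h * (Du w (x + h *\<^sub>R w' + s *\<^sub>R w) - Du w (x + s *\<^sub>R w))" by auto
    have Duw: "smooth_on S (Du w)" unfolding Du_def[abs_def] using smooth_on_frechet[OF F] .
    have d2: "((\<lambda>t. Du w (x + s *\<^sub>R w + t *\<^sub>R w')) has_real_derivative profile_deriv w w' (x +
        s *\<^sub>R w + t *\<^sub>R w')) (at t)"
      if "0 \<le> t" "t \<le> h" for t
      unfolding profile_deriv_def using inS[of s h t w w'] that h s by (intro along Duw) auto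
    from MVT2[OF h(1) d2] obtain t where t: "0 < t" "t < h"
      "Du w (x + s *\<^sub>R w + h *\<^sub>R w') - Du w (x + s *\<^sub>R w + 0 *\<^sub>R w') =
          (h - 0) * profile_deriv w w' (x + s *\<^sub>R w + t *\<^sub>R w')"
      by blast
    have "norm (s *\<^sub>R w + t *\<^sub>R w') \<le> s * norm w + t * norm w'"
      using s t by (metis abs_of_nonneg norm_scaleR norm_triangle_ineq less_imp_le)
    also have "\<dots> \<le> h * (norm w + norm w')"
      using s t by (simp add: distrib_left add_mono mult_right_mono)
    finally have "dist x (x + s *\<^sub>R w + t *\<^sub>R w') \<le> h * (norm w + norm w')"
      by (simp only: dist_eq)
    moreover have "F (x + h *\<^sub>R w + h *\<^sub>R w') - F (x + h *\<^sub>R w) - F (x + h *\<^sub>R w') + F x =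
        \<phi> h - \<phi> 0"
      by (simp add: \<phi>_def algebra_simps)
    moreover have "\<phi> h - \<phi> 0 = h * (h * profile_deriv w w' (x + s *\<^sub>R w + t *\<^sub>R w'))"
      using s(3) t(3) by (simp add: algebra_simps)
    ultimately show ?thesis by (intro exI[of _ "x + s *\<^sub>R w + t *\<^sub>R w'"]) simp
  qed
  \<comment> \<open>The summand 1 keeps \<open>N\<close> positive when \<open>u\<close> and
    \<open>v\<close> vanish. The step sizes \<open>h n\<close> are then small enough to stay in the
    ball of radius \<open>r\<close>, and they tend to 0.\<close>
  define N where "N = norm u + norm v + 1"
  have N: "N > 0" by (simp add: N_def add_nonneg_pos)
  define h where "h n = r / (2 * N * real (Suc n))" for n
  have h: "h n > 0" "h n * N < r" for n
  proof -
    show "h n > 0" using r N by (simp add: h_def)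
    have "h n * N = r / (2 * real (Suc n))" using N by (simp add: h_def field_simps del: of_nat_Suc)
    also have "\<dots> < r"
      using r by (simp add: field_simps) (smt (verit) mult_nonneg_nonneg of_nat_0_le_iff)
    finally show "h n * N < r" .
  qed
  have hN: "h n * (norm u + norm v) \<le> h n * N" for n using h(1)[of n] by (simp add: N_def)
  \<comment> \<open>Both orders expand the same second difference, but their intermediate points are
    in general different; continuity brings them together in the limit.\<close>
  have "\<exists>\<xi> \<xi>'. dist x \<xi> \<le> h n * N \<and> dist x \<xi>' \<le> h n * N \<and> profile_deriv u v \<xi> =
      profile_deriv v u \<xi>'" for n
  proof -
    have 1: "h n * (norm u + norm v) < r" "h n * (norm v + norm u) < r"
      using hN[of n] h(2)[of n] by (simp_all add: add.commute)
    obtain a where a: "dist x a \<le> h n * (norm u + norm v)"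
      "F (x + h n *\<^sub>R u + h n *\<^sub>R v) - F (x + h n *\<^sub>R u) - F (x + h n *\<^sub>R v) + F x =
          h n * h n * profile_deriv u v a"
      using key[OF h(1) 1(1)] by blast
    obtain b where b: "dist x b \<le> h n * (norm v + norm u)"
      "F (x + h n *\<^sub>R v + h n *\<^sub>R u) - F (x + h n *\<^sub>R v) - F (x + h n *\<^sub>R u) + F x =
          h n * h n * profile_deriv v u b"
      using key[OF h(1) 1(2)] by blast
    have "h n * h n * profile_deriv u v a = h n * h n * profile_deriv v u b"
      using a(2) b(2) by (simp add: add.commute add.left_commute algebra_simps)
    then have "profile_deriv u v a = profile_deriv v u b" using h(1)[of n] by simp
    then show ?thesis using a b hN[of n] by (metis add.commute order_trans)
  qed
  then obtain \<xi> \<xi>' where \<xi>: "\<And>n. dist x (\<xi> n) \<le> h n * N" "\<And>n. dist x (\<xi>' n) \<le> h n * N"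
    "\<And>n. profile_deriv u v (\<xi> n) = profile_deriv v u (\<xi>' n)" by metis
  have h0: "(\<lambda>n. h n * N) \<longlonglongrightarrow> 0"
  proof -
    have "(\<lambda>n. (r/2) * (1 / real (Suc n))) \<longlonglongrightarrow> (r/2) * 0"
      by (intro tendsto_mult tendsto_const) (rule LIMSEQ_Suc[OF lim_1_over_n])
    moreover have "h n * N = (r/2) * (1 / real (Suc n))" for n
      using N by (simp add: h_def del: of_nat_Suc)
    ultimately show ?thesis by simp
  qed
  have lim: "\<eta> \<longlonglongrightarrow> x" if "\<And>n. dist x (\<eta> n) \<le> h n * N" for \<eta>
    by (rule metric_tendsto_imp_tendsto[OF h0])
        (use that in \<open>simp add: dist_commute abs_mult abs_of_pos[OF h(1)] abs_of_pos[OF N]\<close>)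
  have cont: "isCont (profile_deriv w w') x" for w w'
  proof -
    have "smooth_on S (profile_deriv w w')" unfolding profile_deriv_def[abs_def] Du_def[abs_def]
      using smooth_on_frechet[OF smooth_on_frechet[OF F]] .
    then show ?thesis using smooth_on_continuous S continuous_on_eq_continuous_at by blast
  qed
  have "(\<lambda>n. profile_deriv u v (\<xi> n)) \<longlonglongrightarrow> profile_deriv u v x"
    using isCont_tendsto_compose[OF cont lim[OF \<xi>(1)]] .
  moreover have "(\<lambda>n. profile_deriv v u (\<xi>' n)) \<longlonglongrightarrow> profile_deriv v u x"
    using isCont_tendsto_compose[OF cont lim[OF \<xi>(2)]] .
  ultimately have "profile_deriv u v x = profile_deriv v u x"
    using \<xi>(3) LIMSEQ_unique by fastforce
  then show ?thesis by (simp add: profile_deriv_def Du_def[abs_def])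
qed

section \<open>Wirtinger derivatives\<close>

text \<open>The real derivative written as \<open>p dz + q dz\<close>-bar. Carrying both
  coefficients as data gives purely algebraic rules, and uniqueness of derivatives identifies them
  with the values of \<open>wirtinger\<close> and \<open>wirtinger_bar\<close>.\<close>

definition has_wirt :: "(complex \<Rightarrow> complex) \<Rightarrow> complex \<Rightarrow> complex \<Rightarrow> complex \<Rightarrow> bool" where
  "has_wirt \<alpha> p q z \<longleftrightarrow> (\<alpha> has_derivative (\<lambda>h. p * h + q * cnj h)) (at z)"

lemma has_wirt_wirtinger: "has_wirt \<alpha> p q z \<Longrightarrow> wirtinger 1 \<i> \<alpha> z = p"
  and has_wirt_wirtinger_bar: "has_wirt \<alpha> p q z \<Longrightarrow> wirtinger_bar 1 \<i> \<alpha> z = q"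
  by (auto simp: has_wirt_def wirtinger_def wirtinger_bar_def algebra_simps
      dest!: frechet_derivative_at[symmetric])

lemma has_wirt_unique: "has_wirt \<alpha> p q z \<Longrightarrow> has_wirt \<alpha> p' q' z \<Longrightarrow> p = p' \<and> q = q'"
  using has_wirt_wirtinger has_wirt_wirtinger_bar by metis

text \<open>Any real-linear map of the plane has the form \<open>p * h + q * cnj h\<close>: split
  \<open>h\<close> into real and imaginary part and write both through \<open>h\<close> and
  \<open>cnj h\<close>.\<close>

lemma has_wirt_exists:
  assumes "\<alpha> differentiable (at z)"
  shows "has_wirt \<alpha> (wirtinger 1 \<i> \<alpha> z) (wirtinger_bar 1 \<i> \<alpha> z) z"
proof -
  define D where "D = frechet_derivative \<alpha> (at z)"
  have D: "(\<alpha> has_derivative D) (at z)" using assms frechet_derivative_works D_def by blast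
  interpret bounded_linear D using D has_derivative_bounded_linear by blast
  have "D h = wirtinger 1 \<i> \<alpha> z * h + wirtinger_bar 1 \<i> \<alpha> z * cnj h" for h
  proof -
    have "h = Re h *\<^sub>R 1 + Im h *\<^sub>R \<i>" by (simp add: complex_eq_iff)
    then have "D h = Re h *\<^sub>R D 1 + Im h *\<^sub>R D \<i>" by (metis add scaleR)
    also have "\<dots> = D 1 * ((h + cnj h) / 2) - \<i> * D \<i> * ((h - cnj h) / 2)"
      by (simp add: complex_add_cnj complex_diff_cnj scaleR_conv_of_real mult_ac)
    also have "\<dots> = wirtinger 1 \<i> \<alpha> z * h + wirtinger_bar 1 \<i> \<alpha> z * cnj h"
      unfolding wirtinger_def wirtinger_bar_def D_def[symmetric] by (simp add: field_simps)
    finally show ?thesis .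
  qed
  then show ?thesis unfolding has_wirt_def by (intro has_derivative_eq_rhs[OF D] ext)
qed

lemma has_wirt_cong:
  assumes "open S" "z \<in> S" "\<And>y. y \<in> S \<Longrightarrow> \<alpha> y = \<beta> y" "has_wirt \<alpha> p q z"
  shows "has_wirt \<beta> p q z"
  using assms has_derivative_transform_within_open unfolding has_wirt_def by blast

lemma has_wirt_add: "has_wirt \<alpha> p q z \<Longrightarrow> has_wirt \<beta> p' q' z \<Longrightarrow>
    has_wirt (\<lambda>z. \<alpha> z + \<beta> z) (p + p') (q + q') z"
  unfolding has_wirt_def
    by (rule has_derivative_eq_rhs, erule (1) has_derivative_add) (auto simp: algebra_simps)

lemma has_wirt_mult:
  "has_wirt \<alpha> p q z \<Longrightarrow> has_wirt \<beta> p' q' z \<Longrightarrow> has_wirt (\<lambda>z. \<alpha> z * \<beta> z) (p * \<beta> z + \<alpha> z * p')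
      (q * \<beta> z + \<alpha> z * q') z"
  unfolding has_wirt_def
    by (rule has_derivative_eq_rhs, erule (1) has_derivative_mult) (auto simp: algebra_simps)

lemma has_wirt_cnj: "has_wirt \<alpha> p q z \<Longrightarrow> has_wirt (\<lambda>z. cnj (\<alpha> z)) (cnj q) (cnj p) z"
  unfolding has_wirt_def
  by (drule bounded_linear.has_derivative[OF bounded_linear_cnj], erule has_derivative_eq_rhs)
      (auto simp: algebra_simps)

lemma has_wirt_compose_holomorphic:
  assumes "has_wirt \<alpha> p q (\<phi> z)" "(\<phi> has_field_derivative d) (at z)"
  shows "has_wirt (\<lambda>z. \<alpha> (\<phi> z)) (p * d) (q * cnj d) z"
  unfolding has_wirt_def
  by (rule has_derivative_eq_rhs, rule has_derivative_compose[OF assms(2)[unfolded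
      has_field_derivative_def] assms(1)[unfolded has_wirt_def]])
     (auto simp: algebra_simps)

lemma has_wirt_holomorphic: "(\<phi> has_field_derivative d) (at z) \<Longrightarrow> has_wirt \<phi> d 0 z"
  by (simp add: has_wirt_def has_field_derivative_def)

section \<open>Wirtinger calculus in two variables\<close>

definition has_wirt2 :: "(complex \<times> complex \<Rightarrow> complex) \<Rightarrow> complex \<Rightarrow> complex \<Rightarrow> complex \<Rightarrow> complex \<Rightarrow>
    complex \<times> complex \<Rightarrow> bool" where
  "has_wirt2 F p1 q1 p2 q2 y \<longleftrightarrow>
     (F has_derivative (\<lambda>h. p1 * fst h + q1 * cnj (fst h) + p2 * snd h + q2 * cnj (snd h))) (at y)"

lemma one_neq_two [simp]: "(1::2) \<noteq> 2"
  by auto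

lemma has_wirt2_pd:
  assumes "has_wirt2 F p1 q1 p2 q2 y"
  shows "pd 1 F y = p1" "pdbar 1 F y = q1" "pd 2 F y = p2" "pdbar 2 F y = q2"
proof -
  have *: "frechet_derivative F (at y) = (\<lambda>h. p1 * fst h + q1 * cnj (fst h) + p2 * snd h +
      q2 * cnj (snd h))"
    using assms unfolding has_wirt2_def by (rule frechet_derivative_at[symmetric])
  show "pd 1 F y = p1" "pdbar 1 F y = q1" "pd 2 F y = p2" "pdbar 2 F y = q2"
    by (simp_all add: * pd_def pdbar_def wirtinger_def wirtinger_bar_def coord_dir_def
        algebra_simps)
qed

lemma has_wirt2_cong:
  assumes "open S" "z \<in> S" "\<And>y. y \<in> S \<Longrightarrow> F y = G y" "has_wirt2 F p q p' q' z"
  shows "has_wirt2 G p q p' q' z"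
  using assms has_derivative_transform_within_open unfolding has_wirt2_def by blast

lemma has_wirt2_const: "has_wirt2 (\<lambda>_. c) 0 0 0 0 y"
  by (simp add: has_wirt2_def)

lemma has_wirt2_snd: "has_wirt2 snd 0 0 1 0 y"
  unfolding has_wirt2_def by (auto intro!: derivative_eq_intros)

lemma has_wirt2_add:
  "has_wirt2 F p1 q1 p2 q2 y \<Longrightarrow> has_wirt2 G p1' q1' p2' q2' y \<Longrightarrow>
   has_wirt2 (\<lambda>y. F y + G y) (p1 + p1') (q1 + q1') (p2 + p2') (q2 + q2') y"
  unfolding has_wirt2_def
    by (rule has_derivative_eq_rhs, erule (1) has_derivative_add) (auto simp: algebra_simps)

lemma has_wirt2_diff:
  "has_wirt2 F p1 q1 p2 q2 y \<Longrightarrow> has_wirt2 G p1' q1' p2' q2' y \<Longrightarrow>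
   has_wirt2 (\<lambda>y. F y - G y) (p1 - p1') (q1 - q1') (p2 - p2') (q2 - q2') y"
  unfolding has_wirt2_def
    by (rule has_derivative_eq_rhs, erule (1) has_derivative_diff) (auto simp: algebra_simps)

lemma has_wirt2_mult:
  "has_wirt2 F p1 q1 p2 q2 y \<Longrightarrow> has_wirt2 G p1' q1' p2' q2' y \<Longrightarrow>
   has_wirt2 (\<lambda>y. F y * G y) (p1 * G y + F y * p1') (q1 * G y + F y * q1')
     (p2 * G y + F y * p2') (q2 * G y + F y * q2') y"
  unfolding has_wirt2_def
    by (rule has_derivative_eq_rhs, erule (1) has_derivative_mult) (auto simp: algebra_simps)

lemma has_wirt2_inverse:
  assumes "has_wirt2 F p1 q1 p2 q2 y" "F y \<noteq> 0"
  shows "has_wirt2 (\<lambda>y. inverse (F y)) (- p1 / (F y)\<^sup>2) (- q1 / (F y)\<^sup>2) (- p2 / (F y)\<^sup>2)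
      (- q2 / (F y)\<^sup>2) y"
  unfolding has_wirt2_def
  by (rule has_derivative_eq_rhs, rule Deriv.has_derivative_inverse[OF assms(2)
      assms(1)[unfolded has_wirt2_def]])
    (use assms(2) in \<open>auto simp: field_simps power2_eq_square\<close>)

lemma has_wirt2_divide:
  assumes "has_wirt2 F p1 q1 p2 q2 y" "has_wirt2 G p1' q1' p2' q2' y" "G y \<noteq> 0"
  shows "has_wirt2 (\<lambda>y. F y / G y) ((p1 * G y - F y * p1') / (G y)\<^sup>2) ((q1 * G y - F y * q1')
      / (G y)\<^sup>2)
     ((p2 * G y - F y * p2') / (G y)\<^sup>2) ((q2 * G y - F y * q2') / (G y)\<^sup>2) y"
proof -
  have eq: "p * inverse (G y) + F y * (- p' / (G y)\<^sup>2) = (p * G y - F y * p') / (G y)\<^sup>2" for p p'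
    using assms(3) by (simp add: field_simps power2_eq_square)
  show ?thesis
    using has_wirt2_mult[OF assms(1) has_wirt2_inverse[OF assms(2,3)]]
    unfolding eq divide_inverse[of "F _" "G _", symmetric] by (simp add: divide_inverse)
qed

lemma has_wirt2_cnj: "has_wirt2 F p1 q1 p2 q2 y \<Longrightarrow>
    has_wirt2 (\<lambda>y. cnj (F y)) (cnj q1) (cnj p1) (cnj q2) (cnj p2) y"
  unfolding has_wirt2_def
  by (drule bounded_linear.has_derivative[OF bounded_linear_cnj], erule has_derivative_eq_rhs)
      (auto simp: algebra_simps)

lemma has_wirt2_fst:
  assumes "has_wirt \<alpha> p q (fst y)" shows "has_wirt2 (\<lambda>y. \<alpha> (fst y)) p q 0 0 y"
  unfolding has_wirt2_def
  by (rule has_derivative_eq_rhs,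
      rule has_derivative_compose[OF bounded_linear_imp_has_derivative[OF bounded_linear_fst]
          assms[unfolded has_wirt_def]])
    auto

text \<open>The chain rule has to pass through the reals, where \<open>G\<close> lives:
  \<open>\<sigma>\<close> has the derivative \<open>Re (D h)\<close>, and uniqueness of derivatives
  then shows that \<open>D\<close> is real valued.\<close>

lemma of_real_compose_derivative:
  fixes \<sigma> :: "'e::real_normed_vector \<Rightarrow> real" and D :: "'e \<Rightarrow> complex"
  assumes "((\<lambda>y. complex_of_real (\<sigma> y)) has_derivative D) (at y)"
    and "(G has_real_derivative G') (at (\<sigma> y))"
  shows "((\<lambda>y. complex_of_real (G (\<sigma> y))) has_derivative (\<lambda>h. of_real G' * D h)) (at y)"
proof -
  have R: "(\<sigma> has_derivative (\<lambda>h. Re (D h))) (at y)"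
    using bounded_linear.has_derivative[OF bounded_linear_Re assms(1)] by simp
  then have "((\<lambda>y. complex_of_real (\<sigma> y)) has_derivative (\<lambda>h. of_real (Re (D h)))) (at y)"
    by (rule bounded_linear.has_derivative[OF bounded_linear_of_real])
  then have D: "D = (\<lambda>h. of_real (Re (D h)))"
    using assms(1) has_derivative_unique by blast
  have "((\<lambda>y. G (\<sigma> y)) has_derivative (\<lambda>h. G' * Re (D h))) (at y)"
    using has_derivative_compose[OF R assms(2)[unfolded has_field_derivative_def]] .
  then have "((\<lambda>y. complex_of_real (G (\<sigma> y))) has_derivative (\<lambda>h. of_real (G' * Re (D h)))) (at y)"
    by (rule bounded_linear.has_derivative[OF bounded_linear_of_real])
  then show ?thesis
    by (rule has_derivative_eq_rhs) (subst D, simp)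
qed

lemma has_wirt2_real:
  assumes "has_wirt2 (\<lambda>y. of_real (\<sigma> y)) p1 q1 p2 q2 y" "(G has_real_derivative G') (at (\<sigma> y))"
  shows "has_wirt2 (\<lambda>y. of_real (G (\<sigma> y))) (of_real G' * p1) (of_real G' * q1) (of_real G' * p2)
      (of_real G' * q2) y"
  unfolding has_wirt2_def
  by (rule has_derivative_eq_rhs, rule of_real_compose_derivative[OF assms(1)[unfolded
      has_wirt2_def] assms(2)])
    (auto simp: algebra_simps)

lemma has_wirt_real:
  assumes "has_wirt (\<lambda>y. of_real (\<sigma> y)) p q y" "(G has_real_derivative G') (at (\<sigma> y))"
  shows "has_wirt (\<lambda>y. of_real (G (\<sigma> y))) (of_real G' * p) (of_real G' * q) y"
  unfolding has_wirt_def
  by (rule has_derivative_eq_rhs, rule of_real_compose_derivative[OF assms(1)[unfolded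
      has_wirt_def] assms(2)])
    (auto simp: algebra_simps)

lemma has_wirt_ln_norm:
  assumes "w \<noteq> 0"
  shows "has_wirt (\<lambda>w. of_real (ln ((cmod w)\<^sup>2))) (1 / w) (1 / cnj w) w"
proof -
  have id: "has_wirt (\<lambda>w. w) 1 0 w" by (simp add: has_wirt_def)
  have "has_wirt (\<lambda>w. of_real ((cmod w)\<^sup>2)) (cnj w) w w"
    using has_wirt_mult[OF id has_wirt_cnj[OF id]]
    by (simp add: complex_norm_square del: of_real_power)
  from has_wirt_real[OF this DERIV_ln_divide] assms
  have "has_wirt (\<lambda>w. of_real (ln ((cmod w)\<^sup>2))) (of_real (1 / (cmod w)\<^sup>2) * cnj w)
      (of_real (1 / (cmod w)\<^sup>2) * w) w"
    by simp
  moreover have "of_real (1 / (cmod w)\<^sup>2) * cnj w = 1 / w" "of_real (1 / (cmod w)\<^sup>2) * w =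
      1 / cnj w"
    using assms complex_norm_square[of w] by (simp_all add: field_simps)
  ultimately show ?thesis by simp
qed

section \<open>Smooth complex-valued functions\<close>

definition csmooth :: "'e::euclidean_space set \<Rightarrow> ('e \<Rightarrow> complex) \<Rightarrow> bool" where
  "csmooth S \<alpha> \<longleftrightarrow> smooth_on S (\<lambda>x. Re (\<alpha> x)) \<and> smooth_on S (\<lambda>x. Im (\<alpha> x))"

lemma csmooth_cong: "open S \<Longrightarrow> (\<And>x. x \<in> S \<Longrightarrow> \<alpha> x = \<beta> x) \<Longrightarrow> csmooth S \<alpha> \<Longrightarrow> csmooth S \<beta>"
  unfolding csmooth_def
  using smooth_on_cong[of S "\<lambda>x. Re (\<alpha> x)" "\<lambda>x. Re (\<beta> x)"]
    smooth_on_cong[of S "\<lambda>x. Im (\<alpha> x)" "\<lambda>x. Im (\<beta> x)"] by simp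

lemma csmooth_of_real: "smooth_on S u \<Longrightarrow> csmooth S (\<lambda>x. of_real (u x))"
  by (simp add: csmooth_def)

lemma csmooth_const: "csmooth S (\<lambda>x. c)"
  by (simp add: csmooth_def)

lemma csmooth_linear: "bounded_linear L \<Longrightarrow> csmooth S L"
  unfolding csmooth_def
  by (auto intro!: smooth_on_linear bounded_linear_compose[OF bounded_linear_Re]
      bounded_linear_compose[OF bounded_linear_Im])

lemma csmooth_add: "open S \<Longrightarrow> csmooth S \<alpha> \<Longrightarrow> csmooth S \<beta> \<Longrightarrow> csmooth S (\<lambda>x. \<alpha> x + \<beta> x)"
  by (simp add: csmooth_def smooth_on_add)

lemma csmooth_mult: "open S \<Longrightarrow> csmooth S \<alpha> \<Longrightarrow> csmooth S \<beta> \<Longrightarrow> csmooth S (\<lambda>x. \<alpha> x * \<beta> x)"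
  by (simp add: csmooth_def smooth_on_add smooth_on_diff smooth_on_mult)

lemma csmooth_cnj: "open S \<Longrightarrow> csmooth S \<alpha> \<Longrightarrow> csmooth S (\<lambda>x. cnj (\<alpha> x))"
  using smooth_on_diff[of S "\<lambda>_. 0" "\<lambda>x. Im (\<alpha> x)"] by (simp add: csmooth_def)

lemma csmooth_inverse:
  assumes "open S" "csmooth S \<alpha>" "\<And>x. x \<in> S \<Longrightarrow> \<alpha> x \<noteq> 0"
  shows "csmooth S (\<lambda>x. inverse (\<alpha> x))"
proof -
  have 1: "smooth_on S (\<lambda>x. Re (\<alpha> x) * Re (\<alpha> x) + Im (\<alpha> x) * Im (\<alpha> x))"
    using assms by (simp add: csmooth_def smooth_on_add smooth_on_mult)
  have nz: "Re (\<alpha> x) * Re (\<alpha> x) + Im (\<alpha> x) * Im (\<alpha> x) \<noteq> 0" if "x \<in> S" for x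
    using assms(3)[OF that] by (simp add: complex_eq_iff sum_squares_eq_zero_iff)
  have 2: "smooth_on S (\<lambda>x. inverse (Re (\<alpha> x) * Re (\<alpha> x) + Im (\<alpha> x) * Im (\<alpha> x)))"
    by (rule smooth_on_compose_real[OF assms(1) smooth_on_inverse_real 1]) (use nz in auto)
  have "csmooth S (\<lambda>x. cnj (\<alpha> x) * of_real (inverse (Re (\<alpha> x) * Re (\<alpha> x) + Im (\<alpha> x) * Im (\<alpha> x))))"
    using assms(1,2) 2 by (intro csmooth_mult csmooth_cnj csmooth_of_real)
  then show ?thesis
    by (rule csmooth_cong[OF assms(1), rotated])
      (simp add: complex_eq_iff power2_eq_square divide_inverse right_inverse[OF nz])
qed

lemma csmooth_continuous: "csmooth S \<alpha> \<Longrightarrow> continuous_on S \<alpha>"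
  unfolding csmooth_def continuous_on_componentwise[of S \<alpha>]
  by (auto simp: Basis_complex_def intro: smooth_on_continuous)

lemma csmooth_has_derivative:
  assumes "csmooth S \<alpha>" "x \<in> S"
  shows "(\<alpha> has_derivative (\<lambda>v. Complex (frechet_derivative (\<lambda>x. Re (\<alpha> x)) (at x) v)
             (frechet_derivative (\<lambda>x. Im (\<alpha> x)) (at x) v))) (at x)"
proof -
  have "((\<lambda>x. of_real (Re (\<alpha> x)) + \<i> * of_real (Im (\<alpha> x))) has_derivative
     (\<lambda>v. of_real (frechet_derivative (\<lambda>x. Re (\<alpha> x)) (at x) v) +
          \<i> * of_real (frechet_derivative (\<lambda>x. Im (\<alpha> x)) (at x) v))) (at x)"
    using assms unfolding csmooth_def
    by (intro derivative_intros smooth_on_has_derivative) auto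
  then show ?thesis by (simp add: Complex_eq complex_eq[symmetric])
qed

lemma csmooth_frechet_eq:
  assumes "csmooth S \<alpha>" "x \<in> S"
  shows "frechet_derivative \<alpha> (at x) = (\<lambda>v. Complex (frechet_derivative (\<lambda>x. Re (\<alpha> x)) (at x) v)
             (frechet_derivative (\<lambda>x. Im (\<alpha> x)) (at x) v))"
  using frechet_derivative_at[OF csmooth_has_derivative[OF assms]] by simp

lemma csmooth_differentiable: "csmooth S \<alpha> \<Longrightarrow> x \<in> S \<Longrightarrow> \<alpha> differentiable (at x)"
  using csmooth_has_derivative differentiable_def by blast

lemma csmooth_frechet:
  assumes "open S" "csmooth S \<alpha>"
  shows "csmooth S (\<lambda>x. frechet_derivative \<alpha> (at x) v)"
proof -
  have "csmooth S (\<lambda>x. Complex (frechet_derivative (\<lambda>x. Re (\<alpha> x)) (at x) v)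
             (frechet_derivative (\<lambda>x. Im (\<alpha> x)) (at x) v))"
    using assms(2) by (simp add: csmooth_def smooth_on_frechet)
  then show ?thesis
    by (rule csmooth_cong[OF assms(1), rotated]) (simp add: csmooth_frechet_eq[OF assms(2)])
qed

lemma csmooth_diff: "open S \<Longrightarrow> csmooth S \<alpha> \<Longrightarrow> csmooth S \<beta> \<Longrightarrow> csmooth S (\<lambda>x. \<alpha> x - \<beta> x)"
  by (simp add: csmooth_def smooth_on_diff)

lemma csmooth_wirtinger:
  assumes "open S" "csmooth S \<alpha>" shows "csmooth S (wirtinger e e' \<alpha>)"
  unfolding wirtinger_def[abs_def] divide_inverse
  by (intro csmooth_mult csmooth_diff csmooth_frechet csmooth_const assms)

lemma csmooth_wirtinger_bar:
  assumes "open S" "csmooth S \<alpha>" shows "csmooth S (wirtinger_bar e e' \<alpha>)"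
  unfolding wirtinger_bar_def[abs_def] divide_inverse
  by (intro csmooth_mult csmooth_add csmooth_frechet csmooth_const assms)

lemma csmooth_Schwarz:
  assumes "open S" "csmooth S \<alpha>" "x \<in> S"
  shows "frechet_derivative (\<lambda>y. frechet_derivative \<alpha> (at y) u) (at x) v =
         frechet_derivative (\<lambda>y. frechet_derivative \<alpha> (at y) v) (at x) u"
proof -
  have "frechet_derivative (\<lambda>y. frechet_derivative \<alpha> (at y) u) (at x) v =
      Complex (frechet_derivative (\<lambda>y. frechet_derivative (\<lambda>x. Re (\<alpha> x)) (at y) u) (at x) v)
        (frechet_derivative (\<lambda>y. frechet_derivative (\<lambda>x. Im (\<alpha> x)) (at y) u) (at x) v)" for u v
  proof -
    have "frechet_derivative (\<lambda>y. frechet_derivative \<alpha> (at y) u) (at x) v =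
      frechet_derivative (\<lambda>y. Complex (frechet_derivative (\<lambda>x. Re (\<alpha> x)) (at y) u)
             (frechet_derivative (\<lambda>x. Im (\<alpha> x)) (at y) u)) (at x) v"
      by (subst frechet_derivative_cong_open[OF assms(1,3)])
        (auto simp: csmooth_frechet_eq[OF assms(2)])
    also have "\<dots> = Complex (frechet_derivative (\<lambda>y. frechet_derivative (\<lambda>x. Re (\<alpha> x)) (at y) u)
        (at x) v)
        (frechet_derivative (\<lambda>y. frechet_derivative (\<lambda>x. Im (\<alpha> x)) (at y) u) (at x) v)"
      by (subst csmooth_frechet_eq[OF _ assms(3)])
        (use assms(2) in \<open>simp_all add: csmooth_def smooth_on_frechet\<close>)
    finally show ?thesis .
  qed
  then show ?thesis
    using Schwarz_symmetry[OF assms(1,3)] assms(2) by (simp add: csmooth_def)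
qed

text \<open>Expanded into real derivatives, the two sides differ only in the order of the mixed
  derivatives along \<open>e\<close> and \<open>e'\<close>.\<close>

lemma wirtinger_commute:
  assumes "open S" "csmooth S \<alpha>" "z \<in> S"
  shows "wirtinger e e' (wirtinger_bar e e' \<alpha>) z = wirtinger_bar e e' (wirtinger e e' \<alpha>) z"
proof -
  define D where "D u y = frechet_derivative \<alpha> (at y) u" for u y
  have D: "(D u has_derivative frechet_derivative (D u) (at z)) (at z)" for u
    using csmooth_differentiable[OF csmooth_frechet[OF assms(1,2)] assms(3)]
        frechet_derivative_works
    unfolding D_def by blast
  have 1: "frechet_derivative (wirtinger_bar e e' \<alpha>) (at z) =
     (\<lambda>h. (frechet_derivative (D e) (at z) h + \<i> * frechet_derivative (D e') (at z) h) / 2)"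
    unfolding wirtinger_bar_def[abs_def] D_def[symmetric]
    by (rule frechet_derivative_at[symmetric]) (auto intro!: derivative_eq_intros D)
  have 2: "frechet_derivative (wirtinger e e' \<alpha>) (at z) =
     (\<lambda>h. (frechet_derivative (D e) (at z) h - \<i> * frechet_derivative (D e') (at z) h) / 2)"
    unfolding wirtinger_def[abs_def] D_def[symmetric]
    by (rule frechet_derivative_at[symmetric]) (auto intro!: derivative_eq_intros D)
  have 3: "frechet_derivative (D e) (at z) e' = frechet_derivative (D e') (at z) e"
    unfolding D_def[abs_def] by (rule csmooth_Schwarz[OF assms])
  show ?thesis
    unfolding wirtinger_def[of e e' "wirtinger_bar e e' \<alpha>"] wirtinger_bar_def[of e e'
        "wirtinger e e' \<alpha>"]
      1 2 3 by (simp add: field_simps)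
qed

lemma csmooth_has_wirt:
  assumes "csmooth S \<alpha>" "z \<in> S"
  shows "has_wirt \<alpha> (wirtinger 1 \<i> \<alpha> z) (wirtinger_bar 1 \<i> \<alpha> z) z"
  using has_wirt_exists csmooth_differentiable assms by blast

lemma csmooth_holomorphic:
  assumes "open S" "\<phi> holomorphic_on S"
  shows "csmooth S \<phi>"
proof -
  \<comment> \<open>The constant \<open>c\<close> makes the induction close: the derivative of
    \<open>Re (c * \<phi> z)\<close> along \<open>v\<close> is the real part of \<open>c * v\<close>
    times \<open>deriv \<phi> z\<close>, of the same shape. The constants 1 and
    \<open>- \<i>\<close> give real and imaginary part.\<close>
  have "Ck_on k S (\<lambda>z. Re (c * \<phi> z))" if "\<phi> holomorphic_on S" for k c \<phi>
    using that
  proof (induction k arbitrary: \<phi> c)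
    case 0
    then show ?case by (auto intro!: continuous_intros holomorphic_on_imp_continuous_on)
  next
    case (Suc k)
    have "((\<lambda>z. Re (c * \<phi> z)) has_derivative (\<lambda>v. Re (c * (deriv \<phi> z * v)))) (at z)" if
        "z \<in> S" for z
    proof -
      have "(\<phi> has_derivative (\<lambda>v. deriv \<phi> z * v)) (at z)"
        using holomorphic_derivI[OF Suc.prems assms(1) that] by (simp add: has_field_derivative_def)
      then show ?thesis by (auto intro!: derivative_eq_intros)
    qed
    moreover have "Ck_on k S (\<lambda>z. Re (c * (deriv \<phi> z * v)))" for v
      using Suc.IH[OF holomorphic_deriv[OF Suc.prems assms(1)], of "c * v"]
      by (simp add: mult_ac)
    ultimately show ?case by (rule Ck_on_Suc_derivI[OF assms(1)])
  qed
  then have "Ck_on k S (\<lambda>z. Re (1 * \<phi> z))" "Ck_on k S (\<lambda>z. Re (- \<i> * \<phi> z))" for k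
    using assms(2) by blast+
  then show ?thesis unfolding csmooth_def smooth_on_def by simp
qed

text \<open>\<open>ddbar1\<close> takes a real part by definition. For real \<open>u\<close> nothing
  is lost: conjugation exchanges the two Wirtinger derivatives and these commute, so the mixed
  derivative equals its own conjugate.\<close>

lemma ddbar1_has_wirt:
  assumes "open S" "csmooth S (\<lambda>y. of_real (u y))" "z \<in> S"
  shows "wirtinger 1 \<i> (wirtinger_bar 1 \<i> (\<lambda>y. complex_of_real (u y))) z = of_real (ddbar1 u z)"
    and "wirtinger_bar 1 \<i> (wirtinger 1 \<i> (\<lambda>y. complex_of_real (u y))) z = of_real (ddbar1 u z)"
    and "wirtinger_bar 1 \<i> (\<lambda>y. complex_of_real (u y)) z =
        cnj (wirtinger 1 \<i> (\<lambda>y. complex_of_real (u y)) z)"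
proof -
  let ?u = "\<lambda>y. complex_of_real (u y)"
  have bar: "wirtinger_bar 1 \<i> ?u y = cnj (wirtinger 1 \<i> ?u y)" if "y \<in> S" for y
  proof -
    have "has_wirt ?u (wirtinger 1 \<i> ?u y) (wirtinger_bar 1 \<i> ?u y) y"
      using csmooth_has_wirt[OF assms(2) that] .
    moreover from has_wirt_cnj[OF this]
    have "has_wirt ?u (cnj (wirtinger_bar 1 \<i> ?u y)) (cnj (wirtinger 1 \<i> ?u y)) y"
      by (simp only: complex_cnj_complex_of_real)
    ultimately show ?thesis using has_wirt_unique by blast
  qed
  then show "wirtinger_bar 1 \<i> ?u z = cnj (wirtinger 1 \<i> ?u z)" using assms by blast
  note c = wirtinger_commute[OF assms(1,2,3), of 1 \<i>]
  have W: "has_wirt (wirtinger 1 \<i> ?u) (wirtinger 1 \<i> (wirtinger 1 \<i> ?u) z)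
      (wirtinger_bar 1 \<i> (wirtinger 1 \<i> ?u) z) z"
    using csmooth_has_wirt[OF csmooth_wirtinger[OF assms(1,2)] assms(3)] .
  have "has_wirt (wirtinger_bar 1 \<i> ?u) (cnj (wirtinger_bar 1 \<i> (wirtinger 1 \<i> ?u) z))
      (cnj (wirtinger 1 \<i> (wirtinger 1 \<i> ?u) z)) z"
    by (rule has_wirt_cong[OF assms(1,3) _ has_wirt_cnj[OF W]]) (simp add: bar)
  then have "wirtinger 1 \<i> (wirtinger_bar 1 \<i> ?u) z = cnj (wirtinger_bar 1 \<i> (wirtinger 1 \<i> ?u) z)"
    by (rule has_wirt_wirtinger)
  then have "wirtinger 1 \<i> (wirtinger_bar 1 \<i> ?u) z = cnj (wirtinger 1 \<i> (wirtinger_bar 1 \<i> ?u) z)"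
    using c by simp
  from arg_cong[OF this, of Im] have "Im (wirtinger 1 \<i> (wirtinger_bar 1 \<i> ?u) z) = 0"
    by simp
  then show "wirtinger 1 \<i> (wirtinger_bar 1 \<i> ?u) z = of_real (ddbar1 u z)"
    by (simp add: ddbar1_def complex_eq_iff)
  then show "wirtinger_bar 1 \<i> (wirtinger 1 \<i> ?u) z = of_real (ddbar1 u z)"
    using c by simp
qed

lemma has_wirt2_eqI:
  "has_wirt2 F p1 q1 p2 q2 y \<Longrightarrow> p1 = p1' \<Longrightarrow> q1 = q1' \<Longrightarrow> p2 = p2' \<Longrightarrow> q2 = q2' \<Longrightarrow>
      has_wirt2 F p1' q1' p2' q2' y"
  by simp

text \<open>The curvature uses only the conjugate derivatives of the connection; the other two
  coefficients are hidden here and never have to be simplified.\<close>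

lemma has_wirt2_exI:
  "has_wirt2 F p1 q1 p2 q2 y \<Longrightarrow> q1 = q1' \<Longrightarrow> q2 = q2' \<Longrightarrow> \<exists>p p'. has_wirt2 F p q1' p' q2' y"
  by blast

text \<open>\<open>matrix_inv\<close> is a choice, made meaningful by the adjugate. The form
  \<open>H ** C\<close> allows a matrix \<open>matrix_inv H ** B\<close> to be identified by
  checking \<open>B = H ** C\<close>, without inverting \<open>H\<close>.\<close>

lemma matrix_inv_cancel_2:
  fixes H C :: "complex^2^2"
  assumes "H$1$1 * H$2$2 - H$1$2 * H$2$1 \<noteq> 0"
  shows "matrix_inv H ** (H ** C) = C"
proof -
  define D where "D = H$1$1 * H$2$2 - H$1$2 * H$2$1"
  define J :: "complex^2^2" where
    "J = (\<chi> i j. if i = 1 then (if j = 1 then H$2$2 / D else - H$1$2 / D)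
                   else (if j = 1 then - H$2$1 / D else H$1$1 / D))"
  have "D \<noteq> 0" using assms D_def by simp
  then have "H ** J = mat 1 \<and> J ** H = mat 1"
    by (auto simp: vec_eq_iff forall_2 matrix_matrix_mult_def sum_2 J_def mat_def
        diff_divide_distrib[symmetric]
        add_divide_distrib[symmetric] mult.commute)
      (auto simp: D_def field_simps)
  then have "\<exists>J. H ** J = mat 1 \<and> J ** H = mat 1" by blast
  from someI_ex[OF this] have "matrix_inv H ** H = mat 1"
    by (simp add: matrix_inv_def)
  then show ?thesis by (simp add: matrix_mul_assoc)
qed

section \<open>Curvature of the momentum construction\<close>

text \<open>
  Here and below the profile is read as a function of \<open>s\<close>: \<open>\<phi>\<close> is \<open>f''\<close>, and \<open>v\<close>, \<open>v2\<close> are the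
  first two derivatives of the profile in \<open>\<gamma>\<close>, so that \<open>d\<phi>/ds = v \<phi>\<close>.
\<close>

definition momentum_curvature ::
  "(real \<Rightarrow> real) \<Rightarrow> (real \<Rightarrow> real) \<Rightarrow> (real \<Rightarrow> real) \<Rightarrow> (real \<Rightarrow> real) \<Rightarrow> real \<Rightarrow> real" where
  "momentum_curvature \<gamma> \<phi> v v2 r =
     2 * ((1 + \<phi> r / \<gamma> r) * v2 r + (v r - \<phi> r / \<gamma> r) * (v r * \<gamma> r - \<phi> r) / (\<gamma> r)\<^sup>2) / \<gamma> r"

text \<open>
  On the base, \<open>\<eta> = ln h\<close> and \<open>\<omega>\<^sub>\<Sigma>\<close> has the density \<open>K\<close>; the remaining data are \<open>a = \<eta>\<^sub>z\<close>,
  \<open>b = \<eta>\<^sub>z\<^sub>z\<close> and \<open>l = (ln K)\<^sub>z\<close>. The equation for \<open>l\<close> is the condition \<open>Ric = -2\<omega>\<^sub>\<Sigma>\<close>.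
\<close>

locale momentum_chart =
  fixes S :: "complex set" and \<eta> K :: "complex \<Rightarrow> real" and a b b' l l' :: "complex \<Rightarrow> complex"
    and f \<gamma> \<phi> v v2 :: "real \<Rightarrow> real"
  assumes S: "open S"
    and has_wirt_eta: "z \<in> S \<Longrightarrow> has_wirt (\<lambda>z. of_real (\<eta> z)) (a z) (cnj (a z)) z"
    and has_wirt_a: "z \<in> S \<Longrightarrow> has_wirt a (b z) (of_real (K z)) z"
    and has_wirt_b: "z \<in> S \<Longrightarrow> has_wirt b (b' z) (of_real (K z) * l z) z"
    and has_wirt_K: "z \<in> S \<Longrightarrow> has_wirt (\<lambda>z. of_real (K z)) (of_real (K z) * l z) (of_real (K z)
        * cnj (l z)) z"
    and has_wirt_l: "z \<in> S \<Longrightarrow> has_wirt l (l' z) (2 * of_real (K z)) z"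
    and K_pos: "z \<in> S \<Longrightarrow> K z > 0"
    and f: "(f has_real_derivative (\<gamma> r - 1)) (at r)"
    and \<gamma>: "(\<gamma> has_real_derivative \<phi> r) (at r)"
    and \<phi>: "(\<phi> has_real_derivative v r * \<phi> r) (at r)"
    and v: "(v has_real_derivative v2 r * \<phi> r) (at r)"
    and \<gamma>_pos: "\<gamma> r > 0" and \<phi>_pos: "\<phi> r > 0"
begin

definition "punctured = S \<times> (- {0::complex})"

definition s :: "complex \<times> complex \<Rightarrow> real" where
  "s y = ln ((cmod (snd y))\<^sup>2) + \<eta> (fst y)"

text \<open>As \<open>\<phi>\<close> is the derivative of \<open>\<gamma>\<close>, this is the
  logarithmic derivative of \<open>\<gamma>\<close> in \<open>s\<close>; in the same way
  \<open>v\<close> is that of \<open>\<phi>\<close>. The connection is built from these two.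
  \<open>u1\<close> is the derivative of \<open>uu\<close>.\<close>

definition "uu r = \<phi> r / \<gamma> r"
definition "u1 r = \<phi> r * (v r * \<gamma> r - \<phi> r) / (\<gamma> r)\<^sup>2"

lemma uu: "(uu has_real_derivative u1 r) (at r)"
  unfolding uu_def[abs_def] u1_def
  using \<gamma>_pos[of r] by (auto intro!: derivative_eq_intros \<phi> \<gamma> simp: power2_eq_square algebra_simps)

lemma open_punctured: "open punctured"
  unfolding punctured_def using S by (intro open_Times) auto

lemma has_wirt2_s:
  assumes "y \<in> punctured"
  shows "has_wirt2 (\<lambda>y. of_real (s y)) (a (fst y)) (cnj (a (fst y))) (1 / snd y)
      (1 / cnj (snd y)) y"
proof -
  have "has_wirt (\<lambda>w. of_real (ln ((cmod w)\<^sup>2))) (1 / snd y) (1 / cnj (snd y)) (snd y)"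
    by (rule has_wirt_ln_norm) (use assms in \<open>auto simp: punctured_def\<close>)
  then have "has_wirt2 (\<lambda>y. of_real (ln ((cmod (snd y))\<^sup>2))) 0 0 (1 / snd y) (1 / cnj (snd y)) y"
    unfolding has_wirt2_def has_wirt_def
    by (intro has_derivative_eq_rhs[OF has_derivative_compose[OF
        bounded_linear_imp_has_derivative[OF bounded_linear_snd]]])
      auto
  from has_wirt2_add[OF this has_wirt2_fst[OF has_wirt_eta]] assms show ?thesis
    by (auto simp: s_def punctured_def)
qed

lemma has_wirt2_comp_s:
  assumes "y \<in> punctured" "\<And>r. (G has_real_derivative G' r) (at r)"
  shows "has_wirt2 (\<lambda>y. of_real (G (s y))) (of_real (G' (s y)) * a (fst y)) (of_real (G' (s y))
      * cnj (a (fst y)))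
    (of_real (G' (s y)) / snd y) (of_real (G' (s y)) / cnj (snd y)) y"
  using has_wirt2_real[OF has_wirt2_s[OF assms(1)] assms(2)] by simp

abbreviation "cA y \<equiv> a (fst y)"
abbreviation "cB y \<equiv> b (fst y)"
abbreviation "cL y \<equiv> l (fst y)"
abbreviation "cK y \<equiv> complex_of_real (K (fst y))"
abbreviation "cG y \<equiv> complex_of_real (\<gamma> (s y))"
abbreviation "cP y \<equiv> complex_of_real (\<phi> (s y))"
abbreviation "cV y \<equiv> complex_of_real (v (s y))"
abbreviation "cU y \<equiv> complex_of_real (uu (s y))"
abbreviation "cU1 y \<equiv> complex_of_real (u1 (s y))"
abbreviation "cV1 y \<equiv> complex_of_real (v2 (s y)) * complex_of_real (\<phi> (s y))"

context
  fixes y assumes y: "y \<in> punctured"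
begin

lemma fy: "fst y \<in> S" and wy: "snd y \<noteq> 0" "cnj (snd y) \<noteq> 0"
  using y by (auto simp: punctured_def)

lemma nz: "cG y \<noteq> 0" "cP y \<noteq> 0" "cK y \<noteq> 0"
  using \<gamma>_pos[of "s y"] \<phi>_pos[of "s y"] K_pos[OF fy] by auto

lemma cU_eq: "cU y = cP y / cG y"
  by (simp add: uu_def)

lemma has_wirt2_G: "has_wirt2 cG (cP y * cA y) (cP y * cnj (cA y)) (cP y / snd y)
    (cP y / cnj (snd y)) y"
  by (rule has_wirt2_comp_s[OF y \<gamma>])

lemma has_wirt2_G1: "has_wirt2 (\<lambda>y. cG y - 1) (cP y * cA y) (cP y * cnj (cA y)) (cP y / snd y)
    (cP y / cnj (snd y)) y"
  by (rule has_wirt2_eqI, rule has_wirt2_diff[OF has_wirt2_G has_wirt2_const]) auto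

lemma has_wirt2_P: "has_wirt2 cP (cV y * cP y * cA y) (cV y * cP y * cnj (cA y))
    (cV y * cP y / snd y) (cV y * cP y / cnj (snd y)) y"
  using has_wirt2_comp_s[OF y \<phi>] by simp

lemma has_wirt2_V: "has_wirt2 cV (cV1 y * cA y) (cV1 y * cnj (cA y)) (cV1 y / snd y)
    (cV1 y / cnj (snd y)) y"
  using has_wirt2_comp_s[OF y v] by simp

lemma has_wirt2_U: "has_wirt2 cU (cU1 y * cA y) (cU1 y * cnj (cA y)) (cU1 y / snd y)
    (cU1 y / cnj (snd y)) y"
  using has_wirt2_comp_s[OF y uu] by simp

lemma has_wirt2_A: "has_wirt2 cA (cB y) (cK y) 0 0 y"
  by (rule has_wirt2_fst[OF has_wirt_a[OF fy]])

lemma has_wirt2_Ac: "has_wirt2 (\<lambda>y. cnj (cA y)) (cK y) (cnj (cB y)) 0 0 y"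
  using has_wirt2_cnj[OF has_wirt2_A] by simp

lemma has_wirt2_B: "has_wirt2 cB (b' (fst y)) (cK y * cL y) 0 0 y"
  by (rule has_wirt2_fst[OF has_wirt_b[OF fy]])

lemma has_wirt2_K: "has_wirt2 cK (cK y * cL y) (cK y * cnj (cL y)) 0 0 y"
  by (rule has_wirt2_fst[OF has_wirt_K[OF fy]])

lemma has_wirt2_L: "has_wirt2 cL (l' (fst y)) (2 * cK y) 0 0 y"
  by (rule has_wirt2_fst[OF has_wirt_l[OF fy]])

lemma has_wirt2_wc: "has_wirt2 (\<lambda>y. cnj (snd y)) 0 0 0 1 y"
  using has_wirt2_cnj[OF has_wirt2_snd[of y]] by simp

lemma has_wirt2_f: "has_wirt2 (\<lambda>y. of_real (f (s y))) ((cG y - 1) * cA y) ((cG y - 1) * cnj (cA y))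
   ((cG y - 1) / snd y) ((cG y - 1) / cnj (snd y)) y"
  using has_wirt2_comp_s[OF y f] by simp

lemma has_wirt2_dbar1_f: "has_wirt2 (\<lambda>y. (cG y - 1) * cnj (cA y))
   (cP y * cA y * cnj (cA y) + (cG y - 1) * cK y)
   (cP y * cnj (cA y) * cnj (cA y) + (cG y - 1) * cnj (cB y))
   (cP y * cnj (cA y) / snd y) (cP y * cnj (cA y) / cnj (snd y)) y"
  by (rule has_wirt2_eqI, rule has_wirt2_mult[OF has_wirt2_G1 has_wirt2_Ac]) auto

lemma has_wirt2_dbar2_f: "has_wirt2 (\<lambda>y. (cG y - 1) / cnj (snd y))
   (cP y * cA y / cnj (snd y)) (cP y * cnj (cA y) / cnj (snd y))
   (cP y / (snd y * cnj (snd y))) ((cP y - (cG y - 1)) / (cnj (snd y) * cnj (snd y))) y"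
  by (rule has_wirt2_eqI, rule has_wirt2_divide[OF has_wirt2_G1 has_wirt2_wc wy(2)])
    (use wy in \<open>auto simp: field_simps power2_eq_square\<close>)

end

text \<open>A separate \<open>g\<close> is allowed because \<open>omega_coeff\<close> composes
  \<open>f\<close> with an inverse chart, which agrees with \<open>f (s y)\<close> on the punctured
  chart only.\<close>

lemma ddbar_comp:
  assumes "y \<in> punctured" "\<And>y. y \<in> punctured \<Longrightarrow> g y = f (s y)"
  shows "pd 1 (pdbar 1 (\<lambda>y. of_real (g y))) y = cP y * cA y * cnj (cA y) + (cG y - 1) * cK y"
    "pd 2 (pdbar 1 (\<lambda>y. of_real (g y))) y = cP y * cnj (cA y) / snd y"
    "pd 1 (pdbar 2 (\<lambda>y. of_real (g y))) y = cP y * cA y / cnj (snd y)"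
    "pd 2 (pdbar 2 (\<lambda>y. of_real (g y))) y = cP y / (snd y * cnj (snd y))"
proof -
  have g: "has_wirt2 (\<lambda>y. of_real (g y)) ((cG y - 1) * cA y) ((cG y - 1) * cnj (cA y))
   ((cG y - 1) / snd y) ((cG y - 1) / cnj (snd y)) y" if "y \<in> punctured" for y
    by (rule has_wirt2_cong[OF open_punctured that _ has_wirt2_f[OF that]]) (simp add: assms(2))
  have 1: "pdbar 1 (\<lambda>y. of_real (g y)) y = (cG y - 1) * cnj (cA y)"
    "pdbar 2 (\<lambda>y. of_real (g y)) y = (cG y - 1) / cnj (snd y)" if "y \<in> punctured" for y
    using has_wirt2_pd[OF g[OF that]] by auto
  note H1 = has_wirt2_cong[OF open_punctured assms(1) 1(1)[symmetric]
      has_wirt2_dbar1_f[OF assms(1)]]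
  note H2 = has_wirt2_cong[OF open_punctured assms(1) 1(2)[symmetric]
      has_wirt2_dbar2_f[OF assms(1)]]
  show "pd 1 (pdbar 1 (\<lambda>y. of_real (g y))) y = cP y * cA y * cnj (cA y) + (cG y - 1) * cK y"
    "pd 2 (pdbar 1 (\<lambda>y. of_real (g y))) y = cP y * cnj (cA y) / snd y"
    "pd 1 (pdbar 2 (\<lambda>y. of_real (g y))) y = cP y * cA y / cnj (snd y)"
    "pd 2 (pdbar 2 (\<lambda>y. of_real (g y))) y = cP y / (snd y * cnj (snd y))"
    using has_wirt2_pd(1,3)[OF H1] has_wirt2_pd(1,3)[OF H2] by auto
qed

text \<open>The matrix of \<open>ddbar_comp\<close> with the base form added in the first entry,
  where it turns the coefficient \<open>\<gamma> - 1\<close> of \<open>K\<close> into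
  \<open>\<gamma>\<close>. The order of the indices is the transposed one of
  \<open>herm_mat\<close>.\<close>

definition h11 where "h11 y = cG y * cK y + cP y * cA y * cnj (cA y)"
definition h12 where "h12 y = cP y * cnj (cA y) / snd y"
definition h21 where "h21 y = cP y * cA y / cnj (snd y)"
definition h22 where "h22 y = cP y / (snd y * cnj (snd y))"

text \<open>The part of the matrix that carries \<open>\<phi>\<close> has rank one, being built from
  the vector \<open>(a, 1/w)\<close>. Its own determinant vanishes, so only its last entry meets
  \<open>\<gamma> K\<close>.\<close>

lemma det_h: "y \<in> punctured \<Longrightarrow> h11 y * h22 y - h12 y * h21 y =
    cG y * cK y * cP y / (snd y * cnj (snd y))"
  unfolding h11_def h12_def h21_def h22_def using wy[of y] by (simp add: field_simps)

context
  fixes y assumes y: "y \<in> punctured"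
begin

lemma has_wirt2_h11: "has_wirt2 h11
   (cP y * cA y * cK y + cG y * cK y * cL y + cV y * cP y * cA y * cA y * cnj (cA y)
     + cP y * cB y * cnj (cA y) + cP y * cA y * cK y)
   (cP y * cnj (cA y) * cK y + cG y * cK y * cnj (cL y) + cV y * cP y * cnj (cA y)
       * cA y * cnj (cA y)
     + cP y * cK y * cnj (cA y) + cP y * cA y * cnj (cB y))
   (cP y * cK y / snd y + cV y * cP y * cA y * cnj (cA y) / snd y)
   (cP y * cK y / cnj (snd y) + cV y * cP y * cA y * cnj (cA y) / cnj (snd y)) y"
  unfolding h11_def[abs_def]
  by (rule has_wirt2_eqI, rule has_wirt2_add[OF has_wirt2_mult[OF has_wirt2_G[OF y]
      has_wirt2_K[OF y]]
        has_wirt2_mult[OF has_wirt2_mult[OF has_wirt2_P[OF y] has_wirt2_A[OF y]]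
            has_wirt2_Ac[OF y]]]) (auto simp: algebra_simps)

lemma has_wirt2_h12: "has_wirt2 h12
   ((cV y * cP y * cA y * cnj (cA y) + cP y * cK y) / snd y)
   ((cV y * cP y * cnj (cA y) * cnj (cA y) + cP y * cnj (cB y)) / snd y)
   ((cV y - 1) * cP y * cnj (cA y) / (snd y)\<^sup>2)
   (cV y * cP y * cnj (cA y) / (snd y * cnj (snd y))) y"
  unfolding h12_def[abs_def]
  by (rule has_wirt2_eqI, rule has_wirt2_divide[OF has_wirt2_mult[OF has_wirt2_P[OF y]
      has_wirt2_Ac[OF y]] has_wirt2_snd wy(1)[OF y]])
    (use wy[OF y] in \<open>auto simp: field_simps power2_eq_square\<close>)

lemma has_wirt2_h21: "has_wirt2 h21
   ((cV y * cP y * cA y * cA y + cP y * cB y) / cnj (snd y))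
   ((cV y * cP y * cnj (cA y) * cA y + cP y * cK y) / cnj (snd y))
   (cV y * cP y * cA y / (snd y * cnj (snd y)))
   ((cV y - 1) * cP y * cA y / (cnj (snd y))\<^sup>2) y"
  unfolding h21_def[abs_def]
  by (rule has_wirt2_eqI, rule has_wirt2_divide[OF has_wirt2_mult[OF has_wirt2_P[OF y]
      has_wirt2_A[OF y]] has_wirt2_wc[of y, OF y] wy(2)[OF y]])
    (use wy[OF y] in \<open>auto simp: field_simps power2_eq_square\<close>)

lemma has_wirt2_h22: "has_wirt2 h22
   (cV y * cP y * cA y / (snd y * cnj (snd y)))
   (cV y * cP y * cnj (cA y) / (snd y * cnj (snd y)))
   ((cV y - 1) * cP y / ((snd y)\<^sup>2 * cnj (snd y)))
   ((cV y - 1) * cP y / (snd y * (cnj (snd y))\<^sup>2)) y"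
  unfolding h22_def[abs_def]
  by (rule has_wirt2_eqI, rule has_wirt2_divide[OF has_wirt2_P[OF y]
      has_wirt2_mult[OF has_wirt2_snd has_wirt2_wc[of y, OF y]]])
    (use wy[OF y] in \<open>auto simp: field_simps power2_eq_square\<close>)

end

text \<open>
  The entries of \<open>H\<^sup>-\<^sup>1\<partial>H\<close>. They are found from \<open>H = P\<^sup>* D P\<close> with \<open>D = diag(\<gamma>K, \<phi>)\<close> and the
  frame change \<open>P\<close> with rows \<open>(1, 0)\<close> and \<open>(a, 1/w)\<close>.
\<close>

definition "t11 y = 2 * cU y * cA y + cL y"
definition "t12 y = cU y / snd y"
definition "t21 y = snd y * (cV y * cA y * cA y + cB y - cA y * (2 * cU y * cA y + cL y))"
definition "t22 y = (cV y - cU y) * cA y"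
definition "r22 y = (cV y - 1) / snd y"

text \<open>The candidates are verified by multiplying them with \<open>H\<close> and comparing with
  the derivatives of \<open>H\<close>. \<open>C k $ a $ b\<close> is the Christoffel symbol with
  upper index \<open>a\<close> and lower indices \<open>k\<close>, \<open>b\<close>; the repetitions
  of \<open>t12\<close> and \<open>t22\<close> are its symmetry in the lower indices, valid since
  the metric is Kaehler.\<close>

lemma connection:
  fixes H :: "complex \<times> complex \<Rightarrow> complex^2^2"
  assumes "y \<in> punctured" and H: "\<And>y. y \<in> punctured \<Longrightarrow> H y $ 1 $ 1 = h11 y" "\<And>y. y \<in> punctured \<Longrightarrow>
      H y $ 1 $ 2 = h12 y"
    "\<And>y. y \<in> punctured \<Longrightarrow> H y $ 2 $ 1 = h21 y" "\<And>y. y \<in> punctured \<Longrightarrow> H y $ 2 $ 2 = h22 y"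
  defines "C \<equiv> \<lambda>k. matrix_inv (H y) ** (\<chi> a b. pd k (\<lambda>y'. H y' $ a $ b) y)"
  shows "C 1 $ 1 $ 1 = t11 y" "C 1 $ 1 $ 2 = t12 y" "C 1 $ 2 $ 1 = t21 y" "C 1 $ 2 $ 2 = t22 y"
    "C 2 $ 1 $ 1 = t12 y" "C 2 $ 1 $ 2 = 0" "C 2 $ 2 $ 1 = t22 y" "C 2 $ 2 $ 2 = r22 y"
proof -
  note y = assms(1)
  note w = wy[OF y] note n = nz[OF y]
  note P11 = has_wirt2_pd(1,3)[OF has_wirt2_cong[OF open_punctured y H(1)[symmetric]
      has_wirt2_h11[OF y]]]
  note P12 = has_wirt2_pd(1,3)[OF has_wirt2_cong[OF open_punctured y H(2)[symmetric]
      has_wirt2_h12[OF y]]]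
  note P21 = has_wirt2_pd(1,3)[OF has_wirt2_cong[OF open_punctured y H(3)[symmetric]
      has_wirt2_h21[OF y]]]
  note P22 = has_wirt2_pd(1,3)[OF has_wirt2_cong[OF open_punctured y H(4)[symmetric]
      has_wirt2_h22[OF y]]]
  define T1 :: "complex^2^2" where
    "T1 = (\<chi> i j. if i = 1 then (if j = 1 then t11 y else t12 y)
        else (if j = 1 then t21 y else t22 y))"
  define T2 :: "complex^2^2" where
    "T2 = (\<chi> i j. if i = 1 then (if j = 1 then t12 y else 0) else (if j = 1 then t22 y else r22 y))"
  have det: "H y $ 1 $ 1 * H y $ 2 $ 2 - H y $ 1 $ 2 * H y $ 2 $ 1 \<noteq> 0"
    using det_h[OF y] w n by (simp add: H y)
  have "(\<chi> a b. pd 1 (\<lambda>y'. H y' $ a $ b) y) = H y ** T1"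
    by (simp add: vec_eq_iff forall_2 matrix_matrix_mult_def sum_2 P11 P12 P21 P22 H y T1_def
        h11_def h12_def h21_def h22_def t11_def t12_def t21_def t22_def cU_eq[OF y])
      (use w n in \<open>auto simp: field_simps\<close>)
  then have 1: "C 1 = T1" unfolding C_def using matrix_inv_cancel_2[OF det] by simp
  have "(\<chi> a b. pd 2 (\<lambda>y'. H y' $ a $ b) y) = H y ** T2"
    by (simp add: vec_eq_iff forall_2 matrix_matrix_mult_def sum_2 P11 P12 P21 P22 H y T2_def
        h11_def h12_def h21_def h22_def t12_def t22_def r22_def cU_eq[OF y])
      (use w n in \<open>auto simp: field_simps power2_eq_square\<close>)
  then have 2: "C 2 = T2" unfolding C_def using matrix_inv_cancel_2[OF det] by simp
  show "C 1 $ 1 $ 1 = t11 y" "C 1 $ 1 $ 2 = t12 y" "C 1 $ 2 $ 1 = t21 y" "C 1 $ 2 $ 2 = t22 y"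
    "C 2 $ 1 $ 1 = t12 y" "C 2 $ 1 $ 2 = 0" "C 2 $ 2 $ 1 = t22 y" "C 2 $ 2 $ 2 = r22 y"
    by (simp_all add: 1 2 T1_def T2_def)
qed

context
  fixes y assumes y: "y \<in> punctured"
begin

lemma has_wirt2_VU: "has_wirt2 (\<lambda>y. cV y - cU y) ((cV1 y - cU1 y) * cA y) ((cV1 y - cU1 y)
    * cnj (cA y))
   ((cV1 y - cU1 y) / snd y) ((cV1 y - cU1 y) / cnj (snd y)) y"
  by (rule has_wirt2_eqI, rule has_wirt2_diff[OF has_wirt2_V[OF y] has_wirt2_U[OF y]])
      (auto simp: algebra_simps diff_divide_distrib)

lemma pdbar_t11: "\<exists>p p'. has_wirt2 t11 p (2 * cU1 y * cnj (cA y) * cA y + 2 * cU y * cK y +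
    2 * cK y)
    p' (2 * cU1 y * cA y / cnj (snd y)) y"
  unfolding t11_def[abs_def]
  by (rule has_wirt2_exI, rule has_wirt2_add[OF has_wirt2_mult[OF has_wirt2_mult[OF
      has_wirt2_const has_wirt2_U[OF y]] has_wirt2_A[OF y]] has_wirt2_L[OF y]])
    (auto simp: algebra_simps)

lemma pdbar_t12: "\<exists>p p'. has_wirt2 t12 p (cU1 y * cnj (cA y) / snd y)
    p' (cU1 y / (snd y * cnj (snd y))) y"
  unfolding t12_def[abs_def]
  by (rule has_wirt2_exI, rule has_wirt2_divide[OF has_wirt2_U[OF y] has_wirt2_snd wy(1)[OF y]])
    (use wy[OF y] in \<open>auto simp: field_simps power2_eq_square\<close>)

lemma pdbar_t22: "\<exists>p p'. has_wirt2 t22 p ((cV1 y - cU1 y) * cnj (cA y) * cA y + (cV y -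
    cU y) * cK y)
    p' ((cV1 y - cU1 y) * cA y / cnj (snd y)) y"
  unfolding t22_def[abs_def]
  by (rule has_wirt2_exI, rule has_wirt2_mult[OF has_wirt2_VU has_wirt2_A[OF y]])
    (auto simp: algebra_simps)

lemma pdbar_r22: "\<exists>p p'. has_wirt2 r22 p (cV1 y * cnj (cA y) / snd y)
    p' (cV1 y / (snd y * cnj (snd y))) y"
  unfolding r22_def[abs_def]
  by (rule has_wirt2_exI, rule has_wirt2_divide[OF has_wirt2_diff[OF has_wirt2_V[OF y]
      has_wirt2_const] has_wirt2_snd wy(1)[OF y]])
    (use wy[OF y] in \<open>auto simp: field_simps power2_eq_square\<close>)

text \<open>The term \<open>K * l\<close> contributed by the conjugate derivative of
  \<open>b\<close> cancels the one that arises from differentiating \<open>a\<close> in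
  \<open>a * t11\<close>; hence \<open>l\<close> does not occur in the result.\<close>

lemma pdbar_t21: "\<exists>p p'. has_wirt2 t21 p
    (snd y * ((cV1 y - 2 * cU1 y) * cnj (cA y) * cA y * cA y + (2 * cV y - 4 * cU y - 2)
        * cA y * cK y))
    p' (snd y * ((cV1 y - 2 * cU1 y) * cA y * cA y) / cnj (snd y)) y"
proof -
  obtain p p' where t: "has_wirt2 t11 p (2 * cU1 y * cnj (cA y) * cA y + 2 * cU y * cK y + 2 * cK y)
    p' (2 * cU1 y * cA y / cnj (snd y)) y" using pdbar_t11 by blast
  show ?thesis
  unfolding t21_def[abs_def] t11_def[symmetric]
  by (rule has_wirt2_exI, rule has_wirt2_mult[OF has_wirt2_snd has_wirt2_diff[OF has_wirt2_add[OF
      has_wirt2_mult[OF has_wirt2_mult[OF has_wirt2_V[OF y] has_wirt2_A[OF y]] has_wirt2_A[OF y]]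
      has_wirt2_B[OF y]]
     has_wirt2_mult[OF has_wirt2_A[OF y] t]]])
    (use wy[OF y] in \<open>auto simp: field_simps t11_def\<close>)
qed

end

text \<open>No \<open>a\<close>, \<open>b\<close> or \<open>l\<close> survives, as invariance
  predicts: a change of trivialization makes \<open>a\<close> vanish at a given point without
  affecting the determinant. The 2 in \<open>2 + 2 * cU y\<close> is the curvature of the base,
  coming from \<open>has_wirt_l\<close>.\<close>

theorem chern_form:
  fixes C :: "2 \<Rightarrow> complex \<times> complex \<Rightarrow> complex^2^2"
  assumes y: "y \<in> punctured"
    and C: "\<And>y. y \<in> punctured \<Longrightarrow> C 1 y $ 1 $ 1 = t11 y" "\<And>y. y \<in> punctured \<Longrightarrow> C 1 y $ 1 $ 2 = t12 y"
      "\<And>y. y \<in> punctured \<Longrightarrow> C 1 y $ 2 $ 1 = t21 y" "\<And>y. y \<in> punctured \<Longrightarrow> C 1 y $ 2 $ 2 = t22 y"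
      "\<And>y. y \<in> punctured \<Longrightarrow> C 2 y $ 1 $ 1 = t12 y" "\<And>y. y \<in> punctured \<Longrightarrow> C 2 y $ 1 $ 2 = 0"
      "\<And>y. y \<in> punctured \<Longrightarrow> C 2 y $ 2 $ 1 = t22 y" "\<And>y. y \<in> punctured \<Longrightarrow> C 2 y $ 2 $ 2 = r22 y"
  defines "\<Theta> \<equiv> \<lambda>a b. (\<chi> k l. - pdbar l (\<lambda>y'. C k y' $ a $ b) y) :: complex^2^2"
  shows "wedge11 (\<Theta> 1 1) (\<Theta> 2 2) - wedge11 (\<Theta> 1 2) (\<Theta> 2 1) =
    cK y / (snd y * cnj (snd y)) * ((2 + 2 * cU y) * cV1 y + 2 * cU1 y * (cV y - cU y))"
proof -
  note w = wy[OF y]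
  obtain p1 p1' where 1: "has_wirt2 t11 p1 (2 * cU1 y * cnj (cA y) * cA y + 2 * cU y * cK y +
      2 * cK y)
    p1' (2 * cU1 y * cA y / cnj (snd y)) y" using pdbar_t11[OF y] by blast
  obtain p2 p2' where 2: "has_wirt2 t12 p2 (cU1 y * cnj (cA y) / snd y)
      p2' (cU1 y / (snd y * cnj (snd y))) y"
    using pdbar_t12[OF y] by blast
  obtain p3 p3' where 3: "has_wirt2 t21 p3
    (snd y * ((cV1 y - 2 * cU1 y) * cnj (cA y) * cA y * cA y + (2 * cV y - 4 * cU y - 2)
        * cA y * cK y))
    p3' (snd y * ((cV1 y - 2 * cU1 y) * cA y * cA y) / cnj (snd y)) y" using pdbar_t21[OF y]
        by blast
  obtain p4 p4' where 4: "has_wirt2 t22 p4 ((cV1 y - cU1 y) * cnj (cA y) * cA y + (cV y -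
      cU y) * cK y)
    p4' ((cV1 y - cU1 y) * cA y / cnj (snd y)) y" using pdbar_t22[OF y] by blast
  obtain p5 p5' where 5: "has_wirt2 r22 p5 (cV1 y * cnj (cA y) / snd y)
      p5' (cV1 y / (snd y * cnj (snd y))) y"
    using pdbar_r22[OF y] by blast
  note E = has_wirt2_pd(2,4)[OF has_wirt2_cong[OF open_punctured y C(1)[symmetric] 1]]
    has_wirt2_pd(2,4)[OF has_wirt2_cong[OF open_punctured y C(2)[symmetric] 2]]
    has_wirt2_pd(2,4)[OF has_wirt2_cong[OF open_punctured y C(3)[symmetric] 3]]
    has_wirt2_pd(2,4)[OF has_wirt2_cong[OF open_punctured y C(4)[symmetric] 4]]
    has_wirt2_pd(2,4)[OF has_wirt2_cong[OF open_punctured y C(5)[symmetric] 2]]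
    has_wirt2_pd(2,4)[OF has_wirt2_cong[OF open_punctured y C(6)[symmetric] has_wirt2_const]]
    has_wirt2_pd(2,4)[OF has_wirt2_cong[OF open_punctured y C(7)[symmetric] 4]]
    has_wirt2_pd(2,4)[OF has_wirt2_cong[OF open_punctured y C(8)[symmetric] 5]]
  show ?thesis
    unfolding wedge11_def \<Theta>_def
    by (simp add: E) (use w in \<open>simp add: field_simps\<close>)
qed

text \<open>The right-hand side is the bracket of \<open>chern_form\<close>, and
  \<open>\<gamma> * \<phi>\<close> is the corresponding factor of the squared metric. Both
  \<open>u1\<close> and the term with \<open>v2\<close> contain \<open>\<phi>\<close>, so it cancels
  and the quotient stays regular where the profile vanishes.\<close>

lemma momentum_curvature_eq:
  "momentum_curvature \<gamma> \<phi> v v2 r * (\<gamma> r * \<phi> r) =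
      (2 + 2 * uu r) * (v2 r * \<phi> r) + 2 * u1 r * (v r - uu r)"
  using \<gamma>_pos[of r] by (simp add: momentum_curvature_def uu_def u1_def field_simps power2_eq_square)

end

lemma momentum_chartI:
  fixes \<eta> K :: "complex \<Rightarrow> real"
  assumes S: "open S" and \<eta>: "smooth_on S \<eta>" and K: "smooth_on S K" and pos: "\<And>z. z \<in> S \<Longrightarrow> K z > 0"
    and d1: "\<And>z. z \<in> S \<Longrightarrow> ddbar1 \<eta> z = K z" and d2: "\<And>z. z \<in> S \<Longrightarrow> ddbar1 (\<lambda>z. ln (K z)) z = 2 * K z"
    and prof: "\<And>r. (f has_real_derivative (\<gamma> r - 1)) (at r)"
        "\<And>r. (\<gamma> has_real_derivative \<phi> r) (at r)"
      "\<And>r. (\<phi> has_real_derivative v r * \<phi> r) (at r)" "\<And>r. (v has_real_derivative v2 r * \<phi> r) (at r)"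
      "\<And>r. \<gamma> r > 0" "\<And>r. \<phi> r > 0"
  shows "\<exists>a b b' l l'. momentum_chart S \<eta> K a b b' l l' f \<gamma> \<phi> v v2"
proof -
  let ?a = "wirtinger 1 \<i> (\<lambda>z. complex_of_real (\<eta> z))"
  let ?l = "wirtinger 1 \<i> (\<lambda>z. complex_of_real (ln (K z)))"
  have c\<eta>: "csmooth S (\<lambda>z. complex_of_real (\<eta> z))" using csmooth_of_real[OF \<eta>] .
  have "smooth_on S (\<lambda>z. ln (K z))"
    by (rule smooth_on_compose_real[OF S smooth_on_ln K]) (use pos in auto)
  then have cK: "csmooth S (\<lambda>z. complex_of_real (ln (K z)))" by (rule csmooth_of_real)
  have ca: "csmooth S ?a" by (rule csmooth_wirtinger[OF S c\<eta>])
  have cb: "csmooth S (wirtinger 1 \<i> ?a)" by (rule csmooth_wirtinger[OF S ca])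
  have cl: "csmooth S ?l" by (rule csmooth_wirtinger[OF S cK])
  \<comment> \<open>Writing \<open>K\<close> as \<open>exp (ln K)\<close> produces the derivative in
    the form \<open>K * l\<close>, with \<open>l\<close> the derivative of the logarithm.\<close>
  have WK: "has_wirt (\<lambda>z. of_real (K z)) (of_real (K z) * ?l z) (of_real (K z) * cnj (?l z))
      z" if z: "z \<in> S" for z
  proof -
    have "has_wirt (\<lambda>z. of_real (ln (K z))) (?l z) (cnj (?l z)) z"
      using csmooth_has_wirt[OF cK z] ddbar1_has_wirt(3)[OF S cK z] by simp
    from has_wirt_real[OF this DERIV_exp]
    have "has_wirt (\<lambda>z. of_real (exp (ln (K z)))) (of_real (K z) * ?l z) (of_real (K z)
        * cnj (?l z)) z"
      using pos[OF z] by simp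
    then show ?thesis by (rule has_wirt_cong[OF S z, rotated]) (use pos in simp)
  qed
  have Wa: "has_wirt ?a (wirtinger 1 \<i> ?a z) (of_real (K z)) z" if z: "z \<in> S" for z
    using csmooth_has_wirt[OF ca z] ddbar1_has_wirt(2)[OF S c\<eta> z] d1[OF z] by simp
  \<comment> \<open>Commuting the two derivatives reduces this third derivative of
    \<open>\<eta>\<close> to the derivative of \<open>K\<close>, because the conjugate derivative of
    \<open>?a\<close> is \<open>K\<close>.\<close>
  have "wirtinger_bar 1 \<i> (wirtinger 1 \<i> ?a) z = of_real (K z) * ?l z" if z: "z \<in> S" for z
  proof -
    have "wirtinger_bar 1 \<i> (wirtinger 1 \<i> ?a) z = wirtinger 1 \<i> (wirtinger_bar 1 \<i> ?a) z"
      using wirtinger_commute[OF S ca z] by simp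
    also have "\<dots> = of_real (K z) * ?l z"
      by (rule has_wirt_wirtinger[OF has_wirt_cong[OF S z _ WK[OF z]]])
          (use has_wirt_wirtinger_bar[OF Wa] in simp)
    finally show ?thesis .
  qed
  then have Wb: "has_wirt (wirtinger 1 \<i> ?a) (wirtinger 1 \<i> (wirtinger 1 \<i> ?a) z) (of_real (K z)
      * ?l z) z" if z: "z \<in> S" for z
    using csmooth_has_wirt[OF cb z] z by simp
  have "momentum_chart S \<eta> K ?a (wirtinger 1 \<i> ?a) (wirtinger 1 \<i> (wirtinger 1 \<i> ?a))
      ?l (wirtinger 1 \<i> ?l) f \<gamma> \<phi> v v2"
  proof
    show "has_wirt (\<lambda>z. of_real (\<eta> z)) (?a z) (cnj (?a z)) z" if "z \<in> S" for z
      using csmooth_has_wirt[OF c\<eta> that] ddbar1_has_wirt(3)[OF S c\<eta> that] by simp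
    show "has_wirt ?l (wirtinger 1 \<i> ?l z) (2 * complex_of_real (K z)) z" if "z \<in> S" for z
      using csmooth_has_wirt[OF cl that] ddbar1_has_wirt(2)[OF S cK that] d2[OF that] by simp
  qed (use S Wa Wb WK pos prof in auto)
  then show ?thesis by blast
qed

section \<open>Holomorphic change of variables\<close>

text \<open>The change of variables formula is applied on \<open>real^2\<close>, where the Jacobian
  is the determinant of a matrix; this map and its inverse carry it over to the complex
  plane.\<close>

definition vec_to_complex :: "real^2 \<Rightarrow> complex" where
  "vec_to_complex x = Complex (x $ 1) (x $ 2)"

definition complex_to_vec :: "complex \<Rightarrow> real^2" where
  "complex_to_vec z = (\<chi> i. if i = 1 then Re z else Im z)"

lemma vec_to_complex_inverse [simp]: "vec_to_complex (complex_to_vec z) = z"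
  by (simp add: vec_to_complex_def complex_to_vec_def)

lemma complex_to_vec_inverse [simp]: "complex_to_vec (vec_to_complex x) = x"
  by (simp add: vec_to_complex_def complex_to_vec_def vec_eq_iff forall_2)

lemma bounded_linear_vec_to_complex: "bounded_linear vec_to_complex"
  unfolding linear_conv_bounded_linear[symmetric]
  by (rule linearI) (auto simp: vec_to_complex_def complex_eq_iff)

lemma bounded_linear_complex_to_vec: "bounded_linear complex_to_vec"
  unfolding linear_conv_bounded_linear[symmetric]
  by (rule linearI) (auto simp: complex_to_vec_def vec_eq_iff)

lemma measurable_vec_to_complex [measurable]: "vec_to_complex \<in> borel_measurable borel"
  by (intro borel_measurable_continuous_onI linear_continuous_on bounded_linear_vec_to_complex)

lemma vimage_vec_to_complex: "vec_to_complex -` A = complex_to_vec ` A"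
  by (auto simp: image_iff) (metis complex_to_vec_inverse)

text \<open>Lebesgue measure is determined by its values on boxes, and \<open>vec_to_complex\<close>
  pulls boxes back to boxes with the same side lengths.\<close>

lemma lborel_complex_vec: "(lborel :: complex measure) = distr lborel borel vec_to_complex"
proof (rule lborel_eqI)
  fix l u :: complex
  assume lu: "\<And>b. b \<in> Basis \<Longrightarrow> l \<bullet> b \<le> u \<bullet> b"
  have "emeasure (distr lborel borel vec_to_complex) (box l u)
      = emeasure lborel (vec_to_complex -` box l u \<inter> space lborel)"
    by (subst emeasure_distr) auto
  also have "vec_to_complex -` box l u \<inter> space lborel = box (complex_to_vec l) (complex_to_vec u)"
    by (auto simp: vec_to_complex_def complex_to_vec_def mem_box_cart forall_2 in_box_complex_iff)
  also have "emeasure lborel \<dots> = (\<Prod>b\<in>Basis. (complex_to_vec u - complex_to_vec l) \<bullet> b)"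
  proof (rule emeasure_lborel_box)
    fix b :: "real^2" assume "b \<in> Basis"
    then obtain i where "b = axis i 1" by (auto simp: Basis_vec_def)
    then show "complex_to_vec l \<bullet> b \<le> complex_to_vec u \<bullet> b"
      using lu[of 1] lu[of \<i>] by (auto simp: inner_axis complex_to_vec_def Basis_complex_def)
  qed
  also have "(\<Prod>b\<in>Basis. (complex_to_vec u - complex_to_vec l) \<bullet> b) = (\<Prod>b\<in>Basis. (u - l) \<bullet> b)"
  proof -
    have B: "(Basis :: (real^2) set) = {axis 1 1, axis 2 1}"
      by (auto simp: Basis_vec_def) (metis exhaust_2)
    have "axis 1 1 \<noteq> (axis 2 1 :: real^2)"
      by (simp add: axis_eq_axis)
    then have "(\<Prod>b\<in>Basis. g b) = g (axis 1 1) * g (axis 2 1)" for g :: "real^2 \<Rightarrow> real"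
      unfolding B by (subst prod.insert) auto
    then show ?thesis
      by (simp only:) (simp add: Basis_complex_def inner_axis complex_to_vec_def)
  qed
  finally show "emeasure (distr lborel borel vec_to_complex) (box l u) = (\<Prod>b\<in>Basis. (u - l) \<bullet> b)" .
qed simp

text \<open>\<open>has_measure_differentiable_image\<close> relates a finite measure of the image to
  a gauge integral of the Jacobian. The passage to nonnegative integrals, where the value may be
  infinite, needs both directions of that equivalence.\<close>

lemma emeasure_differentiable_image:
  fixes f :: "real^'n::{finite,wellorder} \<Rightarrow> real^'n::_"
  assumes B: "B \<in> sets borel" "f ` B \<in> sets borel"
    and der: "\<And>x. x \<in> B \<Longrightarrow> (f has_derivative f' x) (at x)"
    and inj: "inj_on f B"
    and meas: "(\<lambda>x. \<bar>det (matrix (f' x))\<bar> * indicator B x) \<in> borel_measurable borel"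
  shows "emeasure lborel (f ` B) = (\<integral>\<^sup>+x\<in>B. ennreal \<bar>det (matrix (f' x))\<bar> \<partial>lborel)"
proof -
  let ?d = "\<lambda>x. \<bar>det (matrix (f' x))\<bar>"
  have eq: "(\<integral>\<^sup>+x\<in>B. ennreal (?d x) \<partial>lborel) = (\<integral>\<^sup>+x. ennreal (?d x * indicator B x) \<partial>lborel)"
    by (intro nn_integral_cong) (auto split: split_indicator)
  have key: "f ` B \<in> lmeasurable \<and> measure lebesgue (f ` B) = m \<longleftrightarrow> (?d has_integral m) B" for m
    using der B inj by (intro has_measure_differentiable_image)
        (auto intro: has_derivative_at_withinI)
  have restr: "(?d has_integral m) B \<longleftrightarrow> ((\<lambda>x. ?d x * indicator B x) has_integral m) UNIV" for m
  proof -
    have "(\<lambda>x. ?d x * indicator B x) = (\<lambda>x. if x \<in> B then ?d x else 0)"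
      by (auto split: split_indicator)
    then show ?thesis by (simp add: has_integral_restrict_UNIV)
  qed
  show ?thesis
  proof (cases "(\<integral>\<^sup>+x. ennreal (?d x * indicator B x) \<partial>lborel) = \<infinity>")
    case False
    then obtain m where m: "m \<ge> 0" "(\<integral>\<^sup>+x. ennreal (?d x * indicator B x) \<partial>lborel) = ennreal m"
      by (cases "\<integral>\<^sup>+x. ennreal (?d x * indicator B x) \<partial>lborel") auto
    have "((\<lambda>x. ?d x * indicator B x) has_integral m) UNIV"
      by (rule nn_integral_has_integral[OF _ _ m(2)]) (use meas m in auto)
    then have "f ` B \<in> lmeasurable" "measure lebesgue (f ` B) = m" using key restr by auto
    then have "emeasure lebesgue (f ` B) = ennreal m"
      by (simp add: emeasure_eq_measure2)
    then show ?thesis using B(2) eq m(2) by (simp add: emeasure_completion main_part_sets)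
  next
    case True
    \<comment> \<open>If the image had finite measure, the equivalence would make the Jacobian
      integrable, against the case assumption.\<close>
    have "emeasure lebesgue (f ` B) = \<infinity>"
    proof (rule ccontr)
      assume "emeasure lebesgue (f ` B) \<noteq> \<infinity>"
      then have "f ` B \<in> lmeasurable" using B(2) by (auto simp: fmeasurable_def top.not_eq_extremum)
      then have "((\<lambda>x. ?d x * indicator B x) has_integral (measure lebesgue (f ` B))) UNIV"
        using key restr by blast
      then have "(\<integral>\<^sup>+x. ennreal (?d x * indicator B x) \<partial>lborel) =
          ennreal (measure lebesgue (f ` B))"
        by (intro nn_integral_has_integral_lborel) (use meas in auto)
      then show False using True by simp
    qed
    then show ?thesis using True eq B(2) by (simp add: emeasure_completion main_part_sets)
  qed
qed

lemma borel_image_homeomorphism: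
  fixes \<phi> :: "'e::topological_space \<Rightarrow> 'f::topological_space"
  assumes "homeomorphism S T \<phi> \<psi>" "T \<in> sets borel" "B \<in> sets borel" "B \<subseteq> S"
  shows "\<phi> ` B \<in> sets borel"
proof -
  have "\<phi> ` B = \<psi> -` B \<inter> T"
    using assms(1,4) unfolding homeomorphism_def by (force simp: image_iff subset_iff)
  moreover have "\<psi> \<in> measurable (restrict_space borel T) borel"
    using assms(1) by (intro borel_measurable_continuous_on_restrict) (simp add: homeomorphism_def)
  from measurable_sets[OF this assms(3)] have "\<psi> -` B \<inter> T \<in> sets borel"
    using assms(2) by (simp add: space_restrict_space sets_restrict_space_iff)
  ultimately show ?thesis by simp
qed

lemma emeasure_holomorphic_image:
  assumes S: "open S" and T: "open T" and hol: "\<phi> holomorphic_on S"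
    and hom: "homeomorphism S T \<phi> \<psi>" and B: "B \<in> sets borel" "B \<subseteq> S"
  shows "emeasure lborel (\<phi> ` B) = (\<integral>\<^sup>+z\<in>B. ennreal ((cmod (deriv \<phi> z))\<^sup>2) \<partial>lborel)"
proof -
  let ?J = vec_to_complex and ?J' = complex_to_vec
  define f where "f = ?J' \<circ> \<phi> \<circ> ?J"
  define f' where "f' x = (\<lambda>h. ?J' (deriv \<phi> (?J x) * ?J h))" for x
  define B' where "B' = ?J -` B"
  have B': "B' \<in> sets borel" unfolding B'_def
    using measurable_sets[OF measurable_vec_to_complex B(1)] by simp
  have fB': "f ` B' = ?J -` (\<phi> ` B)"
    unfolding f_def B'_def vimage_vec_to_complex by (auto simp: image_iff)
  have \<phi>B: "\<phi> ` B \<in> sets borel"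
    using borel_image_homeomorphism[OF hom] T B by simp
  then have fB'b: "f ` B' \<in> sets borel" unfolding fB'
    using measurable_sets[OF measurable_vec_to_complex \<phi>B] by simp
  \<comment> \<open>Multiplication by a complex number is a rotation composed with a scaling, so its
    real determinant is the squared modulus.\<close>
  have det: "\<bar>det (matrix (f' x))\<bar> = (cmod (deriv \<phi> (?J x)))\<^sup>2" for x
  proof -
    have "det (matrix (f' x)) = (Re (deriv \<phi> (?J x)))\<^sup>2 + (Im (deriv \<phi> (?J x)))\<^sup>2"
      by (simp add: det_2 matrix_def f'_def complex_to_vec_def vec_to_complex_def axis_def
          power2_eq_square)
    then show ?thesis by (simp add: cmod_power2)
  qed
  have "continuous_on S (\<lambda>z. (cmod (deriv \<phi> z))\<^sup>2)"
    by (intro continuous_intros holomorphic_on_imp_continuous_on holomorphic_deriv[OF hol S])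
  then have m0: "(\<lambda>z. indicator B z *\<^sub>R (cmod (deriv \<phi> z))\<^sup>2) \<in> borel_measurable borel"
    using B by (intro borel_measurable_continuous_on_indicator) (auto intro: continuous_on_subset)
  have "emeasure lborel (\<phi> ` B) = emeasure lborel (f ` B')"
    by (subst lborel_complex_vec, subst emeasure_distr) (use \<phi>B fB' in auto)
  also have "\<dots> = (\<integral>\<^sup>+x\<in>B'. ennreal \<bar>det (matrix (f' x))\<bar> \<partial>lborel)"
  proof (rule emeasure_differentiable_image[OF B' fB'b])
    show "(f has_derivative f' x) (at x)" if "x \<in> B'" for x
    proof -
      have "(\<phi> has_derivative (*) (deriv \<phi> (?J x))) (at (?J x))"
        using holomorphic_derivI[OF hol S] that B unfolding B'_def has_field_derivative_def by blast
      from bounded_linear.has_derivative[OF bounded_linear_complex_to_vec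
          has_derivative_compose[OF bounded_linear_imp_has_derivative[OF
              bounded_linear_vec_to_complex] this]]
      show ?thesis by (simp add: f_def f'_def[abs_def] o_def)
    qed
    show "inj_on f B'"
    proof (rule inj_onI)
      fix x y assume "x \<in> B'" "y \<in> B'" "f x = f y"
      then have "\<phi> (?J x) = \<phi> (?J y)" "?J x \<in> S" "?J y \<in> S"
        using B unfolding f_def B'_def by (auto dest: arg_cong[of _ _ ?J])
      then have "?J x = ?J y" using hom unfolding homeomorphism_def by metis
      then show "x = y" by (metis complex_to_vec_inverse)
    qed
    have "(\<lambda>x. \<bar>det (matrix (f' x))\<bar> * indicator B' x) =
       (\<lambda>z. indicator B z *\<^sub>R (cmod (deriv \<phi> z))\<^sup>2) \<circ> ?J"
      by (auto simp: det B'_def split: split_indicator)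
    then show "(\<lambda>x. \<bar>det (matrix (f' x))\<bar> * indicator B' x) \<in> borel_measurable borel"
      using measurable_comp[OF measurable_vec_to_complex m0] by simp
  qed
  also have "\<dots> = (\<integral>\<^sup>+x. ennreal (indicator B (?J x) *\<^sub>R (cmod (deriv \<phi> (?J x)))\<^sup>2) \<partial>lborel)"
    by (intro nn_integral_cong) (auto simp: det B'_def split: split_indicator)
  also have "\<dots> = (\<integral>\<^sup>+z. ennreal (indicator B z *\<^sub>R (cmod (deriv \<phi> z))\<^sup>2) \<partial>distr lborel borel ?J)"
    by (subst nn_integral_distr) (use m0 in auto)
  also have "\<dots> = (\<integral>\<^sup>+z\<in>B. ennreal ((cmod (deriv \<phi> z))\<^sup>2) \<partial>lborel)"
    unfolding lborel_complex_vec[symmetric]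
      by (intro nn_integral_cong) (auto split: split_indicator)
  finally show ?thesis .
qed

text \<open>Both sides integrate \<open>F\<close>, once against Lebesgue measure on \<open>T\<close>
  and once against the image under \<open>\<phi>\<close> of the density \<open>|\<phi>'|^2\<close>
  on \<open>S\<close>. These two measures agree on Borel sets by
  \<open>emeasure_holomorphic_image\<close>.\<close>

theorem nn_integral_holomorphic_change:
  assumes S: "open S" and T: "open T" and hol: "\<phi> holomorphic_on S"
    and hom: "homeomorphism S T \<phi> \<psi>" and F: "F \<in> borel_measurable borel"
  shows "(\<integral>\<^sup>+w\<in>T. F w \<partial>lborel) = (\<integral>\<^sup>+z\<in>S. F (\<phi> z) * ennreal ((cmod (deriv \<phi> z))\<^sup>2) \<partial>lborel)"
proof -
  \<comment> \<open>Extended by 0 to be Borel measurable on the whole plane; the density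
    \<open>d\<close> vanishes off \<open>S\<close>, so the value there has no effect.\<close>
  define g where "g z = (if z \<in> S then \<phi> z else 0)" for z
  have g: "g \<in> borel_measurable borel"
    unfolding g_def[abs_def] using S hol
    by (intro borel_measurable_continuous_on_if) (auto intro: holomorphic_on_imp_continuous_on)
  have cont: "continuous_on S (\<lambda>z. (cmod (deriv \<phi> z))\<^sup>2)"
    by (intro continuous_intros holomorphic_on_imp_continuous_on holomorphic_deriv[OF hol S])
  define d where "d z = ennreal (indicator S z *\<^sub>R (cmod (deriv \<phi> z))\<^sup>2)" for z
  have d: "d \<in> borel_measurable lborel" unfolding d_def[abs_def]
    using borel_measurable_continuous_on_indicator[OF _ cont] S by simp
  have "distr (density lborel d) borel g = density lborel (indicator T)"
  proof (rule measure_eqI)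
    fix A assume "A \<in> sets (distr (density lborel d) borel g)"
    then have A: "A \<in> sets borel" by simp
    let ?B = "g -` A \<inter> S"
    have B: "?B \<in> sets borel" using measurable_sets[OF g A] S by auto
    have im: "\<phi> ` ?B = A \<inter> T"
      using hom unfolding homeomorphism_def g_def by auto
    have "emeasure (distr (density lborel d) borel g) A = emeasure (density lborel d) (g -` A)"
      by (subst emeasure_distr) (use g A in auto)
    also have "\<dots> = (\<integral>\<^sup>+z. d z * indicator (g -` A) z \<partial>lborel)"
      using measurable_sets[OF g A] by (subst emeasure_density[OF d]) auto
    also have "\<dots> = (\<integral>\<^sup>+z\<in>?B. ennreal ((cmod (deriv \<phi> z))\<^sup>2) \<partial>lborel)"
      by (intro nn_integral_cong) (auto simp: d_def split: split_indicator)
    also have "\<dots> = emeasure lborel (\<phi> ` ?B)"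
      by (rule emeasure_holomorphic_image[OF S T hol hom B, symmetric]) auto
    also have "\<dots> = (\<integral>\<^sup>+z. indicator T z * indicator A z \<partial>lborel)"
    proof -
      have "emeasure lborel (A \<inter> T) = (\<integral>\<^sup>+z. indicator (A \<inter> T) z \<partial>lborel)"
        using A T by simp
      also have "\<dots> = (\<integral>\<^sup>+z. indicator T z * indicator A z \<partial>lborel)"
        by (intro nn_integral_cong) (auto split: split_indicator)
      finally show ?thesis unfolding im .
    qed
    also have "\<dots> = emeasure (density lborel (indicator T)) A"
      using A T by (subst emeasure_density) auto
    finally show "emeasure (distr (density lborel d) borel g) A =
        emeasure (density lborel (indicator T)) A" .
  qed simp
  then have "(\<integral>\<^sup>+w. F w \<partial>density lborel (indicator T)) =
      (\<integral>\<^sup>+w. F w \<partial>distr (density lborel d) borel g)"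
    by simp
  also have "\<dots> = (\<integral>\<^sup>+z. d z * F (g z) \<partial>lborel)"
    using F g d by (subst nn_integral_distr) (auto simp: nn_integral_density)
  also have "\<dots> = (\<integral>\<^sup>+z\<in>S. F (\<phi> z) * ennreal ((cmod (deriv \<phi> z))\<^sup>2) \<partial>lborel)"
    by (intro nn_integral_cong) (auto simp: d_def g_def mult.commute split: split_indicator)
  also have "(\<integral>\<^sup>+w. F w \<partial>density lborel (indicator T)) = (\<integral>\<^sup>+w\<in>T. F w \<partial>lborel)"
    using F T by (subst nn_integral_density) (auto simp: mult.commute)
  finally show ?thesis .
qed

section \<open>Measures with densities in charts\<close>

lemma borel_in_sigma_algebra: "sigma_algebra (topspace X) (borel_in X)"
  unfolding borel_in_def by (rule sigma_algebra_sigma_sets) (auto dest: openin_subset)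

text \<open>The transformation rule for densities is assumed in integrated form, as
  \<open>consistent\<close>; the actual substitutions are carried out where the locale is
  instantiated. \<open>cover\<close> asks for finitely many charts, which lets the measure be glued
  as a finite sum.\<close>

locale density_charts =
  fixes X :: "'p topology" and I :: "'i set" and dm :: "'i \<Rightarrow> 'p set"
    and ch :: "'i \<Rightarrow> 'p \<Rightarrow> 'e::euclidean_space" and \<rho> :: "'i \<Rightarrow> 'p \<Rightarrow> real"
  assumes cover: "\<exists>J. finite J \<and> J \<subseteq> I \<and> topspace X \<subseteq> (\<Union>i\<in>J. dm i)"
    and dm_open: "i \<in> I \<Longrightarrow> openin X (dm i)"
    and inj: "i \<in> I \<Longrightarrow> inj_on (ch i) (dm i)"
    and open_iff: "i \<in> I \<Longrightarrow> U \<subseteq> dm i \<Longrightarrow> openin X U \<longleftrightarrow> open (ch i ` U)"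
    and cont: "i \<in> I \<Longrightarrow> continuous_on (ch i ` dm i) (\<lambda>y. \<rho> i (inv_into (dm i) (ch i) y))"
    and consistent: "i \<in> I \<Longrightarrow> j \<in> I \<Longrightarrow> B \<in> borel_in X \<Longrightarrow> B \<subseteq> dm i \<Longrightarrow> B \<subseteq> dm j \<Longrightarrow>
        (\<integral>\<^sup>+ y \<in> ch i ` B. ennreal (\<rho> i (inv_into (dm i) (ch i) y)) \<partial>lborel) =
        (\<integral>\<^sup>+ y \<in> ch j ` B. ennreal (\<rho> j (inv_into (dm j) (ch j) y)) \<partial>lborel)"
begin

interpretation bX: sigma_algebra "topspace X" "borel_in X"
  by (rule borel_in_sigma_algebra)

lemma openin_borel_in: "openin X U \<Longrightarrow> U \<in> borel_in X"
  unfolding borel_in_def by auto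

lemma chart_image_borel:
  assumes i: "i \<in> I" and B: "B \<in> borel_in X"
  shows "ch i ` (B \<inter> dm i) \<in> sets borel"
  using B unfolding borel_in_def
proof (induction rule: sigma_sets.induct)
  case (Basic U)
  then have "open (ch i ` (U \<inter> dm i))"
    using open_iff[OF i, of "U \<inter> dm i"] dm_open[OF i] by auto
  then show ?case by simp
next
  case Empty
  then show ?case by simp
next
  case (Compl U)
  have "(topspace X - U) \<inter> dm i = dm i - (U \<inter> dm i)"
    using openin_subset[OF dm_open[OF i]] by auto
  then have "ch i ` ((topspace X - U) \<inter> dm i) = ch i ` dm i - ch i ` (U \<inter> dm i)"
    using inj_on_image_set_diff[OF inj[OF i], of "dm i" "U \<inter> dm i"] by auto
  moreover have "open (ch i ` dm i)"
    using open_iff[OF i] dm_open[OF i] by auto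
  ultimately show ?case using Compl by auto
next
  case (Union A)
  have "ch i ` (\<Union> (range A) \<inter> dm i) = (\<Union>n. ch i ` (A n \<inter> dm i))" by auto
  then show ?case using Union by auto
qed

definition chart_measure :: "'i \<Rightarrow> 'e measure" where
  "chart_measure i = density lborel
     (\<lambda>y. ennreal (indicator (ch i ` dm i) y *\<^sub>R \<rho> i (inv_into (dm i) (ch i) y)))"

lemma chart_measure:
  assumes "i \<in> I" "B \<in> borel_in X" "B \<subseteq> dm i"
  shows "emeasure (chart_measure i) (ch i ` B) =
     (\<integral>\<^sup>+ y \<in> ch i ` B. ennreal (\<rho> i (inv_into (dm i) (ch i) y)) \<partial>lborel)"
proof -
  have "open (ch i ` dm i)" using open_iff[OF assms(1)] dm_open[OF assms(1)] by auto
  then have "(\<lambda>y. indicator (ch i ` dm i) y *\<^sub>R \<rho> i (inv_into (dm i) (ch i) y))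
      \<in> borel_measurable borel"
    by (intro borel_measurable_continuous_on_indicator cont assms) auto
  moreover have "ch i ` B \<in> sets borel"
    using chart_image_borel[OF assms(1,2)] assms(3) by (simp add: Int_absorb2)
  moreover have "ch i ` B \<subseteq> ch i ` dm i" using assms(3) by auto
  ultimately show ?thesis
    unfolding chart_measure_def
    by (subst emeasure_density) (auto intro!: nn_integral_cong split: split_indicator dest:
        subsetD[OF _ imageI])
qed

lemma finite_pieces:
  obtains n :: nat and j D where "\<And>k. k < n \<Longrightarrow> j k \<in> I"
    "\<And>k. k < n \<Longrightarrow> D k \<in> borel_in X" "\<And>k. k < n \<Longrightarrow> D k \<subseteq> dm (j k)" "disjoint_family_on D {..<n}"
    "(\<Union>k<n. D k) = topspace X"
proof -
  obtain J where J: "finite J" "J \<subseteq> I" "topspace X \<subseteq> (\<Union>i\<in>J. dm i)" using cover by blast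
  then obtain j :: "nat \<Rightarrow> 'i" and n where j: "J = j ` {..<n}"
    by (metis finite_imp_nat_seg_image_inj_on lessThan_def)
  define D where "D k = dm (j k) - (\<Union>l<k. dm (j l))" for k
  have jI: "j k \<in> I" if "k < n" for k using J j that by auto
  have dmb: "dm (j k) \<in> borel_in X" if "k < n" for k
    using openin_borel_in[OF dm_open[OF jI[OF that]]] .
  show thesis
  proof
    show "j k \<in> I" if "k < n" for k using jI[OF that] .
    show "D k \<in> borel_in X" if "k < n" for k
      unfolding D_def using dmb that by (intro bX.Diff bX.finite_UN) auto
    show "D k \<subseteq> dm (j k)" for k by (auto simp: D_def)
    show "disjoint_family_on D {..<n}"
    proof -
      have "D k \<inter> D l = {}" if "k < l" for k l using that by (auto simp: D_def)
      then show ?thesis unfolding disjoint_family_on_def by (metis Int_commute nat_neq_iff)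
    qed
    show "(\<Union>k<n. D k) = topspace X"
    proof
      show "(\<Union>k<n. D k) \<subseteq> topspace X"
        using openin_subset[OF dm_open[OF jI]] by (auto simp: D_def)
      show "topspace X \<subseteq> (\<Union>k<n. D k)"
      proof
        fix x assume "x \<in> topspace X"
        then have "\<exists>k. k < n \<and> x \<in> dm (j k)" using J(3) j by auto
        then have k: "(LEAST k. k < n \<and> x \<in> dm (j k)) < n \<and> x \<in> dm (j (LEAST k. k < n \<and>
            x \<in> dm (j k)))"
          by (rule LeastI_ex)
        moreover have "x \<notin> dm (j l)" if "l < (LEAST k. k < n \<and> x \<in> dm (j k))" for l
          using not_less_Least[OF that] k that by auto
        ultimately show "x \<in> (\<Union>k<n. D k)" unfolding D_def by blast
      qed
    qed
  qed
qed

text \<open>Existence: cut the space into finitely many disjoint Borel pieces, each inside one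
  chart, and add the chart measures of the pieces; \<open>consistent\<close> gives the right value
  in every other chart. Uniqueness: additivity over the same pieces leaves no choice.\<close>

theorem density_measure_ex1: "\<exists>!M. is_density_measure X I dm ch \<rho> M"
proof -
  obtain n :: nat and j D where D: "\<And>k. k < n \<Longrightarrow> j k \<in> I"
    "\<And>k. k < n \<Longrightarrow> D k \<in> borel_in X" "\<And>k. k < n \<Longrightarrow> D k \<subseteq> dm (j k)" "disjoint_family_on D {..<n}"
    "(\<Union>k<n. D k) = topspace X" by (rule finite_pieces; blast)
  define \<mu> where "\<mu> B = (\<Sum>k<n. emeasure (chart_measure (j k)) (ch (j k) ` (B \<inter> D k)))" for B
  have img: "ch (j k) ` (B \<inter> D k) \<in> sets borel" if "k < n" "B \<in> borel_in X" for k B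
  proof -
    have "B \<inter> D k \<inter> dm (j k) = B \<inter> D k" using D(3)[OF that(1)] by auto
    then show ?thesis
      using chart_image_borel[OF D(1)[OF that(1)], of "B \<inter> D k"] D(2)[OF that(1)] that(2) by auto
  qed
  have split: "B = (\<Union>k<n. B \<inter> D k)" if "B \<in> borel_in X" for B
    using bX.sets_into_space[OF that] D(5) by auto
  define M where "M = measure_of (topspace X) (borel_in X) \<mu>"
  have sM: "sets M = borel_in X" "space M = topspace X"
    unfolding M_def using bX.space_closed by (auto simp: bX.sigma_sets_eq)
  have eM: "emeasure M B = \<mu> B" if "B \<in> borel_in X" for B
    unfolding M_def
  proof (rule emeasure_measure_of_sigma[OF borel_in_sigma_algebra _ _ that])
    show "positive (borel_in X) \<mu>" by (simp add: positive_def \<mu>_def)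
    show "countably_additive (borel_in X) \<mu>"
    proof (rule countably_additiveI)
      fix A :: "nat \<Rightarrow> 'p set"
      assume A: "range A \<subseteq> borel_in X" "disjoint_family A" "\<Union> (range A) \<in> borel_in X"
      have "suminf (\<lambda>i. \<mu> (A i)) = (\<Sum>k<n. suminf (\<lambda>i. emeasure (chart_measure (j k)) (ch (j k)
          ` (A i \<inter> D k))))"
        unfolding \<mu>_def by (rule suminf_sum) auto
      also have "\<dots> = \<mu> (\<Union> (range A))"
        unfolding \<mu>_def
      proof (rule sum.cong[OF refl])
        fix k assume "k \<in> {..<n}"
        then have k: "k < n" by simp
        have "disjoint_family (\<lambda>i. ch (j k) ` (A i \<inter> D k))"
        proof -
          have "ch (j k) ` (A i \<inter> D k) \<inter> ch (j k) ` (A i' \<inter> D k) = {}" if "i \<noteq> i'" for i i'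
          proof -
            have "(A i \<inter> D k) \<inter> (A i' \<inter> D k) = {}"
              using A(2) that by (auto simp: disjoint_family_on_def)
            then show ?thesis
              using inj_on_image_Int[OF inj[OF D(1)[OF k]], of "A i \<inter> D k" "A i' \<inter> D k"] D(3)[OF k]
                by auto
          qed
          then show ?thesis by (auto simp: disjoint_family_on_def)
        qed
        then have "suminf (\<lambda>i. emeasure (chart_measure (j k)) (ch (j k) ` (A i \<inter> D k))) =
            emeasure (chart_measure (j k)) (\<Union>i. ch (j k) ` (A i \<inter> D k))"
          using img[OF k] A(1) by (intro suminf_emeasure) (auto simp: chart_measure_def)
        also have "(\<Union>i. ch (j k) ` (A i \<inter> D k)) = ch (j k) ` (\<Union> (range A) \<inter> D k)" by auto
        finally show "suminf (\<lambda>i. emeasure (chart_measure (j k)) (ch (j k) ` (A i \<inter> D k))) =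
          emeasure (chart_measure (j k)) (ch (j k) ` (\<Union> (range A) \<inter> D k))" .
      qed
      finally show "suminf (\<lambda>i. \<mu> (A i)) = \<mu> (\<Union> (range A))" .
    qed
  qed
  have "is_density_measure X I dm ch \<rho> M"
    unfolding is_density_measure_def sM
  proof (intro conjI ballI impI refl)
    fix i B assume i: "i \<in> I" and B: "B \<in> borel_in X" "B \<subseteq> dm i"
    have BD: "B \<inter> D k \<in> borel_in X" if "k < n" for k using B D(2)[OF that] by auto
    have "emeasure M B = (\<Sum>k<n. emeasure (chart_measure i) (ch i ` (B \<inter> D k)))"
      unfolding eM[OF B(1)] \<mu>_def
    proof (rule sum.cong[OF refl])
      fix k assume "k \<in> {..<n}"
      then have k: "k < n" by simp
      have s: "B \<inter> D k \<subseteq> dm (j k)" "B \<inter> D k \<subseteq> dm i" using D(3)[OF k] B(2) by auto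
      show "emeasure (chart_measure (j k)) (ch (j k) ` (B \<inter> D k)) =
          emeasure (chart_measure i) (ch i ` (B \<inter> D k))"
        unfolding chart_measure[OF D(1)[OF k] BD[OF k] s(1)] chart_measure[OF i BD[OF k] s(2)]
        by (rule consistent[OF D(1)[OF k] i BD[OF k] s])
    qed
    also have "\<dots> = emeasure (chart_measure i) (\<Union>k<n. ch i ` (B \<inter> D k))"
    proof (rule sum_emeasure)
      show "(\<lambda>k. ch i ` (B \<inter> D k)) ` {..<n} \<subseteq> sets (chart_measure i)"
      proof -
        have "B \<inter> D k \<inter> dm i = B \<inter> D k" for k using B(2) by auto
        then show ?thesis using chart_image_borel[OF i BD] by (auto simp: chart_measure_def)
      qed
      show "disjoint_family_on (\<lambda>k. ch i ` (B \<inter> D k)) {..<n}"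
        unfolding disjoint_family_on_def
      proof (intro ballI impI)
        fix k l assume "k \<in> {..<n}" "l \<in> {..<n}" "k \<noteq> l"
        then have "(B \<inter> D k) \<inter> (B \<inter> D l) = {}" using D(4) by (auto simp: disjoint_family_on_def)
        then show "ch i ` (B \<inter> D k) \<inter> ch i ` (B \<inter> D l) = {}"
          using inj_on_image_Int[OF inj[OF i], of "B \<inter> D k" "B \<inter> D l"] B(2) by auto
      qed
    qed simp
    also have "(\<Union>k<n. ch i ` (B \<inter> D k)) = ch i ` B" by (subst (2) split[OF B(1)]) auto
    finally show "emeasure M B = (\<integral>\<^sup>+ y \<in> ch i ` B. ennreal (\<rho> i (inv_into (dm i) (ch i) y))
        \<partial>lborel)"
      using chart_measure[OF i B] by simp
  qed
  moreover have "M' = M" if "is_density_measure X I dm ch \<rho> M'" for M'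
  proof (rule measure_eqI)
    have sM': "sets M' = borel_in X" using that by (simp add: is_density_measure_def)
    then show "sets M' = sets M" using sM by simp
    fix B assume "B \<in> sets M'"
    then have B: "B \<in> borel_in X" using sM' by simp
    have "emeasure M' B = emeasure M' (\<Union>k<n. B \<inter> D k)" using split[OF B] by simp
    also have "\<dots> = (\<Sum>k<n. emeasure M' (B \<inter> D k))"
    proof (rule sum_emeasure[symmetric])
      show "disjoint_family_on (\<lambda>k. B \<inter> D k) {..<n}"
        using D(4) unfolding disjoint_family_on_def by blast
    qed (use sM' B D(2) in auto)
    also have "\<dots> = \<mu> B"
      unfolding \<mu>_def
    proof (rule sum.cong[OF refl])
      fix k assume "k \<in> {..<n}"
      then have k: "k < n" by simp
      have BD: "B \<inter> D k \<in> borel_in X" "B \<inter> D k \<subseteq> dm (j k)" using B D(2,3)[OF k] by auto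
      show "emeasure M' (B \<inter> D k) = emeasure (chart_measure (j k)) (ch (j k) ` (B \<inter> D k))"
        using that BD D(1)[OF k] sM' unfolding is_density_measure_def
        by (subst chart_measure[OF D(1)[OF k] BD]) auto
    qed
    finally show "emeasure M' B = emeasure M B" using eM[OF B] by simp
  qed
  ultimately show ?thesis by blast
qed

end

section \<open>The ruled surface\<close>

locale ruled =
  fixes E :: "('a::t2_space, 'l) polarized_surface" and hn :: "'l \<Rightarrow> real"
  assumes genus_setup: "genus_two_setup E hn"
begin

lemma line_bundle: "holomorphic_line_bundle (charts E) (pr E) (trivs E)"
  using genus_setup by (simp add: genus_two_setup_def)

lemma atlas: "riemann_surface_atlas (charts E)"
  using genus_setup by (simp add: genus_two_setup_def compact_riemann_surface_def)

lemma triv_cover: "\<exists>T\<in>trivs E. p \<in> fst T"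
proof -
  have "p \<in> (\<Union>(U, t)\<in>trivs E. U)" using line_bundle unfolding holomorphic_line_bundle_def by simp
  then show ?thesis by force
qed

lemma triv_open: "T \<in> trivs E \<Longrightarrow> open (fst T)"
  using line_bundle unfolding holomorphic_line_bundle_def by (auto simp: case_prod_beta)

lemma triv_bij: "T \<in> trivs E \<Longrightarrow> p \<in> fst T \<Longrightarrow> bij_betw (snd T) {v. pr E v = p} UNIV"
  using line_bundle unfolding holomorphic_line_bundle_def by (auto simp: case_prod_beta)

lemma triv_transition: "T \<in> trivs E \<Longrightarrow> T' \<in> trivs E \<Longrightarrow> \<exists>g.
        holomorphic_fun_on (charts E) (fst T \<inter> fst T') g \<and> (\<forall>p\<in>fst T \<inter> fst T'. g p \<noteq> 0) \<and>
        (\<forall>v. pr E v \<in> fst T \<inter> fst T' \<longrightarrow> snd T' v = g (pr E v) * snd T v)"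
proof -
  assume T: "T \<in> trivs E" "T' \<in> trivs E"
  have "\<forall>(U, t)\<in>trivs E. \<forall>(U', t')\<in>trivs E. \<exists>g.
        holomorphic_fun_on (charts E) (U \<inter> U') g \<and> (\<forall>p\<in>U \<inter> U'. g p \<noteq> 0) \<and>
        (\<forall>v. pr E v \<in> U \<inter> U' \<longrightarrow> t' v = g (pr E v) * t v)"
    using line_bundle unfolding holomorphic_line_bundle_def by (elim conjE)
  from bspec[OF bspec[OF this T(1), unfolded case_prod_beta] T(2), unfolded case_prod_beta]
  show ?thesis .
qed

lemma chart_cover: "\<exists>C\<in>charts E. p \<in> fst C"
proof -
  have "p \<in> (\<Union>(V, c)\<in>charts E. V)" using atlas unfolding riemann_surface_atlas_def by simp
  then show ?thesis by force
qed

abbreviation cinv :: "'a chart \<Rightarrow> complex \<Rightarrow> 'a" where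
  "cinv C \<equiv> inv_into (fst C) (snd C)"

lemma chart_open: "C \<in> charts E \<Longrightarrow> open (fst C)"
  and chart_hom: "C \<in> charts E \<Longrightarrow> homeomorphism (fst C) (snd C ` fst C) (snd C) (cinv C)"
  and chart_open_image: "C \<in> charts E \<Longrightarrow> open (snd C ` fst C)"
  using atlas unfolding riemann_surface_atlas_def by (auto simp: case_prod_beta)

lemma chart_trans: "C \<in> charts E \<Longrightarrow> C' \<in> charts E \<Longrightarrow>
    (\<lambda>z. snd C' (cinv C z)) holomorphic_on snd C ` (fst C \<inter> fst C')"
  using atlas unfolding riemann_surface_atlas_def
  by (cases C; cases C') (fastforce simp: o_def)

lemma cinv [simp]: "C \<in> charts E \<Longrightarrow> p \<in> fst C \<Longrightarrow> cinv C (snd C p) = p"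
  using chart_hom unfolding homeomorphism_def by blast

lemma chart_inj: "C \<in> charts E \<Longrightarrow> p \<in> fst C \<Longrightarrow> q \<in> fst C \<Longrightarrow> snd C p = snd C q \<longleftrightarrow> p = q"
  by (metis cinv)

lemma chart_image_open:
  assumes "C \<in> charts E" "open U" "U \<subseteq> fst C"
  shows "open (snd C ` U)"
proof -
  have "open (snd C ` fst C \<inter> cinv C -` U)"
    using chart_hom[OF assms(1)] chart_open_image[OF assms(1)] assms(2)
    by (intro continuous_open_preimage) (auto simp: homeomorphism_def)
  moreover have "snd C ` fst C \<inter> cinv C -` U = snd C ` U"
    using assms by (auto simp: image_iff subset_iff)
  ultimately show ?thesis by simp
qed

section \<open>Fibre coordinates and points of the ruled surface\<close>

definition fvec :: "('a, 'l) triv \<Rightarrow> 'a \<Rightarrow> complex \<Rightarrow> 'l" where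
  "fvec T p w = (THE v. pr E v = p \<and> snd T v = w)"

lemma vec_ex1: "T \<in> trivs E \<Longrightarrow> p \<in> fst T \<Longrightarrow> \<exists>!v. pr E v = p \<and> snd T v = w"
  using triv_bij[of T p]
    unfolding bij_betw_def inj_on_def by (auto simp: image_iff set_eq_iff) metis

lemma fvec:
  assumes "T \<in> trivs E" "p \<in> fst T"
  shows "pr E (fvec T p w) = p" "snd T (fvec T p w) = w"
  using theI'[OF vec_ex1[OF assms, of w], folded fvec_def] by auto

lemma vec_eqI: "T \<in> trivs E \<Longrightarrow> pr E v \<in> fst T \<Longrightarrow> pr E v = pr E v' \<Longrightarrow> snd T v = snd T v' \<Longrightarrow> v = v'"
  using vec_ex1[of T "pr E v" "snd T v"] by metis

lemma vec_self: "T \<in> trivs E \<Longrightarrow> pr E v \<in> fst T \<Longrightarrow> fvec T (pr E v) (snd T v) = v"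
  by (rule vec_eqI) (auto simp: fvec)

text \<open>An explicit transition function: by linearity it must be the
  \<open>T'\<close>-coordinate of the vector whose \<open>T\<close>-coordinate is 1. The bundle
  axioms only assert that some function of this kind exists for each pair.\<close>

definition trn :: "('a, 'l) triv \<Rightarrow> ('a, 'l) triv \<Rightarrow> 'a \<Rightarrow> complex" where
  "trn T T' p = snd T' (fvec T p 1)"

lemma trn:
  assumes "T \<in> trivs E" "T' \<in> trivs E"
  shows "p \<in> fst T \<Longrightarrow> p \<in> fst T' \<Longrightarrow> trn T T' p \<noteq> 0"
    "pr E v \<in> fst T \<Longrightarrow> pr E v \<in> fst T' \<Longrightarrow> snd T' v = trn T T' (pr E v) * snd T v"
    "C \<in> charts E \<Longrightarrow> (\<lambda>z. trn T T' (cinv C z)) holomorphic_on snd C ` (fst C \<inter> (fst T \<inter> fst T'))"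
proof -
  obtain g where g: "holomorphic_fun_on (charts E) (fst T \<inter> fst T') g" "\<forall>p\<in>fst T \<inter> fst T'. g p \<noteq> 0"
        "\<forall>v. pr E v \<in> fst T \<inter> fst T' \<longrightarrow> snd T' v = g (pr E v) * snd T v"
    using triv_transition[OF assms] by blast
  have gt: "trn T T' p = g p" if "p \<in> fst T" "p \<in> fst T'" for p
    using g(3) fvec[OF assms(1) that(1), of 1] that by (simp add: trn_def)
  show "p \<in> fst T \<Longrightarrow> p \<in> fst T' \<Longrightarrow> trn T T' p \<noteq> 0"
    using g(2) gt by auto
  show "pr E v \<in> fst T \<Longrightarrow> pr E v \<in> fst T' \<Longrightarrow> snd T' v = trn T T' (pr E v) * snd T v"
    using g(3) gt by auto
  show "(\<lambda>z. trn T T' (cinv C z)) holomorphic_on snd C ` (fst C \<inter> (fst T \<inter> fst T'))" if C: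
      "C \<in> charts E"
  proof -
    have "(\<lambda>z. g (cinv C z)) holomorphic_on snd C ` (fst C \<inter> (fst T \<inter> fst T'))"
      using g(1) C unfolding holomorphic_fun_on_def by (cases C) auto
    then show ?thesis
      by (rule holomorphic_transform) (use gt C in auto)
  qed
qed

lemma vec_trn: "T \<in> trivs E \<Longrightarrow> T' \<in> trivs E \<Longrightarrow> p \<in> fst T \<Longrightarrow> p \<in> fst T' \<Longrightarrow>
    fvec T p w = fvec T' p (trn T T' p * w)"
  by (rule vec_eqI[of T']) (auto simp: fvec trn(2)[of T T'])

text \<open>\<open>fibre_scale\<close> prescribes the scaled coordinate in all trivializations at
  once. Transition functions act linearly on the fibre, so solving the condition in one
  trivialization solves it in all.\<close>

lemma fibre_scale_ex1: "\<exists>!v'. pr E v' = pr E v \<and>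
        (\<forall>(U, t)\<in>trivs E. pr E v \<in> U \<longrightarrow> t v' = \<mu> * t v)"
proof -
  obtain T where T: "T \<in> trivs E" "pr E v \<in> fst T" using triv_cover by blast
  define v' where "v' = fvec T (pr E v) (\<mu> * snd T v)"
  have v': "pr E v' = pr E v" "snd T v' = \<mu> * snd T v" using fvec[OF T] by (auto simp: v'_def)
  have "snd T' v' = \<mu> * snd T' v" if "T' \<in> trivs E" "pr E v \<in> fst T'" for T'
    using trn(2)[OF T(1) that(1)] T(2) that(2) v' by simp
  then have "pr E v' = pr E v \<and> (\<forall>(U, t)\<in>trivs E. pr E v \<in> U \<longrightarrow> t v' = \<mu> * t v)"
    using v'(1) by (auto simp: case_prod_beta)
  moreover have "v'' = v'" if "pr E v'' = pr E v \<and> (\<forall>(U, t)\<in>trivs E. pr E v \<in> U \<longrightarrow> t v'' =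
      \<mu> * t v)" for v''
  proof (rule vec_eqI[OF T(1)])
    show "snd T v'' = snd T v'"
      using bspec[OF conjunct2[OF that] T(1), unfolded case_prod_beta] T(2) v'(2) by simp
  qed (use conjunct1[OF that] v'(1) T(2) in auto)
  ultimately show ?thesis by (rule ex1I)
qed

lemma fibre_scale_pr [simp]: "pr E (fibre_scale E \<mu> v) = pr E v"
  and fibre_scale_snd: "T \<in> trivs E \<Longrightarrow> pr E v \<in> fst T \<Longrightarrow> snd T (fibre_scale E \<mu> v) = \<mu> * snd T v"
proof -
  note * = theI'[OF fibre_scale_ex1[of v \<mu>], folded fibre_scale_def]
  show "pr E (fibre_scale E \<mu> v) = pr E v" using * by (rule conjunct1)
  show "snd T (fibre_scale E \<mu> v) = \<mu> * snd T v" if "T \<in> trivs E" "pr E v \<in> fst T"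
    using bspec[OF conjunct2[OF *] that(1), unfolded case_prod_beta] that(2) by simp
qed

lemma is_zero_vec_iff: "T \<in> trivs E \<Longrightarrow> pr E v \<in> fst T \<Longrightarrow> is_zero_vec E v \<longleftrightarrow> snd T v = 0"
proof -
  assume T: "T \<in> trivs E" "pr E v \<in> fst T"
  have 0: "snd T (fibre_scale E 0 v) = 0" using fibre_scale_snd[OF T, of 0] by simp
  show "is_zero_vec E v \<longleftrightarrow> snd T v = 0"
    unfolding is_zero_vec_def
  proof
    assume "fibre_scale E 0 v = v"
    with 0 show "snd T v = 0" by (simp only:)
  next
    assume "snd T v = 0"
    then show "fibre_scale E 0 v = v"
      using T 0 by (intro vec_eqI[OF T(1)]) auto
  qed
qed

lemma fibre_scale_vec: "T \<in> trivs E \<Longrightarrow> p \<in> fst T \<Longrightarrow> fibre_scale E \<mu> (fvec T p w) = fvec T p (\<mu> * w)"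
  by (rule vec_eqI[of T]) (auto simp: fvec fibre_scale_snd)

text \<open>The inverse of the chart with trivialization \<open>T\<close> and flag \<open>b\<close>,
  as a function of the base point and the fibre coordinate. Sets and functions on the surface are
  computed through it; the two flags are related by \<open>w\<close> to
  \<open>1 / w\<close>.\<close>

definition pnt :: "('a, 'l) triv \<Rightarrow> bool \<Rightarrow> 'a \<Rightarrow> complex \<Rightarrow> 'l pt" where
  "pnt T b p w = (if b then span_line E (fvec T p 1) w else span_line E (fvec T p w) 1)"

lemma span_line_vec:
  "T \<in> trivs E \<Longrightarrow> p \<in> fst T \<Longrightarrow> span_line E (fvec T p w) k = {(fvec T p (\<mu> * w), \<mu> * k) | \<mu>. True}"
  by (auto simp: span_line_def fibre_scale_vec)

lemma span_line_scale:
  assumes "T \<in> trivs E" "p \<in> fst T" "r \<noteq> 0"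
  shows "span_line E (fvec T p (r * w)) (r * k) = span_line E (fvec T p w) k"
  unfolding span_line_vec[OF assms(1,2)]
proof (intro equalityI subsetI)
  fix x assume "x \<in> {(fvec T p (\<mu> * (r * w)), \<mu> * (r * k)) | \<mu>. True}"
  then obtain \<mu> where "x = (fvec T p (\<mu> * (r * w)), \<mu> * (r * k))" by blast
  then have "x = (fvec T p ((\<mu> * r) * w), (\<mu> * r) * k)" by (simp add: mult.assoc)
  then show "x \<in> {(fvec T p (\<mu> * w), \<mu> * k) | \<mu>. True}" by blast
next
  fix x assume "x \<in> {(fvec T p (\<mu> * w), \<mu> * k) | \<mu>. True}"
  then obtain \<mu> where "x = (fvec T p (\<mu> * w), \<mu> * k)" by blast
  then have "x = (fvec T p ((\<mu> / r) * (r * w)), (\<mu> / r) * (r * k))" using assms(3) by simp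
  then show "x \<in> {(fvec T p (\<mu> * (r * w)), \<mu> * (r * k)) | \<mu>. True}" by blast
qed

lemma pnt_flip:
  assumes "T \<in> trivs E" "p \<in> fst T" "w \<noteq> 0"
  shows "pnt T b p w = pnt T (\<not> b) p (1 / w)"
proof -
  have *: "span_line E (fvec T p w) 1 = span_line E (fvec T p 1) (1 / w)" if "w \<noteq> 0" for w
    using span_line_scale[OF assms(1,2) that, of 1 "1/w"] that by simp
  show ?thesis using *[OF assms(3)] *[of "1 / w"] assms(3) by (auto simp: pnt_def)
qed

lemma pnt_trn:
  assumes "T \<in> trivs E" "T' \<in> trivs E" "p \<in> fst T" "p \<in> fst T'"
  shows "pnt T False p w = pnt T' False p (trn T T' p * w)"
    "pnt T True p w = pnt T' True p (w / trn T T' p)"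
proof -
  show "pnt T False p w = pnt T' False p (trn T T' p * w)"
    by (simp add: pnt_def vec_trn[OF assms])
  show "pnt T True p w = pnt T' True p (w / trn T T' p)"
    using span_line_scale[OF assms(2,4) trn(1)[OF assms], of 1 "w / trn T T' p"] trn(1)[OF assms]
    by (simp add: pnt_def vec_trn[OF assms])
qed

lemma pnt_mem:
  assumes "T \<in> trivs E" "p \<in> fst T"
  shows "(v, k) \<in> pnt T False p w \<longleftrightarrow> pr E v = p \<and> snd T v = k * w"
    "(v, k) \<in> pnt T True p w \<longleftrightarrow> pr E v = p \<and> k = w * snd T v"
proof -
  have v: "v = fvec T p a \<longleftrightarrow> pr E v = p \<and> snd T v = a" for a
    using fvec[OF assms] vec_eqI[OF assms(1)] assms(2) by metis
  show "(v, k) \<in> pnt T False p w \<longleftrightarrow> pr E v = p \<and> snd T v = k * w"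
    "(v, k) \<in> pnt T True p w \<longleftrightarrow> pr E v = p \<and> k = w * snd T v"
    unfolding pnt_def if_True if_False span_line_vec[OF assms] by (auto simp: v)
qed

lemma pnt_eq_iff:
  assumes "T \<in> trivs E" "p \<in> fst T" "p' \<in> fst T"
  shows "pnt T b p w = pnt T b p' w' \<longleftrightarrow> p = p' \<and> w = w'"
proof
  assume eq: "pnt T b p w = pnt T b p' w'"
  show "p = p' \<and> w = w'"
  proof (cases b)
    case True
    have "(fvec T p 1, w) \<in> pnt T b p w"
      using True by (simp add: pnt_mem[OF assms(1,2)] fvec[OF assms(1,2)])
    then show ?thesis
      unfolding eq using True by (auto simp: pnt_mem[OF assms(1,3)] fvec[OF assms(1,2)])
  next
    case False
    have "(fvec T p w, 1) \<in> pnt T b p w"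
      using False by (simp add: pnt_mem[OF assms(1,2)] fvec[OF assms(1,2)])
    then show ?thesis
      unfolding eq using False by (auto simp: pnt_mem[OF assms(1,3)] fvec[OF assms(1,2)])
  qed
qed simp

lemma X_proj_pnt:
  assumes "T \<in> trivs E" "p \<in> fst T"
  shows "X_proj E (pnt T b p w) = p"
  unfolding X_proj_def
proof (rule the_equality)
  show "\<forall>(v, k)\<in>pnt T b p w. pr E v = p"
    by (cases b) (auto simp: pnt_mem[OF assms])
  fix q assume q: "\<forall>(v, k)\<in>pnt T b p w. pr E v = q"
  have "(fvec T p (if b then 1 else w), if b then w else 1) \<in> pnt T b p w"
    by (cases b) (auto simp: pnt_mem[OF assms] fvec[OF assms])
  then show "q = p" using q fvec[OF assms] by auto
qed

lemma pnt_eqD: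
  assumes "T \<in> trivs E" "p \<in> fst T" "T' \<in> trivs E" "p' \<in> fst T'" "pnt T b p w = pnt T' b' p' w'"
  shows "p = p'"
  using X_proj_pnt[OF assms(1,2)] X_proj_pnt[OF assms(3,4)] assms(5) by metis

lemma span_line_pnt:
  assumes "T \<in> trivs E" "pr E v \<in> fst T"
  shows "k \<noteq> 0 \<Longrightarrow> span_line E v k = pnt T False (pr E v) (snd T v / k)"
    "snd T v \<noteq> 0 \<Longrightarrow> span_line E v k = pnt T True (pr E v) (k / snd T v)"
proof -
  show "span_line E v k = pnt T False (pr E v) (snd T v / k)" if "k \<noteq> 0"
    using span_line_scale[OF assms that, of "snd T v / k" 1] that vec_self[OF assms]
      by (simp add: pnt_def)
  show "span_line E v k = pnt T True (pr E v) (k / snd T v)" if "snd T v \<noteq> 0"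
    using span_line_scale[OF assms that, of 1 "k / snd T v"] that vec_self[OF assms]
      by (simp add: pnt_def)
qed

lemma X_dom_eq:
  assumes "T \<in> trivs E"
  shows "X_dom E (C, T, b) = {pnt T b p w | p w. p \<in> fst C \<inter> fst T}"
proof (cases b)
  case True
  have "X_dom E (C, T, True) = {span_line E v k | v k. pr E v \<in> fst C \<inter> fst T \<and> \<not> is_zero_vec E v}"
    by (cases C; cases T) simp
  also have "\<dots> = {pnt T True p w | p w. p \<in> fst C \<inter> fst T}"
  proof safe
    fix v k assume v: "pr E v \<in> fst C" "pr E v \<in> fst T" "\<not> is_zero_vec E v"
    then have "snd T v \<noteq> 0" using is_zero_vec_iff[OF assms v(2)] by simp
    then show "\<exists>p w. span_line E v k = pnt T True p w \<and> p \<in> fst C \<inter> fst T"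
      using span_line_pnt(2)[OF assms v(2)] v by blast
  next
    fix p w assume p: "p \<in> fst C" "p \<in> fst T"
    show "\<exists>v k. pnt T True p w = span_line E v k \<and> pr E v \<in> fst C \<inter> fst T \<and> \<not> is_zero_vec E v"
      using fvec[OF assms p(2), of 1] p is_zero_vec_iff[OF assms, of "fvec T p 1"]
      by (intro exI[of _ "fvec T p 1"] exI[of _ w]) (simp add: pnt_def)
  qed
  finally show ?thesis using True by simp
next
  case False
  have "X_dom E (C, T, False) = {span_line E v k | v k. pr E v \<in> fst C \<inter> fst T \<and> k \<noteq> 0}"
    by (cases C; cases T) simp
  also have "\<dots> = {pnt T False p w | p w. p \<in> fst C \<inter> fst T}"
  proof safe
    fix v and k :: complex assume v: "pr E v \<in> fst C" "pr E v \<in> fst T" "k \<noteq> 0"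
    then show "\<exists>p w. span_line E v k = pnt T False p w \<and> p \<in> fst C \<inter> fst T"
      using span_line_pnt(1)[OF assms v(2)] v by blast
  next
    fix p w assume p: "p \<in> fst C" "p \<in> fst T"
    show "\<exists>v k. pnt T False p w = span_line E v k \<and> pr E v \<in> fst C \<inter> fst T \<and> k \<noteq> 0"
      using fvec[OF assms p(2), of w] p
      by (intro exI[of _ "fvec T p w"] exI[of _ 1]) (simp add: pnt_def)
  qed
  finally show ?thesis using False by simp
qed

lemma X_chart_pnt:
  assumes "T \<in> trivs E" "p \<in> fst T"
  shows "X_chart E (C, T, b) (pnt T b p w) = (snd C p, w)"
proof (cases b)
  case True
  have "X_chart E (C, T, True) x = (THE y. \<forall>(v, k)\<in>x. snd T v \<noteq> 0 \<longrightarrow> y =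
      (snd C (pr E v), k / snd T v))" for x
    by (cases C; cases T) simp
  moreover have "(THE y. \<forall>(v, k)\<in>pnt T True p w. snd T v \<noteq> 0 \<longrightarrow> y =
      (snd C (pr E v), k / snd T v)) = (snd C p, w)"
  proof (rule the_equality)
    fix y assume y: "\<forall>(v, k)\<in>pnt T True p w. snd T v \<noteq> 0 \<longrightarrow> y = (snd C (pr E v), k / snd T v)"
    have "(fvec T p 1, w) \<in> pnt T True p w" by (simp add: pnt_mem[OF assms] fvec[OF assms])
    from bspec[OF y this] show "y = (snd C p, w)" by (simp add: fvec[OF assms])
  qed (auto simp: pnt_mem[OF assms])
  ultimately show ?thesis using True by simp
next
  case False
  have "X_chart E (C, T, False) x = (THE y. \<forall>(v, k)\<in>x. k \<noteq> 0 \<longrightarrow> y =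
      (snd C (pr E v), snd T v / k))" for x
    by (cases C; cases T) simp
  moreover have "(THE y. \<forall>(v, k)\<in>pnt T False p w. k \<noteq> 0 \<longrightarrow> y = (snd C (pr E v), snd T v / k)) =
      (snd C p, w)"
  proof (rule the_equality)
    fix y assume y: "\<forall>(v, k)\<in>pnt T False p w. k \<noteq> 0 \<longrightarrow> y = (snd C (pr E v), snd T v / k)"
    have "(fvec T p w, 1) \<in> pnt T False p w" by (simp add: pnt_mem[OF assms] fvec[OF assms])
    from bspec[OF y this] show "y = (snd C p, w)" by (simp add: fvec[OF assms])
  qed (auto simp: pnt_mem[OF assms])
  ultimately show ?thesis using False by simp
qed

lemma X_set_eq: "X_set E = {pnt T b p w | T b p w. T \<in> trivs E \<and> p \<in> fst T}"
proof (intro equalityI subsetI)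
  fix x assume "x \<in> X_set E"
  then obtain v k where x: "x = span_line E v k" "\<not> (is_zero_vec E v \<and> k = 0)"
    by (auto simp: X_set_def)
  obtain T where T: "T \<in> trivs E" "pr E v \<in> fst T" using triv_cover by blast
  show "x \<in> {pnt T b p w | T b p w. T \<in> trivs E \<and> p \<in> fst T}"
    using x span_line_pnt[OF T, of k] T is_zero_vec_iff[OF T] by blast
next
  fix x assume "x \<in> {pnt T b p w | T b p w. T \<in> trivs E \<and> p \<in> fst T}"
  then obtain T b p w where T: "T \<in> trivs E" "p \<in> fst T" and x: "x = pnt T b p w" by blast
  have "\<not> is_zero_vec E (fvec T p 1)"
    using is_zero_vec_iff[OF T(1), of "fvec T p 1"] fvec[OF T] T by simp
  then show "x \<in> X_set E"
  proof (cases b)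
    case True
    then have "x = span_line E (fvec T p 1) w" using x by (simp add: pnt_def)
    then show ?thesis unfolding X_set_def using \<open>\<not> is_zero_vec E (fvec T p 1)\<close> by blast
  next
    case False
    then have "x = span_line E (fvec T p w) 1" using x by (simp add: pnt_def)
    then show ?thesis
      unfolding X_set_def by (intro CollectI exI[of _ "fvec T p w"] exI[of _ 1]) simp
  qed
qed

lemma pnt_True_0_neq:
  assumes "T \<in> trivs E" "p \<in> fst T" "T' \<in> trivs E" "p' \<in> fst T'"
  shows "pnt T True p 0 \<noteq> pnt T' False p' w"
proof
  assume eq: "pnt T True p 0 = pnt T' False p' w"
  have "(fvec T' p' w, 1) \<in> pnt T' False p' w"
    by (simp add: pnt_mem[OF assms(3,4)] fvec[OF assms(3,4)])
  then show False unfolding eq[symmetric] by (simp add: pnt_mem[OF assms(1,2)])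
qed

lemma S_zero_eq: "S_zero E = {pnt T False p 0 | T p. T \<in> trivs E \<and> p \<in> fst T}"
proof (intro equalityI subsetI)
  fix x assume "x \<in> S_zero E"
  then obtain v k where x: "x = span_line E v k" "is_zero_vec E v" "k \<noteq> 0"
    by (auto simp: S_zero_def)
  obtain T where T: "T \<in> trivs E" "pr E v \<in> fst T" using triv_cover by blast
  show "x \<in> {pnt T False p 0 | T p. T \<in> trivs E \<and> p \<in> fst T}"
  proof -
    have "x = pnt T False (pr E v) 0"
      using x span_line_pnt(1)[OF T x(3)] is_zero_vec_iff[OF T] by simp
    then show ?thesis using T by blast
  qed
next
  fix x assume "x \<in> {pnt T False p 0 | T p. T \<in> trivs E \<and> p \<in> fst T}"
  then obtain T p where T: "T \<in> trivs E" "p \<in> fst T" and x: "x = pnt T False p 0" by blast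
  have "is_zero_vec E (fvec T p 0)"
    using is_zero_vec_iff[OF T(1), of "fvec T p 0"] fvec[OF T] T by simp
  then show "x \<in> S_zero E"
    unfolding S_zero_def x pnt_def by (intro CollectI exI[of _ "fvec T p 0"] exI[of _ 1]) simp
qed

lemma S_inf_eq: "S_inf E = {pnt T True p 0 | T p. T \<in> trivs E \<and> p \<in> fst T}"
proof (intro equalityI subsetI)
  fix x assume "x \<in> S_inf E"
  then obtain v where x: "x = span_line E v 0" "\<not> is_zero_vec E v" by (auto simp: S_inf_def)
  obtain T where T: "T \<in> trivs E" "pr E v \<in> fst T" using triv_cover by blast
  show "x \<in> {pnt T True p 0 | T p. T \<in> trivs E \<and> p \<in> fst T}"
  proof -
    have "x = pnt T True (pr E v) 0"
      using x span_line_pnt(2)[OF T, of 0] is_zero_vec_iff[OF T] by simp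
    then show ?thesis using T by blast
  qed
next
  fix x assume "x \<in> {pnt T True p 0 | T p. T \<in> trivs E \<and> p \<in> fst T}"
  then obtain T p where T: "T \<in> trivs E" "p \<in> fst T" and x: "x = pnt T True p 0" by blast
  have "\<not> is_zero_vec E (fvec T p 1)"
    using is_zero_vec_iff[OF T(1), of "fvec T p 1"] fvec[OF T] T by simp
  then show "x \<in> S_inf E"
    unfolding S_inf_def x pnt_def by auto
qed

lemma pnt_X_set: "T \<in> trivs E \<Longrightarrow> p \<in> fst T \<Longrightarrow> pnt T b p w \<in> X_set E"
  unfolding X_set_eq by blast

lemma pnt_S_zero:
  assumes "T \<in> trivs E" "p \<in> fst T"
  shows "pnt T b p w \<in> S_zero E \<longleftrightarrow> \<not> b \<and> w = 0"
proof
  assume "pnt T b p w \<in> S_zero E"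
  then obtain T' p' where T': "T' \<in> trivs E" "p' \<in> fst T'" and eq: "pnt T b p w = pnt T' False p' 0"
    unfolding S_zero_eq by blast
  have p: "p' = p" using pnt_eqD[OF assms T' eq] by simp
  have eq2: "pnt T' False p' 0 = pnt T False p 0"
    using pnt_trn(1)[OF T'(1) assms(1) T'(2), of 0] assms p by simp
  show "\<not> b \<and> w = 0"
  proof (cases "b")
    case True
    then have "w \<noteq> 0" using pnt_True_0_neq[OF assms T'] eq by metis
    then have "pnt T b p w = pnt T False p (1 / w)"
      using pnt_flip[OF assms \<open>w \<noteq> 0\<close>, of b] True by simp
    then have "1 / w = 0" using eq eq2 pnt_eq_iff[OF assms(1,2,2)] by metis
    then show ?thesis using \<open>w \<noteq> 0\<close> by simp
  next
    case False
    then show ?thesis using eq eq2 pnt_eq_iff[OF assms(1,2,2)] by metis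
  qed
next
  assume "\<not> b \<and> w = 0"
  then have "pnt T b p w = pnt T False p 0" by simp
  then show "pnt T b p w \<in> S_zero E" unfolding S_zero_eq using assms by blast
qed

lemma pnt_S_inf:
  assumes "T \<in> trivs E" "p \<in> fst T"
  shows "pnt T b p w \<in> S_inf E \<longleftrightarrow> b \<and> w = 0"
proof
  assume "pnt T b p w \<in> S_inf E"
  then obtain T' p' where T': "T' \<in> trivs E" "p' \<in> fst T'" and eq: "pnt T b p w = pnt T' True p' 0"
    unfolding S_inf_eq by blast
  have p: "p' = p" using pnt_eqD[OF assms T' eq] by simp
  have eq2: "pnt T' True p' 0 = pnt T True p 0"
    using pnt_trn(2)[OF T'(1) assms(1) T'(2), of 0] assms p by simp
  have b: b using pnt_True_0_neq[OF T' assms] eq by (cases b) auto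
  then show "b \<and> w = 0" using eq eq2 pnt_eq_iff[OF assms(1,2,2), of True] by auto
next
  assume "b \<and> w = 0"
  then have "pnt T b p w = pnt T True p 0" by simp
  then show "pnt T b p w \<in> S_inf E" unfolding S_inf_eq using assms by blast
qed

lemma pnt_X_reg: "T \<in> trivs E \<Longrightarrow> p \<in> fst T \<Longrightarrow> pnt T b p w \<in> X_reg E \<longleftrightarrow> w \<noteq> 0"
  unfolding X_reg_def
    using pnt_X_set[of T p b w] pnt_S_zero[of T p b w] pnt_S_inf[of T p b w] by auto

lemma X_regE:
  assumes "x \<in> X_reg E" "T \<in> trivs E" "X_proj E x \<in> fst T"
  obtains w where "w \<noteq> 0" "x = pnt T b (X_proj E x) w"
proof -
  have "x \<in> X_set E" using assms(1) by (simp add: X_reg_def)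
  then obtain T' b' p w where x: "x = pnt T' b' p w" "T' \<in> trivs E" "p \<in> fst T'"
    unfolding X_set_eq by blast
  have p: "X_proj E x = p" using X_proj_pnt x by simp
  have w: "w \<noteq> 0" using assms(1) pnt_X_reg x by simp
  obtain w' where w': "w' \<noteq> 0" "x = pnt T' False p w'"
  proof (cases b')
    case True
    then show ?thesis using that[of "1 / w"] x w pnt_flip[OF x(2,3) w, of b'] by simp
  next
    case False
    then show ?thesis using that[of w] x w by simp
  qed
  have g: "trn T' T p \<noteq> 0" using trn(1)[OF x(2) assms(2) x(3)] assms(3) p by simp
  have 1: "x = pnt T False p (trn T' T p * w')"
    using pnt_trn(1)[OF x(2) assms(2) x(3)] assms(3) p w' by simp
  then have 2: "x = pnt T True p (1 / (trn T' T p * w'))"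
    using pnt_flip[OF assms(2), of p "trn T' T p * w'" False] g w' assms(3) p by simp
  show thesis
  proof (cases b)
    case True then show ?thesis using that[of "1 / (trn T' T p * w')"] 2 p g w' by simp
  next
    case False then show ?thesis using that[of "trn T' T p * w'"] 1 p g w' by simp
  qed
qed

lemma X_chart_image:
  assumes "T \<in> trivs E" 
  shows "X_chart E (C, T, b) ` X_dom E (C, T, b) = snd C ` (fst C \<inter> fst T) \<times> UNIV"
  unfolding X_dom_eq[OF assms]
    by (auto simp: X_chart_pnt[OF assms] image_iff) (metis IntI X_chart_pnt assms)

lemma X_chart_inj: "C \<in> charts E \<Longrightarrow> T \<in> trivs E \<Longrightarrow> inj_on (X_chart E (C, T, b)) (X_dom E (C, T, b))"
  unfolding X_dom_eq inj_on_def by (auto simp: X_chart_pnt chart_inj)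

lemma X_inv:
  assumes "C \<in> charts E" "T \<in> trivs E" "z \<in> snd C ` (fst C \<inter> fst T)"
  shows "inv_into (X_dom E (C, T, b)) (X_chart E (C, T, b)) (z, w) = pnt T b (cinv C z) w"
proof -
  obtain p where p: "z = snd C p" "p \<in> fst C" "p \<in> fst T" using assms by blast
  have "inv_into (X_dom E (C, T, b)) (X_chart E (C, T, b)) (X_chart E (C, T, b) (pnt T b p w)) =
      pnt T b p w"
    by (rule inv_into_f_f[OF X_chart_inj[OF assms(1,2)]]) (use p X_dom_eq[OF assms(2)] in blast)
  then show ?thesis using p assms by (simp add: X_chart_pnt)
qed

lemma pnt_X_dom:
  assumes "T \<in> trivs E" "p \<in> fst T" "T' \<in> trivs E"
  shows "pnt T b p w \<in> X_dom E (C', T', b') \<longleftrightarrow> p \<in> fst C' \<inter> fst T' \<and> (b \<noteq> b' \<longrightarrow> w \<noteq> 0)"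
proof
  assume "pnt T b p w \<in> X_dom E (C', T', b')"
  then obtain p' w' where p': "p' \<in> fst C' \<inter> fst T'" and eq: "pnt T b p w = pnt T' b' p' w'"
    unfolding X_dom_eq[OF assms(3)] by blast
  have p: "p = p'" using pnt_eqD[OF assms(1,2,3) _ eq] p' by blast
  have "w \<noteq> 0" if "b \<noteq> b'"
  proof
    assume "w = 0"
    \<comment> \<open>A point with vanishing fibre coordinate lies on one of the two sections, and
      which of them reveals the flag.\<close>
    then have "pnt T b p w \<in> S_zero E \<union> S_inf E" "\<not> b \<longrightarrow> pnt T b p w \<in> S_zero E" "b \<longrightarrow>
        pnt T b p w \<in> S_inf E"
      using pnt_S_zero[OF assms(1,2)] pnt_S_inf[OF assms(1,2)] by auto
    then show False
      using pnt_S_zero[OF assms(3), of p' b' w'] pnt_S_inf[OF assms(3), of p' b' w'] p' eq that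
        by auto
  qed
  then show "p \<in> fst C' \<inter> fst T' \<and> (b \<noteq> b' \<longrightarrow> w \<noteq> 0)" using p p' by simp
next
  assume *: "p \<in> fst C' \<inter> fst T' \<and> (b \<noteq> b' \<longrightarrow> w \<noteq> 0)"
  have "\<exists>w'. pnt T b p w = pnt T b' p w'"
    using * pnt_flip[OF assms(1,2), of w b] by (cases "b = b'") auto
  then obtain w' where w': "pnt T b p w = pnt T b' p w'" by blast
  have "\<exists>w''. pnt T b' p w' = pnt T' b' p w''"
    using pnt_trn[OF assms(1,3,2), of w'] * by (cases b') auto
  then show "pnt T b p w \<in> X_dom E (C', T', b')"
    unfolding X_dom_eq[OF assms(3)] using w' * by auto
qed

text \<open>The fibre part of the change of charts. Near \<open>S_inf E\<close> the coordinate is a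
  reciprocal, so it scales by the inverse of the transition function, and a change of flag adds an
  inversion.\<close>

definition fib :: "('a, 'l) triv \<Rightarrow> bool \<Rightarrow> ('a, 'l) triv \<Rightarrow> bool \<Rightarrow> 'a \<Rightarrow> complex \<Rightarrow> complex" where
  "fib T b T' b' p w = (if b then (if b' then w / trn T T' p else trn T T' p / w)
     else (if b' then 1 / (trn T T' p * w) else trn T T' p * w))"

lemma pnt_fib:
  assumes "T \<in> trivs E" "T' \<in> trivs E" "p \<in> fst T" "p \<in> fst T'" "b \<noteq> b' \<longrightarrow> w \<noteq> 0"
  shows "pnt T b p w = pnt T' b' p (fib T b T' b' p w)"
proof -
  note g = trn(1)[OF assms(1-4)]
  show ?thesis
  proof (cases "b = b'")
    case True
    then show ?thesis using pnt_trn[OF assms(1-4)] by (cases b) (auto simp: fib_def)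
  next
    case False
    then have w: "w \<noteq> 0" using assms by simp
    show ?thesis
    proof (cases b)
      case True
      then show ?thesis
        using False pnt_trn(2)[OF assms(1-4), of w] pnt_flip[OF assms(2,4), of
            "w / trn T T' p" True] w g
        by (simp add: fib_def)
    next
      case b: False
      then show ?thesis
        using False pnt_trn(1)[OF assms(1-4), of w] pnt_flip[OF assms(2,4), of
            "trn T T' p * w" False] w g
        by (simp add: fib_def)
    qed
  qed
qed

lemma X_chart_overlap:
  assumes "C \<in> charts E" "T \<in> trivs E" "C' \<in> charts E" "T' \<in> trivs E"
  shows "X_chart E (C, T, b) ` (X_dom E (C, T, b) \<inter> X_dom E (C', T', b')) =
     snd C ` (fst C \<inter> fst T \<inter> fst C' \<inter> fst T') \<times> {w. b \<noteq> b' \<longrightarrow> w \<noteq> 0}" (is "?L = ?R")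
proof (intro equalityI subsetI)
  fix y assume "y \<in> ?L"
  then obtain p w where "y = X_chart E (C, T, b) (pnt T b p w)" "p \<in> fst C \<inter> fst T"
      "pnt T b p w \<in> X_dom E (C', T', b')"
    by (auto simp: X_dom_eq[OF assms(2)])
  then show "y \<in> ?R"
    using pnt_X_dom[OF assms(2) _ assms(4)] by (auto simp: X_chart_pnt[OF assms(2)])
next
  fix y assume "y \<in> ?R"
  then obtain p w where y: "y = (snd C p, w)" "p \<in> fst C" "p \<in> fst T" "p \<in> fst C'" "p \<in> fst T'"
      "b \<noteq> b' \<longrightarrow> w \<noteq> 0"
    by blast
  then have "y = X_chart E (C, T, b) (pnt T b p w)" by (simp add: X_chart_pnt[OF assms(2)])
  moreover have "pnt T b p w \<in> X_dom E (C, T, b) \<inter> X_dom E (C', T', b')"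
    using y pnt_X_dom[OF assms(2) y(3) assms(4)] pnt_X_dom[OF assms(2) y(3) assms(2)] by auto
  ultimately show "y \<in> ?L" by blast
qed

lemma open_overlap:
  assumes "C \<in> charts E" "T \<in> trivs E" "C' \<in> charts E" "T' \<in> trivs E"
  shows "open (snd C ` (fst C \<inter> fst T \<inter> fst C' \<inter> fst T') \<times> {w. (b::bool) \<noteq> b' \<longrightarrow> w \<noteq> (0::complex)})"
proof (rule open_Times)
  show "open (snd C ` (fst C \<inter> fst T \<inter> fst C' \<inter> fst T'))"
    using assms by (intro chart_image_open) (auto intro: chart_open triv_open)
  show "open {w. b \<noteq> b' \<longrightarrow> w \<noteq> (0::complex)}"
  proof (cases "b = b'")
    case False
    then have "{w. b \<noteq> b' \<longrightarrow> w \<noteq> (0::complex)} = - {0}" by auto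
    then show ?thesis by (simp add: open_Compl)
  qed auto
qed

definition tau :: "'a chart \<Rightarrow> ('a, 'l) triv \<Rightarrow> bool \<Rightarrow> 'a chart \<Rightarrow> ('a, 'l) triv \<Rightarrow> bool \<Rightarrow>
    complex \<times> complex \<Rightarrow> complex \<times> complex" where
  "tau C T b C' T' b' y = (snd C' (cinv C (fst y)), fib T b T' b' (cinv C (fst y)) (snd y))"

lemma csmooth_fst_holomorphic:
  assumes "open S" "open U" "\<phi> holomorphic_on U" "fst ` S \<subseteq> U"
  shows "csmooth (S :: (complex \<times> complex) set) (\<lambda>y. \<phi> (fst y))"
proof -
  have c: "csmooth U \<phi>" using csmooth_holomorphic assms by blast
  have f: "smooth_on S (\<lambda>y. fst y \<bullet> b)" for b
    by (intro smooth_on_linear bounded_linear_compose[OF bounded_linear_inner_left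
        bounded_linear_fst])
  show ?thesis
    unfolding csmooth_def
    using smooth_on_compose[OF assms(1) _ f assms(4)] c unfolding csmooth_def by blast
qed

lemma tau_csmooth:
  fixes b b' :: bool
  assumes "C \<in> charts E" "T \<in> trivs E" "C' \<in> charts E" "T' \<in> trivs E"
  defines "Ov \<equiv> snd C ` (fst C \<inter> fst T \<inter> fst C' \<inter> fst T') \<times> {w. b \<noteq> b' \<longrightarrow> w \<noteq> 0}"
  shows "csmooth Ov (\<lambda>y. fst (tau C T b C' T' b' y))" "csmooth Ov (\<lambda>y. snd (tau C T b C' T' b' y))"
proof -
  have Ov: "open Ov" unfolding Ov_def by (rule open_overlap[OF assms(1-4)])
  have U: "open (snd C ` (fst C \<inter> fst T \<inter> fst C' \<inter> fst T'))"
    using assms by (intro chart_image_open) (auto intro: chart_open triv_open)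
  have sub: "fst ` Ov \<subseteq> snd C ` (fst C \<inter> fst T \<inter> fst C' \<inter> fst T')" unfolding Ov_def by auto
  show "csmooth Ov (\<lambda>y. fst (tau C T b C' T' b' y))"
    unfolding tau_def fst_conv
    by (rule csmooth_fst_holomorphic[OF Ov U _ sub])
        (rule holomorphic_on_subset[OF chart_trans[OF assms(1,3)]], auto)
  have t: "csmooth Ov (\<lambda>y. trn T T' (cinv C (fst y)))"
    by (rule csmooth_fst_holomorphic[OF Ov U _ sub])
        (rule holomorphic_on_subset[OF trn(3)[OF assms(2,4,1)]], auto)
  have tnz: "trn T T' (cinv C (fst y)) \<noteq> 0" if "y \<in> Ov" for y
  proof -
    have "fst y \<in> snd C ` (fst C \<inter> fst T \<inter> fst C' \<inter> fst T')"
      using that by (simp add: Ov_def mem_Times_iff)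
    then obtain p where "p \<in> fst C" "p \<in> fst T" "p \<in> fst T'" "fst y = snd C p" by blast
    then show ?thesis using trn(1)[OF assms(2,4)] assms(1) by simp
  qed
  have w: "csmooth Ov snd" by (intro csmooth_linear bounded_linear_snd)
  have wnz: "snd y \<noteq> 0" if "y \<in> Ov" "b \<noteq> b'" for y using that unfolding Ov_def by auto
  show "csmooth Ov (\<lambda>y. snd (tau C T b C' T' b' y))"
    unfolding tau_def snd_conv fib_def divide_inverse mult_1_left
    by (cases b; cases b'; simp only: if_True if_False)
      (intro csmooth_mult csmooth_inverse Ov t w; use tnz wnz in auto)+
qed

lemma tau_continuous:
  assumes "C \<in> charts E" "T \<in> trivs E" "C' \<in> charts E" "T' \<in> trivs E"
  shows "continuous_on (snd C ` (fst C \<inter> fst T \<inter> fst C' \<inter> fst T') \<times> {w. b \<noteq> b' \<longrightarrow>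
      w \<noteq> 0}) (tau C T b C' T' b')"
  using continuous_on_Pair[OF csmooth_continuous[OF tau_csmooth(1)[OF assms]]
      csmooth_continuous[OF tau_csmooth(2)[OF assms]]]
  by simp

lemma X_chart_tau:
  assumes "C \<in> charts E" "T \<in> trivs E" "C' \<in> charts E" "T' \<in> trivs E"
    and "x \<in> X_dom E (C, T, b)" "x \<in> X_dom E (C', T', b')"
  shows "X_chart E (C', T', b') x = tau C T b C' T' b' (X_chart E (C, T, b) x)"
proof -
  obtain p w where x: "x = pnt T b p w" "p \<in> fst C" "p \<in> fst T"
    using assms(5) unfolding X_dom_eq[OF assms(2)] by blast
  have p: "p \<in> fst C'" "p \<in> fst T'" "b \<noteq> b' \<longrightarrow> w \<noteq> 0"
    using assms(6) pnt_X_dom[OF assms(2) x(3) assms(4)] x(1) by auto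
  show ?thesis
    unfolding x(1) X_chart_pnt[OF assms(2) x(3)]
    by (subst pnt_fib[OF assms(2,4) x(3) p(2,3)]) (use x p assms in \<open>simp add: X_chart_pnt tau_def\<close>)
qed

section \<open>The topology of the ruled surface\<close>

lemma X_indexE:
  assumes "i \<in> X_index E"
  obtains C T b where "i = (C, T, b)" "C \<in> charts E" "T \<in> trivs E"
  using assms unfolding X_index_def by auto

lemma X_index_iff: "(C, T, b) \<in> X_index E \<longleftrightarrow> C \<in> charts E \<and> T \<in> trivs E"
  by (auto simp: X_index_def)

lemma X_inj: "i \<in> X_index E \<Longrightarrow> inj_on (X_chart E i) (X_dom E i)"
  using X_chart_inj by (auto elim!: X_indexE)

text \<open>\<open>X_top\<close> is specified by its open sets and carries no information until
  these are known to form a topology. Injectivity of the charts is what lets images commute with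
  intersections.\<close>

lemma istopology_X: "istopology (\<lambda>W. W \<subseteq> X_set E \<and>
       (\<forall>i\<in>X_index E. open (X_chart E i ` (W \<inter> X_dom E i))))"
  unfolding istopology_def
proof (intro conjI allI impI)
  fix V W
  assume V: "V \<subseteq> X_set E \<and> (\<forall>i\<in>X_index E. open (X_chart E i ` (V \<inter> X_dom E i)))"
    and W: "W \<subseteq> X_set E \<and> (\<forall>i\<in>X_index E. open (X_chart E i ` (W \<inter> X_dom E i)))"
  have "open (X_chart E i ` (V \<inter> W \<inter> X_dom E i))" if "i \<in> X_index E" for i
  proof -
    have "X_chart E i ` (V \<inter> W \<inter> X_dom E i) =
        X_chart E i ` (V \<inter> X_dom E i) \<inter> X_chart E i ` (W \<inter> X_dom E i)"
      using inj_on_image_Int[OF X_inj[OF that], of "V \<inter> X_dom E i" "W \<inter> X_dom E i"]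
      by (simp add: Int_ac)
    then show ?thesis using V W that by auto
  qed
  then show "V \<inter> W \<subseteq> X_set E" "\<forall>i\<in>X_index E. open (X_chart E i ` (V \<inter> W \<inter> X_dom E i))"
    using V by auto
next
  fix K assume K: "\<forall>W\<in>K. W \<subseteq> X_set E \<and> (\<forall>i\<in>X_index E. open (X_chart E i ` (W \<inter> X_dom E i)))"
  then show "\<Union> K \<subseteq> X_set E" by auto
  show "\<forall>i\<in>X_index E. open (X_chart E i ` (\<Union> K \<inter> X_dom E i))"
  proof
    fix i assume i: "i \<in> X_index E"
    have "X_chart E i ` (\<Union> K \<inter> X_dom E i) = (\<Union>W\<in>K. X_chart E i ` (W \<inter> X_dom E i))" by auto
    then show "open (X_chart E i ` (\<Union> K \<inter> X_dom E i))" using K i by auto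
  qed
qed

lemma openin_X: "openin (X_top E) W \<longleftrightarrow> W \<subseteq> X_set E \<and>
       (\<forall>i\<in>X_index E. open (X_chart E i ` (W \<inter> X_dom E i)))"
  unfolding X_top_def topology_inverse'[OF istopology_X] by simp

lemma X_dom_subset: "i \<in> X_index E \<Longrightarrow> X_dom E i \<subseteq> X_set E"
  by (elim X_indexE) (auto simp: X_dom_eq intro: pnt_X_set)

text \<open>The definition tests a set in all charts. For a set inside one chart domain that chart
  decides, because changes of charts are continuous on overlaps with open image.\<close>

lemma openin_X_chart:
  assumes i: "i \<in> X_index E" and W: "W \<subseteq> X_dom E i"
  shows "openin (X_top E) W \<longleftrightarrow> open (X_chart E i ` W)"
proof
  assume "openin (X_top E) W"
  then show "open (X_chart E i ` W)" unfolding openin_X using i W by (metis Int_absorb2)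
next
  assume op: "open (X_chart E i ` W)"
  obtain C T b where iC: "i = (C, T, b)" "C \<in> charts E" "T \<in> trivs E" using i X_indexE by blast
  show "openin (X_top E) W"
    unfolding openin_X
  proof (intro conjI ballI)
    show "W \<subseteq> X_set E" using W X_dom_subset[OF i] by blast
    fix j assume "j \<in> X_index E"
    then obtain C' T' b' where j: "j = (C', T', b')" "C' \<in> charts E" "T' \<in> trivs E"
      using X_indexE by blast
    let ?Ov = "snd C' ` (fst C' \<inter> fst T' \<inter> fst C \<inter> fst T) \<times> {w. b' \<noteq> b \<longrightarrow> w \<noteq> 0}"
    have "X_chart E j ` (W \<inter> X_dom E j) = ?Ov \<inter> tau C' T' b' C T b -` (X_chart E i ` W)"
    proof (intro equalityI subsetI)
      fix y assume "y \<in> X_chart E j ` (W \<inter> X_dom E j)"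
      then obtain x where x: "x \<in> W" "x \<in> X_dom E j" "y = X_chart E j x" by blast
      have "x \<in> X_dom E i" using W x by blast
      then have "y \<in> ?Ov" using X_chart_overlap[OF j(2,3) iC(2,3), of b' b] x iC(1) j(1) by blast
      moreover have "tau C' T' b' C T b y = X_chart E i x"
        using X_chart_tau[OF j(2,3) iC(2,3)] x \<open>x \<in> X_dom E i\<close> iC(1) j(1) by metis
      ultimately show "y \<in> ?Ov \<inter> tau C' T' b' C T b -` (X_chart E i ` W)" using x by auto
    next
      fix y assume y: "y \<in> ?Ov \<inter> tau C' T' b' C T b -` (X_chart E i ` W)"
      then obtain x where x: "x \<in> X_dom E j" "x \<in> X_dom E i" "y = X_chart E j x"
      proof -
        have "y \<in> X_chart E j ` (X_dom E j \<inter> X_dom E i)"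
          unfolding iC(1) j(1) X_chart_overlap[OF j(2,3) iC(2,3), of b' b] using y by blast
        then show ?thesis using that by blast
      qed
      have "tau C' T' b' C T b y = X_chart E i x"
        using X_chart_tau[OF j(2,3) iC(2,3)] x iC(1) j(1) by metis
      moreover have "tau C' T' b' C T b y \<in> X_chart E i ` W" using y by blast
      ultimately obtain x' where "x' \<in> W" "X_chart E i x' = X_chart E i x" by (metis imageE)
      then have "x \<in> W" using X_inj[OF i] W x by (metis inj_onD subsetD)
      then show "y \<in> X_chart E j ` (W \<inter> X_dom E j)" using x by blast
    qed
    then show "open (X_chart E j ` (W \<inter> X_dom E j))"
      using continuous_open_preimage[OF tau_continuous[OF j(2,3) iC(2,3)] open_overlap[OF j(2,3)
          iC(2,3)] op]
        by simp
  qed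
qed

lemma X_chart_image_open: "i \<in> X_index E \<Longrightarrow> open (X_chart E i ` X_dom E i)"
  by (elim X_indexE) (auto simp: X_chart_image intro!: open_Times chart_image_open chart_open
      triv_open)

lemma openin_X_dom: "i \<in> X_index E \<Longrightarrow> openin (X_top E) (X_dom E i)"
  using openin_X_chart[of i "X_dom E i"] X_chart_image_open by simp

lemma X_cover: "x \<in> X_set E \<Longrightarrow> \<exists>i\<in>X_index E. x \<in> X_dom E i"
proof -
  assume "x \<in> X_set E"
  then obtain T b p w where x: "x = pnt T b p w" "T \<in> trivs E" "p \<in> fst T"
    unfolding X_set_eq by blast
  obtain C where "C \<in> charts E" "p \<in> fst C" using chart_cover by blast
  then show ?thesis
    using x pnt_X_dom[OF x(2,3,2)] by (intro bexI[of _ "(C, T, b)"]) (auto simp: X_index_iff)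
qed

lemma topspace_X: "topspace (X_top E) = X_set E"
proof
  show "topspace (X_top E) \<subseteq> X_set E" using openin_X[of "topspace (X_top E)"] by simp
  show "X_set E \<subseteq> topspace (X_top E)"
    using X_cover openin_subset[OF openin_X_dom] by blast
qed

lemma continuous_map_X:
  fixes F :: "'l pt \<Rightarrow> 'b::topological_space"
  assumes "\<And>C T b. C \<in> charts E \<Longrightarrow> T \<in> trivs E \<Longrightarrow>
     continuous_on (snd C ` (fst C \<inter> fst T) \<times> UNIV) (\<lambda>y. F (pnt T b (cinv C (fst y)) (snd y)))"
  shows "continuous_map (X_top E) euclidean F"
  unfolding continuous_map_def topspace_X
proof (intro conjI allI impI)
  fix U :: "'b set" assume "openin euclidean U"
  then have U: "open U" by simp
  show "openin (X_top E) {x \<in> X_set E. F x \<in> U}"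
    unfolding openin_X
  proof (intro conjI ballI)
    fix i assume "i \<in> X_index E"
    then obtain C T b where i: "i = (C, T, b)" "C \<in> charts E" "T \<in> trivs E" using X_indexE by blast
    have "X_chart E i ` ({x \<in> X_set E. F x \<in> U} \<inter> X_dom E i) =
      (snd C ` (fst C \<inter> fst T) \<times> UNIV) \<inter> (\<lambda>y. F (pnt T b (cinv C (fst y)) (snd y))) -` U" (is
          "?L = ?R")
    proof (intro equalityI subsetI)
      fix y assume "y \<in> ?L"
      then obtain p w where "y = X_chart E i (pnt T b p w)" "p \<in> fst C" "p \<in> fst T"
          "F (pnt T b p w) \<in> U"
        using i by (auto simp: X_dom_eq)
      then show "y \<in> ?R" using i by (auto simp: X_chart_pnt)
    next
      fix y assume "y \<in> ?R"
      then obtain p where p: "fst y = snd C p" "p \<in> fst C" "p \<in> fst T" "F (pnt T b p (snd y)) \<in> U"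
        using i by auto
      then have "y = X_chart E i (pnt T b p (snd y))"
        unfolding i(1) X_chart_pnt[OF i(3) p(3)] by (simp add: prod_eq_iff)
      moreover have "pnt T b p (snd y) \<in> {x \<in> X_set E. F x \<in> U} \<inter> X_dom E i"
        using p i by (auto simp: X_dom_eq pnt_X_set)
      ultimately show "y \<in> ?L" by blast
    qed
    moreover have "open (snd C ` (fst C \<inter> fst T) \<times> (UNIV :: complex set))"
      using i by (intro open_Times chart_image_open) (auto intro: chart_open triv_open)
    ultimately show "open (X_chart E i ` ({x \<in> X_set E. F x \<in> U} \<inter> X_dom E i))"
      using continuous_open_preimage[OF assms[OF i(2,3)] _ U] by simp
  qed auto
qed auto

lemma continuous_X_proj: "continuous_map (X_top E) euclidean (X_proj E)"
proof (rule continuous_map_X)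
  fix C T b assume CT: "C \<in> charts E" "T \<in> trivs E"
  have "continuous_on (snd C ` fst C) (cinv C)"
    using chart_hom[OF CT(1)] by (simp add: homeomorphism_def)
  then have "continuous_on (snd C ` (fst C \<inter> fst T) \<times> (UNIV::complex set)) (\<lambda>y. cinv C (fst y))"
    by (rule continuous_on_compose2) (auto intro: continuous_intros)
  then show "continuous_on (snd C ` (fst C \<inter> fst T) \<times> UNIV)
      (\<lambda>y. X_proj E (pnt T b (cinv C (fst y)) (snd y)))"
    by (rule continuous_on_eq) (use CT in \<open>auto simp: X_proj_pnt\<close>)
qed

lemma pnt_0_trn:
  assumes "T \<in> trivs E" "T' \<in> trivs E" "p \<in> fst T" "p \<in> fst T'"
  shows "pnt T b p 0 = pnt T' b p 0"
  using pnt_trn[OF assms, of 0] by (cases b) auto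

lemma sec_zero_eq:
  assumes "T \<in> trivs E" "p \<in> fst T"
  shows "sec_zero E p = pnt T False p 0"
  unfolding sec_zero_def
proof (rule inv_into_f_eq)
  show "inj_on (X_proj E) (S_zero E)"
  proof (rule inj_onI)
    fix x y assume "x \<in> S_zero E" "y \<in> S_zero E" and eq: "X_proj E x = X_proj E y"
    then obtain T p T' p' where x: "x = pnt T False p 0" "T \<in> trivs E" "p \<in> fst T"
      and y: "y = pnt T' False p' 0" "T' \<in> trivs E" "p' \<in> fst T'" unfolding S_zero_eq by blast
    have "p = p'" using eq X_proj_pnt[OF x(2,3)] X_proj_pnt[OF y(2,3)] x(1) y(1) by metis
    then show "x = y" using pnt_0_trn[OF x(2) y(2) x(3)] x y by simp
  qed
  show "pnt T False p 0 \<in> S_zero E" using assms S_zero_eq by blast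
qed (rule X_proj_pnt[OF assms])

lemma sec_inf_eq:
  assumes "T \<in> trivs E" "p \<in> fst T"
  shows "sec_inf E p = pnt T True p 0"
  unfolding sec_inf_def
proof (rule inv_into_f_eq)
  show "inj_on (X_proj E) (S_inf E)"
  proof (rule inj_onI)
    fix x y assume "x \<in> S_inf E" "y \<in> S_inf E" and eq: "X_proj E x = X_proj E y"
    then obtain T p T' p' where x: "x = pnt T True p 0" "T \<in> trivs E" "p \<in> fst T"
      and y: "y = pnt T' True p' 0" "T' \<in> trivs E" "p' \<in> fst T'" unfolding S_inf_eq by blast
    have "p = p'" using eq X_proj_pnt[OF x(2,3)] X_proj_pnt[OF y(2,3)] x(1) y(1) by metis
    then show "x = y" using pnt_0_trn[OF x(2) y(2) x(3)] x y by simp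
  qed
  show "pnt T True p 0 \<in> S_inf E" using assms S_inf_eq by blast
qed (rule X_proj_pnt[OF assms])

text \<open>Stated for any map with fibre coordinate 0, so that it covers \<open>sec_zero\<close>
  and \<open>sec_inf\<close> at once.\<close>

lemma continuous_pnt_0:
  assumes sec: "\<And>T p. T \<in> trivs E \<Longrightarrow> p \<in> fst T \<Longrightarrow> sec p = pnt T b p 0"
  shows "continuous_map euclidean (X_top E) sec"
  unfolding continuous_map_def topspace_X
proof (intro conjI allI impI)
  show "sec \<in> topspace euclidean \<rightarrow> X_set E"
  proof
    fix p
    obtain T where "T \<in> trivs E" "p \<in> fst T" using triv_cover by blast
    then show "sec p \<in> X_set E" using sec pnt_X_set by simp
  qed
  fix U assume U: "openin (X_top E) U"
  have "open {p. sec p \<in> U}"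
  proof (subst open_subopen, intro ballI)
    fix p assume p: "p \<in> {p. sec p \<in> U}"
    obtain C T where CT: "C \<in> charts E" "p \<in> fst C" "T \<in> trivs E" "p \<in> fst T"
      using chart_cover triv_cover by blast
    let ?i = "(C, T, b)"
    have i: "?i \<in> X_index E" using CT by (simp add: X_index_iff)
    have op: "open (X_chart E ?i ` (U \<inter> X_dom E ?i))" using U i openin_X by blast
    define N where "N = (fst C \<inter> fst T) \<inter> (\<lambda>q. (snd C q, 0)) -` (X_chart E ?i ` (U \<inter> X_dom E ?i))"
    have "continuous_on (fst C \<inter> fst T) (\<lambda>q. (snd C q, 0::complex))"
      using chart_hom[OF CT(1)] unfolding homeomorphism_def
      by (intro continuous_intros) (auto intro: continuous_on_subset)
    then have "open N" unfolding N_def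
      using CT op by (intro continuous_open_preimage) (auto intro: chart_open triv_open)
    moreover have "p \<in> N"
    proof -
      have "(snd C p, 0) = X_chart E ?i (pnt T b p 0)" using CT by (simp add: X_chart_pnt)
      moreover have "pnt T b p 0 \<in> U \<inter> X_dom E ?i"
        using p sec[OF CT(3,4)] pnt_X_dom[OF CT(3,4,3)] CT by auto
      ultimately show ?thesis unfolding N_def using CT by blast
    qed
    moreover have "N \<subseteq> {p. sec p \<in> U}"
    proof
      fix q assume "q \<in> N"
      then obtain x where q: "q \<in> fst C" "q \<in> fst T" and x: "x \<in> U" "x \<in> X_dom E ?i"
          "X_chart E ?i x = (snd C q, 0)"
        unfolding N_def by auto
      have "X_chart E ?i (pnt T b q 0) = (snd C q, 0)" using CT q by (simp add: X_chart_pnt)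
      moreover have "pnt T b q 0 \<in> X_dom E ?i" using pnt_X_dom[OF CT(3) q(2) CT(3)] q by auto
      ultimately have "x = pnt T b q 0" using X_inj[OF i] x by (metis inj_onD)
      then show "q \<in> {p. sec p \<in> U}" using x sec[OF CT(3) q(2)] by simp
    qed
    ultimately show "\<exists>N. open N \<and> p \<in> N \<and> N \<subseteq> {p. sec p \<in> U}" by blast
  qed
  then show "openin euclidean {x \<in> topspace euclidean. sec x \<in> U}" by simp
qed

lemma continuous_sec_zero: "continuous_map euclidean (X_top E) (sec_zero E)"
  using continuous_pnt_0[of "sec_zero E" False] sec_zero_eq by blast

lemma continuous_sec_inf: "continuous_map euclidean (X_top E) (sec_inf E)"
  using continuous_pnt_0[of "sec_inf E" True] sec_inf_eq by blast

lemma openin_X_reg: "openin (X_top E) (X_reg E)"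
  unfolding openin_X
proof (intro conjI ballI)
  show "X_reg E \<subseteq> X_set E" by (auto simp: X_reg_def)
  fix i assume "i \<in> X_index E"
  then obtain C T b where i: "i = (C, T, b)" "C \<in> charts E" "T \<in> trivs E" using X_indexE by blast
  have "X_chart E i ` (X_reg E \<inter> X_dom E i) = snd C ` (fst C \<inter> fst T) \<times> (- {0})" (is "?L = ?R")
  proof (intro equalityI subsetI)
    fix y assume "y \<in> ?L"
    then show "y \<in> ?R" using i by (auto simp: X_dom_eq X_chart_pnt pnt_X_reg)
  next
    fix y assume "y \<in> ?R"
    then have "fst y \<in> snd C ` (fst C \<inter> fst T)" "snd y \<noteq> 0" by (simp_all add: mem_Times_iff)
    then obtain p where p: "fst y = snd C p" "p \<in> fst C" "p \<in> fst T" "snd y \<noteq> 0" by blast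
    then have "y = X_chart E i (pnt T b p (snd y))"
      unfolding i(1) X_chart_pnt[OF i(3) p(3)] by (simp add: prod_eq_iff)
    moreover have "pnt T b p (snd y) \<in> X_reg E \<inter> X_dom E i"
      using p i by (auto simp: X_dom_eq pnt_X_reg)
    ultimately show "y \<in> ?L" by blast
  qed
  then show "open (X_chart E i ` (X_reg E \<inter> X_dom E i))"
    using i by (auto intro!: open_Times chart_image_open chart_open triv_open)
qed

lemma finite_cover: "\<exists>J. finite J \<and> J \<subseteq> charts E \<times> trivs E \<and> UNIV = (\<Union>(C, T)\<in>J. fst C \<inter> fst T)"
proof -
  have "compact (UNIV :: 'a set)"
    using genus_setup by (simp add: genus_two_setup_def compact_riemann_surface_def)
  moreover have "\<And>CT. CT \<in> charts E \<times> trivs E \<Longrightarrow> open (fst (fst CT) \<inter> fst (snd CT))"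
    using chart_open triv_open by (simp add: mem_Times_iff open_Int)
  moreover have "UNIV \<subseteq> (\<Union>CT\<in>charts E \<times> trivs E. fst (fst CT) \<inter> fst (snd CT))"
    using chart_cover triv_cover by fastforce
  ultimately obtain J where "J \<subseteq> charts E \<times> trivs E" "finite J"
      "UNIV \<subseteq> (\<Union>CT\<in>J. fst (fst CT) \<inter> fst (snd CT))"
    by (rule compactE_image)
  then show ?thesis by (intro exI[of _ J]) (auto simp: case_prod_beta)
qed

end

section \<open>Momentum profiles\<close>

lemma mono_bounded_below_tendsto_at_bot:
  fixes F :: "real \<Rightarrow> real"
  assumes "mono F" "\<And>r. F r \<ge> B"
  shows "\<exists>L. (F \<longlongrightarrow> L) at_bot"
proof (intro exI order_tendstoI)
  let ?L = "INF r. F r"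
  have bdd: "bdd_below (range F)" using assms(2) by (intro bdd_belowI2)
  show "eventually (\<lambda>r. a < F r) at_bot" if "a < ?L" for a
    using that cINF_lower[OF bdd] by (intro always_eventually) (meson UNIV_I less_le_trans)
  show "eventually (\<lambda>r. F r < a) at_bot" if "?L < a" for a
  proof -
    have "\<exists>r\<in>UNIV. F r < a" using that by (simp only: cINF_less_iff[OF UNIV_not_empty bdd])
    then obtain r0 where "F r0 < a" by (elim bexE)
    then show ?thesis
      unfolding eventually_at_bot_linorder using assms(1) by (meson le_less_trans monoD)
  qed
qed

text \<open>\<open>F' - c F\<close> is increasing near minus infinity, which bounds \<open>F\<close> from below.\<close>

lemma exponential_decay_tendsto:
  fixes F :: "real \<Rightarrow> real"
  assumes F: "\<And>r. (F has_real_derivative F1 r) (at r)" "\<And>r. (F1 has_real_derivative F2 r) (at r)"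
    and pos: "\<And>r. F1 r > 0" and c: "c > 0" "\<And>r. r \<le> r0 \<Longrightarrow> F2 r \<ge> c * F1 r"
  shows "\<exists>L. (F \<longlongrightarrow> L) at_bot"
proof (rule mono_bounded_below_tendsto_at_bot)
  show mono: "mono F"
  proof (rule monoI)
    fix x y :: real assume "x \<le> y"
    then show "F x \<le> F y"
      by (rule DERIV_nonneg_imp_nondecreasing) (blast intro: F less_imp_le[OF pos])
  qed
  define B where "B = (c * F r0 - F1 r0) / c"
  have "F r \<ge> min B (F r0)" for r
  proof (cases "r \<le> r0")
    case True
    have "F1 r - c * F r \<le> F1 r0 - c * F r0"
    proof (rule DERIV_nonneg_imp_nondecreasing[OF True, of "\<lambda>r. F1 r - c * F r"])
      fix x assume "r \<le> x" "x \<le> r0"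
      then show "\<exists>y. ((\<lambda>r. F1 r - c * F r) has_real_derivative y) (at x) \<and> 0 \<le> y"
        using c(2) by (intro exI[of _ "F2 x - c * F1 x"]) (auto intro!: derivative_eq_intros F)
    qed
    then have "c * F r \<ge> c * F r0 - F1 r0" using pos[of r] by linarith
    then have "F r \<ge> B" using c(1) by (simp add: B_def field_simps)
    then show ?thesis by simp
  next
    case False
    then have "F r \<ge> F r0" using mono by (simp add: monoD)
    then show ?thesis by simp
  qed
  then show "F r \<ge> min B (F r0)" for r .
qed

locale profile =
  fixes m \<beta>0 \<beta>inf :: real and f :: "real \<Rightarrow> real"
  assumes m: "m > 0" and b0: "\<beta>0 > 0" and binf: "\<beta>inf > 0"
    and conical: "momentum_conical m \<beta>0 \<beta>inf f"
begin

definition "\<gamma> r = 1 + deriv f r"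

lemma smooth_f: "smooth_on UNIV f"
  using conical by (simp add: momentum_conical_def)

lemma smooth_has_deriv:
  fixes F :: "real \<Rightarrow> real"
  assumes "smooth_on UNIV F"
  shows "(F has_real_derivative deriv F r) (at r)" "smooth_on UNIV (deriv F)"
proof -
  have d: "(F has_real_derivative frechet_derivative F (at r) 1) (at r)" for r
  proof -
    have D: "(F has_derivative frechet_derivative F (at r)) (at r)"
      using smooth_on_has_derivative[OF assms] by simp
    have "frechet_derivative F (at r) = (*) (frechet_derivative F (at r) 1)"
      using linear_times_of_real has_derivative_bounded_linear[OF D]
      by (metis D frechet_derivative_at has_field_derivative_def has_real_derivative
          mult.commute mult_1)
    then show ?thesis using D unfolding has_field_derivative_def by simp
  qed
  then have eq: "deriv F = (\<lambda>r. frechet_derivative F (at r) 1)" using DERIV_imp_deriv by blast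
  show "(F has_real_derivative deriv F r) (at r)" unfolding eq by (rule d)
  show "smooth_on UNIV (deriv F)" unfolding eq by (rule smooth_on_frechet[OF assms])
qed

lemma deriv_f: "(f has_real_derivative (\<gamma> r - 1)) (at r)"
  using smooth_has_deriv(1)[OF smooth_f] by (simp add: \<gamma>_def)

lemma deriv_\<gamma>0: "(\<gamma> has_real_derivative deriv (deriv f) r) (at r)"
  unfolding \<gamma>_def[abs_def] using smooth_has_deriv(1)[OF smooth_has_deriv(2)[OF smooth_f], of r]
  by (auto intro!: derivative_eq_intros)

text \<open>The tangents at \<open>x\<close> and \<open>y\<close> lie below the graph at the
  midpoint, while strict convexity puts the graph strictly below the chord there; comparing the two
  separates the slopes.\<close>

lemma deriv_f_strict_mono: "x < y \<Longrightarrow> deriv f x < deriv f y"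
proof -
  assume xy: "x < y"
  have strict: "f ((1 - t) * a + t * b) < (1 - t) * f a + t * f b" if "a \<noteq> b" "0 < t"
      "t < 1" for a b t
    using conical that unfolding momentum_conical_def by blast
  have conv: "convex_on UNIV f"
  proof (rule convex_onI)
    fix t a b :: real assume "0 < t" "t < 1"
    then show "f ((1 - t) *\<^sub>R a + t *\<^sub>R b) \<le> (1 - t) * f a + t * f b"
      using strict[of a b t] by (cases "a = b") (auto simp: algebra_simps)
  qed simp
  have tang: "f b - f a \<ge> deriv f a * (b - a)" for a b
    by (rule convex_on_imp_above_tangent[OF conv]) (use smooth_has_deriv(1)[OF smooth_f] in auto)
  define c where "c = (x + y) / 2"
  have "f c < (f x + f y) / 2"
    using strict[of x y "1/2"] xy by (simp add: c_def field_simps)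
  moreover have "f c - f x \<ge> deriv f x * ((y - x) / 2)"
    using tang[of x c] by (simp add: c_def field_simps)
  moreover have "f c - f y \<ge> - (deriv f y * ((y - x) / 2))"
    using tang[of y c] by (simp add: c_def field_simps)
  ultimately have "deriv f x * ((y - x) / 2) < deriv f y * ((y - x) / 2)" by argo
  then show ?thesis using xy by (simp add: mult_less_cancel_right)
qed

lemma lim_bot: "(\<gamma> \<longlongrightarrow> 1) at_bot" and lim_top: "(\<gamma> \<longlongrightarrow> m + 1) at_top"
proof -
  have l: "(deriv f \<longlongrightarrow> 0) at_bot" "(deriv f \<longlongrightarrow> m) at_top"
    using conical by (simp_all add: momentum_conical_def)
  show "(\<gamma> \<longlongrightarrow> 1) at_bot" "(\<gamma> \<longlongrightarrow> m + 1) at_top"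
    unfolding \<gamma>_def[abs_def]
    using tendsto_add[OF tendsto_const[of 1] l(1)] tendsto_add[OF tendsto_const[of 1] l(2)]
    by (simp_all add: add.commute)
qed

text \<open>The limits give weak bounds; used at \<open>r - 1\<close> and \<open>r + 1\<close> they
  become strict at \<open>r\<close>. Strictness keeps \<open>\<gamma>\<close> in the interior of
  \<open>{1..m+1}\<close>, where the one-sided derivatives of the profile are ordinary ones.\<close>

lemma \<gamma>_range: "1 < \<gamma> r" "\<gamma> r < m + 1"
proof -
  have "1 \<le> \<gamma> (r - 1)"
    by (rule tendsto_upperbound[OF lim_bot])
      (auto simp: eventually_at_bot_linorder \<gamma>_def intro!: exI[of _
          "r - 1"] dest: deriv_f_strict_mono simp: le_less)
  then show "1 < \<gamma> r" using deriv_f_strict_mono[of "r - 1" r] by (simp add: \<gamma>_def)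
  have "m + 1 \<ge> \<gamma> (r + 1)"
    by (rule tendsto_lowerbound[OF lim_top])
      (auto simp: eventually_at_top_linorder \<gamma>_def intro!: exI[of _
          "r + 1"] dest: deriv_f_strict_mono simp: le_less)
  then show "\<gamma> r < m + 1" using deriv_f_strict_mono[of r "r + 1"] by (simp add: \<gamma>_def)
qed

text \<open>The momentum profile (entry 0) together with all its one-sided derivatives, fixed once
  by choice. The conditions speak of \<open>{1..m+1}\<close> only; values elsewhere are
  arbitrary.\<close>

definition "profile_deriv = (SOME D :: nat \<Rightarrow> real \<Rightarrow> real. (\<forall>r. D 0 (\<gamma> r) = deriv (deriv f) r) \<and>
   (\<forall>k. \<forall>x\<in>{1..m+1}. (D k has_real_derivative D (Suc k) x) (at x within {1..m+1})) \<and>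
   (\<forall>g. 1 < g \<and> g < m + 1 \<longrightarrow> D 0 g > 0) \<and> D 0 1 = 0 \<and> D 0 (m + 1) = 0 \<and>
   (D 0 has_real_derivative \<beta>0) (at 1 within {1..m + 1}) \<and>
   (D 0 has_real_derivative - \<beta>inf) (at (m + 1) within {1..m + 1}))"

lemma profile_deriv: "profile_deriv 0 (\<gamma> r) = deriv (deriv f) r"
   "x \<in> {1..m+1} \<Longrightarrow> (profile_deriv k has_real_derivative profile_deriv (Suc k) x)
       (at x within {1..m+1})"
   "1 < g \<Longrightarrow> g < m + 1 \<Longrightarrow> profile_deriv 0 g > 0" "profile_deriv 0 1 = 0" "profile_deriv 0 (m + 1) = 0"
   "(profile_deriv 0 has_real_derivative \<beta>0) (at 1 within {1..m + 1})"
   "(profile_deriv 0 has_real_derivative - \<beta>inf) (at (m + 1) within {1..m + 1})"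
proof -
  have "\<exists>D :: nat \<Rightarrow> real \<Rightarrow> real. (\<forall>r. D 0 (\<gamma> r) = deriv (deriv f) r) \<and>
   (\<forall>k. \<forall>x\<in>{1..m+1}. (D k has_real_derivative D (Suc k) x) (at x within {1..m+1})) \<and>
   (\<forall>g. 1 < g \<and> g < m + 1 \<longrightarrow> D 0 g > 0) \<and> D 0 1 = 0 \<and> D 0 (m + 1) = 0 \<and>
   (D 0 has_real_derivative \<beta>0) (at 1 within {1..m + 1}) \<and>
   (D 0 has_real_derivative - \<beta>inf) (at (m + 1) within {1..m + 1})"
    using conical unfolding momentum_conical_def smooth_on_Icc_def \<gamma>_def by blast
  from someI_ex[OF this] show "profile_deriv 0 (\<gamma> r) = deriv (deriv f) r"
   "x \<in> {1..m+1} \<Longrightarrow> (profile_deriv k has_real_derivative profile_deriv (Suc k) x)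
       (at x within {1..m+1})"
   "1 < g \<Longrightarrow> g < m + 1 \<Longrightarrow> profile_deriv 0 g > 0" "profile_deriv 0 1 = 0" "profile_deriv 0 (m + 1) = 0"
   "(profile_deriv 0 has_real_derivative \<beta>0) (at 1 within {1..m + 1})"
   "(profile_deriv 0 has_real_derivative - \<beta>inf) (at (m + 1) within {1..m + 1})"
    unfolding profile_deriv_def[symmetric] by blast+
qed

definition "\<phi> r = profile_deriv 0 (\<gamma> r)"
definition "v r = profile_deriv 1 (\<gamma> r)"
definition "v2 r = profile_deriv 2 (\<gamma> r)"

lemma deriv_\<gamma>: "(\<gamma> has_real_derivative \<phi> r) (at r)"
  using deriv_\<gamma>0 by (simp add: \<phi>_def profile_deriv(1))

lemma deriv_profile_deriv_\<gamma>: "((\<lambda>r. profile_deriv k (\<gamma> r))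
    has_real_derivative profile_deriv (Suc k) (\<gamma> r) * \<phi> r) (at r)"
proof -
  have "(profile_deriv k has_real_derivative profile_deriv (Suc k) (\<gamma> r)) (at (\<gamma> r))"
    using profile_deriv(2)[of "\<gamma> r" k] \<gamma>_range[of r] by (simp add: at_within_Icc_at)
  then show ?thesis using DERIV_chain2 deriv_\<gamma> by blast
qed

lemma deriv_\<phi>: "(\<phi> has_real_derivative v r * \<phi> r) (at r)"
  using deriv_profile_deriv_\<gamma>[of 0 r] unfolding \<phi>_def[abs_def] v_def by simp

lemma deriv_v: "(v has_real_derivative v2 r * \<phi> r) (at r)"
  using deriv_profile_deriv_\<gamma>[of 1 r] unfolding v_def[abs_def] v2_def by (simp add: numeral_2_eq_2)

lemma \<gamma>_pos: "\<gamma> r > 0" using \<gamma>_range(1)[of r] by simp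

lemma \<phi>_pos: "\<phi> r > 0" using profile_deriv(3) \<gamma>_range by (simp add: \<phi>_def)

lemma f_lim_bot: "\<exists>L. (f \<longlongrightarrow> L) at_bot"
proof -
  have "((\<lambda>g. (profile_deriv 0 g - profile_deriv 0 1) / (g - 1)) \<longlongrightarrow> \<beta>0) (at 1 within {1..m+1})"
    using profile_deriv(6) by (simp add: has_field_derivative_iff)
  \<comment> \<open>Half of the slope \<open>\<beta>0\<close> leaves room for the difference
    quotient to stay above it near 1; it becomes the constant \<open>c\<close> in
    \<open>exponential_decay_tendsto\<close>.\<close>
  then have "eventually (\<lambda>g. (profile_deriv 0 g - profile_deriv 0 1) / (g - 1) > \<beta>0 / 2)
      (at 1 within {1..m+1})"
    using b0 by (intro order_tendstoD(1)) auto
  then obtain d where d: "d > 0" "\<And>g. g \<in> {1..m+1} \<Longrightarrow> g \<noteq> 1 \<Longrightarrow> dist g 1 < d \<Longrightarrow>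
      profile_deriv 0 g / (g - 1) > \<beta>0 / 2"
    unfolding eventually_at by (auto simp: profile_deriv(4))
  have "eventually (\<lambda>r. \<gamma> r < 1 + d) at_bot"
    using lim_bot d(1) by (intro order_tendstoD(2)) auto
  then obtain r0 where r0: "\<And>r. r \<le> r0 \<Longrightarrow> \<gamma> r < 1 + d" unfolding eventually_at_bot_linorder by blast
  show ?thesis
  proof (rule exponential_decay_tendsto[where F = f and ?F1.0 = "\<lambda>r. \<gamma> r - 1" and ?F2.0 =
      \<phi> and c = "\<beta>0 / 2" and ?r0.0 = r0])
    show "\<beta>0 / 2 * (\<gamma> r - 1) \<le> \<phi> r" if "r \<le> r0" for r
    proof -
      have "profile_deriv 0 (\<gamma> r) / (\<gamma> r - 1) > \<beta>0 / 2"
        using r0[OF that] \<gamma>_range[of r] by (intro d(2)) (auto simp: dist_real_def)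
      then show ?thesis using \<gamma>_range(1)[of r] by (simp add: \<phi>_def pos_less_divide_eq)
    qed
  qed (use b0 \<gamma>_range deriv_f deriv_\<gamma> in \<open>auto intro!: derivative_eq_intros\<close>)
qed

lemma f_lim_top: "\<exists>L. ((\<lambda>r. f r - m * r) \<longlongrightarrow> L) at_top"
proof -
  have "((\<lambda>g. (profile_deriv 0 g - profile_deriv 0 (m+1)) / (g - (m+1))) \<longlongrightarrow> - \<beta>inf) (at (m+1)
      within {1..m+1})"
    using profile_deriv(7) by (simp add: has_field_derivative_iff)
  then have "eventually (\<lambda>g. (profile_deriv 0 g - profile_deriv 0 (m+1)) / (g - (m+1)) < -
      \<beta>inf / 2) (at (m+1) within {1..m+1})"
    using binf by (intro order_tendstoD(2)) auto
  then obtain d where d: "d > 0" "\<And>g. g \<in> {1..m+1} \<Longrightarrow> g \<noteq> m+1 \<Longrightarrow> dist g (m+1) < d \<Longrightarrow>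
      profile_deriv 0 g / (g - (m+1)) < - \<beta>inf / 2"
    unfolding eventually_at by (auto simp: profile_deriv(5))
  have "eventually (\<lambda>r. \<gamma> r > m + 1 - d) at_top"
    using lim_top d(1) by (intro order_tendstoD(1)) auto
  then obtain r0 where r0: "\<And>r. r \<ge> r0 \<Longrightarrow> \<gamma> r > m + 1 - d"
    unfolding eventually_at_top_linorder by blast
  \<comment> \<open>Reflection moves the end at plus infinity to minus infinity. The reflected
    function has the derivative \<open>m + 1 - \<gamma> (- r)\<close>, which is positive and tends
    to 0 there, as \<open>exponential_decay_tendsto\<close> expects.\<close>
  have "\<exists>L. ((\<lambda>r. f (- r) + m * r) \<longlongrightarrow> L) at_bot"
  proof (rule exponential_decay_tendsto[where F = "\<lambda>r. f (- r) + m * r" and ?F1.0 =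
      "\<lambda>r. m - (\<gamma> (- r) - 1)"
        and ?F2.0 = "\<lambda>r. \<phi> (- r)" and c = "\<beta>inf / 2" and ?r0.0 = "- r0"])
    show "\<beta>inf / 2 * (m - (\<gamma> (- r) - 1)) \<le> \<phi> (- r)" if "r \<le> - r0" for r
    proof -
      have "profile_deriv 0 (\<gamma> (-r)) / (\<gamma> (-r) - (m+1)) < - \<beta>inf / 2"
        using r0[of "-r"] that \<gamma>_range[of "-r"] by (intro d(2)) (auto simp: dist_real_def)
      then have "- \<beta>inf / 2 * (\<gamma> (-r) - (m+1)) < profile_deriv 0 (\<gamma> (-r))"
        using \<gamma>_range(2)[of "-r"] by (simp only: neg_divide_less_eq diff_less_0_iff_less)
      moreover have "- \<beta>inf / 2 * (\<gamma> (-r) - (m+1)) = \<beta>inf / 2 * (m - (\<gamma> (- r) - 1))"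
        by (simp add: field_simps)
      ultimately show ?thesis by (simp add: \<phi>_def)
    qed
    show "((\<lambda>r. f (- r) + m * r) has_real_derivative m - (\<gamma> (- r) - 1)) (at r)" for r
      by (rule derivative_eq_intros DERIV_chain2[OF deriv_f] refl)+ simp
    show "((\<lambda>r. m - (\<gamma> (- r) - 1)) has_real_derivative \<phi> (- r)) (at r)" for r
      by (rule derivative_eq_intros DERIV_chain2[OF deriv_\<gamma>] refl)+ simp
    show "0 < m - (\<gamma> (- r) - 1)" for r using \<gamma>_range(2)[of "-r"] by simp
  qed (use binf in auto)
  then obtain L where "((\<lambda>r. f (- r) + m * r) \<longlongrightarrow> L) at_bot" by blast
  then have "((\<lambda>r. f r - m * r) \<longlongrightarrow> L) at_top"
    by (simp add: filterlim_at_bot_mirror)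
  then show ?thesis by blast
qed

abbreviation "Lam \<equiv> momentum_curvature \<gamma> \<phi> v v2"

lemma continuous_profile_deriv: "continuous_on {1..m+1} (profile_deriv k)"
  by (rule DERIV_continuous_on[where D = "profile_deriv (Suc k)"]) (rule profile_deriv(2))

lemma continuous_\<gamma>: "continuous_on UNIV \<gamma>"
  using deriv_\<gamma> DERIV_isCont by (blast intro: continuous_at_imp_continuous_on)

lemma \<gamma>_mem: "\<gamma> r \<in> {1..m+1}"
  using \<gamma>_range[of r] by simp

lemma continuous_Lam: "continuous_on UNIV Lam"
proof -
  have c: "continuous_on UNIV (\<lambda>r. profile_deriv k (\<gamma> r))" for k
    by (rule continuous_on_compose2[OF continuous_profile_deriv continuous_\<gamma>]) (use \<gamma>_mem in blast)
  show ?thesis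
    unfolding momentum_curvature_def[abs_def] \<phi>_def v_def v2_def
    using \<gamma>_pos by (intro continuous_intros c continuous_\<gamma>) (auto simp: less_le)
qed

lemma bounded_Lam: "\<exists>M. \<forall>r. \<bar>Lam r\<bar> \<le> M"
proof -
  let ?L = "\<lambda>g. 2 * ((1 + profile_deriv 0 g / g) * profile_deriv 2 g + (profile_deriv 1 g -
      profile_deriv 0 g / g) * (profile_deriv 1 g * g - profile_deriv 0 g) / g\<^sup>2) / g"
  have "continuous_on {1..m+1} ?L"
    by (intro continuous_intros continuous_profile_deriv) auto
  then have "compact (?L ` {1..m+1})" by (intro compact_continuous_image) auto
  then have "bounded (?L ` {1..m+1})" by (rule compact_imp_bounded)
  then obtain M where M: "\<forall>x\<in>?L ` {1..m+1}. norm x \<le> M" unfolding bounded_iff by blast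
  have "\<bar>Lam r\<bar> \<le> M" for r
  proof -
    have "Lam r = ?L (\<gamma> r)" by (simp add: momentum_curvature_def \<phi>_def v_def v2_def)
    then show ?thesis using bspec[OF M imageI[OF \<gamma>_mem[of r]]] by simp
  qed
  then show ?thesis by blast
qed

end

section \<open>The base curve\<close>

lemma ddbar1_cong:
  assumes "open S" "z \<in> S" "\<And>y. y \<in> S \<Longrightarrow> u y = u' y"
  shows "ddbar1 u z = ddbar1 u' z"
proof -
  have 1: "wirtinger_bar 1 \<i> (\<lambda>y. complex_of_real (u y)) y =
      wirtinger_bar 1 \<i> (\<lambda>y. complex_of_real (u' y)) y" if "y \<in> S" for y
    unfolding wirtinger_bar_def
    using frechet_derivative_cong_open[OF assms(1) that, of "\<lambda>y. complex_of_real (u y)"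
        "\<lambda>y. complex_of_real (u' y)"]
    by (simp add: assms(3))
  show ?thesis
    unfolding ddbar1_def wirtinger_def
    using frechet_derivative_cong_open[OF assms(1,2) 1] by simp
qed

lemma has_wirt_wirtinger_bar_real:
  assumes "open S" "smooth_on S u" "z \<in> S"
  shows "has_wirt (wirtinger_bar 1 \<i> (\<lambda>y. complex_of_real (u y))) (of_real (ddbar1 u z))
    (wirtinger_bar 1 \<i> (wirtinger_bar 1 \<i> (\<lambda>y. complex_of_real (u y))) z) z"
  using csmooth_has_wirt[OF csmooth_wirtinger_bar[OF assms(1) csmooth_of_real[OF assms(2)],
      of 1 \<i>] assms(3)]
    ddbar1_has_wirt(1)[OF assms(1) csmooth_of_real[OF assms(2)] assms(3)] by simp

lemma ddbar1_eqI:
  assumes "open S" "z \<in> S" "\<And>y. y \<in> S \<Longrightarrow> has_wirt (\<lambda>y. complex_of_real (u y)) (p y) (q y) y"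
    "has_wirt q r r' z"
  shows "ddbar1 u z = Re r"
proof -
  have "has_wirt (wirtinger_bar 1 \<i> (\<lambda>y. complex_of_real (u y))) r r' z"
    by (rule has_wirt_cong[OF assms(1,2) _ assms(4)]) (use has_wirt_wirtinger_bar[OF assms(3)]
        in simp)
  then show ?thesis unfolding ddbar1_def by (simp add: has_wirt_wirtinger)
qed

lemma ddbar1_add:
  assumes "open S" "smooth_on S u" "smooth_on S u'" "z \<in> S"
  shows "ddbar1 (\<lambda>y. u y + u' y) z = ddbar1 u z + ddbar1 u' z"
proof -
  note W = csmooth_has_wirt[OF csmooth_of_real[OF assms(2)]] and W' =
      csmooth_has_wirt[OF csmooth_of_real[OF assms(3)]]
  have "ddbar1 (\<lambda>y. u y + u' y) z = Re (of_real (ddbar1 u z) + of_real (ddbar1 u' z))"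
    using has_wirt_add[OF W W']
    by (intro ddbar1_eqI[OF assms(1,4) _ has_wirt_add[OF has_wirt_wirtinger_bar_real[OF
        assms(1,2,4)] has_wirt_wirtinger_bar_real[OF assms(1,3,4)]]])
       auto
  then show ?thesis by simp
qed

lemma smooth_on_ln_norm_holomorphic:
  assumes "open S" "g holomorphic_on S" "\<And>z. z \<in> S \<Longrightarrow> g z \<noteq> 0"
  shows "smooth_on S (\<lambda>z. ln ((cmod (g z))\<^sup>2))"
proof -
  have c: "csmooth S g" by (rule csmooth_holomorphic[OF assms(1,2)])
  have "smooth_on S (\<lambda>z. Re (g z) * Re (g z) + Im (g z) * Im (g z))"
    using c assms(1) by (simp add: csmooth_def smooth_on_add smooth_on_mult)
  moreover have "(\<lambda>z. Re (g z) * Re (g z) + Im (g z) * Im (g z)) = (\<lambda>z. (cmod (g z))\<^sup>2)"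
    by (rule ext) (metis cmod_power2 power2_eq_square)
  ultimately have "smooth_on S (\<lambda>z. (cmod (g z))\<^sup>2)" by simp
  then show ?thesis
    by (rule smooth_on_compose_real[OF assms(1) smooth_on_ln]) (use assms(3) in auto)
qed

text \<open>The conjugate derivative of \<open>ln |g|^2\<close> is the conjugate of
  \<open>deriv g z / g z\<close>, which is antiholomorphic and so has vanishing
  \<open>z\<close>-derivative.\<close>

lemma ddbar1_ln_norm_holomorphic:
  assumes "open S" "g holomorphic_on S" "\<And>z. z \<in> S \<Longrightarrow> g z \<noteq> 0" "z \<in> S"
  shows "ddbar1 (\<lambda>z. ln ((cmod (g z))\<^sup>2)) z = 0"
proof -
  have "(\<lambda>z. deriv g z / g z) holomorphic_on S"
    using assms by (intro holomorphic_intros holomorphic_deriv) auto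
  then obtain d where "((\<lambda>z. deriv g z / g z) has_field_derivative d) (at z)"
    using assms holomorphic_derivI by blast
  from has_wirt_cnj[OF has_wirt_holomorphic[OF this]]
  have "has_wirt (\<lambda>z. 1 / cnj (g z) * cnj (deriv g z)) 0 (cnj d) z" by (simp add: mult.commute)
  moreover have "has_wirt (\<lambda>z. of_real (ln ((cmod (g z))\<^sup>2))) (1 / g y * deriv g y) (1 / cnj (g y)
      * cnj (deriv g y)) y"
    if "y \<in> S" for y
    by (rule has_wirt_compose_holomorphic[OF has_wirt_ln_norm[OF assms(3)[OF that]]
        holomorphic_derivI[OF assms(2,1) that]])
  ultimately have "ddbar1 (\<lambda>z. ln ((cmod (g z))\<^sup>2)) z = Re 0"
    by (intro ddbar1_eqI[OF assms(1,4)])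
  then show ?thesis by simp
qed

text \<open>The second derivative of \<open>\<phi>\<close> enters only through the conjugate of
  \<open>deriv \<phi>\<close>, whose \<open>z\<close>-derivative is 0; this is the
  \<open>cnj 0\<close> in the product rule below.\<close>

lemma ddbar1_holomorphic_compose:
  assumes "open S" "open S'" "\<phi> holomorphic_on S" "\<phi> ` S \<subseteq> S'" "smooth_on S' u" "z \<in> S"
  shows "ddbar1 (\<lambda>z. u (\<phi> z)) z = ddbar1 u (\<phi> z) * (cmod (deriv \<phi> z))\<^sup>2"
proof -
  note d = holomorphic_derivI[OF assms(3,1)]
  have W: "has_wirt (\<lambda>y. complex_of_real (u y)) (wirtinger 1 \<i> (\<lambda>y. complex_of_real (u y)) y)
      (wirtinger_bar 1 \<i> (\<lambda>y. complex_of_real (u y)) y) y"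
    if "y \<in> S'" for y using csmooth_has_wirt[OF csmooth_of_real[OF assms(5)] that] .
  have z': "\<phi> z \<in> S'" using assms by blast
  obtain e where e: "(deriv \<phi> has_field_derivative e) (at z)"
    using holomorphic_derivI[OF holomorphic_deriv[OF assms(3,1)] assms(1,6)] by blast
  have "ddbar1 (\<lambda>z. u (\<phi> z)) z = Re (of_real (ddbar1 u (\<phi> z)) * deriv \<phi> z * cnj (deriv \<phi> z) +
      wirtinger_bar 1 \<i> (\<lambda>y. complex_of_real (u y)) (\<phi> z) * cnj 0)"
  proof (rule ddbar1_eqI[OF assms(1,6)])
    show "has_wirt (\<lambda>y. complex_of_real (u (\<phi> y))) (wirtinger 1 \<i> (\<lambda>y. complex_of_real (u y))
        (\<phi> y) * deriv \<phi> y)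
      (wirtinger_bar 1 \<i> (\<lambda>y. complex_of_real (u y)) (\<phi> y) * cnj (deriv \<phi> y)) y" if "y \<in> S" for y
      by (rule has_wirt_compose_holomorphic[OF W d[OF that]]) (use assms that in blast)
    show "has_wirt (\<lambda>y. wirtinger_bar 1 \<i> (\<lambda>y. complex_of_real (u y)) (\<phi> y) * cnj (deriv \<phi> y))
       (of_real (ddbar1 u (\<phi> z)) * deriv \<phi> z * cnj (deriv \<phi> z) +
           wirtinger_bar 1 \<i> (\<lambda>y. complex_of_real (u y)) (\<phi> z) * cnj 0)
       (wirtinger_bar 1 \<i> (wirtinger_bar 1 \<i> (\<lambda>y. complex_of_real (u y))) (\<phi> z) * cnj (deriv \<phi> z)
           * cnj (deriv \<phi> z)
        + wirtinger_bar 1 \<i> (\<lambda>y. complex_of_real (u y)) (\<phi> z) * cnj e) z"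
      by (rule has_wirt_mult[OF has_wirt_compose_holomorphic[OF has_wirt_wirtinger_bar_real[OF
          assms(2,5) z'] d[OF assms(6)]]
            has_wirt_cnj[OF has_wirt_holomorphic[OF e]]])
  qed
  also have "\<dots> = ddbar1 u (\<phi> z) * (cmod (deriv \<phi> z))\<^sup>2"
    by (simp add: mult.assoc complex_norm_square[symmetric] flip: of_real_mult of_real_power)
  finally show ?thesis .
qed

lemma borel_in_euclidean: "borel_in (euclidean :: 'p::topological_space topology) = sets borel"
  by (simp add: borel_in_def borel_def)

section \<open>Area, degree and Hermitian weights on the base\<close>

context ruled
begin

lemma kaehler: "kaehler_form (charts E) (kform E)"
  and hermitian: "hermitian_metric E hn"
  and degree: "has_degree E (- 1)"
  using genus_setup by (simp_all add: genus_two_setup_def)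

lemma kform_pos: "C \<in> charts E \<Longrightarrow> p \<in> fst C \<Longrightarrow> kform E C p > 0"
  and kform_smooth: "C \<in> charts E \<Longrightarrow> smooth_on (snd C ` fst C) (\<lambda>y. kform E C (cinv C y))"
  and kform_compat: "C \<in> charts E \<Longrightarrow> C' \<in> charts E \<Longrightarrow> p \<in> fst C \<Longrightarrow> p \<in> fst C' \<Longrightarrow>
     kform E C p = kform E C' p * (cmod (deriv (\<lambda>z. snd C' (cinv C z)) (snd C p)))\<^sup>2"
  using kaehler unfolding kaehler_form_def o_def by blast+

lemma chart_trans_hom:
  assumes "C \<in> charts E" "C' \<in> charts E" "W \<subseteq> fst C" "W \<subseteq> fst C'"
  shows "homeomorphism (snd C ` W) (snd C' ` W) (\<lambda>z. snd C' (cinv C z)) (\<lambda>z. snd C (cinv C' z))"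
proof -
  have c: "continuous_on (snd D ` W) (\<lambda>z. snd D' (cinv D z))"
    if "D \<in> charts E" "D' \<in> charts E" "W \<subseteq> fst D" "W \<subseteq> fst D'" for D D'
    by (rule holomorphic_on_imp_continuous_on[OF holomorphic_on_subset[OF chart_trans[OF
        that(1,2)]]]) (use that in auto)
  have i: "(\<lambda>z. snd D' (cinv D z)) ` snd D ` W = snd D' ` W" if "D \<in> charts E" "W \<subseteq> fst D" for D D'
    using that by (auto simp: image_image subset_iff)
  show ?thesis
    unfolding homeomorphism_def
  proof (intro conjI ballI)
    show "snd C (cinv C' (snd C' (cinv C z))) = z" if "z \<in> snd C ` W" for z
      using that assms by (auto simp: subset_iff)
    show "snd C' (cinv C (snd C (cinv C' z))) = z" if "z \<in> snd C' ` W" for z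
      using that assms by (auto simp: subset_iff)
    show "(\<lambda>z. snd C' (cinv C z)) ` snd C ` W = snd C' ` W" by (rule i[OF assms(1,3)])
    show "(\<lambda>z. snd C (cinv C' z)) ` snd C' ` W = snd C ` W" by (rule i[OF assms(2,4)])
  qed (use c assms in blast)+
qed

lemma base_change:
  assumes "C \<in> charts E" "C' \<in> charts E" "open W" "W \<subseteq> fst C" "W \<subseteq> fst C'"
      "H \<in> borel_measurable borel"
  shows "(\<integral>\<^sup>+w\<in>snd C' ` W. H w \<partial>lborel) =
    (\<integral>\<^sup>+z\<in>snd C ` W. H (snd C' (cinv C z)) * ennreal ((cmod (deriv (\<lambda>z. snd C' (cinv C z)) z))\<^sup>2)
        \<partial>lborel)"
proof (rule nn_integral_holomorphic_change[OF _ _ _ chart_trans_hom[OF assms(1,2,4,5)] assms(6)])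
  show "open (snd C ` W)" by (rule chart_image_open[OF assms(1,3,4)])
  show "open (snd C' ` W)" by (rule chart_image_open[OF assms(2,3,5)])
  show "(\<lambda>z. snd C' (cinv C z)) holomorphic_on snd C ` W"
    by (rule holomorphic_on_subset[OF chart_trans[OF assms(1,2)]]) (use assms(4,5) in blast)
qed

text \<open>\<open>kform_compat\<close> scales by the squared modulus of the derivative of the
  coordinate change, which is exactly its real Jacobian.\<close>

lemma area_charts: "density_charts (euclidean :: 'a topology) (charts E)
    fst snd (\<lambda>C p. 2 * kform E C p)"
proof
  obtain J where J: "finite J" "J \<subseteq> charts E \<times> trivs E" "UNIV = (\<Union>(C, T)\<in>J. fst C \<inter> fst T)"
    using finite_cover by blast
  show "\<exists>J. finite J \<and> J \<subseteq> charts E \<and> topspace (euclidean :: 'a topology) \<subseteq> (\<Union>i\<in>J. fst i)"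
  proof (intro exI[of _ "fst ` J"] conjI)
    show "topspace euclidean \<subseteq> (\<Union>i\<in>fst ` J. fst i)"
    proof
      fix p :: 'a
      have "p \<in> (\<Union>(C, T)\<in>J. fst C \<inter> fst T)" using J(3) UNIV_I by metis
      then obtain C T where "(C, T) \<in> J" "p \<in> fst C" by blast
      then show "p \<in> (\<Union>i\<in>fst ` J. fst i)" by force
    qed
  qed (use J in auto)
  show "openin euclidean (fst C)" if "C \<in> charts E" for C using chart_open[OF that] by simp
  show "inj_on (snd C) (fst C)" if "C \<in> charts E" for C
    using chart_inj[OF that] by (auto intro: inj_onI)
  show "openin euclidean U \<longleftrightarrow> open (snd C ` U)" if C: "C \<in> charts E" and U: "U \<subseteq> fst C" for C U
  proof
    assume "open (snd C ` U)"
    then have "open (fst C \<inter> snd C -` (snd C ` U))"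
      using chart_hom[OF C] chart_open[OF C]
        by (intro continuous_open_preimage) (auto simp: homeomorphism_def)
    moreover have "fst C \<inter> snd C -` (snd C ` U) = U"
      using U chart_inj[OF C] by (auto simp: subset_iff)
    ultimately show "openin euclidean U" by simp
  qed (use chart_image_open[OF C _ U] in simp)
  show "continuous_on (snd C ` fst C) (\<lambda>y. 2 * kform E C (cinv C y))" if "C \<in> charts E" for C
    by (intro continuous_intros smooth_on_continuous kform_smooth that)
  show "(\<integral>\<^sup>+ y \<in> snd C ` B. ennreal (2 * kform E C (cinv C y)) \<partial>lborel) =
        (\<integral>\<^sup>+ y \<in> snd C' ` B. ennreal (2 * kform E C' (cinv C' y)) \<partial>lborel)"
    if C: "C \<in> charts E" "C' \<in> charts E" and B: "B \<in> borel_in euclidean" "B \<subseteq> fst C"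
        "B \<subseteq> fst C'" for C C' B
  proof -
    \<comment> \<open>Cut off outside the image of \<open>B\<close>: the integrand becomes Borel on
      the whole plane, and the substitution can be made on the open overlap.\<close>
    define H where "H w = ennreal (indicator (snd C' ` B) w *\<^sub>R (2 * kform E C' (cinv C' w)))" for w
    let ?W = "fst C \<inter> fst C'"
    have "snd C' ` B \<in> sets borel"
      using borel_image_homeomorphism[OF chart_hom[OF C(2)]] B chart_open_image[OF C(2)]
        by (simp add: borel_in_euclidean)
    moreover have "continuous_on (snd C' ` B) (\<lambda>w. 2 * kform E C' (cinv C' w))"
      by (intro continuous_intros continuous_on_subset[OF smooth_on_continuous[OF kform_smooth[OF
          C(2)]]]) (use B in auto)
    ultimately have H: "H \<in> borel_measurable borel"
      unfolding H_def[abs_def] using borel_measurable_continuous_on_indicator by measurable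
    have "(\<integral>\<^sup>+ y \<in> snd C' ` B. ennreal (2 * kform E C' (cinv C' y)) \<partial>lborel) =
        (\<integral>\<^sup>+w\<in>snd C' ` ?W. H w \<partial>lborel)"
      using B by (intro nn_integral_cong) (auto simp: H_def split: split_indicator)
    also have "\<dots> = (\<integral>\<^sup>+z\<in>snd C ` ?W. H (snd C' (cinv C z))
        * ennreal ((cmod (deriv (\<lambda>z. snd C' (cinv C z)) z))\<^sup>2) \<partial>lborel)"
      by (rule base_change[OF C _ _ _ H]) (auto intro: chart_open C)
    also have "\<dots> = (\<integral>\<^sup>+ y \<in> snd C ` B. ennreal (2 * kform E C (cinv C y)) \<partial>lborel)"
    proof (intro nn_integral_cong)
      fix z
      show "H (snd C' (cinv C z)) * ennreal ((cmod (deriv (\<lambda>z. snd C' (cinv C z)) z))\<^sup>2)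
          * indicator (snd C ` ?W) z =
        ennreal (2 * kform E C (cinv C z)) * indicator (snd C ` B) z"
      proof (cases "z \<in> snd C ` ?W")
        case True
        then obtain p where p: "z = snd C p" "p \<in> fst C" "p \<in> fst C'" by blast
        have "snd C' p \<in> snd C' ` B \<longleftrightarrow> p \<in> B" "snd C p \<in> snd C ` B \<longleftrightarrow> p \<in> B"
          using p B chart_inj[OF C(1)] chart_inj[OF C(2)] by (auto simp: subset_iff image_iff)
        then show ?thesis
          using p C kform_compat[OF C p(2,3)] kform_pos[OF C(2) p(3)]
          by (auto simp: H_def ennreal_mult'[symmetric] mult.assoc split: split_indicator)
      qed (use B in \<open>auto split: split_indicator\<close>)
    qed
    finally show ?thesis by simp
  qed
qed

lemma area_ex1: "\<exists>!M. is_area_measure E M"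
  unfolding is_area_measure_def by (rule density_charts.density_measure_ex1[OF area_charts])

abbreviation "area \<equiv> area_measure E"

lemma is_area: "is_area_measure E area"
  unfolding area_measure_def by (rule theI'[OF area_ex1])

lemma area_space: "space area = UNIV" "sets area = sets borel"
  using is_area by (auto simp: is_area_measure_def is_density_measure_def borel_in_euclidean)

lemma emeasure_area: "C \<in> charts E \<Longrightarrow> B \<in> sets borel \<Longrightarrow> B \<subseteq> fst C \<Longrightarrow>
   emeasure area B = (\<integral>\<^sup>+ y \<in> snd C ` B. ennreal (2 * kform E C (cinv C y)) \<partial>lborel)"
  using is_area area_space(2) unfolding is_area_measure_def is_density_measure_def by auto

text \<open>\<open>base_integral\<close> obtains the ratio to the Kaehler form from a definite
  description at each point; positivity of \<open>kform\<close> makes this ratio unique.\<close>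

lemma base_integral_eqI:
  assumes "\<And>C p. C \<in> charts E \<Longrightarrow> p \<in> fst C \<Longrightarrow> a C p = r p * kform E C p"
  shows "base_integral E a = (LINT p | area. r p)"
proof -
  have "(THE r. \<forall>C\<in>charts E. p \<in> fst C \<longrightarrow> a C p = r * kform E C p) = r p" for p
  proof (rule the_equality)
    fix r' assume r': "\<forall>C\<in>charts E. p \<in> fst C \<longrightarrow> a C p = r' * kform E C p"
    obtain C where C: "C \<in> charts E" "p \<in> fst C" using chart_cover by blast
    then have "r' * kform E C p = r p * kform E C p" using r' assms by metis
    then show "r' = r p" using kform_pos[OF C] by simp
  qed (use assms in auto)
  then show ?thesis by (simp add: base_integral_def)
qed

text \<open>The Kaehler form is minus the curvature form, and the latter integrates to
  \<open>2 * pi\<close> times the degree -1.\<close>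

lemma area_total: "emeasure area UNIV = ennreal (2 * pi)" and finite_area: "finite_measure area"
proof -
  have curv: "curvature_form E hn C p = - 1 * kform E C p" if "C \<in> charts E" "p \<in> fst C" for C p
    using genus_setup that by (auto simp: genus_two_setup_def)
  have "base_integral E (curvature_form E hn) = (LINT p | area. - 1)"
    by (rule base_integral_eqI) (use curv in auto)
  moreover have "base_integral E (curvature_form E hn) / (2 * pi) = - 1"
    using degree hermitian unfolding has_degree_def by auto
  ultimately have m: "measure area UNIV = 2 * pi" by (simp add: area_space field_simps)
  \<comment> \<open>\<open>measure\<close> takes the value 0 on sets of infinite measure, so the
    nonzero value excludes that case.\<close>
  then have "emeasure area UNIV \<noteq> \<infinity>" by (auto simp: measure_def)
  then show "emeasure area UNIV = ennreal (2 * pi)"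
    using m by (simp add: emeasure_eq_ennreal_measure)
  then show "finite_measure area" by (intro finite_measureI) (simp add: area_space)
qed

abbreviation lm :: "('a, 'l) triv \<Rightarrow> 'a \<Rightarrow> real" where
  "lm T \<equiv> local_metric E hn T"

lemma local_metric_fvec: "local_metric E hn' T p = hn' (fvec T p 1)"
  by (simp add: local_metric_def fvec_def)

lemma lm_pos: "T \<in> trivs E \<Longrightarrow> p \<in> fst T \<Longrightarrow> lm T p > 0"
  and lm_norm: "T \<in> trivs E \<Longrightarrow> pr E u \<in> fst T \<Longrightarrow> hn u = lm T (pr E u) * (cmod (snd T u))\<^sup>2"
  using hermitian unfolding hermitian_metric_def by blast+

lemma lm_smooth: "T \<in> trivs E \<Longrightarrow> C \<in> charts E \<Longrightarrow>
    smooth_on (snd C ` (fst C \<inter> fst T)) (\<lambda>y. lm T (cinv C y))"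
  using hermitian unfolding hermitian_metric_def smooth_fun_on_def by (cases C) fastforce

lemma lm_trn: "T \<in> trivs E \<Longrightarrow> T' \<in> trivs E \<Longrightarrow> p \<in> fst T \<Longrightarrow> p \<in> fst T' \<Longrightarrow>
    lm T p = lm T' p * (cmod (trn T T' p))\<^sup>2"
  using lm_norm[of T' "fvec T p 1"] by (simp add: local_metric_fvec trn_def fvec)

definition eta :: "'a chart \<Rightarrow> ('a, 'l) triv \<Rightarrow> complex \<Rightarrow> real" where
  "eta C T z = ln (lm T (cinv C z))"

definition Kc :: "'a chart \<Rightarrow> complex \<Rightarrow> real" where
  "Kc C z = kform E C (cinv C z)"

lemma open_CT: "C \<in> charts E \<Longrightarrow> T \<in> trivs E \<Longrightarrow> open (snd C ` (fst C \<inter> fst T))"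
  by (intro chart_image_open) (auto intro: chart_open triv_open)

lemma eta_smooth: "C \<in> charts E \<Longrightarrow> T \<in> trivs E \<Longrightarrow> smooth_on (snd C ` (fst C \<inter> fst T)) (eta C T)"
  unfolding eta_def[abs_def]
  by (rule smooth_on_compose_real[OF open_CT smooth_on_ln lm_smooth]) (auto intro: lm_pos)

text \<open>\<open>curvature_form\<close> is a description over all trivializations at the point, so
  it denotes only if they agree. Two weights differ by \<open>|g|^2\<close> with \<open>g\<close>
  holomorphic and without zeros, and \<open>ln |g|^2\<close> is harmonic.\<close>

lemma ddbar_eta_indep:
  assumes C: "C \<in> charts E" and T: "T \<in> trivs E" "T' \<in> trivs E" and p: "p \<in> fst C" "p \<in> fst T"
      "p \<in> fst T'"
  shows "ddbar1 (eta C T) (snd C p) = ddbar1 (eta C T') (snd C p)"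
proof -
  let ?S = "snd C ` (fst C \<inter> (fst T \<inter> fst T'))"
  let ?g = "\<lambda>z. trn T T' (cinv C z)"
  have S: "open ?S" using C T by (intro chart_image_open) (auto intro: chart_open triv_open)
  have pS: "snd C p \<in> ?S" using p by blast
  have g: "?g holomorphic_on ?S" "\<And>z. z \<in> ?S \<Longrightarrow> ?g z \<noteq> 0"
    using trn(3)[OF T C] trn(1)[OF T] C by auto
  have "ddbar1 (eta C T) (snd C p) = ddbar1 (\<lambda>z. eta C T' z + ln ((cmod (?g z))\<^sup>2)) (snd C p)"
  proof (rule ddbar1_cong[OF S pS])
    fix y assume "y \<in> ?S"
    then obtain q where q: "y = snd C q" "q \<in> fst C" "q \<in> fst T" "q \<in> fst T'" by blast
    then show "eta C T y = eta C T' y + ln ((cmod (?g y))\<^sup>2)"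
      using C lm_trn[OF T q(3,4)] lm_pos[OF T(2) q(4)] trn(1)[OF T q(3,4)]
      by (simp add: eta_def ln_mult_pos)
  qed
  also have "\<dots> = ddbar1 (eta C T') (snd C p) + ddbar1 (\<lambda>z. ln ((cmod (?g z))\<^sup>2)) (snd C p)"
    by (rule ddbar1_add[OF S _ smooth_on_ln_norm_holomorphic[OF S g] pS])
      (rule smooth_on_subset[OF eta_smooth[OF C T(2)]], auto)
  also have "ddbar1 (\<lambda>z. ln ((cmod (?g z))\<^sup>2)) (snd C p) = 0"
    by (rule ddbar1_ln_norm_holomorphic[OF S g pS])
  finally show ?thesis by simp
qed

lemma ddbar_eta:
  assumes C: "C \<in> charts E" and T: "T \<in> trivs E" and p: "p \<in> fst C" "p \<in> fst T"
  shows "ddbar1 (eta C T) (snd C p) = kform E C p"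
proof -
  have f: "ddbar_form (\<lambda>q. ln (local_metric E hn T q)) C p = ddbar1 (eta C T) (snd C p)" for T
    by (simp add: ddbar_form_def eta_def[abs_def])
  have "curvature_form E hn C p = - ddbar1 (eta C T) (snd C p)"
    unfolding curvature_form_def f
  proof (rule the_equality)
    show "\<forall>T'\<in>trivs E. p \<in> fst T' \<longrightarrow> - ddbar1 (eta C T) (snd C p) = - ddbar1 (eta C T') (snd C p)"
      using ddbar_eta_indep[OF C T _ p] by auto
    fix k assume "\<forall>T\<in>trivs E. p \<in> fst T \<longrightarrow> k = - ddbar1 (eta C T) (snd C p)"
    then show "k = - ddbar1 (eta C T) (snd C p)" using T p by blast
  qed
  moreover have "curvature_form E hn C p = - kform E C p"
    using genus_setup C p by (auto simp: genus_two_setup_def)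
  ultimately show ?thesis by simp
qed

text \<open>
  The metrics \<open>hn\<close> and \<open>exp g hn\<close> have the same degree, and their curvature forms differ by
  \<open>\<partial>\<partial>bar g\<close>; this replaces Stokes' theorem.
\<close>

lemma Stokes:
  assumes g: "\<And>C T. C \<in> charts E \<Longrightarrow> T \<in> trivs E \<Longrightarrow>
      smooth_on (snd C ` (fst C \<inter> fst T)) (\<lambda>y. g (cinv C y))"
  shows "base_integral E (\<lambda>C p. c * ddbar_form g C p) = 0"
proof -
  \<comment> \<open>\<open>ddbar_form g\<close> transforms between charts in the same way as
    \<open>kform\<close>, so their quotient \<open>r\<close> below is a function on the
    base.\<close>
  have compat: "ddbar_form g C p = ddbar_form g C' p * (cmod (deriv (\<lambda>z. snd C' (cinv C z))
      (snd C p)))\<^sup>2"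
    if C: "C \<in> charts E" "C' \<in> charts E" and p: "p \<in> fst C" "p \<in> fst C'" for C C' p
  proof -
    obtain T where T: "T \<in> trivs E" "p \<in> fst T" using triv_cover by blast
    let ?S = "snd C ` (fst C \<inter> fst C' \<inter> fst T)"
    have S: "open ?S" using C T by (intro chart_image_open) (auto intro: chart_open triv_open)
    have pS: "snd C p \<in> ?S" using p T by blast
    have "ddbar_form g C p = ddbar1 (\<lambda>z. g (cinv C' (snd C' (cinv C z)))) (snd C p)"
      unfolding ddbar_form_def by (rule ddbar1_cong[OF S pS]) (use C in auto)
    also have "\<dots> = ddbar1 (\<lambda>z. g (cinv C' z)) (snd C' (cinv C (snd C p)))
        * (cmod (deriv (\<lambda>z. snd C' (cinv C z)) (snd C p)))\<^sup>2"
      by (rule ddbar1_holomorphic_compose[OF S open_CT[OF C(2) T(1)] _ _ g[OF C(2) T(1)] pS])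
        (use C holomorphic_on_subset[OF chart_trans[OF C], of ?S] in auto)
    finally show ?thesis using C p by (simp add: ddbar_form_def)
  qed
  define ch where "ch p = (SOME C. C \<in> charts E \<and> p \<in> fst C)" for p
  have ch: "ch p \<in> charts E" "p \<in> fst (ch p)" for p
  proof -
    have "\<exists>C. C \<in> charts E \<and> p \<in> fst C" using chart_cover by blast
    from someI_ex[OF this, folded ch_def] show "ch p \<in> charts E" "p \<in> fst (ch p)" by auto
  qed
  define r where "r p = ddbar_form g (ch p) p / kform E (ch p) p" for p
  have r: "ddbar_form g C p = r p * kform E C p" if "C \<in> charts E" "p \<in> fst C" for C p
    using compat[OF that(1) ch(1) that(2) ch(2)] kform_compat[OF that(1) ch(1) that(2) ch(2)]
      less_imp_neq[OF kform_pos[OF ch], of p] by (simp add: r_def)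
  define hn' where "hn' u = hn u * exp (g (pr E u))" for u
  have lm': "local_metric E hn' T p = lm T p * exp (g p)" if "T \<in> trivs E" "p \<in> fst T" for T p
    using fvec[OF that] by (simp add: local_metric_fvec hn'_def)
  have "hermitian_metric E hn'"
    unfolding hermitian_metric_def
  proof (intro ballI conjI allI impI)
    fix T assume T: "T \<in> trivs E"
    show "local_metric E hn' T p > 0" if "p \<in> fst T" for p using lm' lm_pos T that by simp
    show "hn' u = local_metric E hn' T (pr E u) * (cmod (snd T u))\<^sup>2" if "pr E u \<in> fst T" for u
      using lm'[OF T that] lm_norm[OF T that] by (simp add: hn'_def)
    show "smooth_fun_on (charts E) (fst T) (local_metric E hn' T)"
      unfolding smooth_fun_on_def
    proof (intro ballI)
      fix C assume "C \<in> charts E"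
      then have C: "C \<in> charts E" by simp
      have "smooth_on (snd C ` (fst C \<inter> fst T)) (\<lambda>y. lm T (cinv C y) * exp (g (cinv C y)))"
        by (intro smooth_on_mult open_CT[OF C T] lm_smooth[OF T C]
            smooth_on_compose_real[OF open_CT[OF C T] smooth_on_exp g[OF C T]]) auto
      then have "smooth_on (snd C ` (fst C \<inter> fst T)) (\<lambda>y. local_metric E hn' T (cinv C y))"
      proof (rule smooth_on_cong[OF open_CT[OF C T], rotated])
        fix y assume "y \<in> snd C ` (fst C \<inter> fst T)"
        then obtain q where "y = snd C q" "q \<in> fst C" "q \<in> fst T" by blast
        then show "lm T (cinv C y) * exp (g (cinv C y)) = local_metric E hn' T (cinv C y)"
          using lm'[OF T, of q] C by simp
      qed
      then show "case C of (V, c) \<Rightarrow> smooth_on (c ` (V \<inter> fst T))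
          (\<lambda>y. local_metric E hn' T (inv_into V c y))"
        by (simp add: case_prod_beta)
    qed
  qed
  then have "base_integral E (curvature_form E hn') / (2 * pi) = - 1"
    using degree unfolding has_degree_def by auto
  moreover have "base_integral E (curvature_form E hn') = (LINT p | area. - 1 - r p)"
  proof (rule base_integral_eqI)
    fix C p assume C: "C \<in> charts E" and p: "p \<in> fst C"
    have dd: "ddbar_form (\<lambda>q. ln (local_metric E hn' T q)) C p = kform E C p + ddbar_form g C p"
      if T: "T \<in> trivs E" "p \<in> fst T" for T
    proof -
      have S: "open (snd C ` (fst C \<inter> fst T))" "snd C p \<in> snd C ` (fst C \<inter> fst T)"
        using open_CT[OF C T(1)] T p by auto
      have "ddbar_form (\<lambda>q. ln (local_metric E hn' T q)) C p =
          ddbar1 (\<lambda>y. eta C T y + g (cinv C y)) (snd C p)"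
        unfolding ddbar_form_def
      proof (rule ddbar1_cong[OF S])
        fix y assume "y \<in> snd C ` (fst C \<inter> fst T)"
        then obtain q where "y = snd C q" "q \<in> fst C" "q \<in> fst T" by blast
        then show "ln (local_metric E hn' T (cinv C y)) = eta C T y + g (cinv C y)"
          using C lm'[OF T(1), of q] lm_pos[OF T(1), of q] by (simp add: eta_def ln_mult_pos)
      qed
      also have "\<dots> = kform E C p + ddbar_form g C p"
        using ddbar1_add[OF S(1) eta_smooth[OF C T(1)] g[OF C T(1)] S(2)]
            ddbar_eta[OF C T(1) p T(2)]
        by (simp add: ddbar_form_def)
      finally show ?thesis .
    qed
    obtain T where T: "T \<in> trivs E" "p \<in> fst T" using triv_cover by blast
    have "curvature_form E hn' C p = - (kform E C p + ddbar_form g C p)"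
      unfolding curvature_form_def using dd T by (intro the_equality) auto
    then show "curvature_form E hn' C p = (- 1 - r p) * kform E C p"
      using r[OF C p] by (simp add: algebra_simps)
  qed
  ultimately have I: "(LINT p | area. - 1 - r p) = - 2 * pi" by (simp add: field_simps)
  \<comment> \<open>A function that is not integrable has Bochner integral 0, so the value
    \<open>- 2 * pi\<close> certifies integrability.\<close>
  then have int: "integrable area (\<lambda>p. - 1 - r p)"
    using not_integrable_integral_eq pi_neq_zero by fastforce
  interpret finite_measure area by (rule finite_area)
  have "integrable area (\<lambda>p. - 1 - (- 1 - r p))"
    by (rule Bochner_Integration.integrable_diff[OF _ int]) simp
  then have "integrable area r" by simp
  then have "(LINT p | area. - 1 - r p) = - measure area UNIV - (LINT p | area. r p)"
    by (simp add: area_space)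
  moreover have "measure area UNIV = 2 * pi" using area_total by (simp add: measure_def)
  ultimately have "(LINT p | area. r p) = 0" using I by simp
  moreover have "base_integral E (\<lambda>C p. c * ddbar_form g C p) = (LINT p | area. c * r p)"
    by (rule base_integral_eqI) (use r in simp)
  ultimately show ?thesis by simp
qed

lemma s_fun_pnt:
  assumes "T \<in> trivs E" "p \<in> fst T" "w \<noteq> 0"
  shows "s_fun E hn (pnt T False p w) = ln ((cmod w)\<^sup>2) + ln (lm T p)"
proof -
  have "s_fun E hn (pnt T False p w) = ln (hn (fvec T p w))"
    unfolding s_fun_def
  proof (rule the_equality)
    show "\<forall>u. (u, 1) \<in> pnt T False p w \<longrightarrow> ln (hn (fvec T p w)) = ln (hn u)"
      using vec_self[OF assms(1)] assms(2) by (auto simp: pnt_mem[OF assms(1,2)])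
    fix r assume "\<forall>u. (u, 1) \<in> pnt T False p w \<longrightarrow> r = ln (hn u)"
    then show "r = ln (hn (fvec T p w))"
      using fvec[OF assms(1,2)] by (auto simp: pnt_mem[OF assms(1,2)])
  qed
  then show ?thesis
    using lm_norm[OF assms(1), of "fvec T p w"] fvec[OF assms(1,2)] assms lm_pos[OF assms(1,2)]
    by (simp add: ln_mult_pos)
qed

lemma R_dom_eq: "T \<in> trivs E \<Longrightarrow> R_dom E (C, T) = {pnt T False p w | p w. p \<in> fst C \<inter> fst T \<and> w \<noteq> 0}"
  unfolding R_dom_def fst_conv snd_conv using pnt_X_reg[of T _ False]
  by (subst X_dom_eq; (blast | assumption))

lemma R_chart_pnt: "T \<in> trivs E \<Longrightarrow> p \<in> fst T \<Longrightarrow> R_chart E (C, T) (pnt T False p w) = (snd C p, w)"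
  by (simp add: R_chart_def X_chart_pnt)

lemma R_chart_image: 
  assumes "T \<in> trivs E"
  shows "R_chart E (C, T) ` R_dom E (C, T) = snd C ` (fst C \<inter> fst T) \<times> (- {0})" (is "?L = ?R")
proof (intro equalityI subsetI)
  fix y assume "y \<in> ?R"
  then have "fst y \<in> snd C ` (fst C \<inter> fst T)" "snd y \<noteq> 0" by (simp_all add: mem_Times_iff)
  then obtain p where p: "fst y = snd C p" "p \<in> fst C" "p \<in> fst T" "snd y \<noteq> 0" by blast
  have "y = R_chart E (C, T) (pnt T False p (snd y))"
    using R_chart_pnt[OF assms p(3)] p(1) by (simp add: prod_eq_iff)
  moreover have "pnt T False p (snd y) \<in> R_dom E (C, T)"
    unfolding R_dom_eq[OF assms] using p by blast
  ultimately show "y \<in> ?L" by blast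
qed (use assms in \<open>auto simp: R_dom_eq R_chart_pnt\<close>)

lemma R_chart_inj: "C \<in> charts E \<Longrightarrow> T \<in> trivs E \<Longrightarrow> inj_on (R_chart E (C, T)) (R_dom E (C, T))"
  unfolding R_chart_def R_dom_def fst_conv snd_conv
  by (rule inj_on_subset[OF X_chart_inj]) auto

lemma R_inv:
  assumes "C \<in> charts E" "T \<in> trivs E" "z \<in> snd C ` (fst C \<inter> fst T)" "w \<noteq> 0"
  shows "inv_into (R_dom E (C, T)) (R_chart E (C, T)) (z, w) = pnt T False (cinv C z) w"
proof -
  obtain p where p: "z = snd C p" "p \<in> fst C" "p \<in> fst T" using assms by blast
  have "inv_into (R_dom E (C, T)) (R_chart E (C, T)) (R_chart E (C, T) (pnt T False p w)) =
      pnt T False p w"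
    by (rule inv_into_f_f[OF R_chart_inj[OF assms(1,2)]]) (use p R_dom_eq[OF assms(2)] assms(4)
        in blast)
  then show ?thesis using p assms by (simp add: R_chart_pnt)
qed

end

section \<open>Curvature and volume of the conical metric\<close>

locale conical = ruled E hn + profile m \<beta>0 \<beta>inf f
  for E :: "('a::t2_space, 'l) polarized_surface" and hn :: "'l \<Rightarrow> real" and m \<beta>0 \<beta>inf f
begin

lemma chart_ex:
  assumes C: "C \<in> charts E" and T: "T \<in> trivs E"
  shows "\<exists>a b b' l l'. momentum_chart (snd C ` (fst C \<inter> fst T)) (eta C T) (Kc C)
      a b b' l l' f \<gamma> \<phi> v v2"
proof (rule momentum_chartI)
  show "open (snd C ` (fst C \<inter> fst T))" by (rule open_CT[OF C T])
  show "smooth_on (snd C ` (fst C \<inter> fst T)) (eta C T)" by (rule eta_smooth[OF C T])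
  show "smooth_on (snd C ` (fst C \<inter> fst T)) (Kc C)"
    unfolding Kc_def[abs_def] by (rule smooth_on_subset[OF kform_smooth[OF C]]) auto
  fix z assume "z \<in> snd C ` (fst C \<inter> fst T)"
  then obtain p where p: "z = snd C p" "p \<in> fst C" "p \<in> fst T" by blast
  show "Kc C z > 0" using p C kform_pos by (simp add: Kc_def)
  show "ddbar1 (eta C T) z = Kc C z" using ddbar_eta[OF C T p(2,3)] p C by (simp add: Kc_def)
  have "ricci_form (kform E) C p = - 2 * kform E C p"
    using genus_setup C p by (auto simp: genus_two_setup_def)
  then show "ddbar1 (\<lambda>z. ln (Kc C z)) z = 2 * Kc C z"
    using p C by (simp add: ricci_form_def Kc_def)
qed (use deriv_f deriv_\<gamma> deriv_\<phi> deriv_v \<gamma>_pos \<phi>_pos in auto)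

abbreviation "ss C T y \<equiv> ln ((cmod (snd y))\<^sup>2) + eta C T (fst y)"

text \<open>On the punctured chart the inverse of \<open>R_chart\<close> turns \<open>s_fun\<close>
  into \<open>ln |w|^2 + ln h\<close>; after this identification the entries of
  \<open>herm_mat\<close> are those computed in \<open>momentum_chart\<close>.\<close>

lemma curvature_in_chart:
  assumes C: "C \<in> charts E" and T: "T \<in> trivs E"
    and y: "y \<in> snd C ` (fst C \<inter> fst T) \<times> (- {0})"
  shows "omega_sq E hn f (C, T) y =
      - of_real (2 * \<gamma> (ss C T y) * Kc C (fst y) * \<phi> (ss C T y) / (cmod (snd y))\<^sup>2)" (is ?A)
    and "chern_top E hn f (C, T) y =
      of_real (Lam (ss C T y) / (2 * (2 * pi)\<^sup>2)) * omega_sq E hn f (C, T) y" (is ?B)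
proof -
  obtain a b b' l l' where "momentum_chart (snd C ` (fst C \<inter> fst T)) (eta C T) (Kc C)
      a b b' l l' f \<gamma> \<phi> v v2"
    using chart_ex[OF C T] by blast
  then interpret M: momentum_chart "snd C ` (fst C \<inter> fst T)" "eta C T"
      "Kc C" a b b' l l' f \<gamma> \<phi> v v2 .
  have punctured: "M.punctured = snd C ` (fst C \<inter> fst T) \<times> (- {0})" by (simp add: M.punctured_def)
  have g: "f (s_fun E hn (inv_into (R_dom E (C, T)) (R_chart E (C, T)) y)) = f (M.s y)" if y:
      "y \<in> M.punctured" for y
  proof -
    have "fst y \<in> snd C ` (fst C \<inter> fst T)" and w: "snd y \<noteq> 0"
      using y unfolding punctured by (simp_all add: mem_Times_iff)
    then obtain p where "fst y = snd C p" "p \<in> fst C \<inter> fst T" by (elim imageE)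
    then have p: "fst y = snd C p" "p \<in> fst C" "p \<in> fst T" "snd y \<noteq> 0" using w by auto
    have "cinv C (fst y) = p" using p cinv[OF C p(2)] by simp
    moreover have "inv_into (R_dom E (C, T)) (R_chart E (C, T)) (fst y, snd y) =
        pnt T False (cinv C (fst y)) (snd y)"
      by (rule R_inv[OF C T _ p(4)]) (use p in blast)
    ultimately have "inv_into (R_dom E (C, T)) (R_chart E (C, T)) y = pnt T False p (snd y)"
      by (simp only: prod.collapse)
    then show ?thesis using s_fun_pnt[OF T p(3,4)] p C by (simp add: M.s_def eta_def)
  qed
  note dd = M.ddbar_comp[OF _ g]
  have om: "omega_coeff E hn f (C, T) y $ 1 $ 1 = M.h11 y" "omega_coeff E hn f (C, T) y $ 2 $ 1 =
      M.h12 y"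
    "omega_coeff E hn f (C, T) y $ 1 $ 2 = M.h21 y" "omega_coeff E hn f (C, T) y $ 2 $ 2 = M.h22 y"
    if "y \<in> M.punctured" for y
    using dd[OF that]
    by (simp_all add: omega_coeff_def M.h11_def M.h12_def M.h21_def M.h22_def Kc_def algebra_simps)
  have H: "herm_mat E hn f (C, T) y $ 1 $ 1 = M.h11 y" "herm_mat E hn f (C, T) y $ 1 $ 2 = M.h12 y"
    "herm_mat E hn f (C, T) y $ 2 $ 1 = M.h21 y" "herm_mat E hn f (C, T) y $ 2 $ 2 = M.h22 y"
    if "y \<in> M.punctured" for y
    using om[OF that] by (simp_all add: herm_mat_def transpose_def)
  have y': "y \<in> M.punctured" using y punctured by simp
  have w: "snd y \<noteq> 0" using y by (simp add: mem_Times_iff)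
  have s: "M.s y = ss C T y" by (simp add: M.s_def)
  \<comment> \<open>Wedging the form with itself gives twice the determinant, and
    \<open>\<i>\<^sup>2\<close> gives the sign.\<close>
  have sq: "omega_sq E hn f (C, T) y = - (2 * (of_real (\<gamma> (M.s y)) * of_real (Kc C (fst y))
      * of_real (\<phi> (M.s y)) / (snd y * cnj (snd y))))"
    using M.det_h[OF y'] unfolding omega_sq_def wedge11_def om[OF y'] by (simp add: algebra_simps)
  then show ?A
    unfolding s complex_norm_square[symmetric] by simp
  note con = M.connection[where H = "herm_mat E hn f (C, T)", OF _ H, folded conn_mat_def]
  have "wedge11 (curv_mat E hn f (C, T) 1 1 y) (curv_mat E hn f (C, T) 2 2 y)
      - wedge11 (curv_mat E hn f (C, T) 1 2 y) (curv_mat E hn f (C, T) 2 1 y) =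
    of_real (Kc C (fst y)) / (snd y * cnj (snd y)) * of_real (Lam (M.s y) * (\<gamma> (M.s y)
        * \<phi> (M.s y)))"
    unfolding curv_mat_def M.momentum_curvature_eq
    using M.chern_form[where C = "conn_mat E hn f (C, T)", OF y' con] by simp
  then show ?B
    unfolding chern_top_def sq s[symmetric]
    by (simp add: power2_eq_square field_simps)
qed

end

section \<open>Integration in a logarithmic fibre coordinate\<close>

lemma measurable_Complex: "(\<lambda>(x, y). Complex x y) \<in> borel_measurable (lborel \<Otimes>\<^sub>M lborel)"
proof -
  have "(\<lambda>p. Complex (fst p) (snd p)) \<in> borel_measurable (borel :: (real \<times> real) measure)"
    unfolding Complex_eq by (intro borel_measurable_continuous_onI continuous_intros)
  then show ?thesis unfolding lborel_prod case_prod_beta by simp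
qed

lemma lborel_complex_prod:
  "(lborel :: complex measure) = distr (lborel \<Otimes>\<^sub>M lborel) borel (\<lambda>(x, y). Complex x y)"
proof (rule lborel_eqI)
  fix l u :: complex
  assume lu: "\<And>b. b \<in> Basis \<Longrightarrow> l \<bullet> b \<le> u \<bullet> b"
  have "emeasure (distr (lborel \<Otimes>\<^sub>M lborel) borel (\<lambda>(x, y). Complex x y)) (box l u)
     = emeasure (lborel \<Otimes>\<^sub>M lborel) ({Re l<..<Re u} \<times> {Im l<..<Im u})"
    by (subst emeasure_distr[OF measurable_Complex])
      (auto intro!: arg_cong2[where f = emeasure] simp: in_box_complex_iff space_pair_measure)
  also have "\<dots> = ennreal (Re u - Re l) * ennreal (Im u - Im l)"
    using lu[of 1] lu[of \<i>]
      by (subst lborel.emeasure_pair_measure_Times) (auto simp: Basis_complex_def)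
  also have "\<dots> = (\<Prod>b\<in>Basis. (u - l) \<bullet> b)"
    using lu[of 1] lu[of \<i>] by (simp add: Basis_complex_def ennreal_mult)
  finally show "emeasure (distr (lborel \<Otimes>\<^sub>M lborel) borel (\<lambda>(x, y). Complex x y)) (box l u)
     = (\<Prod>b\<in>Basis. (u - l) \<bullet> b)" .
qed simp

lemma emeasure_lborel_real_axis: "emeasure lborel {w::complex. Im w = 0} = 0"
proof -
  have "{w::complex. Im w = 0} = {w. w \<bullet> \<i> = 0}" by simp
  moreover have "negligible {w::complex. \<i> \<bullet> w = 0}"
    by (rule negligible_hyperplane) simp
  ultimately have "negligible {w::complex. Im w = 0}" by (simp add: inner_commute)
  moreover have "{w::complex. Im w = 0} \<in> sets borel"
    by (intro borel_closed closed_Collect_eq continuous_intros)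
  ultimately show ?thesis
    by (metis emeasure_completion main_part_sets negligible_iff_emeasure0 null_setsD1
        null_sets_completion_iff negligible_iff_null_sets sets_lborel)
qed

text \<open>\<open>exp\<close> maps the open strip of width \<open>2 * pi\<close> homeomorphically
  onto the slit plane, and the slit is a null set. The Jacobian will absorb the factor
  \<open>1 / |w|^2\<close> of the volume density.\<close>

lemma nn_integral_exp:
  assumes F: "F \<in> borel_measurable (borel :: complex measure)"
  shows "(\<integral>\<^sup>+w\<in>- {0}. F w \<partial>lborel) = (\<integral>\<^sup>+\<zeta>\<in>{\<zeta>. - pi < Im \<zeta> \<and>
      Im \<zeta> < pi}. F (exp \<zeta>) * ennreal ((cmod (exp \<zeta>))\<^sup>2) \<partial>lborel)"
proof -
  let ?S = "{\<zeta>. - pi < Im \<zeta> \<and> Im \<zeta> < pi}" and ?T = "- \<real>\<^sub>\<le>\<^sub>0 :: complex set"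
  have S: "open ?S" by (intro open_Collect_conj open_Collect_less continuous_intros)
  have T: "open ?T" by (simp add: open_Compl)
  have hom: "homeomorphism ?S ?T exp Ln"
    unfolding homeomorphism_def
  proof (intro conjI ballI)
    show e: "exp ` ?S = ?T"
    proof (intro equalityI subsetI)
      fix w assume "w \<in> exp ` ?S"
      then obtain z where z: "w = exp z" "- pi < Im z" "Im z < pi" by auto
      then have "Ln w = z" by (simp add: Ln_exp)
      have "w \<noteq> 0" using z by simp
      have "w \<notin> \<real>\<^sub>\<le>\<^sub>0"
      proof
        assume "w \<in> \<real>\<^sub>\<le>\<^sub>0"
        then have "Re w < 0" "Im w = 0"
          using \<open>w \<noteq> 0\<close> by (auto simp: complex_nonpos_Reals_iff complex_eq_iff)
        then have "Im (Ln w) = pi" using Im_Ln_eq_pi[OF \<open>w \<noteq> 0\<close>] by simp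
        then show False using \<open>Ln w = z\<close> z by simp
      qed
      then show "w \<in> ?T" by simp
    next
      fix w assume w: "w \<in> ?T"
      then have "w \<noteq> 0" by auto
      then have "exp (Ln w) = w" "- pi < Im (Ln w)" "Im (Ln w) < pi"
        using mpi_less_Im_Ln Im_Ln_less_pi w by auto
      then show "w \<in> exp ` ?S" by (intro image_eqI[of _ _ "Ln w"]) auto
    qed
    show "Ln (exp z) = z" if "z \<in> ?S" for z using that by (simp add: Ln_exp)
    show "exp (Ln w) = w" if "w \<in> ?T" for w
    proof -
      have "w \<noteq> 0" using that by auto
      then show ?thesis by simp
    qed
    show "Ln ` ?T = ?S" unfolding e[symmetric] by (force simp: image_iff Ln_exp)
    show "continuous_on ?T Ln" by (intro continuous_on_Ln) auto
  qed (intro continuous_intros)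
  have "(\<integral>\<^sup>+w\<in>- {0}. F w \<partial>lborel) = (\<integral>\<^sup>+w\<in>?T. F w \<partial>lborel)"
  proof (intro nn_integral_cong_AE)
    have "{w::complex. Im w = 0} \<in> null_sets lborel"
      using emeasure_lborel_real_axis
        by (intro null_setsI) (auto intro!: borel_closed closed_Collect_eq continuous_intros)
    then have "AE w in lborel. Im w \<noteq> 0" by (auto dest: AE_not_in)
    then show "AE w in lborel. F w * indicator (- {0}) w = F w * indicator ?T w"
      by eventually_elim (auto simp: complex_nonpos_Reals_iff split: split_indicator)
  qed
  also have "\<dots> = (\<integral>\<^sup>+\<zeta>\<in>?S. F (exp \<zeta>) * ennreal ((cmod (deriv exp \<zeta>))\<^sup>2) \<partial>lborel)"
    by (rule nn_integral_holomorphic_change[OF S T _ hom F]) (intro holomorphic_intros)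
  also have "deriv exp = (exp :: complex \<Rightarrow> complex)" by (intro ext DERIV_imp_deriv DERIV_exp)
  finally show ?thesis .
qed

lemma nn_integral_complex_prod:
  assumes F: "F \<in> borel_measurable (borel :: complex measure)"
  shows "(\<integral>\<^sup>+\<zeta>. F \<zeta> \<partial>lborel) = (\<integral>\<^sup>+x. \<integral>\<^sup>+y. F (Complex x y) \<partial>lborel \<partial>lborel)"
proof -
  have "(\<integral>\<^sup>+\<zeta>. F \<zeta> \<partial>lborel) = (\<integral>\<^sup>+p. F (case p of (x, y) \<Rightarrow> Complex x y) \<partial>(lborel \<Otimes>\<^sub>M lborel))"
    by (subst lborel_complex_prod, subst nn_integral_distr[OF measurable_Complex]) (use F in auto)
  also have "\<dots> = (\<integral>\<^sup>+x. \<integral>\<^sup>+y. F (Complex x y) \<partial>lborel \<partial>lborel)"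
    using lborel.nn_integral_fst[OF measurable_compose[OF measurable_Complex F], symmetric] by simp
  finally show ?thesis .
qed

context profile
begin

text \<open>The integrand is the derivative of \<open>2 * (\<gamma> (2 * x + e))\<^sup>2\<close>,
  whose limits are 2 and \<open>2 * (m + 1)\<^sup>2\<close>. With \<open>x = ln |w|\<close> the
  argument is \<open>s\<close>; the weight \<open>e = ln h\<close> of the base point is a mere
  translation.\<close>

lemma nn_integral_profile:
  "(\<integral>\<^sup>+x. ennreal (8 * \<gamma> (2 * x + e) * \<phi> (2 * x + e)) \<partial>lborel) = ennreal (2 * ((m + 1)\<^sup>2 - 1))"
proof -
  let ?f = "\<lambda>x. 8 * \<gamma> (2 * x + e) * \<phi> (2 * x + e)"
  let ?F = "\<lambda>x. 2 * (\<gamma> (2 * x + e))\<^sup>2"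
  have aff: "((\<lambda>x. 2 * x + e) has_real_derivative 2) (at x)" for x :: real
    by (auto intro!: derivative_eq_intros)
  have F: "(?F has_real_derivative ?f x) (at x)" for x
    by (rule derivative_eq_intros DERIV_chain2[OF deriv_\<gamma> aff] refl)+ simp
  have c: "isCont ?f x" for x
    using DERIV_isCont[OF DERIV_chain2[OF deriv_\<gamma> aff]]
        DERIV_isCont[OF DERIV_chain2[OF deriv_\<phi> aff]]
    by (intro continuous_intros) auto
  have nn: "?f x \<ge> 0" for x using \<gamma>_pos[of "2*x+e"] \<phi>_pos[of "2*x+e"] by simp
  have tb: "filterlim (\<lambda>x::real. 2 * x + e) at_bot at_bot"
      "filterlim (\<lambda>x::real. 2 * x + e) at_top at_top"
    by real_asymp+
  have lb: "(?F \<longlongrightarrow> 2 * 1\<^sup>2) at_bot" and lt: "(?F \<longlongrightarrow> 2 * (m+1)\<^sup>2) at_top"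
    by (intro tendsto_intros filterlim_compose[OF lim_bot tb(1)]
        filterlim_compose[OF lim_top tb(2)])+
  have LB: "((?F \<circ> real_of_ereal) \<longlongrightarrow> 2 * 1\<^sup>2) (at_right (-\<infinity>))"
    unfolding ereal_tendsto_simps1(4) by (rule lb)
  have LT: "((?F \<circ> real_of_ereal) \<longlongrightarrow> 2 * (m+1)\<^sup>2) (at_left \<infinity>)"
    unfolding ereal_tendsto_simps1(3) by (rule lt)
  \<comment> \<open>For a nonnegative integrand the fundamental theorem on the whole line yields
    integrability together with the value.\<close>
  have "set_integrable lborel (einterval (-\<infinity>) \<infinity>) ?f \<and> (LBINT x=-\<infinity>..\<infinity>. ?f x) = 2 * (m+1)\<^sup>2 - 2 * 1\<^sup>2"
    by (intro conjI interval_integral_FTC_nonneg[where F = ?F, OF _ F c _ LB LT]) (use nn in auto)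
  then have int: "set_integrable lborel (einterval (-\<infinity>) \<infinity>) ?f"
    and I: "(LBINT x=-\<infinity>..\<infinity>. ?f x) = 2 * (m+1)\<^sup>2 - 2 * 1\<^sup>2" by blast+
  have e: "einterval (-\<infinity>) \<infinity> = UNIV" by (auto simp: einterval_def)
  have "integrable lborel ?f" using int unfolding e set_integrable_def by simp
  moreover have "(LINT x|lborel. ?f x) = 2 * (m+1)\<^sup>2 - 2 * 1\<^sup>2"
    using I unfolding interval_lebesgue_integral_def set_lebesgue_integral_def e by simp
  ultimately show ?thesis
    using nn by (subst nn_integral_eq_integral) auto
qed

text \<open>The integral of \<open>dens e\<close> over a punctured fibre, the same for every
  \<open>e\<close>: the total from \<open>nn_integral_profile\<close> times the width
  \<open>2 * pi\<close> of the strip.\<close>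

definition "vol_const = 4 * pi * ((m + 1)\<^sup>2 - 1)"

lemma vol_const_pos: "vol_const > 0"
proof -
  have "(m + 1)\<^sup>2 > 1" using m by (simp add: power2_eq_square algebra_simps add_pos_pos)
  then show ?thesis by (simp add: vol_const_def)
qed

lemma continuous_\<phi>: "continuous_on UNIV \<phi>"
  using deriv_\<phi> DERIV_isCont by (blast intro: continuous_at_imp_continuous_on)

text \<open>The volume density with the base factor \<open>Kc\<close> split off. The 8 is the 4 of
  the passage to Lebesgue measure times the 2 in \<open>omega_sq\<close>.\<close>

definition dens :: "real \<Rightarrow> complex \<Rightarrow> real" where
  "dens e w = 8 * \<gamma> (ln ((cmod w)\<^sup>2) + e) * \<phi> (ln ((cmod w)\<^sup>2) + e) / (cmod w)\<^sup>2"

lemma dens_nonneg: "dens e w \<ge> 0"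
  using \<gamma>_pos \<phi>_pos by (simp add: dens_def less_imp_le)

lemma nn_integral_dens: "(\<integral>\<^sup>+w\<in>- {0}. ennreal (dens e w) \<partial>lborel) = ennreal vol_const"
proof -
  let ?S = "{\<zeta>. - pi < Im \<zeta> \<and> Im \<zeta> < pi}"
  have cont: "continuous_on (- {0}) (dens e)"
    unfolding dens_def[abs_def]
    by (intro continuous_intros continuous_on_compose2[OF continuous_\<gamma>]
        continuous_on_compose2[OF continuous_\<phi>]) auto
  define F where "F w = ennreal (indicator (- {0}) w *\<^sub>R dens e w)" for w
  have F: "F \<in> borel_measurable borel"
    unfolding F_def[abs_def] using borel_measurable_continuous_on_indicator[OF _ cont] by measurable
  have "(\<integral>\<^sup>+w\<in>- {0}. ennreal (dens e w) \<partial>lborel) = (\<integral>\<^sup>+w\<in>- {0}. F w \<partial>lborel)"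
    by (intro nn_integral_cong) (auto simp: F_def split: split_indicator)
  also have "\<dots> = (\<integral>\<^sup>+\<zeta>\<in>?S. F (exp \<zeta>) * ennreal ((cmod (exp \<zeta>))\<^sup>2) \<partial>lborel)"
    by (rule nn_integral_exp[OF F])
  also have "\<dots> = (\<integral>\<^sup>+\<zeta>. ennreal (8 * \<gamma> (2 * Re \<zeta> + e) * \<phi> (2 * Re \<zeta> + e)) * indicator ?S \<zeta> \<partial>lborel)"
  proof (intro nn_integral_cong)
    fix \<zeta> :: complex
    have "ln ((cmod (exp \<zeta>))\<^sup>2) = 2 * Re \<zeta>" by (simp add: ln_realpow)
    moreover have "(cmod (exp \<zeta>))\<^sup>2 \<noteq> 0" by simp
    ultimately have "dens e (exp \<zeta>) * (cmod (exp \<zeta>))\<^sup>2 = 8 * \<gamma> (2 * Re \<zeta> + e) * \<phi> (2 * Re \<zeta> + e)"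
      by (simp add: dens_def)
    then show "F (exp \<zeta>) * ennreal ((cmod (exp \<zeta>))\<^sup>2) * indicator ?S \<zeta> =
       ennreal (8 * \<gamma> (2 * Re \<zeta> + e) * \<phi> (2 * Re \<zeta> + e)) * indicator ?S \<zeta>"
      by (simp add: F_def ennreal_mult'[OF dens_nonneg, symmetric])
  qed
  also have "\<dots> = (\<integral>\<^sup>+x. \<integral>\<^sup>+y. ennreal (8 * \<gamma> (2 * x + e) * \<phi> (2 * x + e))
      * indicator {- pi<..<pi} y \<partial>lborel \<partial>lborel)"
  proof -
    have "continuous_on UNIV (\<lambda>\<zeta>. 8 * \<gamma> (2 * Re \<zeta> + e) * \<phi> (2 * Re \<zeta> + e))"
      by (intro continuous_intros continuous_on_compose2[OF continuous_\<gamma>]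
          continuous_on_compose2[OF continuous_\<phi>]) auto
    then have "(\<lambda>\<zeta>. 8 * \<gamma> (2 * Re \<zeta> + e) * \<phi> (2 * Re \<zeta> + e)) \<in> borel_measurable borel"
      by (rule borel_measurable_continuous_onI)
    moreover have "?S \<in> sets borel"
      by (intro borel_open open_Collect_conj open_Collect_less continuous_intros)
    ultimately have "(\<lambda>\<zeta>. ennreal (8 * \<gamma> (2 * Re \<zeta> + e) * \<phi> (2 * Re \<zeta> + e)) * indicator ?S \<zeta>)
        \<in> borel_measurable borel"
      by measurable
    then show ?thesis
      by (subst nn_integral_complex_prod) (auto intro!: nn_integral_cong split: split_indicator)
  qed
  also have "\<dots> = (\<integral>\<^sup>+x. ennreal (8 * \<gamma> (2 * x + e) * \<phi> (2 * x + e)) * ennreal (2 * pi) \<partial>lborel)"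
  proof (intro nn_integral_cong)
    fix x :: real
    have "emeasure lborel {- pi<..<pi} = ennreal (2 * pi)" by (subst emeasure_lborel_Ioo) simp_all
    then show "(\<integral>\<^sup>+y. ennreal (8 * \<gamma> (2 * x + e) * \<phi> (2 * x + e))
        * indicator {- pi<..<pi} y \<partial>lborel) =
        ennreal (8 * \<gamma> (2 * x + e) * \<phi> (2 * x + e)) * ennreal (2 * pi)"
      by (subst nn_integral_cmult_indicator) simp_all
  qed
  also have "\<dots> = ennreal (2 * ((m + 1)\<^sup>2 - 1)) * ennreal (2 * pi)"
  proof -
    have "continuous_on UNIV (\<lambda>x. 8 * \<gamma> (2 * x + e) * \<phi> (2 * x + e))"
      by (intro continuous_intros continuous_on_compose2[OF continuous_\<gamma>]
          continuous_on_compose2[OF continuous_\<phi>]) auto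
    then have "(\<lambda>x. 8 * \<gamma> (2 * x + e) * \<phi> (2 * x + e)) \<in> borel_measurable borel"
      by (rule borel_measurable_continuous_onI)
    then show ?thesis by (subst nn_integral_multc) (auto simp: nn_integral_profile)
  qed
  also have "\<dots> = ennreal vol_const"
    using vol_const_pos by (simp add: vol_const_def ennreal_mult'[symmetric] algebra_simps)
  finally show ?thesis .
qed

end

section \<open>Higher scalar curvature and the volume measure\<close>

context conical
begin

lemma ss_pnt:
  assumes "C \<in> charts E" "T \<in> trivs E" "p \<in> fst C" "p \<in> fst T" "w \<noteq> 0"
  shows "ln ((cmod w)\<^sup>2) + eta C T (snd C p) = s_fun E hn (pnt T False p w)"
  using s_fun_pnt[OF assms(2,4,5)] assms(1,3) by (simp add: eta_def)

lemma X_reg_R_dom: "x \<in> X_reg E \<Longrightarrow> \<exists>C T. C \<in> charts E \<and> T \<in> trivs E \<and> x \<in> R_dom E (C, T)"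
proof -
  assume x: "x \<in> X_reg E"
  obtain C T where CT: "C \<in> charts E" "X_proj E x \<in> fst C" "T \<in> trivs E" "X_proj E x \<in> fst T"
    using chart_cover triv_cover by blast
  obtain w where "w \<noteq> 0" "x = pnt T False (X_proj E x) w" using X_regE[OF x CT(3,4)] by blast
  then have "x \<in> R_dom E (C, T)" unfolding R_dom_eq[OF CT(3)] using CT by blast
  then show ?thesis using CT by blast
qed

lemma R_domE:
  assumes "x \<in> R_dom E (C, T)" "T \<in> trivs E"
  obtains p w where "x = pnt T False p w" "p \<in> fst C" "p \<in> fst T" "w \<noteq> 0"
  using assms R_dom_eq by blast

text \<open>The definition imposes one equation for each chart through the point. Since
  \<open>omega_sq\<close> does not vanish, each has exactly one solution; it depends on
  \<open>s\<close> only, so the equations agree, and a regular point lies in at least one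
  chart.\<close>

lemma is_scal_iff:
  assumes "x \<in> X_reg E"
  shows "is_higher_scalar_curvature E hn f x l \<longleftrightarrow> l = Lam (s_fun E hn x)"
proof -
  have *: "chern_top E hn f j (R_chart E j x) =
      of_real (l / (2 * (2 * pi)\<^sup>2)) * omega_sq E hn f j (R_chart E j x)
     \<longleftrightarrow> l = Lam (s_fun E hn x)" if jm: "j \<in> charts E \<times> trivs E" and xj: "x \<in> R_dom E j" for j
  proof -
    obtain C T where j: "j = (C, T)" "C \<in> charts E" "T \<in> trivs E" using jm by auto
    obtain p w where x: "x = pnt T False p w" "p \<in> fst C" "p \<in> fst T" "w \<noteq> 0"
      using R_domE[of x C T] xj j by blast
    have y: "(snd C p, w) \<in> snd C ` (fst C \<inter> fst T) \<times> (- {0})" using x by blast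
    note cc = curvature_in_chart[OF j(2,3) y, unfolded fst_conv snd_conv ss_pnt[OF j(2,3) x(2-4)],
        folded x(1)]
    have "omega_sq E hn f (C, T) (snd C p, w) \<noteq> 0"
      using cc(1) \<gamma>_pos[of "s_fun E hn x"] \<phi>_pos[of
          "s_fun E hn x"] kform_pos[OF j(2) x(2)] x(2,4) j(2)
      by (simp add: Kc_def)
    moreover have "R_chart E j x = (snd C p, w)" using R_chart_pnt[OF j(3) x(3)] x(1) j(1) by simp
    ultimately show ?thesis using cc(2) j(1) by (auto simp: of_real_eq_iff simp del: of_real_divide)
  qed
  obtain j where "j \<in> charts E \<times> trivs E" "x \<in> R_dom E j" using X_reg_R_dom[OF assms] by blast
  then show ?thesis
    unfolding is_higher_scalar_curvature_def using * by blast
qed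

lemma scal_ex1: "x \<in> X_reg E \<Longrightarrow> \<exists>!l. is_higher_scalar_curvature E hn f x l"
  by (simp add: is_scal_iff)

lemma higher_scal_eq: "x \<in> X_reg E \<Longrightarrow> higher_scal E hn f x = Lam (s_fun E hn x)"
  unfolding higher_scal_def by (rule the_equality) (simp_all only: is_scal_iff)

definition rho :: "('a, 'l) reg_index \<Rightarrow> 'l pt \<Rightarrow> real" where
  "rho j x = - 4 * Re (omega_sq E hn f j (R_chart E j x))"

definition qd :: "'a chart \<Rightarrow> ('a, 'l) triv \<Rightarrow> complex \<times> complex \<Rightarrow> real" where
  "qd C T y = Kc C (fst y) * dens (eta C T (fst y)) (snd y)"

lemma rho_inv:
  assumes C: "C \<in> charts E" and T: "T \<in> trivs E" and y: "y \<in> snd C ` (fst C \<inter> fst T) \<times> (- {0})"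
  shows "rho (C, T) (inv_into (R_dom E (C, T)) (R_chart E (C, T)) y) = qd C T y"
proof -
  have "R_chart E (C, T) (inv_into (R_dom E (C, T)) (R_chart E (C, T)) y) = y"
    by (rule f_inv_into_f) (use y R_chart_image[OF T] in blast)
  then show ?thesis
    unfolding rho_def qd_def dens_def
      using curvature_in_chart(1)[OF C T y] by (simp add: algebra_simps)
qed

lemma continuous_qd:
  assumes C: "C \<in> charts E" and T: "T \<in> trivs E"
  shows "continuous_on (snd C ` (fst C \<inter> fst T) \<times> (- {0})) (qd C T)"
proof -
  have e: "continuous_on (snd C ` (fst C \<inter> fst T)) (eta C T)"
    by (rule smooth_on_continuous[OF eta_smooth[OF C T]])
  have k: "continuous_on (snd C ` (fst C \<inter> fst T)) (Kc C)"
    unfolding Kc_def[abs_def]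
      by (rule continuous_on_subset[OF smooth_on_continuous[OF kform_smooth[OF C]]]) auto
  show ?thesis
    unfolding qd_def[abs_def] dens_def
    by (intro continuous_intros continuous_on_compose2[OF continuous_\<gamma>]
        continuous_on_compose2[OF continuous_\<phi>]
        continuous_on_compose2[OF e] continuous_on_compose2[OF k]) auto
qed

text \<open>The volume density on \<open>B\<close>, continued by 0 to a Borel function of two
  complex variables, so that Fubini applies.\<close>

definition gd :: "'a chart \<Rightarrow> ('a, 'l) triv \<Rightarrow> 'l pt set \<Rightarrow> complex \<times> complex \<Rightarrow> ennreal" where
  "gd C T B y = ennreal (indicator (R_chart E (C, T) ` B) y *\<^sub>R qd C T y)"

lemma gd_measurable:
  assumes "C \<in> charts E" "T \<in> trivs E" "B \<subseteq> R_dom E (C, T)" "R_chart E (C, T) ` B \<in> sets borel"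
  shows "gd C T B \<in> borel_measurable borel"
proof -
  have "continuous_on (R_chart E (C, T) ` B) (qd C T)"
    by (rule continuous_on_subset[OF continuous_qd[OF assms(1,2)]])
      (use assms(3) R_chart_image[OF assms(2), of C] in blast)
  then show ?thesis
    unfolding gd_def[abs_def]
      using borel_measurable_continuous_on_indicator[OF assms(4)] by measurable
qed

lemma nn_integral_rho:
  assumes "C \<in> charts E" "T \<in> trivs E" "B \<subseteq> R_dom E (C, T)" "R_chart E (C, T) ` B \<in> sets borel"
  shows "(\<integral>\<^sup>+ y \<in> R_chart E (C, T) ` B. ennreal (rho (C, T) (inv_into (R_dom E (C, T))
      (R_chart E (C, T)) y)) \<partial>lborel)
     = (\<integral>\<^sup>+z. \<integral>\<^sup>+w. gd C T B (z, w) \<partial>lborel \<partial>lborel)"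
proof -
  have "(\<integral>\<^sup>+ y \<in> R_chart E (C, T) ` B. ennreal (rho (C, T) (inv_into (R_dom E (C, T))
      (R_chart E (C, T)) y)) \<partial>lborel)
    = (\<integral>\<^sup>+y. gd C T B y \<partial>lborel)"
  proof (intro nn_integral_cong)
    fix y
    show "ennreal (rho (C, T) (inv_into (R_dom E (C, T)) (R_chart E (C, T)) y))
        * indicator (R_chart E (C, T) ` B) y = gd C T B y"
    proof (cases "y \<in> R_chart E (C, T) ` B")
      case True
      then have "y \<in> snd C ` (fst C \<inter> fst T) \<times> (- {0})"
        using assms(3) R_chart_image[OF assms(2), of C] by blast
      then show ?thesis using rho_inv[OF assms(1,2)] True by (simp add: gd_def)
    qed (simp add: gd_def)
  qed
  also have "\<dots> = (\<integral>\<^sup>+y. gd C T B y \<partial>(lborel \<Otimes>\<^sub>M lborel))" by (simp add: lborel_prod)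
  also have "\<dots> = (\<integral>\<^sup>+z. \<integral>\<^sup>+w. gd C T B (z, w) \<partial>lborel \<partial>lborel)"
    by (rule lborel.nn_integral_fst[symmetric]) (use gd_measurable[OF assms]
        in \<open>simp add: lborel_prod\<close>)
  finally show ?thesis .
qed

text \<open>\<open>s\<close> is the same in both trivializations. The squared modulus of
  \<open>trn\<close> comes from the \<open>1 / (cmod w)\<^sup>2\<close> in \<open>dens\<close>, the
  squared derivative from \<open>kform_compat\<close>.\<close>

lemma gd_trans:
  assumes C: "C \<in> charts E" "C' \<in> charts E" and T: "T \<in> trivs E" "T' \<in> trivs E"
    and B: "B \<subseteq> R_dom E (C, T)" "B \<subseteq> R_dom E (C', T')"
    and p: "p \<in> fst C" "p \<in> fst T" "p \<in> fst C'" "p \<in> fst T'"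
  shows "gd C T B (snd C p, w) =
    gd C' T' B (snd C' p, trn T T' p * w) * ennreal ((cmod (trn T T' p))\<^sup>2) *
      ennreal ((cmod (deriv (\<lambda>z. snd C' (cinv C z)) (snd C p)))\<^sup>2)"
proof -
  have mem: "(snd D p, u) \<in> R_chart E (D, U) ` B \<longleftrightarrow> pnt U False p u \<in> B"
    if D: "D \<in> charts E" "U \<in> trivs E" "B \<subseteq> R_dom E (D, U)" "p \<in> fst D" "p \<in> fst U" for D U u
  proof
    assume "(snd D p, u) \<in> R_chart E (D, U) ` B"
    then obtain x where x: "x \<in> B" "R_chart E (D, U) x = (snd D p, u)" by auto
    then obtain q w where q: "x = pnt U False q w" "q \<in> fst D" "q \<in> fst U"
      using R_domE[of x D U] D by blast
    then have "snd D q = snd D p" "w = u" using x(2) R_chart_pnt[OF D(2) q(3)] by auto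
    then show "pnt U False p u \<in> B" using q x chart_inj[OF D(1) q(2) D(4)] by simp
  next
    assume "pnt U False p u \<in> B"
    then show "(snd D p, u) \<in> R_chart E (D, U) ` B"
      using R_chart_pnt[OF D(2,5), of D u] by (metis imageI)
  qed
  let ?g = "trn T T' p"
  have g: "?g \<noteq> 0" using trn(1)[OF T p(2,4)] .
  have pt: "pnt T False p w = pnt T' False p (?g * w)" by (rule pnt_trn(1)[OF T p(2,4)])
  show ?thesis
  proof (cases "pnt T False p w \<in> B")
    case False
    then show ?thesis
      using mem[OF C(1) T(1) B(1) p(1,2)] mem[OF C(2) T(2) B(2) p(3,4)] pt by (simp add: gd_def)
  next
    case True
    then have w: "w \<noteq> 0" using B(1) R_dom_def pnt_X_reg[OF T(1) p(2)] by blast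
    have s: "ln ((cmod w)\<^sup>2) + eta C T (snd C p) = ln ((cmod (?g * w))\<^sup>2) + eta C' T' (snd C' p)"
      using ss_pnt[OF C(1) T(1) p(1,2) w] ss_pnt[OF C(2) T(2) p(3,4), of "?g * w"] pt w g by simp
    have "qd C T (snd C p, w) = qd C' T' (snd C' p, ?g * w) * (cmod ?g)\<^sup>2 *
        (cmod (deriv (\<lambda>z. snd C' (cinv C z)) (snd C p)))\<^sup>2"
      unfolding qd_def fst_conv snd_conv dens_def s using C p kform_compat[OF C p(1,3)] g
      by (simp add: Kc_def norm_mult power_mult_distrib)
    moreover have "qd C' T' (snd C' p, ?g * w) \<ge> 0"
      using kform_pos[OF C(2) p(3)] dens_nonneg C p by (simp add: qd_def Kc_def)
    ultimately show ?thesis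
      using True mem[OF C(1) T(1) B(1) p(1,2)] mem[OF C(2) T(2) B(2) p(3,4)] pt
      by (simp add: gd_def ennreal_mult')
  qed
qed

lemma gd_zero: 
  assumes T: "T \<in> trivs E" and B: "B \<subseteq> R_dom E (C, T)" and "gd C T B (z, w) \<noteq> 0"
  shows "\<exists>p. z = snd C p \<and> pnt T False p w \<in> B \<and> p \<in> fst C \<and> p \<in> fst T"
proof -
  have "(z, w) \<in> R_chart E (C, T) ` B"
    using assms(3) by (auto simp: gd_def split: split_indicator_asm)
  then obtain x where x: "x \<in> B" "R_chart E (C, T) x = (z, w)" by auto
  then obtain q u where q: "x = pnt T False q u" "q \<in> fst C" "q \<in> fst T"
    using R_domE[of x C T] T B by blast
  then show ?thesis using x R_chart_pnt[OF T q(3)] by auto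
qed

text \<open>The change of coordinates is triangular: the new base coordinate depends on
  \<open>z\<close> alone, and the new fibre coordinate is a multiple of \<open>w\<close> for fixed
  \<open>z\<close>. A linear substitution in the fibre followed by \<open>base_change\<close>
  therefore does it, each in one complex variable.\<close>

lemma nn_integral_gd_trans:
  assumes C: "C \<in> charts E" "C' \<in> charts E" and T: "T \<in> trivs E" "T' \<in> trivs E"
    and B: "B \<subseteq> R_dom E (C, T)" "B \<subseteq> R_dom E (C', T')"
    and Bb: "R_chart E (C', T') ` B \<in> sets borel"
  shows "(\<integral>\<^sup>+z. \<integral>\<^sup>+w. gd C T B (z, w) \<partial>lborel \<partial>lborel) =
      (\<integral>\<^sup>+z. \<integral>\<^sup>+w. gd C' T' B (z, w) \<partial>lborel \<partial>lborel)"
proof -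
  let ?W = "fst C \<inter> fst T \<inter> fst C' \<inter> fst T'"
  define H where "H z = (\<integral>\<^sup>+w. gd C' T' B (z, w) \<partial>lborel)" for z
  have gm: "gd C' T' B \<in> borel_measurable (lborel \<Otimes>\<^sub>M lborel)"
    using gd_measurable[OF C(2) T(2) B(2) Bb] by (simp add: lborel_prod)
  have H: "H \<in> borel_measurable borel"
    using lborel.borel_measurable_nn_integral_fst[OF gm] by (simp add: H_def[abs_def])
  have inner: "(\<integral>\<^sup>+w. gd C T B (snd C p, w) \<partial>lborel) =
      H (snd C' p) * ennreal ((cmod (deriv (\<lambda>z. snd C' (cinv C z)) (snd C p)))\<^sup>2)" if p:
          "p \<in> ?W" for p
  proof -
    let ?g = "trn T T' p"
    have g: "?g \<noteq> 0" using trn(1)[OF T] p by auto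
    have m2: "(\<lambda>w. gd C' T' B (snd C' p, w)) \<in> borel_measurable borel"
      using measurable_compose[OF measurable_Pair1'[of "snd C' p" lborel lborel] gm] by simp
    have hom: "homeomorphism UNIV UNIV (\<lambda>w. ?g * w) (\<lambda>w. w / ?g)"
      using g by (intro homeomorphismI continuous_intros) auto
    have "H (snd C' p) = (\<integral>\<^sup>+w\<in>UNIV. gd C' T' B (snd C' p, w) \<partial>lborel)" by (simp add: H_def)
    also have "\<dots> = (\<integral>\<^sup>+w\<in>UNIV. gd C' T' B (snd C' p, ?g * w) * ennreal ((cmod (deriv (\<lambda>w. ?g * w)
        w))\<^sup>2) \<partial>lborel)"
      by (rule nn_integral_holomorphic_change[OF _ _ _ hom m2]) (auto intro: holomorphic_intros)
    also have "\<dots> = (\<integral>\<^sup>+w. gd C' T' B (snd C' p, ?g * w) * ennreal ((cmod ?g)\<^sup>2) \<partial>lborel)"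
    proof -
      have "deriv (\<lambda>w. ?g * w) w = ?g" for w
        by (rule DERIV_imp_deriv) (auto intro!: derivative_eq_intros)
      then show ?thesis by simp
    qed
    finally have Hp: "H (snd C' p) = (\<integral>\<^sup>+w. gd C' T' B (snd C' p, ?g * w) * ennreal ((cmod ?g)\<^sup>2)
        \<partial>lborel)" .
    have m3: "(\<lambda>w. gd C' T' B (snd C' p, ?g * w) * ennreal ((cmod ?g)\<^sup>2)) \<in> borel_measurable lborel"
    proof -
      have "(\<lambda>w. ?g * w) \<in> borel_measurable borel" by measurable
      from measurable_compose[OF this m2] show ?thesis by measurable
    qed
    show ?thesis
      unfolding Hp nn_integral_multc[OF m3, symmetric]
      by (intro nn_integral_cong gd_trans[OF C T B]) (use p in auto)
  qed
  \<comment> \<open>Over base points outside the overlap the inner integrand vanishes, which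
    restricts the outer integrals to the open set where \<open>base_change\<close> applies.\<close>
  have Wz: "z \<in> snd C ` ?W" if nonzero: "gd C T B (z, w) \<noteq> 0" for z w
  proof -
    obtain p where p: "z = snd C p" "pnt T False p w \<in> B" "p \<in> fst C" "p \<in> fst T"
      using gd_zero[OF T(1) B(1) nonzero] by blast
    have "pnt T False p w \<in> R_dom E (C', T')" using p(2) B(2) by (rule rev_subsetD)
    then obtain q u where q: "pnt T False p w = pnt T' False q u" "q \<in> fst C'" "q \<in> fst T'"
      by (rule R_domE[OF _ T(2)])
    have "p = q" by (rule pnt_eqD[OF T(1) p(4) T(2) q(3,1)])
    then show ?thesis using p(1,3,4) q(2,3) by simp
  qed
  have Wz': "z \<in> snd C' ` ?W" if nonzero: "gd C' T' B (z, w) \<noteq> 0" for z w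
  proof -
    obtain p where p: "z = snd C' p" "pnt T' False p w \<in> B" "p \<in> fst C'" "p \<in> fst T'"
      using gd_zero[OF T(2) B(2) nonzero] by blast
    have "pnt T' False p w \<in> R_dom E (C, T)" using p(2) B(1) by (rule rev_subsetD)
    then obtain q u where q: "pnt T' False p w = pnt T False q u" "q \<in> fst C" "q \<in> fst T"
      by (rule R_domE[OF _ T(1)])
    have "p = q" by (rule pnt_eqD[OF T(2) p(4) T(1) q(3,1)])
    then show ?thesis using p(1,3,4) q(2,3) by simp
  qed
  have "(\<integral>\<^sup>+z. H z \<partial>lborel) = (\<integral>\<^sup>+z\<in>snd C' ` ?W. H z \<partial>lborel)"
  proof (intro nn_integral_cong)
    fix z show "H z = H z * indicator (snd C' ` ?W) z"
    proof (cases "z \<in> snd C' ` ?W")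
      case False
      then have "gd C' T' B (z, w) = 0" for w using Wz' by blast
      then show ?thesis by (simp add: H_def)
    qed simp
  qed
  also have "\<dots> = (\<integral>\<^sup>+z\<in>snd C ` ?W. H (snd C' (cinv C z))
      * ennreal ((cmod (deriv (\<lambda>z. snd C' (cinv C z)) z))\<^sup>2) \<partial>lborel)"
    by (rule base_change[OF C _ _ _ H]) (use C T in \<open>auto intro!: chart_open triv_open\<close>)
  also have "\<dots> = (\<integral>\<^sup>+z. \<integral>\<^sup>+w. gd C T B (z, w) \<partial>lborel \<partial>lborel)"
  proof (intro nn_integral_cong)
    fix z show "H (snd C' (cinv C z)) * ennreal ((cmod (deriv (\<lambda>z. snd C' (cinv C z)) z))\<^sup>2)
        * indicator (snd C ` ?W) z =
       (\<integral>\<^sup>+w. gd C T B (z, w) \<partial>lborel)"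
    proof (cases "z \<in> snd C ` ?W")
      case True
      then obtain p where p: "z = snd C p" "p \<in> ?W" by blast
      then show ?thesis using inner[OF p(2)] C True by simp
    next
      case False
      then have "gd C T B (z, w) = 0" for w using Wz by blast
      then show ?thesis using False by simp
    qed
  qed
  finally show ?thesis by (simp add: H_def[abs_def])
qed

abbreviation "Xr \<equiv> subtopology (X_top E) (X_reg E)"

lemma topspace_Xr: "topspace Xr = X_reg E"
  using openin_subset[OF openin_X_reg] by (simp add: topspace_subtopology Int_absorb1)

lemma openin_Xr: "openin Xr U \<longleftrightarrow> openin (X_top E) U \<and> U \<subseteq> X_reg E"
  by (rule openin_open_subtopology[OF openin_X_reg])

lemma R_dom_subset: "R_dom E j \<subseteq> X_reg E" by (simp add: R_dom_def)

lemma R_open_iff: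
  assumes "C \<in> charts E" "T \<in> trivs E" "U \<subseteq> R_dom E (C, T)"
  shows "openin Xr U \<longleftrightarrow> open (R_chart E (C, T) ` U)"
proof -
  have "U \<subseteq> X_dom E (C, T, False)" "U \<subseteq> X_reg E" using assms(3) by (auto simp: R_dom_def)
  then show ?thesis
    unfolding openin_Xr
      using openin_X_chart[of "(C, T, False)" U] assms by (simp add: X_index_iff R_chart_def)
qed

text \<open>By induction over the generation of Borel sets. It is used to verify the axioms of
  \<open>density_charts\<close> in \<open>vol_charts\<close>, hence a proof outside that
  locale.\<close>

lemma R_image_borel:
  assumes j: "C \<in> charts E" "T \<in> trivs E" and B: "B \<in> borel_in Xr" "B \<subseteq> R_dom E (C, T)"
  shows "R_chart E (C, T) ` B \<in> sets borel"
proof -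
  interpret sigma_algebra "X_reg E" "borel_in Xr"
    using borel_in_sigma_algebra[of Xr] by (simp only: topspace_Xr)
  have "R_chart E (C, T) ` (B \<inter> R_dom E (C, T)) \<in> sets borel"
    using B(1) unfolding borel_in_def
  proof (induction rule: sigma_sets.induct)
    case (Basic U)
    have "openin Xr (R_dom E (C, T))"
      using R_open_iff[OF j, of "R_dom E (C, T)"] R_chart_image[OF j(2), of C] open_CT[OF j]
      by (auto intro!: open_Times simp: open_Compl)
    then have "openin Xr (U \<inter> R_dom E (C, T))" using Basic by auto
    then show ?case using R_open_iff[OF j, of "U \<inter> R_dom E (C, T)"] by auto
  next
    case (Compl U)
    have "(topspace Xr - U) \<inter> R_dom E (C, T) = R_dom E (C, T) - (U \<inter> R_dom E (C, T))"
      unfolding topspace_Xr using R_dom_subset[of "(C, T)"] by blast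
    then have "R_chart E (C, T) ` ((topspace Xr - U) \<inter> R_dom E (C, T)) =
        R_chart E (C, T) ` R_dom E (C, T) - R_chart E (C, T) ` (U \<inter> R_dom E (C, T))"
      using inj_on_image_set_diff[OF R_chart_inj[OF j], of "R_dom E (C, T)" "U \<inter> R_dom E (C, T)"]
        by auto
    moreover have "open (R_chart E (C, T) ` R_dom E (C, T))"
      unfolding R_chart_image[OF j(2)] by (intro open_Times open_CT j) (simp add: open_Compl)
    ultimately show ?case using Compl by auto
  next
    case (Union A)
    have "R_chart E (C, T) ` (\<Union> (range A) \<inter> R_dom E (C, T)) =
        (\<Union>n. R_chart E (C, T) ` (A n \<inter> R_dom E (C, T)))"
      by auto
    then show ?case using Union by auto
  qed simp
  then show ?thesis using B(2) by (simp add: Int_absorb2)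
qed

lemma vol_charts: "density_charts Xr (charts E \<times> trivs E) (R_dom E) (R_chart E) rho"
proof
  obtain J where J: "finite J" "J \<subseteq> charts E \<times> trivs E" "UNIV = (\<Union>(C, T)\<in>J. fst C \<inter> fst T)"
    using finite_cover by blast
  show "\<exists>J. finite J \<and> J \<subseteq> charts E \<times> trivs E \<and> topspace Xr \<subseteq> (\<Union>j\<in>J. R_dom E j)"
  proof (intro exI[of _ J] conjI J(1,2))
    show "topspace Xr \<subseteq> (\<Union>j\<in>J. R_dom E j)"
    proof
      fix x assume "x \<in> topspace Xr"
      then have x: "x \<in> X_reg E" using topspace_Xr by blast
      have "X_proj E x \<in> (\<Union>(C, T)\<in>J. fst C \<inter> fst T)" using J(3) UNIV_I by metis
      then obtain C T where CT: "(C, T) \<in> J" "X_proj E x \<in> fst C" "X_proj E x \<in> fst T" by blast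
      then have T: "T \<in> trivs E" using J(2) by auto
      obtain w where "w \<noteq> 0" "x = pnt T False (X_proj E x) w" using X_regE[OF x T CT(3)] by blast
      then have "x \<in> R_dom E (C, T)" unfolding R_dom_eq[OF T] using CT by blast
      then show "x \<in> (\<Union>j\<in>J. R_dom E j)" using CT(1) by blast
    qed
  qed
  fix j assume "j \<in> charts E \<times> trivs E"
  then obtain C T where j: "j = (C, T)" "C \<in> charts E" "T \<in> trivs E" by auto
  show "openin Xr (R_dom E j)"
    using R_open_iff[OF j(2,3), of "R_dom E j"] R_chart_image[OF j(3), of C] open_CT[OF j(2,3)] j(1)
    by (auto intro!: open_Times simp: open_Compl)
  show "inj_on (R_chart E j) (R_dom E j)" using R_chart_inj j by simp
  show "openin Xr U \<longleftrightarrow> open (R_chart E j ` U)" if "U \<subseteq> R_dom E j" for U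
    using R_open_iff[OF j(2,3)] j(1) that by simp
  show "continuous_on (R_chart E j ` R_dom E j) (\<lambda>y. rho j (inv_into (R_dom E j) (R_chart E j) y))"
    unfolding j(1) R_chart_image[OF j(3)]
    by (rule continuous_on_eq[OF continuous_qd[OF j(2,3)]]) (use rho_inv[OF j(2,3)] in simp)
  fix j' B assume "j' \<in> charts E \<times> trivs E" and B: "B \<in> borel_in Xr" "B \<subseteq> R_dom E j"
      "B \<subseteq> R_dom E j'"
  then obtain C' T' where j': "j' = (C', T')" "C' \<in> charts E" "T' \<in> trivs E" by auto
  note b = R_image_borel[OF j(2,3) B(1)] R_image_borel[OF j'(2,3) B(1)]
  show "(\<integral>\<^sup>+ y \<in> R_chart E j ` B. ennreal (rho j (inv_into (R_dom E j) (R_chart E j) y)) \<partial>lborel) =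
        (\<integral>\<^sup>+ y \<in> R_chart E j' ` B. ennreal (rho j' (inv_into (R_dom E j') (R_chart E j') y))
            \<partial>lborel)"
    unfolding j(1) j'(1)
    using nn_integral_rho[OF j(2,3)] nn_integral_rho[OF j'(2,3)] nn_integral_gd_trans[OF j(2)
        j'(2) j(3) j'(3)] B b j(1) j'(1)
    by simp
qed

lemma vol_ex1: "\<exists>!M. is_omega_sq_measure E hn f M"
  unfolding is_omega_sq_measure_def rho_def[abs_def, symmetric]
  by (rule density_charts.density_measure_ex1[OF vol_charts])

abbreviation "vol \<equiv> omega_sq_measure E hn f"

lemma is_vol: "is_density_measure Xr (charts E \<times> trivs E) (R_dom E) (R_chart E) rho vol"
proof -
  have "is_omega_sq_measure E hn f vol" unfolding omega_sq_measure_def by (rule theI'[OF vol_ex1])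
  then show ?thesis unfolding is_omega_sq_measure_def rho_def[abs_def, symmetric] .
qed

lemma vol_space: "space vol = X_reg E" and vol_sets: "sets vol = borel_in Xr"
  using is_vol topspace_Xr unfolding is_density_measure_def by auto

lemma continuous_borel_vimage:
  fixes F :: "'l pt \<Rightarrow> 'c::topological_space"
  assumes "continuous_map Xr euclidean F" "A \<in> sets borel"
  shows "F -` A \<inter> X_reg E \<in> borel_in Xr"
proof -
  interpret sigma_algebra "X_reg E" "borel_in Xr"
    using borel_in_sigma_algebra[of Xr] by (simp only: topspace_Xr)
  have "A \<in> sigma_sets UNIV {S. open S}" using assms(2) by (simp add: borel_def)
  then show ?thesis
  proof (induction rule: sigma_sets.induct)
    case (Basic U)
    then have "openin Xr {x \<in> X_reg E. F x \<in> U}"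
      using assms(1) unfolding continuous_map_def topspace_Xr by auto
    moreover have "{x \<in> X_reg E. F x \<in> U} = F -` U \<inter> X_reg E" by auto
    ultimately show ?case unfolding borel_in_def by (auto intro: sigma_sets.Basic)
  next
    case (Compl U)
    have "F -` (UNIV - U) \<inter> X_reg E = X_reg E - (F -` U \<inter> X_reg E)" by auto
    then show ?case using Compl by auto
  next
    case (Union A)
    have "F -` (\<Union> (range A)) \<inter> X_reg E = (\<Union>n. F -` A n \<inter> X_reg E)" by auto
    moreover have "(\<Union>n. F -` A n \<inter> X_reg E) \<in> borel_in Xr" using Union by (intro countable_UN) auto
    ultimately show ?case by simp
  qed simp
qed

lemma continuous_measurable_vol:
  fixes F :: "'l pt \<Rightarrow> 'c::topological_space"
  assumes "continuous_map Xr euclidean F"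
  shows "F \<in> measurable vol borel"
  by (rule measurableI) (use continuous_borel_vimage[OF assms] vol_space vol_sets in auto)

text \<open>The push-forward of the volume to the base is a constant multiple of the area:
  integrating over the fibre gives \<open>vol_const * Kc\<close>, and the area has the density
  \<open>2 * Kc\<close>.\<close>

lemma emeasure_vol_proj:
  assumes C: "C \<in> charts E" and T: "T \<in> trivs E" and B: "B \<in> sets borel" "B \<subseteq> fst C \<inter> fst T"
  shows "emeasure vol (X_proj E -` B \<inter> X_reg E) = ennreal (vol_const / 2) * emeasure area B"
proof -
  let ?P = "X_proj E -` B \<inter> X_reg E"
  have cp: "continuous_map Xr euclidean (X_proj E)"
    by (rule continuous_map_from_subtopology[OF continuous_X_proj])
  have P: "?P \<in> borel_in Xr" by (rule continuous_borel_vimage[OF cp B(1)])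
  have PR: "?P \<subseteq> R_dom E (C, T)"
  proof
    fix x assume x: "x \<in> ?P"
    then obtain w where "w \<noteq> 0" "x = pnt T False (X_proj E x) w"
      using X_regE[of x T] T B(2) by blast
    then show "x \<in> R_dom E (C, T)" unfolding R_dom_eq[OF T] using B(2) x by blast
  qed
  have mem: "(z, w) \<in> R_chart E (C, T) ` ?P \<longleftrightarrow> z \<in> snd C ` B \<and> w \<noteq> 0" for z w
  proof
    assume "(z, w) \<in> R_chart E (C, T) ` ?P"
    then obtain x where x: "x \<in> ?P" "(z, w) = R_chart E (C, T) x" by blast
    then obtain p u where p: "x = pnt T False p u" "p \<in> fst C" "p \<in> fst T" "u \<noteq> 0"
      using R_domE[of x C T] PR T by blast
    then have "X_proj E x = p" using X_proj_pnt[OF T] by simp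
    then show "z \<in> snd C ` B \<and> w \<noteq> 0" using x p R_chart_pnt[OF T p(3)] by auto
  next
    assume zw: "z \<in> snd C ` B \<and> w \<noteq> 0"
    then obtain p where p: "z = snd C p" "p \<in> B" by blast
    then have pT: "p \<in> fst T" using B(2) by blast
    have "pnt T False p w \<in> ?P" using X_proj_pnt[OF T pT] pnt_X_reg[OF T pT] p zw by simp
    then show "(z, w) \<in> R_chart E (C, T) ` ?P"
      using R_chart_pnt[OF T pT, of C w] p by (metis imageI)
  qed
  have im: "R_chart E (C, T) ` ?P \<in> sets borel" by (rule R_image_borel[OF C T P PR])
  have cB: "snd C ` B \<in> sets borel"
    using borel_image_homeomorphism[OF chart_hom[OF C]] B chart_open_image[OF C] by auto
  have "emeasure vol ?P = (\<integral>\<^sup>+z. \<integral>\<^sup>+w. gd C T ?P (z, w) \<partial>lborel \<partial>lborel)"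
    using is_vol C T P PR
      unfolding is_density_measure_def by (subst nn_integral_rho[OF C T PR im, symmetric]) auto
  also have "\<dots> = (\<integral>\<^sup>+z. ennreal (vol_const / 2) * (ennreal (2 * Kc C z) * indicator (snd C ` B) z)
      \<partial>lborel)"
  proof (intro nn_integral_cong)
    fix z
    show "(\<integral>\<^sup>+w. gd C T ?P (z, w) \<partial>lborel) = ennreal (vol_const / 2) * (ennreal (2 * Kc C z)
        * indicator (snd C ` B) z)"
    proof (cases "z \<in> snd C ` B")
      case True
      then obtain p where p: "z = snd C p" "p \<in> B" by blast
      then have K: "Kc C z > 0" using kform_pos[OF C, of p] B(2) C by (auto simp: Kc_def)
      have dm: "(\<lambda>w. ennreal (dens (eta C T z) w) * indicator (- {0}) w) \<in> borel_measurable lborel"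
      proof -
        have "continuous_on (- {0}) (dens (eta C T z))"
          unfolding dens_def[abs_def]
          by (intro continuous_intros continuous_on_compose2[OF continuous_\<gamma>]
              continuous_on_compose2[OF continuous_\<phi>]) auto
        then have "(\<lambda>w. indicator (- {0}) w *\<^sub>R dens (eta C T z) w) \<in> borel_measurable borel"
          by (intro borel_measurable_continuous_on_indicator) auto
        then have "(\<lambda>w. ennreal (indicator (- {0}) w *\<^sub>R dens (eta C T z) w))
            \<in> borel_measurable lborel"
          by measurable
        then show ?thesis
          by (rule measurable_cong[THEN iffD1, rotated]) (auto split: split_indicator)
      qed
      have "(\<integral>\<^sup>+w. gd C T ?P (z, w) \<partial>lborel) =
          (\<integral>\<^sup>+w. ennreal (Kc C z) * (ennreal (dens (eta C T z) w) * indicator (- {0}) w) \<partial>lborel)"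
        using K True mem[of z] dens_nonneg
        by (intro nn_integral_cong) (auto simp: gd_def qd_def ennreal_mult' less_imp_le split:
            split_indicator)
      also have "\<dots> = ennreal (Kc C z) * ennreal vol_const"
        by (subst nn_integral_cmult[OF dm]) (simp add: nn_integral_dens)
      also have "\<dots> = ennreal (vol_const / 2) * ennreal (2 * Kc C z)"
        using K vol_const_pos by (simp add: ennreal_mult'[symmetric] mult.commute)
      finally show ?thesis using True by simp
    next
      case False
      then have "gd C T ?P (z, w) = 0" for w using mem by (simp add: gd_def)
      then show ?thesis using False by simp
    qed
  qed
  also have "\<dots> = ennreal (vol_const / 2) * (\<integral>\<^sup>+z\<in>snd C ` B. ennreal (2 * Kc C z) \<partial>lborel)"
  proof (rule nn_integral_cmult)
    have "continuous_on (snd C ` B) (\<lambda>z. 2 * Kc C z)"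
      unfolding Kc_def
        by (intro continuous_intros continuous_on_subset[OF smooth_on_continuous[OF
            kform_smooth[OF C]]]) (use B in auto)
    then have "(\<lambda>z. indicator (snd C ` B) z *\<^sub>R (2 * Kc C z)) \<in> borel_measurable borel"
      by (rule borel_measurable_continuous_on_indicator[OF cB])
    then have "(\<lambda>z. ennreal (indicator (snd C ` B) z *\<^sub>R (2 * Kc C z))) \<in> borel_measurable lborel"
      by measurable
    then show "(\<lambda>z. ennreal (2 * Kc C z) * indicator (snd C ` B) z) \<in> borel_measurable lborel"
      by (rule measurable_cong[THEN iffD1, rotated]) (auto split: split_indicator)
  qed
  also have "(\<integral>\<^sup>+z\<in>snd C ` B. ennreal (2 * Kc C z) \<partial>lborel) = emeasure area B"
    using emeasure_area[OF C B(1)] B(2) by (simp add: Kc_def)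
  finally show ?thesis .
qed

lemma vol_total: "emeasure vol (X_reg E) = ennreal (vol_const * pi)"
proof -
  obtain J where J: "finite J" "J \<subseteq> charts E \<times> trivs E" "UNIV = (\<Union>(C, T)\<in>J. fst C \<inter> fst T)"
    using finite_cover by blast
  then obtain j :: "nat \<Rightarrow> 'a chart \<times> ('a, 'l) triv" and n where j: "J = j ` {..<n}"
    by (metis finite_imp_nat_seg_image_inj_on lessThan_def)
  \<comment> \<open>The finite cover is continued by empty sets to a sequence, for use with
    \<open>disjointed\<close>.\<close>
  define A where "A k = (if k < n then fst (fst (j k)) \<inter> fst (snd (j k)) else {})" for k
  let ?P = "\<lambda>B. X_proj E -` B \<inter> X_reg E"
  have jC: "fst (j k) \<in> charts E" "snd (j k) \<in> trivs E" if "k < n" for k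
  proof -
    have "j k \<in> charts E \<times> trivs E" using J(2) j that by blast
    then show "fst (j k) \<in> charts E" "snd (j k) \<in> trivs E" by (simp_all add: mem_Times_iff)
  qed
  have Ab: "A k \<in> sets borel" for k
    using jC by (auto simp: A_def intro!: borel_open open_Int chart_open triv_open)
  have AU: "(\<Union>k. A k) = UNIV"
  proof -
    have "p \<in> (\<Union>k. A k)" for p
    proof -
      have "p \<in> (\<Union>(C, T)\<in>J. fst C \<inter> fst T)" using J(3) UNIV_I by metis
      then obtain i where i: "i \<in> J" "p \<in> fst (fst i) \<inter> fst (snd i)" by (auto simp: case_prod_beta)
      then obtain k where "k < n" "i = j k" using j by auto
      then have "p \<in> A k" using i(2) by (simp add: A_def)
      then show ?thesis by blast
    qed
    then show ?thesis by blast
  qed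
  let ?D = "disjointed A"
  have Db: "?D k \<in> sets borel" for k
    using sets.range_disjointed_sets[of A borel] Ab by auto
  have cp: "continuous_map Xr euclidean (X_proj E)"
    by (rule continuous_map_from_subtopology[OF continuous_X_proj])
  have each: "emeasure vol (?P (?D k)) = ennreal (vol_const / 2) * emeasure area (?D k)" for k
  proof (cases "k < n")
    case True
    then show ?thesis
      using disjointed_subset[of A k] by (intro emeasure_vol_proj[OF jC] Db) (auto simp: A_def)
  next
    case False
    then have "?D k = {}" using disjointed_subset[of A k] by (simp add: A_def)
    then show ?thesis by simp
  qed
  have "\<exists>k. p \<in> ?D k" for p using UN_disjointed_eq[of A] AU by (metis UN_iff UNIV_I)
  then have "X_reg E = (\<Union>k. ?P (?D k))" by blast
  then have "emeasure vol (X_reg E) = emeasure vol (\<Union>k. ?P (?D k))" by simp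
  also have "\<dots> = suminf (\<lambda>k. emeasure vol (?P (?D k)))"
  proof (rule suminf_emeasure[symmetric])
    show "range (\<lambda>k. ?P (?D k)) \<subseteq> sets vol"
      using continuous_borel_vimage[OF cp Db] vol_sets by auto
    show "disjoint_family (\<lambda>k. ?P (?D k))"
      using disjoint_family_disjointed[of A] by (fastforce simp: disjoint_family_on_def)
  qed
  also have "\<dots> = ennreal (vol_const / 2) * suminf (\<lambda>k. emeasure area (?D k))"
    unfolding each by (rule ennreal_suminf_cmult)
  also have "suminf (\<lambda>k. emeasure area (?D k)) = emeasure area (\<Union>k. ?D k)"
    by (rule suminf_emeasure) (use Db area_space disjoint_family_disjointed in auto)
  also have "(\<Union>k. ?D k) = UNIV" using UN_disjointed_eq[of A] AU by simp
  also have "ennreal (vol_const / 2) * emeasure area UNIV = ennreal (vol_const * pi)"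
    using vol_const_pos by (simp add: area_total ennreal_mult'[symmetric])
  finally show ?thesis .
qed

lemma finite_vol: "finite_measure vol"
  by (rule finite_measureI) (simp add: vol_space vol_total)

lemma measure_vol_pos: "measure vol (X_reg E) > 0"
  using vol_total vol_const_pos by (simp add: measure_def)

end

section \<open>Uniqueness of the measure of a current\<close>

definition bump :: "real \<Rightarrow> real" where
  "bump t = (if t > 0 then exp (- (1 / t)) else 0)"

lemma poly_div_exp_tendsto_0: "((\<lambda>x. poly p x / exp x) \<longlongrightarrow> (0::real)) at_top"
proof -
  have "((\<lambda>x. \<Sum>i\<le>Polynomial.degree p. Polynomial.coeff p i * (x ^ i / exp x))
      \<longlongrightarrow> (\<Sum>i\<le>Polynomial.degree p. Polynomial.coeff p i * (0::real))) at_top"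
    by (intro tendsto_sum tendsto_mult tendsto_const tendsto_power_div_exp_0)
  then show ?thesis by (simp add: poly_altdef sum_divide_distrib)
qed

text \<open>For \<open>t > 0\<close> every derivative is a polynomial in \<open>1 / t\<close> times
  \<open>exp (- (1 / t))\<close>, and the exponential wins as \<open>t\<close> decreases to
  0.\<close>

lemma smooth_bump: "smooth_on UNIV bump"
proof -
  \<comment> \<open>\<open>[:0, 0, 1:]\<close> is the square of the variable: differentiating
    \<open>p (1 / t) * exp (- (1 / t))\<close> gives \<open>(p - p') (1 / t)\<close> times
    \<open>1 / t\<^sup>2\<close> times the exponential.\<close>
  define P :: "nat \<Rightarrow> real poly" where "P = rec_nat 1 (\<lambda>_ p. [:0, 0, 1:] * (p - pderiv p))"
  have P0: "P 0 = 1" and PS: "P (Suc n) = [:0, 0, 1:] * (P n - pderiv (P n))" for n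
    by (simp_all add: P_def)
  define D where "D n t = (if t > 0 then poly (P n) (1 / t) * exp (- (1 / t))
      else 0)" for n and t :: real
  have D: "(D n has_real_derivative D (Suc n) t) (at t)" for n t
  proof -
    consider "t > 0" | "t < 0" | "t = 0" by linarith
    then show ?thesis
    proof cases
      case 1
      have "((\<lambda>t. poly (P n) (1 / t) * exp (- (1 / t))) has_real_derivative D (Suc n) t) (at t)"
        using 1 by (auto intro!: derivative_eq_intros DERIV_chain2[OF poly_DERIV]
            simp: D_def PS field_simps power2_eq_square)
      then show ?thesis
        by (rule has_field_derivative_transform_within_open[of _ _ _
            "{0<..}"]) (use 1 in \<open>auto simp: D_def\<close>)
    next
      case 2
      have "((\<lambda>t. 0) has_real_derivative D (Suc n) t) (at t)" using 2 by (simp add: D_def)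
      then show ?thesis
        by (rule has_field_derivative_transform_within_open[of _ _ _
            "{..<0}"]) (use 2 in \<open>auto simp: D_def\<close>)
    next
      case 3
      have l: "((\<lambda>y. (D n y - D n 0) / (y - 0)) \<longlongrightarrow> 0) (at_left 0)"
        by (rule tendsto_eventually) (auto simp: D_def eventually_at_filter)
      \<comment> \<open>From the right the difference quotient at 0 is \<open>D n y / y\<close>;
        dividing by \<open>y\<close> multiplies the polynomial by its variable, hence
        \<open>[:0, 1:]\<close>.\<close>
      have "filterlim (\<lambda>y::real. 1 / y) at_top (at_right 0)"
        using filterlim_inverse_at_top_right by (simp add: inverse_eq_divide)
      from filterlim_compose[OF poly_div_exp_tendsto_0[of "[:0, 1:] * P n"] this]
      have "((\<lambda>y. poly ([:0, 1:] * P n) (1 / y) / exp (1 / y)) \<longlongrightarrow> 0) (at_right 0)" .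
      then have r: "((\<lambda>y. (D n y - D n 0) / (y - 0)) \<longlongrightarrow> 0) (at_right 0)"
        by (rule Lim_transform_eventually)
          (auto simp: eventually_at_filter D_def exp_minus divide_inverse mult_ac intro!:
              always_eventually)
      have "((\<lambda>y. (D n y - D n 0) / (y - 0)) \<longlongrightarrow> 0) (at 0)" using l r by (rule filterlim_split_at)
      then show ?thesis using 3 by (simp add: has_field_derivative_iff D_def)
    qed
  qed
  have "smooth_on UNIV (D 0)" by (rule smooth_on_real_chain) (use D in auto)
  moreover have "D 0 = bump" by (auto simp: D_def P0 bump_def)
  ultimately show ?thesis by simp
qed

lemma bump_pos_iff: "bump t > 0 \<longleftrightarrow> t > 0" and bump_nonneg: "bump t \<ge> 0"
  by (simp_all add: bump_def)

text \<open>Both conditions are local: differentiability is required at each point, and continuity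
  glues over two open sets.\<close>

lemma Ck_on_Un:
  assumes "open A" "open B" "Ck_on k A F" "Ck_on k B F"
  shows "Ck_on k (A \<union> B) F"
  using assms(3,4)
proof (induction k arbitrary: F)
  case 0
  then show ?case using assms by (simp add: continuous_on_open_Un)
qed auto

lemma smooth_on_Un:
  assumes "open A" "open B" "smooth_on A F" "smooth_on B F"
  shows "smooth_on (A \<union> B) F"
  unfolding smooth_on_def
  by (intro allI Ck_on_Un[OF assms(1,2)] smooth_on_Ck assms(3,4))

section \<open>Bump functions on the ruled surface and its Borel sets\<close>

context ruled
begin

lemma X_smoothI:
  assumes "\<And>C T b. C \<in> charts E \<Longrightarrow> T \<in> trivs E \<Longrightarrow>
    smooth_on (snd C ` (fst C \<inter> fst T) \<times> UNIV) (\<lambda>y. \<psi> (pnt T b (cinv C (fst y)) (snd y)))"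
  shows "X_smooth E \<psi>"
  unfolding X_smooth_def
proof
  fix i assume "i \<in> X_index E"
  then obtain C T b where i: "i = (C, T, b)" "C \<in> charts E" "T \<in> trivs E" using X_indexE by blast
  have "open (snd C ` (fst C \<inter> fst T) \<times> (UNIV :: complex set))"
    by (intro open_Times open_CT i open_UNIV)
  from smooth_on_cong[OF this _ assms[OF i(2,3), of b]]
  show "smooth_on (X_chart E i ` X_dom E i) (\<lambda>y. \<psi> (inv_into (X_dom E i) (X_chart E i) y))"
    unfolding i(1) X_chart_image[OF i(3)] using X_inv[OF i(2,3)] by fastforce
qed

lemma X_smoothD:
  assumes "X_smooth E \<psi>" and i: "C \<in> charts E" "T \<in> trivs E"
  shows "smooth_on (snd C ` (fst C \<inter> fst T) \<times> UNIV) (\<lambda>y. \<psi> (pnt T b (cinv C (fst y)) (snd y)))"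
proof -
  have "(C, T, b) \<in> X_index E" using i by (simp add: X_index_iff)
  then have s: "smooth_on (snd C ` (fst C \<inter> fst T) \<times> UNIV) (\<lambda>y. \<psi> (inv_into (X_dom E (C, T, b))
      (X_chart E (C, T, b)) y))"
    using assms(1) X_chart_image[OF i(2), of C b] unfolding X_smooth_def by metis
  have "open (snd C ` (fst C \<inter> fst T) \<times> (UNIV :: complex set))"
    by (intro open_Times open_CT i open_UNIV)
  from smooth_on_cong[OF this _ s] show ?thesis using X_inv[OF i] by fastforce
qed

lemma X_smooth_compose:
  assumes "X_smooth E \<psi>" "smooth_on UNIV G"
  shows "X_smooth E (\<lambda>x. G (\<psi> x))"
proof (rule X_smoothI)
  fix C T b assume i: "C \<in> charts E" "T \<in> trivs E"
  show "smooth_on (snd C ` (fst C \<inter> fst T) \<times> UNIV) (\<lambda>y. G (\<psi> (pnt T b (cinv C (fst y)) (snd y))))"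
    by (rule smooth_on_compose_real[OF _ assms(2) X_smoothD[OF assms(1) i]])
        (auto intro!: open_Times open_CT i)
qed

lemma X_smooth_mult:
  assumes "X_smooth E \<psi>" "X_smooth E \<psi>'"
  shows "X_smooth E (\<lambda>x. \<psi> x * \<psi>' x)"
proof (rule X_smoothI)
  fix C T b assume i: "C \<in> charts E" "T \<in> trivs E"
  show "smooth_on (snd C ` (fst C \<inter> fst T) \<times> UNIV) (\<lambda>y. \<psi> (pnt T b (cinv C (fst y)) (snd y))
      * \<psi>' (pnt T b (cinv C (fst y)) (snd y)))"
    by (rule smooth_on_mult[OF _ X_smoothD[OF assms(1) i] X_smoothD[OF assms(2) i]])
        (auto intro!: open_Times open_CT i)
qed

lemma X_smooth_const: "X_smooth E (\<lambda>_. c)"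
  by (rule X_smoothI) simp

lemma X_smooth_continuous: "X_smooth E \<psi> \<Longrightarrow> continuous_map (X_top E) euclideanreal \<psi>"
  by (rule continuous_map_X) (intro smooth_on_continuous X_smoothD)

text \<open>A Hausdorff argument: a compact set in a chart stays closed in the whole surface. The
  complement is covered by the points over the complement of the compact set \<open>Q\<close>, by
  the points of the chart off the ball, and by a neighbourhood \<open>N\<close> of the points in
  these fibres that the chart misses.\<close>

lemma closedin_chart_ball:
  assumes i: "C \<in> charts E" "T \<in> trivs E"
    and sub: "cball c r \<subseteq> snd C ` (fst C \<inter> fst T) \<times> (UNIV :: complex set)"
  shows "openin (X_top E) (X_set E - {x \<in> X_dom E (C, T, b). X_chart E (C, T, b) x \<in> cball c r})"
    (is "openin _ (_ - ?K)")
proof -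
  let ?i = "(C, T, b)" and ?j = "(C, T, \<not> b)"
  have ij: "?i \<in> X_index E" "?j \<in> X_index E" using i by (simp_all add: X_index_iff)
  define Q where "Q = cinv C ` fst ` cball c r"
  have fs: "fst ` cball c r \<subseteq> snd C ` (fst C \<inter> fst T)" using sub by auto
  have Qs: "Q \<subseteq> fst C \<inter> fst T"
  proof
    fix q assume "q \<in> Q"
    then obtain z where z: "z \<in> fst ` cball c r" "q = cinv C z" unfolding Q_def by blast
    then have "z \<in> snd C ` (fst C \<inter> fst T)" using fs by (elim subsetD)
    then obtain p where "z = snd C p" "p \<in> fst C \<inter> fst T" by (elim imageE)
    then show "q \<in> fst C \<inter> fst T" using z(2) i(1) by simp
  qed
  have "compact Q" unfolding Q_def
  proof (intro compact_continuous_image)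
    show "continuous_on (fst ` cball c r) (cinv C)"
    proof (rule continuous_on_subset)
      show "continuous_on (snd C ` fst C) (cinv C)"
        using chart_hom[OF i(1)] by (simp add: homeomorphism_def)
      show "fst ` cball c r \<subseteq> snd C ` fst C" using fs by blast
    qed
  qed (auto intro: continuous_intros)
  then have "closed Q" by (rule compact_imp_closed)
  then have U1: "openin (X_top E) {x \<in> X_set E. X_proj E x \<in> - Q}"
    using continuous_X_proj unfolding continuous_map_def topspace_X by auto
  have "X_chart E ?i ` (X_dom E ?i - ?K) = X_chart E ?i ` X_dom E ?i - cball c r" by auto
  then have "open (X_chart E ?i ` (X_dom E ?i - ?K))" using X_chart_image_open[OF ij(1)] by auto
  then have U2: "openin (X_top E) (X_dom E ?i - ?K)"
    using openin_X_chart[OF ij(1), of "X_dom E ?i - ?K"] by auto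
  \<comment> \<open>\<open>R\<close> bounds the fibre coordinate on the ball. The coordinate of the
    other flag is its reciprocal, so \<open>cmod u < 1 / (R + 1)\<close> keeps \<open>N\<close> away
    from the ball.\<close>
  obtain R where R: "R > 0" "\<And>y. y \<in> cball c r \<Longrightarrow> norm y \<le> R"
    using bounded_cball[of c r] unfolding bounded_pos by blast
  define N where "N = {pnt T (\<not> b) q u | q u. q \<in> fst C \<inter> fst T \<and> u \<in> ball 0 (1 / (R + 1))}"
  have Ns: "N \<subseteq> X_dom E ?j" unfolding N_def X_dom_eq[OF i(2)] by blast
  have "X_chart E ?j ` N = snd C ` (fst C \<inter> fst T) \<times> ball 0 (1 / (R + 1))"
  proof (intro equalityI subsetI)
    fix y assume "y \<in> X_chart E ?j ` N"
    then show "y \<in> snd C ` (fst C \<inter> fst T) \<times> ball 0 (1 / (R + 1))"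
      unfolding N_def by (auto simp: X_chart_pnt[OF i(2)])
  next
    fix y assume "y \<in> snd C ` (fst C \<inter> fst T) \<times> ball (0::complex) (1 / (R + 1))"
    then have "fst y \<in> snd C ` (fst C \<inter> fst T)" and u: "snd y \<in> ball 0 (1 / (R + 1))"
      by (simp_all add: mem_Times_iff)
    then obtain q where q: "fst y = snd C q" "q \<in> fst C \<inter> fst T" by (elim imageE)
    then have "y = X_chart E ?j (pnt T (\<not> b) q (snd y))"
      by (simp add: X_chart_pnt[OF i(2)] prod_eq_iff)
    moreover have "pnt T (\<not> b) q (snd y) \<in> N" unfolding N_def using q u by blast
    ultimately show "y \<in> X_chart E ?j ` N" by (rule image_eqI)
  qed
  then have "open (X_chart E ?j ` N)" using open_CT[OF i] by (auto intro!: open_Times)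
  then have U3: "openin (X_top E) N" using openin_X_chart[OF ij(2) Ns] by simp
  have NK: "x \<notin> ?K" if "x \<in> N" for x
  proof
    assume K: "x \<in> ?K"
    obtain q u where q: "x = pnt T (\<not> b) q u" "q \<in> fst C \<inter> fst T" "u \<in> ball 0 (1 / (R + 1))"
      using \<open>x \<in> N\<close> unfolding N_def by blast
    have qT: "q \<in> fst T" using q by simp
    have "x \<in> X_dom E ?i" using K by simp
    then have u: "u \<noteq> 0" using pnt_X_dom[OF i(2) qT i(2), of "\<not> b" u C b] q(1) by simp
    have "x = pnt T b q (1 / u)" using pnt_flip[OF i(2) qT u, of "\<not> b"] q(1) by simp
    then have "(snd C q, 1 / u) \<in> cball c r" using K X_chart_pnt[OF i(2) qT] by simp
    then have "norm (snd C q, 1 / u) \<le> R" by (rule R)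
    then have "cmod (1 / u) \<le> R" by (metis norm_snd_le order_trans snd_conv)
    moreover have "cmod u < 1 / (R + 1)" using q(3) by simp
    ultimately show False using u R(1)
      by (simp add: norm_divide field_simps) (smt (verit)
          mult_left_mono norm_ge_zero zero_less_norm_iff)
  qed
  have "X_set E - ?K = {x \<in> X_set E. X_proj E x \<in> - Q} \<union> ((X_dom E ?i - ?K) \<union> N)"
  proof (intro equalityI subsetI)
    fix x assume x: "x \<in> X_set E - ?K"
    show "x \<in> {x \<in> X_set E. X_proj E x \<in> - Q} \<union> ((X_dom E ?i - ?K) \<union> N)"
    proof (cases "X_proj E x \<in> Q \<and> x \<notin> X_dom E ?i")
      case True
      have "x \<in> X_set E" using x by simp
      then obtain T' b' p w where p: "x = pnt T' b' p w" "T' \<in> trivs E" "p \<in> fst T'"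
        unfolding X_set_eq by blast
      have pQ: "p \<in> fst C \<inter> fst T" using True X_proj_pnt[OF p(2,3)] p(1) Qs by auto
      have "b' \<noteq> b \<and> w = 0" using True pnt_X_dom[OF p(2,3) i(2), of b' w C b] p(1) pQ by auto
      then have "x = pnt T (\<not> b) p 0"
        using pnt_0_trn[OF p(2) i(2) p(3), of b'] pQ p(1) by (cases b; cases b') auto
      moreover have "(0::complex) \<in> ball 0 (1 / (R + 1))" using R(1) by simp
      ultimately have "x \<in> N" unfolding N_def using pQ by blast
      then show ?thesis by blast
    qed (use x in auto)
  next
    fix x assume "x \<in> {x \<in> X_set E. X_proj E x \<in> - Q} \<union> ((X_dom E ?i - ?K) \<union> N)"
    moreover have "X_proj E x \<in> Q" if "x \<in> ?K"
    proof -
      have "x \<in> X_dom E ?i" using that by simp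
      then obtain p w where p: "x = pnt T b p w" "p \<in> fst C" "p \<in> fst T"
        unfolding X_dom_eq[OF i(2)] by blast
      have "(snd C p, w) \<in> cball c r" using that X_chart_pnt[OF i(2) p(3)] p(1) by simp
      then have "cinv C (fst (snd C p, w)) \<in> Q" unfolding Q_def by blast
      then show ?thesis using X_proj_pnt[OF i(2) p(3)] p i by simp
    qed
    ultimately show "x \<in> X_set E - ?K"
      using NK X_dom_subset[OF ij(1)] X_dom_subset[OF ij(2)] Ns by blast
  qed
  then show ?thesis using U1 U2 U3 by (simp add: openin_Un)
qed

text \<open>A bump in one chart, extended by 0. In any other chart it is smooth on the overlap, as a
  composite with \<open>tau\<close>, and 0 off the closed ball. By
  \<open>closedin_chart_ball\<close> the second region is open too, and the two regions cover the
  chart.\<close>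

lemma X_bump:
  assumes i: "C \<in> charts E" "T \<in> trivs E"
    and sub: "cball c r \<subseteq> snd C ` (fst C \<inter> fst T) \<times> (UNIV :: complex set)" and r: "r > 0"
  shows "\<exists>\<psi>. X_smooth E \<psi> \<and> (\<forall>x. \<psi> x \<ge> 0) \<and>
     {x \<in> X_set E. \<psi> x > 0} = {x \<in> X_dom E (C, T, b). X_chart E (C, T, b) x \<in> ball c r}"
proof -
  let ?i = "(C, T, b)"
  have ix: "?i \<in> X_index E" using i by (simp add: X_index_iff)
  let ?K = "{x \<in> X_dom E ?i. X_chart E ?i x \<in> cball c r}"
  define \<psi> where "\<psi> x = (if x \<in> X_dom E ?i then bump (r\<^sup>2 - (X_chart E ?i x - c)
      \<bullet> (X_chart E ?i x - c)) else 0)" for x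
  have pos: "r\<^sup>2 - (y - c) \<bullet> (y - c) > 0 \<longleftrightarrow> y \<in> ball c r" for y :: "complex \<times> complex"
  proof -
    have "(y - c) \<bullet> (y - c) = (dist c y)\<^sup>2"
      by (simp only: dist_norm norm_minus_commute[of c y] power2_norm_eq_inner)
    moreover have "(dist c y)\<^sup>2 < r\<^sup>2 \<longleftrightarrow> dist c y < r"
    proof
      show "(dist c y)\<^sup>2 < r\<^sup>2 \<Longrightarrow> dist c y < r" by (rule power2_less_imp_less) (use r in simp_all)
      show "dist c y < r \<Longrightarrow> (dist c y)\<^sup>2 < r\<^sup>2" by (rule power_strict_mono) simp_all
    qed
    ultimately show ?thesis by simp
  qed
  have "X_smooth E \<psi>"
  proof (rule X_smoothI)
    fix C' T' and b' :: bool assume j: "C' \<in> charts E" "T' \<in> trivs E"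
    let ?j = "(C', T', b')"
    have jx: "?j \<in> X_index E" using j by (simp add: X_index_iff)
    let ?A = "snd C' ` (fst C' \<inter> fst T' \<inter> fst C \<inter> fst T) \<times> {w :: complex. b' \<noteq> b \<longrightarrow> w \<noteq> 0}"
    let ?B = "X_chart E ?j ` ((X_set E - ?K) \<inter> X_dom E ?j)"
    let ?t = "tau C' T' b' C T b"
    let ?F = "\<lambda>y. \<psi> (pnt T' b' (cinv C' (fst y)) (snd y))"
    have A: "open ?A" by (rule open_overlap[OF j i])
    have B: "open ?B" using closedin_chart_ball[OF i sub, of b] jx unfolding openin_X by blast
    have FA: "?F y = bump (r\<^sup>2 - (?t y - c) \<bullet> (?t y - c))" if y: "y \<in> ?A" for y
    proof -
      have "fst y \<in> snd C' ` (fst C' \<inter> fst T' \<inter> fst C \<inter> fst T)" "b' \<noteq> b \<longrightarrow> snd y \<noteq> 0"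
        using y by (simp_all add: mem_Times_iff)
      then obtain p where p: "fst y = snd C' p" "p \<in> fst C'" "p \<in> fst T'" "p \<in> fst C"
          "p \<in> fst T" and w: "b' \<noteq> b \<longrightarrow> snd y \<noteq> 0"
        by auto
      have c: "cinv C' (fst y) = p" using p j by simp
      have d: "pnt T' b' p (snd y) \<in> X_dom E ?i" using pnt_X_dom[OF j(2) p(3) i(2)] p w by simp
      have d': "pnt T' b' p (snd y) \<in> X_dom E ?j" using pnt_X_dom[OF j(2) p(3) j(2)] p w by simp
      have "X_chart E ?i (pnt T' b' p (snd y)) = ?t (X_chart E ?j (pnt T' b' p (snd y)))"
        by (rule X_chart_tau[OF j i d' d])
      also have "X_chart E ?j (pnt T' b' p (snd y)) = y"
        using X_chart_pnt[OF j(2) p(3)] p(1) by (simp add: prod_eq_iff)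
      finally show ?thesis unfolding c using d by (simp add: \<psi>_def)
    qed
    have "smooth_on ?A (\<lambda>y. (?t y - c) \<bullet> (?t y - c))"
    proof -
      have comp: "smooth_on ?A (\<lambda>y. Re (fst (?t y)))" "smooth_on ?A (\<lambda>y. Im (fst (?t y)))"
        "smooth_on ?A (\<lambda>y. Re (snd (?t y)))" "smooth_on ?A (\<lambda>y. Im (snd (?t y)))"
        using tau_csmooth[OF j i, of b' b] unfolding csmooth_def by auto
      have "smooth_on ?A (\<lambda>y. ((Re (fst (?t y)) - Re (fst c)) * (Re (fst (?t y)) - Re (fst c)) +
          (Im (fst (?t y)) - Im (fst c)) * (Im (fst (?t y)) - Im (fst c)))
         + ((Re (snd (?t y)) - Re (snd c)) * (Re (snd (?t y)) - Re (snd c)) + (Im (snd (?t y)) -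
             Im (snd c)) * (Im (snd (?t y)) - Im (snd c))))"
        by (intro smooth_on_add smooth_on_mult smooth_on_diff A comp smooth_on_const)
      then show ?thesis by (simp add: inner_prod_def inner_complex_def)
    qed
    then have "smooth_on ?A (\<lambda>y. bump (r\<^sup>2 - (?t y - c) \<bullet> (?t y - c)))"
      by (intro smooth_on_compose_real[OF A smooth_bump] smooth_on_diff[OF A smooth_on_const]) auto
    then have sA: "smooth_on ?A ?F" by (rule smooth_on_cong[OF A, rotated]) (simp add: FA)
    have "?F y = 0" if yB: "y \<in> ?B" for y
    proof -
      obtain x where x: "y = X_chart E ?j x" "x \<in> X_dom E ?j" "x \<notin> ?K" using yB by blast
      obtain p w where p: "x = pnt T' b' p w" "p \<in> fst C'" "p \<in> fst T'"
        using x(2) unfolding X_dom_eq[OF j(2)] by blast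
      have "pnt T' b' (cinv C' (fst y)) (snd y) = x"
        using p x(1) X_chart_pnt[OF j(2) p(3)] j by simp
      moreover have "\<psi> x = 0"
      proof (cases "x \<in> X_dom E ?i")
        case True
        then have "X_chart E ?i x \<notin> ball c r" using x(3) by auto
        then have "\<not> r\<^sup>2 - (X_chart E ?i x - c) \<bullet> (X_chart E ?i x - c) > 0" using pos by blast
        then show ?thesis by (simp add: \<psi>_def bump_def)
      qed (simp add: \<psi>_def)
      ultimately show ?thesis by simp
    qed
    then have sB: "smooth_on ?B ?F" by (intro smooth_on_cong[OF B _ smooth_on_const[of _ 0]]) simp
    have "snd C' ` (fst C' \<inter> fst T') \<times> UNIV \<subseteq> ?A \<union> ?B"
    proof
      fix y assume "y \<in> snd C' ` (fst C' \<inter> fst T') \<times> (UNIV :: complex set)"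
      then have "y \<in> X_chart E ?j ` X_dom E ?j" using X_chart_image[OF j(2), of C' b'] by simp
      then obtain x where x: "y = X_chart E ?j x" "x \<in> X_dom E ?j" by blast
      show "y \<in> ?A \<union> ?B"
      proof (cases "x \<in> ?K")
        case True
        then have "x \<in> X_dom E ?j \<inter> X_dom E ?i" using x by blast
        then have "y \<in> ?A" unfolding X_chart_overlap[OF j i, symmetric] x(1) by (rule imageI)
        then show ?thesis by blast
      next
        case False
        then have "y \<in> ?B" using x X_dom_subset[OF jx] by blast
        then show ?thesis by blast
      qed
    qed
    then show "smooth_on (snd C' ` (fst C' \<inter> fst T') \<times> UNIV) ?F"
      using smooth_on_subset[OF smooth_on_Un[OF A B sA sB]] by blast
  qed
  moreover have "\<forall>x. \<psi> x \<ge> 0" by (simp add: \<psi>_def bump_nonneg)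
  moreover have "{x \<in> X_set E. \<psi> x > 0} = {x \<in> X_dom E ?i. X_chart E ?i x \<in> ball c r}"
  proof -
    have "\<psi> x > 0 \<longleftrightarrow> x \<in> X_dom E ?i \<and> X_chart E ?i x \<in> ball c r" for x
      using pos[of "X_chart E ?i x"] by (auto simp: \<psi>_def bump_pos_iff)
    then show ?thesis using X_dom_subset[OF ix] by auto
  qed
  ultimately show ?thesis by blast
qed

definition pos_sets :: "'l pt set set" where
  "pos_sets = {{x \<in> X_set E. \<psi> x > 0} | \<psi>. X_smooth E \<psi> \<and> (\<forall>x. \<psi> x \<ge> 0)}"

lemma pos_sets_open: "U \<in> pos_sets \<Longrightarrow> openin (X_top E) U"
proof -
  assume "U \<in> pos_sets"
  then obtain \<psi> where U: "U = {x \<in> X_set E. \<psi> x \<in> {0<..}}" and \<psi>: "X_smooth E \<psi>"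
    unfolding pos_sets_def by auto
  show "openin (X_top E) U"
    unfolding U topspace_X[symmetric]
    by (rule openin_continuous_map_preimage[OF X_smooth_continuous[OF \<psi>]]) simp
qed

text \<open>Inside a chart an open set is a union of balls, countably many by Lindelof, and
  \<open>X_bump\<close> makes each of them a positivity set; finitely many charts cover the
  surface.\<close>

lemma open_sigma_pos_sets:
  assumes W: "openin (X_top E) W"
  shows "W \<in> sigma_sets (X_set E) pos_sets"
proof -
  obtain J where J: "finite J" "J \<subseteq> charts E \<times> trivs E" "UNIV = (\<Union>(C, T)\<in>J. fst C \<inter> fst T)"
    using finite_cover by blast
  let ?I = "{(C, T, b) | C T (b :: bool). (C, T) \<in> J}"
  have fin: "finite ?I"
  proof -
    have "?I \<subseteq> (\<lambda>((C, T), b). (C, T, b)) ` (J \<times> UNIV)" by force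
    moreover have "finite ((\<lambda>((C, T), b :: bool). (C, T, b)) ` (J \<times> UNIV))" using J(1) by simp
    ultimately show ?thesis by (rule finite_subset)
  qed
  have cov: "X_set E \<subseteq> (\<Union>i\<in>?I. X_dom E i)"
  proof
    fix x assume "x \<in> X_set E"
    then obtain T' b p w where x: "x = pnt T' b p w" "T' \<in> trivs E" "p \<in> fst T'"
      unfolding X_set_eq by blast
    have "p \<in> (\<Union>(C, T)\<in>J. fst C \<inter> fst T)" using J(3) UNIV_I by metis
    then obtain C T where CT: "(C, T) \<in> J" "p \<in> fst C" "p \<in> fst T" by blast
    then have "T \<in> trivs E" using J(2) by auto
    then have "x \<in> X_dom E (C, T, b)" using pnt_X_dom[OF x(2,3), of T b w C b] x(1) CT by simp
    then show "x \<in> (\<Union>i\<in>?I. X_dom E i)" using CT(1) by blast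
  qed
  have each: "W \<inter> X_dom E i \<in> sigma_sets (X_set E) pos_sets" if "i \<in> ?I" for i
  proof -
    obtain C T b where i: "i = (C, T, b)" "C \<in> charts E" "T \<in> trivs E" using \<open>i \<in> ?I\<close> J(2) by blast
    have ix: "i \<in> X_index E" using i by (simp add: X_index_iff)
    let ?G = "X_chart E i ` (W \<inter> X_dom E i)"
    have G: "open ?G" using W ix unfolding openin_X by blast
    \<comment> \<open>The closed balls are kept inside the image as well, since
      \<open>X_bump\<close> asks for that.\<close>
    let ?F = "{ball c r | c r. r > 0 \<and> cball c r \<subseteq> ?G}"
    obtain F' where F': "F' \<subseteq> ?F" "countable F'" "\<Union> F' = \<Union> ?F"
      by (rule Lindelof[of ?F]) auto
    have UF: "\<Union> ?F = ?G"
    proof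
      show "\<Union> ?F \<subseteq> ?G" using ball_subset_cball by fast
      show "?G \<subseteq> \<Union> ?F"
      proof
        fix y assume "y \<in> ?G"
        then obtain e where e: "e > 0" "cball y e \<subseteq> ?G" using G open_contains_cball by blast
        have "ball y e \<in> ?F" using e by blast
        then show "y \<in> \<Union> ?F" using e(1) by (intro UnionI[of "ball y e"]) auto
      qed
    qed
    have "W \<inter> X_dom E i = (\<Union>B\<in>F'. {x \<in> X_dom E i. X_chart E i x \<in> B})"
    proof (intro equalityI subsetI)
      fix x assume "x \<in> W \<inter> X_dom E i"
      then have "X_chart E i x \<in> ?G" by (rule imageI)
      then have "X_chart E i x \<in> \<Union> F'" unfolding F'(3) UF .
      then show "x \<in> (\<Union>B\<in>F'. {x \<in> X_dom E i. X_chart E i x \<in> B})" using \<open>x \<in> W \<inter> X_dom E i\<close> by blast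
    next
      fix x assume "x \<in> (\<Union>B\<in>F'. {x \<in> X_dom E i. X_chart E i x \<in> B})"
      then have "x \<in> X_dom E i" "X_chart E i x \<in> \<Union> F'" by blast+
      then have x: "x \<in> X_dom E i" "X_chart E i x \<in> ?G" unfolding F'(3) UF by simp_all
      then obtain x' where x': "x' \<in> W" "x' \<in> X_dom E i" "X_chart E i x = X_chart E i x'" by blast
      then have "x = x'" using inj_onD[OF X_inj[OF ix] x'(3) x(1) x'(2)] by simp
      then show "x \<in> W \<inter> X_dom E i" using x' by simp
    qed
    moreover have "{x \<in> X_dom E i. X_chart E i x \<in> B} \<in> pos_sets" if "B \<in> F'" for B
    proof -
      have "B \<in> ?F" using F'(1) \<open>B \<in> F'\<close> by (rule subsetD)
      then obtain c r where cr: "B = ball c r" "r > 0" "cball c r \<subseteq> ?G" by (elim CollectE exE conjE)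
      then have sub: "cball c r \<subseteq> snd C ` (fst C \<inter> fst T) \<times> (UNIV :: complex set)"
        using X_chart_image[OF i(3), of C b] i(1) by blast
      obtain \<psi> where "X_smooth E \<psi>" "\<forall>x. \<psi> x \<ge> 0"
        "{x \<in> X_set E. \<psi> x > 0} = {x \<in> X_dom E (C, T, b). X_chart E (C, T, b) x \<in> ball c r}"
        using X_bump[OF i(2,3) sub cr(2), of b] by blast
      then show ?thesis unfolding pos_sets_def i(1) cr(1) by blast
    qed
    ultimately show ?thesis
    proof -
      assume eq: "W \<inter> X_dom E i = (\<Union>B\<in>F'. {x \<in> X_dom E i. X_chart E i x \<in> B})"
        and ps: "\<And>B. B \<in> F' \<Longrightarrow> {x \<in> X_dom E i. X_chart E i x \<in> B} \<in> pos_sets"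
      show ?thesis unfolding eq
        by (rule sigma_sets_UNION) (use F'(2) ps in \<open>auto intro: sigma_sets.Basic\<close>)
    qed
  qed
  have "W \<subseteq> X_set E" using openin_subset[OF W] by (simp only: topspace_X)
  then have "W \<inter> (\<Union>i\<in>?I. X_dom E i) = W" using cov by (intro Int_absorb2) (rule order_trans)
  then have "W = \<Union> ((\<lambda>i. W \<inter> X_dom E i) ` ?I)" unfolding Int_UN_distrib by (rule sym)
  moreover have "\<Union> ((\<lambda>i. W \<inter> X_dom E i) ` ?I) \<in> sigma_sets (X_set E) pos_sets"
  proof (rule sigma_sets_UNION)
    show "countable ((\<lambda>i. W \<inter> X_dom E i) ` ?I)" by (rule countable_finite[OF finite_imageI[OF fin]])
    show "A \<in> sigma_sets (X_set E) pos_sets" if "A \<in> (\<lambda>i. W \<inter> X_dom E i) ` ?I" for A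
      using that each by (elim imageE) (simp only:)
  qed
  ultimately show ?thesis by simp
qed

lemma borel_X_pos_sets: "borel_in (X_top E) = sigma_sets (X_set E) pos_sets"
proof
  show "borel_in (X_top E) \<subseteq> sigma_sets (X_set E) pos_sets"
    unfolding borel_in_def topspace_X by (rule sigma_sets_mono) (use open_sigma_pos_sets in blast)
  show "sigma_sets (X_set E) pos_sets \<subseteq> borel_in (X_top E)"
    unfolding borel_in_def topspace_X
      by (rule sigma_sets_mono) (use pos_sets_open in \<open>auto intro: sigma_sets.Basic\<close>)
qed

text \<open>
  Positivity sets of smooth nonnegative functions form a generating \<open>\<pi>\<close>-system, and \<open>1 - exp\<close> of
  the multiples approximates their indicators.
\<close>

lemma represents_current_unique:
  assumes "represents_current E \<tau> M" "represents_current E \<tau> N"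
  shows "M = N"
proof (rule measure_eqI_generator_eq[where \<Omega> = "X_set E" and E = pos_sets and A = "\<lambda>_. X_set E"])
  have M: "finite_measure M" "space M = X_set E" "sets M = borel_in (X_top E)"
    "\<And>\<psi>. X_smooth E \<psi> \<Longrightarrow> integrable M \<psi> \<and> integral\<^sup>L M \<psi> = \<tau> \<psi>"
    and N: "finite_measure N" "space N = X_set E" "sets N = borel_in (X_top E)"
    "\<And>\<psi>. X_smooth E \<psi> \<Longrightarrow> integrable N \<psi> \<and> integral\<^sup>L N \<psi> = \<tau> \<psi>"
    using assms unfolding represents_current_def by auto
  show "Int_stable pos_sets"
  proof (rule Int_stableI)
    fix a b assume "a \<in> pos_sets" "b \<in> pos_sets"
    then obtain \<psi> \<psi>' where a: "a = {x \<in> X_set E. \<psi> x > 0}" "X_smooth E \<psi>" "\<forall>x. \<psi> x \<ge> 0"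
      and b: "b = {x \<in> X_set E. \<psi>' x > 0}" "X_smooth E \<psi>'" "\<forall>x. \<psi>' x \<ge> 0"
        unfolding pos_sets_def by auto
    have "a \<inter> b = {x \<in> X_set E. \<psi> x * \<psi>' x > 0}"
      using a b by (auto simp: zero_less_mult_iff) (metis not_less)+
    then show "a \<inter> b \<in> pos_sets" unfolding pos_sets_def
      using X_smooth_mult[OF a(2) b(2)] a(3) b(3) by (auto intro!: exI[of _ "\<lambda>x. \<psi> x * \<psi>' x"])
  qed
  show "pos_sets \<subseteq> Pow (X_set E)" unfolding pos_sets_def by auto
  show "sets M = sigma_sets (X_set E) pos_sets" "sets N = sigma_sets (X_set E) pos_sets"
    using M(3) N(3) borel_X_pos_sets by auto
  show "range (\<lambda>_. X_set E) \<subseteq> pos_sets"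
    unfolding pos_sets_def using X_smooth_const[of 1] by (auto intro!: exI[of _ "\<lambda>_. 1"])
  show "emeasure M (X_set E) \<noteq> \<infinity>" for i :: nat
    using finite_measure.emeasure_finite[OF M(1)] by simp
  show "emeasure M U = emeasure N U" if "U \<in> pos_sets" for U
  proof -
    obtain \<psi> where U: "U = {x \<in> X_set E. \<psi> x > 0}" and \<psi>: "X_smooth E \<psi>" "\<And>x. \<psi> x \<ge> 0"
      using \<open>U \<in> pos_sets\<close> unfolding pos_sets_def by auto
    define g where "g n x = 1 - exp (- real n * \<psi> x)" for n :: nat and x
    have gs: "X_smooth E (g n)" for n
    proof -
      have "smooth_on UNIV (\<lambda>t::real. 1 - exp (- real n * t))"
        by (intro smooth_on_diff smooth_on_const smooth_on_compose_real[OF open_UNIV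
            smooth_on_exp] smooth_on_linear
            bounded_linear_mult_right) auto
      from X_smooth_compose[OF \<psi>(1) this] show ?thesis by (simp add: g_def[abs_def])
    qed
    have lim: "(\<lambda>n. integral\<^sup>L P (g n)) \<longlonglongrightarrow> measure P U"
      if P: "finite_measure P" "space P = X_set E" "sets P = borel_in (X_top E)"
        "\<And>\<psi>. X_smooth E \<psi> \<Longrightarrow> integrable P \<psi>" for P
    proof -
      interpret finite_measure P by (rule P(1))
      have UP: "U \<in> sets P" using \<open>U \<in> pos_sets\<close> borel_X_pos_sets P(3) by auto
      have "(\<lambda>n. integral\<^sup>L P (g n)) \<longlonglongrightarrow> integral\<^sup>L P (indicator U :: _ \<Rightarrow> real)"
      proof (rule integral_dominated_convergence[where w = "\<lambda>_. 1"])
        show "(indicator U :: _ \<Rightarrow> real) \<in> borel_measurable P" using UP by simp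
        show "g n \<in> borel_measurable P" for n using P(4)[OF gs] by auto
        show "AE x in P. (\<lambda>n. g n x) \<longlonglongrightarrow> indicator U x"
        proof (rule AE_I2)
          fix x assume "x \<in> space P"
          then have x: "x \<in> X_set E" using P(2) by simp
          show "(\<lambda>n. g n x) \<longlonglongrightarrow> indicator U x"
          proof (cases "\<psi> x > 0")
            case True
            then have "(\<lambda>n. exp (- real n * \<psi> x)) \<longlonglongrightarrow> 0" by real_asymp
            from tendsto_diff[OF tendsto_const[of 1] this] show ?thesis
              using True x by (simp add: g_def U)
          next
            case False
            then have "\<psi> x = 0" using \<psi>(2)[of x] by simp
            then show ?thesis by (simp add: g_def U)
          qed
        qed
        show "AE x in P. norm (g n x) \<le> 1" for n
          using \<psi>(2) by (intro AE_I2) (auto simp: g_def)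
      qed simp
      then show ?thesis using UP by simp
    qed
    have "(\<lambda>n. integral\<^sup>L M (g n)) \<longlonglongrightarrow> measure M U" using M by (intro lim) auto
    moreover have "(\<lambda>n. integral\<^sup>L N (g n)) \<longlonglongrightarrow> measure N U" using N by (intro lim) auto
    moreover have "integral\<^sup>L M (g n) = integral\<^sup>L N (g n)" for n
      using M(4)[OF gs] N(4)[OF gs] by simp
    ultimately have "measure M U = measure N U" using LIMSEQ_unique by simp
    then show ?thesis
      using M(1) N(1) by (simp add: finite_measure.emeasure_eq_measure)
  qed
qed auto

end

section \<open>The currents along the two sections\<close>

context conical
begin

lemma s_fun_True:
  assumes "T \<in> trivs E" "p \<in> fst T" "w \<noteq> 0"
  shows "s_fun E hn (pnt T True p w) = - ln ((cmod w)\<^sup>2) + ln (lm T p)"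
proof -
  have "pnt T True p w = pnt T False p (1 / w)" using pnt_flip[OF assms, of True] by simp
  then show ?thesis
    using s_fun_pnt[OF assms(1,2), of "1 / w"] assms(3)
      by (simp add: norm_divide power_divide ln_div)
qed

text \<open>Tubes around a section whose radius varies with the base point through \<open>G\<close>.
  The choices \<open>exp Z / t\<close> and \<open>t / exp Z\<close> give the regions
  \<open>s < Z\<close> and \<open>s > Z\<close> around \<open>S_zero E\<close> and
  \<open>S_inf E\<close>.\<close>

lemma open_lm_set:
  assumes C: "C \<in> charts E" and T: "T \<in> trivs E" and G: "continuous_on {0<..} G"
  shows "openin (X_top E) {pnt T b p w | p w. p \<in> fst C \<inter> fst T \<and> (cmod w)\<^sup>2 < G (lm T p)}" (is
      "openin _ ?N")
proof -
  have ix: "(C, T, b) \<in> X_index E" using C T by (simp add: X_index_iff)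
  have sub: "?N \<subseteq> X_dom E (C, T, b)" unfolding X_dom_eq[OF T] by blast
  let ?S = "snd C ` (fst C \<inter> fst T)"
  have op: "open (?S \<times> (UNIV :: complex set))" by (intro open_Times open_CT C T open_UNIV)
  have "continuous_on ?S (\<lambda>z. lm T (cinv C z))" by (rule smooth_on_continuous[OF lm_smooth[OF T C]])
  then have "continuous_on ?S (\<lambda>z. G (lm T (cinv C z)))"
    by (rule continuous_on_compose2[OF G]) (use lm_pos[OF T] C in auto)
  then have "continuous_on (?S \<times> UNIV) (\<lambda>y. G (lm T (cinv C (fst y))))"
    by (rule continuous_on_compose2) (auto intro: continuous_intros)
  then have c: "continuous_on (?S \<times> UNIV) (\<lambda>y. G (lm T (cinv C (fst y))) - (cmod (snd y))\<^sup>2)"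
    by (intro continuous_intros)
  have "X_chart E (C, T, b) ` ?N = (?S \<times> UNIV) \<inter> (\<lambda>y. G (lm T (cinv C (fst y))) -
      (cmod (snd y))\<^sup>2) -` {0<..}"
  proof (intro equalityI subsetI)
    fix y assume "y \<in> X_chart E (C, T, b) ` ?N"
    then obtain p w where p: "y = X_chart E (C, T, b) (pnt T b p w)" "p \<in> fst C" "p \<in> fst T"
        "(cmod w)\<^sup>2 < G (lm T p)"
      by blast
    then have "y = (snd C p, w)" using X_chart_pnt[OF T] by simp
    then show "y \<in> (?S \<times> UNIV) \<inter> (\<lambda>y. G (lm T (cinv C (fst y))) - (cmod (snd y))\<^sup>2) -` {0<..}"
      using p C by auto
  next
    fix y assume y: "y \<in> (?S \<times> UNIV) \<inter> (\<lambda>y. G (lm T (cinv C (fst y))) - (cmod (snd y))\<^sup>2) -` {0<..}"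
    then have "fst y \<in> ?S" by (simp add: mem_Times_iff)
    then obtain p where p: "fst y = snd C p" "p \<in> fst C" "p \<in> fst T" by blast
    then have "y = X_chart E (C, T, b) (pnt T b p (snd y))"
      by (simp add: X_chart_pnt[OF T] prod_eq_iff)
    moreover have "pnt T b p (snd y) \<in> ?N" using y p C by auto
    ultimately show "y \<in> X_chart E (C, T, b) ` ?N" by (rule image_eqI)
  qed
  moreover have "open ((?S \<times> UNIV) \<inter> (\<lambda>y. G (lm T (cinv C (fst y))) - (cmod (snd y))\<^sup>2) -` {0<..})"
    by (rule continuous_open_preimage[OF c op]) simp
  ultimately show ?thesis using openin_X_chart[OF ix sub] by simp
qed

text \<open>\<open>cont_ext\<close> is defined through \<open>Lim\<close>, which determines a value
  only along a nontrivial filter; so the points of the two sections have to be accumulation points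
  of \<open>X_reg E\<close>.\<close>

lemma nontrivial_at_0:
  assumes T: "T \<in> trivs E" "p \<in> fst T"
  shows "atin_within (X_top E) (pnt T b p 0) (X_reg E) \<noteq> bot"
proof
  assume "atin_within (X_top E) (pnt T b p 0) (X_reg E) = bot"
  then have "eventually (\<lambda>_. False) (atin_within (X_top E) (pnt T b p 0) (X_reg E))" by simp
  then obtain U where U: "openin (X_top E) U" "pnt T b p 0 \<in> U" "\<forall>x\<in>U. x \<in> X_reg E \<and>
      x \<noteq> pnt T b p 0 \<longrightarrow> False"
    unfolding eventually_atin_within topspace_X using pnt_X_set[OF T] by blast
  obtain C where C: "C \<in> charts E" "p \<in> fst C" using chart_cover by blast
  have ix: "(C, T, b) \<in> X_index E" using C T by (simp add: X_index_iff)
  have op: "open (X_chart E (C, T, b) ` (U \<inter> X_dom E (C, T, b)))"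
    using U(1) ix unfolding openin_X by blast
  have "pnt T b p 0 \<in> X_dom E (C, T, b)" using pnt_X_dom[OF T T(1)] C T by simp
  then have "(snd C p, 0) \<in> X_chart E (C, T, b) ` (U \<inter> X_dom E (C, T, b))"
    using U(2) X_chart_pnt[OF T, of C b 0] by (metis IntI imageI)
  then obtain e where e: "e > 0" "ball (snd C p, 0) e \<subseteq> X_chart E (C, T, b)
      ` (U \<inter> X_dom E (C, T, b))"
    using op openE by blast
  \<comment> \<open>The witness leaves the section in the fibre direction only, by half the
    radius.\<close>
  have "(snd C p, complex_of_real (e / 2)) \<in> ball (snd C p, 0) e"
    using e(1) by (simp add: dist_Pair_Pair norm_of_real del: of_real_divide)
  then have "(snd C p, complex_of_real (e / 2)) \<in> X_chart E (C, T, b) ` (U \<inter> X_dom E (C, T, b))"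
    by (rule subsetD[OF e(2)])
  then obtain x where x0: "(snd C p, complex_of_real (e / 2)) = X_chart E (C, T, b) x"
      "x \<in> U \<inter> X_dom E (C, T, b)"
    by (rule imageE)
  have x: "x \<in> U" "x \<in> X_dom E (C, T, b)" by (rule IntD1[OF x0(2)], rule IntD2[OF x0(2)])
  have "x \<in> {pnt T b q w | q w. q \<in> fst C \<inter> fst T}" using x(2) X_dom_eq[OF T(1)] by simp
  then obtain q w where q: "x = pnt T b q w" "q \<in> fst T" by blast
  have "w = of_real (e / 2)" using x0(1) X_chart_pnt[OF T(1) q(2)] q(1) by simp
  have "w \<noteq> 0"
  proof
    assume "w = 0"
    then have "complex_of_real (e / 2) = 0" using \<open>w = of_real (e / 2)\<close> by metis
    then show False using e(1) by (simp only: of_real_eq_0_iff)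
  qed
  then have "x \<in> X_reg E" using pnt_X_reg[OF T(1) q(2)] q(1) by simp
  moreover have "pnt T b p 0 \<notin> X_reg E" using pnt_X_reg[OF T] by simp
  ultimately show False using U(3) x(1) by metis
qed

lemma s_fun_at_S_zero:
  assumes T: "T \<in> trivs E" "p \<in> fst T"
  shows "filterlim (s_fun E hn) at_bot (atin_within (X_top E) (pnt T False p 0) (X_reg E))"
  unfolding filterlim_at_bot
proof
  fix Z :: real
  obtain C where C: "C \<in> charts E" "p \<in> fst C" using chart_cover by blast
  let ?N = "{pnt T False q w | q w. q \<in> fst C \<inter> fst T \<and> (cmod w)\<^sup>2 < exp Z / lm T q}"
  have "openin (X_top E) ?N"
    by (rule open_lm_set[OF C(1) T(1), where G = "\<lambda>t. exp Z / t"]) (intro continuous_intros, auto)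
  moreover have "pnt T False p 0 \<in> ?N"
    using C T lm_pos[OF T] by (intro CollectI exI[of _ p] exI[of _ 0]) simp
  moreover have "s_fun E hn x \<le> Z" if "x \<in> ?N" "x \<in> X_reg E" for x
  proof -
    obtain q w where q: "x = pnt T False q w" "q \<in> fst T" "(cmod w)\<^sup>2 < exp Z / lm T q"
      using \<open>x \<in> ?N\<close> by blast
    have w: "w \<noteq> 0" using \<open>x \<in> X_reg E\<close> q pnt_X_reg[OF T(1) q(2)] by simp
    have l: "lm T q > 0" by (rule lm_pos[OF T(1) q(2)])
    have "ln ((cmod w)\<^sup>2) < ln (exp Z / lm T q)" using q(3) w l by (subst ln_less_cancel_iff) auto
    also have "\<dots> = Z - ln (lm T q)" using l by (simp add: ln_div)
    finally show ?thesis using s_fun_pnt[OF T(1) q(2) w] q(1) by simp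
  qed
  ultimately show "eventually (\<lambda>x. s_fun E hn x \<le>
      Z) (atin_within (X_top E) (pnt T False p 0) (X_reg E))"
    unfolding eventually_atin_within by blast
qed

lemma s_fun_at_S_inf:
  assumes T: "T \<in> trivs E" "p \<in> fst T"
  shows "filterlim (s_fun E hn) at_top (atin_within (X_top E) (pnt T True p 0) (X_reg E))"
  unfolding filterlim_at_top
proof
  fix Z :: real
  obtain C where C: "C \<in> charts E" "p \<in> fst C" using chart_cover by blast
  let ?N = "{pnt T True q w | q w. q \<in> fst C \<inter> fst T \<and> (cmod w)\<^sup>2 < lm T q / exp Z}"
  have "openin (X_top E) ?N"
    by (rule open_lm_set[OF C(1) T(1), where G = "\<lambda>t. t / exp Z"]) (intro continuous_intros, auto)
  moreover have "pnt T True p 0 \<in> ?N"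
    using C T lm_pos[OF T] by (intro CollectI exI[of _ p] exI[of _ 0]) simp
  moreover have "s_fun E hn x \<ge> Z" if "x \<in> ?N" "x \<in> X_reg E" for x
  proof -
    obtain q w where q: "x = pnt T True q w" "q \<in> fst T" "(cmod w)\<^sup>2 < lm T q / exp Z"
      using \<open>x \<in> ?N\<close> by blast
    have w: "w \<noteq> 0" using \<open>x \<in> X_reg E\<close> q pnt_X_reg[OF T(1) q(2)] by simp
    have l: "lm T q > 0" by (rule lm_pos[OF T(1) q(2)])
    have "ln ((cmod w)\<^sup>2) < ln (lm T q / exp Z)" using q(3) w l by (subst ln_less_cancel_iff) auto
    also have "\<dots> = ln (lm T q) - Z" using l by (simp add: ln_div)
    finally show ?thesis using s_fun_True[OF T(1) q(2) w] q(1) by simp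
  qed
  ultimately show "eventually (\<lambda>x. s_fun E hn x \<ge> Z) (atin_within (X_top E) (pnt T True p 0)
      (X_reg E))"
    unfolding eventually_atin_within by blast
qed

lemma cont_ext_S_zero:
  assumes "T \<in> trivs E" "p \<in> fst T" "(F \<longlongrightarrow> L) at_bot"
  shows "cont_ext E (\<lambda>x. F (s_fun E hn x)) (pnt T False p 0) = L"
proof -
  have "pnt T False p 0 \<notin> X_reg E" using pnt_X_reg[OF assms(1,2)] by simp
  then show ?thesis
    unfolding cont_ext_def
    using tendsto_Lim[OF nontrivial_at_0[OF assms(1,2)] filterlim_compose[OF assms(3)
        s_fun_at_S_zero[OF assms(1,2)]]]
    by simp
qed

lemma cont_ext_S_inf:
  assumes "T \<in> trivs E" "p \<in> fst T" "(F \<longlongrightarrow> L) at_top"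
  shows "cont_ext E (\<lambda>x. F (s_fun E hn x)) (pnt T True p 0) = L"
proof -
  have "pnt T True p 0 \<notin> X_reg E" using pnt_X_reg[OF assms(1,2)] by simp
  then show ?thesis
    unfolding cont_ext_def
    using tendsto_Lim[OF nontrivial_at_0[OF assms(1,2)] filterlim_compose[OF assms(3)
        s_fun_at_S_inf[OF assms(1,2)]]]
    by simp
qed

abbreviation "hp \<equiv> hpot E hn f"

lemma hpot_reg: "x \<in> X_reg E \<Longrightarrow> hp x = \<gamma> (s_fun E hn x)"
  by (simp add: hpot_def cont_ext_def \<gamma>_def)

lemma hpot_S_zero: "T \<in> trivs E \<Longrightarrow> p \<in> fst T \<Longrightarrow> hp (pnt T False p 0) = 1"
  unfolding hpot_def using cont_ext_S_zero[OF _ _ lim_bot] by (simp add: \<gamma>_def)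

lemma hpot_S_inf: "T \<in> trivs E \<Longrightarrow> p \<in> fst T \<Longrightarrow> hp (pnt T True p 0) = m + 1"
  unfolding hpot_def using cont_ext_S_inf[OF _ _ lim_top] by (simp add: \<gamma>_def)

text \<open>To be used with \<open>t = exp s = |w|^2 h\<close>, which is continuous across the
  section and vanishes exactly there; this gives continuity jointly in the base and fibre
  coordinates.\<close>

lemma continuous_on_log_ext:
  assumes F: "continuous_on UNIV F" "(F \<longlongrightarrow> L) at_bot"
  shows "continuous_on {0..} (\<lambda>t::real. if t > 0 then F (ln t) else L)"
  unfolding continuous_on_eq_continuous_within
proof
  fix t :: real assume "t \<in> {0..}"
  show "continuous (at t within {0..}) (\<lambda>t. if t > 0 then F (ln t) else L)"
  proof (cases "t > 0")
    case True
    have "continuous_on {0<..} (\<lambda>t. F (ln t))"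
      by (intro continuous_on_compose2[OF F(1)] continuous_intros) auto
    then have "isCont (\<lambda>t. F (ln t)) t" using True by (simp add: continuous_on_eq_continuous_at)
    moreover have "eventually (\<lambda>t. (if t > 0 then F (ln t) else L) = F (ln t)) (nhds t)"
      using eventually_nhds_in_open[of "{0<..}" t] True by (auto elim: eventually_mono)
    ultimately have "isCont (\<lambda>t. if t > 0 then F (ln t) else L) t" by (subst isCont_cong)
    then show ?thesis by (rule continuous_at_imp_continuous_at_within)
  next
    case False
    then have t: "t = 0" using \<open>t \<in> {0..}\<close> by simp
    have "((\<lambda>t. F (ln t)) \<longlongrightarrow> L) (at_right 0)" by (rule filterlim_compose[OF F(2) ln_at_0])
    then have "((\<lambda>t. if t > 0 then F (ln t) else L) \<longlongrightarrow> L) (at_right 0)"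
      by (rule Lim_transform_eventually) (auto simp: eventually_at_filter)
    moreover have "at (0::real) within {0..} = at_right 0"
    proof -
      have "{0::real..} - {0} = {0<..} - {0}" by auto
      then show ?thesis by (simp add: at_within_def)
    qed
    ultimately show ?thesis unfolding t continuous_within by simp
  qed
qed

lemma continuous_hpot: "continuous_map (X_top E) euclideanreal hp"
proof (rule continuous_map_X)
  fix C T b assume C: "C \<in> charts E" and T: "T \<in> trivs E"
  let ?S = "snd C ` (fst C \<inter> fst T)"
  have lmc: "continuous_on (?S \<times> (UNIV::complex set)) (\<lambda>y. lm T (cinv C (fst y)))"
    by (rule continuous_on_compose2[OF smooth_on_continuous[OF lm_smooth[OF T C]]])
        (auto intro: continuous_intros)
  show "continuous_on (?S \<times> UNIV) (\<lambda>y. hp (pnt T b (cinv C (fst y)) (snd y)))"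
  proof (cases b)
    case False
    let ?G = "\<lambda>t::real. if t > 0 then \<gamma> (ln t) else 1"
    have "continuous_on (?S \<times> UNIV) (\<lambda>y. ?G ((cmod (snd y))\<^sup>2 * lm T (cinv C (fst y))))"
      by (rule continuous_on_compose2[OF continuous_on_log_ext[OF continuous_\<gamma> lim_bot]])
        (use lmc C lm_pos[OF T, THEN less_imp_le] in \<open>auto intro!: continuous_intros\<close>)
    then show ?thesis
    proof (rule continuous_on_eq)
      fix y assume "y \<in> ?S \<times> (UNIV :: complex set)"
      then have "fst y \<in> ?S" by (simp add: mem_Times_iff)
      then obtain p where p: "fst y = snd C p" "p \<in> fst C" "p \<in> fst T" by blast
      have l: "lm T p > 0" by (rule lm_pos[OF T p(3)])
      show "?G ((cmod (snd y))\<^sup>2 * lm T (cinv C (fst y))) = hp (pnt T b (cinv C (fst y)) (snd y))"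
      proof (cases "snd y = 0")
        case True
        then show ?thesis using hpot_S_zero[OF T p(3)] p C False by simp
      next
        case w: False
        then have "pnt T False p (snd y) \<in> X_reg E" using pnt_X_reg[OF T p(3)] by simp
        then show ?thesis
          using hpot_reg s_fun_pnt[OF T p(3) w] p C False w l by (simp add: ln_mult_pos)
      qed
    qed
  next
    case True
    \<comment> \<open>At the other section the coordinate is the reciprocal and
      \<open>t = |w|^2 / h\<close> is \<open>exp (- s)\<close>; hence the sign and the limit
      \<open>m + 1\<close>.\<close>
    let ?G = "\<lambda>t::real. if t > 0 then \<gamma> (- ln t) else m + 1"
    have "continuous_on UNIV (\<lambda>r. \<gamma> (- r))"
      by (intro continuous_on_compose2[OF continuous_\<gamma>] continuous_intros) auto
    moreover have "((\<lambda>r. \<gamma> (- r)) \<longlongrightarrow> m + 1) at_bot"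
      using lim_top by (simp add: filterlim_at_top_mirror)
    ultimately have G: "continuous_on {0..} ?G" by (rule continuous_on_log_ext)
    have "continuous_on (?S \<times> UNIV) (\<lambda>y. ?G ((cmod (snd y))\<^sup>2 / lm T (cinv C (fst y))))"
      by (rule continuous_on_compose2[OF G])
        (use lmc C lm_pos[OF T, THEN less_imp_le] lm_pos[OF T, THEN less_imp_neq]
            in \<open>auto intro!: continuous_intros\<close>)
    then show ?thesis
    proof (rule continuous_on_eq)
      fix y assume "y \<in> ?S \<times> (UNIV :: complex set)"
      then have "fst y \<in> ?S" by (simp add: mem_Times_iff)
      then obtain p where p: "fst y = snd C p" "p \<in> fst C" "p \<in> fst T" by blast
      have l: "lm T p > 0" by (rule lm_pos[OF T p(3)])
      show "?G ((cmod (snd y))\<^sup>2 / lm T (cinv C (fst y))) = hp (pnt T b (cinv C (fst y)) (snd y))"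
      proof (cases "snd y = 0")
        case w: True
        then show ?thesis using hpot_S_inf[OF T p(3)] p C True by simp
      next
        case w: False
        then have "pnt T True p (snd y) \<in> X_reg E" using pnt_X_reg[OF T p(3)] by simp
        then show ?thesis using hpot_reg s_fun_True[OF T p(3) w] p C True w l by (simp add: ln_div)
      qed
    qed
  qed
qed

lemma continuous_s_fun: "continuous_map Xr euclideanreal (s_fun E hn)"
  unfolding continuous_map_def topspace_Xr
proof (intro conjI allI impI)
  fix U :: "real set" assume "openin euclideanreal U"
  then have U: "open U" by simp
  let ?V = "{x \<in> X_reg E. s_fun E hn x \<in> U}"
  have each: "openin Xr (?V \<inter> R_dom E (C, T))" if C: "C \<in> charts E" and T: "T \<in> trivs E" for C T
  proof -
    let ?S = "snd C ` (fst C \<inter> fst T)"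
    have e: "continuous_on ?S (eta C T)" by (rule smooth_on_continuous[OF eta_smooth[OF C T]])
    have c: "continuous_on (?S \<times> (- {0})) (\<lambda>y. ss C T y)"
      by (intro continuous_intros continuous_on_compose2[OF e]) auto
    have sv: "s_fun E hn (pnt T False p w) = ss C T (snd C p, w)" if "p \<in> fst C" "p \<in> fst T"
        "w \<noteq> 0" for p w
      using ss_pnt[OF C T that] by simp
    have "R_chart E (C, T) ` (?V \<inter> R_dom E (C, T)) = (?S \<times> (- {0})) \<inter> (\<lambda>y. ss C T y) -` U"
    proof (intro equalityI subsetI)
      fix y assume "y \<in> R_chart E (C, T) ` (?V \<inter> R_dom E (C, T))"
      then obtain x where x: "y = R_chart E (C, T) x" "x \<in> R_dom E (C, T)" "s_fun E hn x \<in> U"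
        by blast
      obtain p w where p: "x = pnt T False p w" "p \<in> fst C" "p \<in> fst T" "w \<noteq> 0"
        by (rule R_domE[OF x(2) T])
      then have "y = (snd C p, w)" using x(1) R_chart_pnt[OF T p(3)] by simp
      then show "y \<in> (?S \<times> (- {0})) \<inter> (\<lambda>y. ss C T y) -` U" using x(3) sv[OF p(2-4)] p by auto
    next
      fix y assume y: "y \<in> (?S \<times> (- {0})) \<inter> (\<lambda>y. ss C T y) -` U"
      then have "fst y \<in> ?S" and w: "snd y \<noteq> 0" by (simp_all add: mem_Times_iff)
      then obtain p where p: "fst y = snd C p" "p \<in> fst C" "p \<in> fst T" by blast
      have "y = R_chart E (C, T) (pnt T False p (snd y))"
        using R_chart_pnt[OF T p(3)] p(1) by (simp add: prod_eq_iff)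
      moreover have "pnt T False p (snd y) \<in> R_dom E (C, T)"
        unfolding R_dom_eq[OF T] using p w by blast
      moreover have "pnt T False p (snd y) \<in> ?V"
        using pnt_X_reg[OF T p(3)] sv[OF p(2,3) w] y w p by simp
      ultimately show "y \<in> R_chart E (C, T) ` (?V \<inter> R_dom E (C, T))" by (intro image_eqI IntI)
    qed
    moreover have "open ((?S \<times> (- {0})) \<inter> (\<lambda>y. ss C T y) -` U)"
      by (rule continuous_open_preimage[OF c _ U]) (intro open_Times open_CT C T,
          simp add: open_Compl)
    ultimately show ?thesis using R_open_iff[OF C T, of "?V \<inter> R_dom E (C, T)"] by simp
  qed
  have "?V = (\<Union>(C, T)\<in>charts E \<times> trivs E. ?V \<inter> R_dom E (C, T))"
  proof (intro equalityI subsetI)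
    fix x assume x: "x \<in> ?V"
    then obtain C T where "C \<in> charts E" "T \<in> trivs E" "x \<in> R_dom E (C, T)"
      using X_reg_R_dom by blast
    then show "x \<in> (\<Union>(C, T)\<in>charts E \<times> trivs E. ?V \<inter> R_dom E (C, T))" using x by blast
  qed auto
  moreover have "openin Xr (\<Union>(C, T)\<in>charts E \<times> trivs E. ?V \<inter> R_dom E (C, T))"
    using each by (intro openin_Union) auto
  ultimately show "openin Xr ?V" by simp
qed auto

section \<open>Integrability and the measures of the two currents\<close>

lemma scal_integrable: "integrable vol (higher_scal E hn f)"
  and hpot_integrable: "integrable vol hp"
  and hpot_scal_integrable: "integrable vol (\<lambda>x. hp x * higher_scal E hn f x)"
proof -
  interpret finite_measure vol by (rule finite_vol)
  have comp: "(\<lambda>x. G (s_fun E hn x)) \<in> borel_measurable vol" if "continuous_on UNIV G" for G ::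
      "real \<Rightarrow> real"
    using measurable_compose[OF continuous_measurable_vol[OF continuous_s_fun]
        borel_measurable_continuous_onI[OF that]] .
  obtain M where M: "\<And>r. \<bar>Lam r\<bar> \<le> M" using bounded_Lam by blast
  have hs: "x \<in> space vol \<Longrightarrow> higher_scal E hn f x = Lam (s_fun E hn x)" and hh: "x \<in> space vol \<Longrightarrow>
      hp x = \<gamma> (s_fun E hn x)" for x
    using higher_scal_eq hpot_reg vol_space by simp_all
  have \<gamma>b: "\<bar>\<gamma> r\<bar> \<le> m + 1" for r using \<gamma>_range[of r] by simp
  have 1: "integrable vol (\<lambda>x. Lam (s_fun E hn x))"
    by (rule integrable_const_bound[of _ M]) (use M comp[OF continuous_Lam] in auto)
  have 2: "integrable vol (\<lambda>x. \<gamma> (s_fun E hn x))"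
    by (rule integrable_const_bound[of _ "m + 1"]) (use \<gamma>b comp[OF continuous_\<gamma>] in auto)
  have 3: "integrable vol (\<lambda>x. \<gamma> (s_fun E hn x) * Lam (s_fun E hn x))"
  proof (rule integrable_const_bound[of _ "(m + 1) * M"])
    show "AE x in vol. norm (\<gamma> (s_fun E hn x) * Lam (s_fun E hn x)) \<le> (m + 1) * M"
      using M \<gamma>b m by (intro AE_I2) (auto simp: abs_mult intro!: mult_mono)
    show "(\<lambda>x. \<gamma> (s_fun E hn x) * Lam (s_fun E hn x)) \<in> borel_measurable vol"
      using comp[OF continuous_\<gamma>] comp[OF continuous_Lam] by (rule borel_measurable_times)
  qed
  show "integrable vol (higher_scal E hn f)"
    using 1 by (subst Bochner_Integration.integrable_cong[OF refl hs])
  show "integrable vol hp" using 2 by (subst Bochner_Integration.integrable_cong[OF refl hh])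
  show "integrable vol (\<lambda>x. hp x * higher_scal E hn f x)"
    using 3 by (rule Bochner_Integration.integrable_cong[THEN iffD1, rotated 2])
        (simp_all add: hs hh)
qed

lemma X_smooth_sec:
  assumes \<psi>: "X_smooth E \<psi>" and sec: "\<And>T p. T \<in> trivs E \<Longrightarrow> p \<in> fst T \<Longrightarrow> sec p = pnt T b p 0"
    and C: "C \<in> charts E" and T: "T \<in> trivs E"
  shows "smooth_on (snd C ` (fst C \<inter> fst T)) (\<lambda>z. \<psi> (sec (cinv C z)))"
proof -
  let ?S = "snd C ` (fst C \<inter> fst T)"
  have S: "open ?S" by (rule open_CT[OF C T])
  have b: "smooth_on ?S (\<lambda>z. (z, 0::complex) \<bullet> e)" for e
    by (intro smooth_on_linear bounded_linear_compose[OF bounded_linear_inner_left]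
        bounded_linear_Pair bounded_linear_ident bounded_linear_zero)
  have "smooth_on ?S (\<lambda>z. (\<lambda>y. \<psi> (pnt T b (cinv C (fst y)) (snd y))) (z, 0))"
    by (rule smooth_on_compose[OF S X_smoothD[OF \<psi> C T] b]) auto
  then show ?thesis
    by (rule smooth_on_cong[OF S, rotated]) (use sec[OF T] C in auto)
qed

definition "X_borel = sigma (X_set E) {U. openin (X_top E) U}"

lemma X_borel: "space X_borel = X_set E" "sets X_borel = borel_in (X_top E)"
  unfolding X_borel_def borel_in_def topspace_X
  using openin_subset[of "X_top E"]
    by (auto simp: topspace_X space_measure_of_conv intro!: sets_measure_of)

lemma measurable_sec:
  assumes "continuous_map euclidean (X_top E) sec"
  shows "sec \<in> measurable area X_borel"
  unfolding X_borel_def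
proof (rule measurable_measure_of)
  show "{U. openin (X_top E) U} \<subseteq> Pow (X_set E)"
    using openin_subset[of "X_top E"] by (auto simp: topspace_X)
  show "sec \<in> space area \<rightarrow> X_set E"
    using assms unfolding continuous_map_def topspace_X by (auto simp: area_space)
  fix U assume "U \<in> {U. openin (X_top E) U}"
  then have "openin euclidean {p. sec p \<in> U}" using assms unfolding continuous_map_def by auto
  moreover have "sec -` U \<inter> space area = {p. sec p \<in> U}" by (auto simp: area_space)
  ultimately show "sec -` U \<inter> space area \<in> sets area" by (simp add: area_space)
qed

lemma continuous_measurable_X_borel:
  fixes F :: "'l pt \<Rightarrow> real"
  assumes "continuous_map (X_top E) euclideanreal F"
  shows "F \<in> borel_measurable X_borel"
proof (rule borel_measurableI)
  fix U :: "real set" assume "open U"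
  then have "openin (X_top E) {x \<in> X_set E. F x \<in> U}"
    using assms unfolding continuous_map_def topspace_X by simp
  moreover have "F -` U \<inter> space X_borel = {x \<in> X_set E. F x \<in> U}" using X_borel by auto
  ultimately show "F -` U \<inter> space X_borel \<in> sets X_borel"
    unfolding X_borel borel_in_def by (auto intro: sigma_sets.Basic)
qed

lemma integrable_area_continuous:
  fixes g :: "'a \<Rightarrow> real"
  assumes "continuous_on UNIV g"
  shows "integrable area g"
proof -
  interpret finite_measure area by (rule finite_area)
  have "compact (UNIV :: 'a set)"
    using genus_setup by (simp add: genus_two_setup_def compact_riemann_surface_def)
  then have "compact (g ` UNIV)" using assms by (intro compact_continuous_image)
  then have "bounded (range g)" by (rule compact_imp_bounded)
  then obtain B where B: "\<And>p. norm (g p) \<le> B" unfolding bounded_iff by blast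
  have "g \<in> borel_measurable area"
    using borel_measurable_continuous_onI[OF assms] area_space(2)
      by (simp cong: measurable_cong_sets)
  then show ?thesis by (intro integrable_const_bound[of _ B]) (use B in auto)
qed

lemma integral_distr_sec:
  assumes sec: "continuous_map euclidean (X_top E) sec" and F:
      "continuous_map (X_top E) euclideanreal F"
  shows "integrable (distr area X_borel sec) F" "(LINT x | distr area X_borel sec. F x) =
      (LINT p | area. F (sec p))"
proof -
  have "continuous_on UNIV (F \<circ> sec)" using continuous_map_compose[OF sec F] by simp
  then have "integrable area (\<lambda>p. F (sec p))" using integrable_area_continuous by (simp add: o_def)
  then show "integrable (distr area X_borel sec) F"
    by (subst integrable_distr_eq[OF measurable_sec[OF sec] continuous_measurable_X_borel[OF F]])
  show "(LINT x | distr area X_borel sec. F x) = (LINT p | area. F (sec p))"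
    by (rule integral_distr[OF measurable_sec[OF sec] continuous_measurable_X_borel[OF F]])
qed

text \<open>\<open>u\<close> stands for the extended potential. Being constant along the section, it
  leaves a multiple of \<open>ddbar_form\<close> under the integral, which is what
  \<open>Stokes\<close> treats.\<close>

lemma current_eq:
  assumes \<psi>: "X_smooth E \<psi>" and sec: "\<And>T p. T \<in> trivs E \<Longrightarrow> p \<in> fst T \<Longrightarrow> sec p = pnt T b p 0"
    and u: "\<And>p. u (sec p) = (L :: real)"
  shows "base_integral E (\<lambda>C p. \<psi> (sec p) * kform E C p) = (LINT p | area. \<psi> (sec p))"
    "base_integral E (\<lambda>C p. u (sec p) * ddbar_form (\<lambda>q. \<psi> (sec q)) C p) = 0"
proof -
  show "base_integral E (\<lambda>C p. \<psi> (sec p) * kform E C p) = (LINT p | area. \<psi> (sec p))"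
    by (rule base_integral_eqI) simp
  show "base_integral E (\<lambda>C p. u (sec p) * ddbar_form (\<lambda>q. \<psi> (sec q)) C p) = 0"
    unfolding u by (rule Stokes) (rule X_smooth_sec[OF \<psi> sec])
qed

lemma S_zero_ex1: "\<exists>!M. represents_current E (wedge_S_zero E hn f) M"
proof (rule ex_ex1I)
  obtain L where L: "(f \<longlongrightarrow> L) at_bot" using f_lim_bot by blast
  have u: "cont_ext E (\<lambda>x. f (s_fun E hn x)) (sec_zero E p) = L" for p
  proof -
    obtain T where T: "T \<in> trivs E" "p \<in> fst T" using triv_cover by blast
    show ?thesis unfolding sec_zero_eq[OF T] by (rule cont_ext_S_zero[OF T L])
  qed
  have "represents_current E (wedge_S_zero E hn f) (distr area X_borel (sec_zero E))"
    unfolding represents_current_def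
  proof (intro conjI allI impI)
    show "finite_measure (distr area X_borel (sec_zero E))"
      by (rule finite_measure.finite_measure_distr[OF finite_area measurable_sec[OF
          continuous_sec_zero]])
    fix \<psi> assume \<psi>: "X_smooth E \<psi>"
    note i = integral_distr_sec[OF continuous_sec_zero X_smooth_continuous[OF \<psi>]]
    show "integrable (distr area X_borel (sec_zero E)) \<psi>" by (rule i(1))
    show "integral\<^sup>L (distr area X_borel (sec_zero E)) \<psi> = wedge_S_zero E hn f \<psi>"
      unfolding i(2) wedge_S_zero_def
      using current_eq[OF \<psi> sec_zero_eq, of "cont_ext E (\<lambda>x. f (s_fun E hn x))" L] u by simp
  qed (simp_all add: X_borel)
  then show "\<exists>M. represents_current E (wedge_S_zero E hn f) M" by blast
qed (rule represents_current_unique)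

lemma S_inf_ex1: "\<exists>!M. represents_current E (wedge_S_inf E hn m f) M"
proof (rule ex_ex1I)
  obtain L where L: "((\<lambda>r. f r - m * r) \<longlongrightarrow> L) at_top" using f_lim_top by blast
  have u: "cont_ext E (\<lambda>x. f (s_fun E hn x) - m * s_fun E hn x) (sec_inf E p) = L" for p
  proof -
    obtain T where T: "T \<in> trivs E" "p \<in> fst T" using triv_cover by blast
    show ?thesis unfolding sec_inf_eq[OF T] by (rule cont_ext_S_inf[OF T L])
  qed
  let ?D = "distr area X_borel (sec_inf E)"
  \<comment> \<open>The weight is the coefficient \<open>m + 1\<close> of the pulled back Kaehler
    form in \<open>wedge_S_inf\<close>.\<close>
  let ?M = "density ?D (\<lambda>_. ennreal (m + 1))"
  have fin: "finite_measure ?D"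
    by (rule finite_measure.finite_measure_distr[OF finite_area measurable_sec[OF
        continuous_sec_inf]])
  have "represents_current E (wedge_S_inf E hn m f) ?M"
    unfolding represents_current_def
  proof (intro conjI allI impI)
    show "finite_measure ?M"
    proof (rule finite_measureI)
      have "emeasure ?M (space ?M) = ennreal (m + 1) * emeasure ?D (space ?D)"
        by (subst emeasure_density) (auto simp: nn_integral_cmult_indicator)
      then show "emeasure ?M (space ?M) \<noteq> \<infinity>"
        using finite_measure.emeasure_finite[OF fin] by (simp add: ennreal_mult_eq_top_iff)
    qed
    fix \<psi> assume \<psi>: "X_smooth E \<psi>"
    note i = integral_distr_sec[OF continuous_sec_inf X_smooth_continuous[OF \<psi>]]
    have ms: "\<psi> \<in> borel_measurable ?D" using i(1) by simp
    show "integrable ?M \<psi>"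
      using m i(1) by (subst integrable_density[OF ms]) auto
    have "integral\<^sup>L ?M \<psi> = (m + 1) * integral\<^sup>L ?D \<psi>"
      using m by (subst integral_density[OF ms]) auto
    then show "integral\<^sup>L ?M \<psi> = wedge_S_inf E hn m f \<psi>"
      unfolding i(2) wedge_S_inf_def
      using current_eq[OF \<psi> sec_inf_eq, of "cont_ext E (\<lambda>x. f (s_fun E hn x) -
          m * s_fun E hn x)" L] u
        by simp
  qed (simp_all add: X_borel)
  then show "\<exists>M. represents_current E (wedge_S_inf E hn m f) M" by blast
qed (rule represents_current_unique)

lemma hpot_bounded: "x \<in> X_set E \<Longrightarrow> \<bar>hp x\<bar> \<le> m + 1"
proof -
  assume "x \<in> X_set E"
  then obtain T b p w where x: "x = pnt T b p w" "T \<in> trivs E" "p \<in> fst T"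
    unfolding X_set_eq by blast
  show "\<bar>hp x\<bar> \<le> m + 1"
  proof (cases "w = 0")
    case True
    then show ?thesis using x hpot_S_zero[OF x(2,3)] hpot_S_inf[OF x(2,3)] m by (cases b) auto
  next
    case False
    then have "x \<in> X_reg E" using pnt_X_reg[OF x(2,3)] x(1) by simp
    then show ?thesis using hpot_reg \<gamma>_range[of "s_fun E hn x"] by simp
  qed
qed

text \<open>\<open>represents_current\<close> grants integrability to smooth functions only. The
  potential is merely continuous; it is integrable because it is bounded and Borel and the measure
  is finite.\<close>

lemma represents_hpot_integrable:
  assumes "represents_current E \<tau> M"
  shows "integrable M hp"
proof -
  have M: "finite_measure M" "space M = X_set E" "sets M = borel_in (X_top E)"
    using assms by (auto simp: represents_current_def)
  have "hp \<in> borel_measurable M"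
    using continuous_measurable_X_borel[OF continuous_hpot]
        X_borel M measurable_cong_sets[of M X_borel borel borel]
      by auto
  then show ?thesis
    by (intro finite_measure.integrable_const_bound[OF M(1), of _
        "m + 1"]) (use hpot_bounded M(2) in auto)
qed

lemma represents_S_zero: "represents_current E (wedge_S_zero E hn f) (S_zero_measure E hn f)"
  unfolding S_zero_measure_def current_measure_def by (rule theI'[OF S_zero_ex1])

lemma represents_S_inf: "represents_current E (wedge_S_inf E hn m f) (S_inf_measure E hn m f)"
  unfolding S_inf_measure_def current_measure_def by (rule theI'[OF S_inf_ex1])

section \<open>The formula for the invariant\<close>

lemma integral_vol_1: "(LINT x | vol. (1::real)) > 0"
  using measure_vol_pos vol_space by simp

lemma integral_hpot_scal_diff:
  "(LINT x | vol. hp x * (higher_scal E hn f x - k)) =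
     (LINT x | vol. hp x * higher_scal E hn f x) - k * (LINT x | vol. hp x)"
proof -
  have "(LINT x | vol. hp x * (higher_scal E hn f x - k)) =
      (LINT x | vol. hp x * higher_scal E hn f x - k * hp x)"
    by (rule Bochner_Integration.integral_cong) (auto simp: algebra_simps)
  also have "\<dots> = (LINT x | vol. hp x * higher_scal E hn f x) - (LINT x | vol. k * hp x)"
    using hpot_scal_integrable hpot_integrable by (intro Bochner_Integration.integral_diff) auto
  finally show ?thesis by simp
qed

text \<open>Integrability of the terms is used in \<open>integral_hpot_scal_diff\<close>, where the
  integral of a difference is split. The rest is algebra with the integrals as numbers and the
  nonzero volume \<open>V\<close> as denominator.\<close>

lemma log_futaki_formula:
  "log_futaki E hn m \<beta>0 \<beta>inf f = - (1 / (2 * (2 * pi)\<^sup>2)) *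
     (LINT x | vol. hp x * (higher_scal E hn f x - lambda_one E hn f))"
proof -
  define V where "V = (LINT x | vol. (1::real))"
  define c where "c = 1 / (2 * (2 * pi)\<^sup>2)"
  have V: "V \<noteq> 0" using integral_vol_1 by (simp add: V_def)
  have c: "c \<noteq> 0" by (simp add: c_def)
  \<comment> \<open>Applied both to \<open>hp\<close> and to the constant 1 inside
    \<open>lambda_zero\<close>.\<close>
  have i: "(LINT x | vol. \<psi> x * (higher_scal E hn f x / (2 * (2 * pi)\<^sup>2))) =
      c * (LINT x | vol. \<psi> x * higher_scal E hn f x)" for \<psi>
  proof -
    have "(LINT x | vol. \<psi> x * (higher_scal E hn f x / (2 * (2 * pi)\<^sup>2))) =
        (LINT x | vol. c * (\<psi> x * higher_scal E hn f x))"
      by (rule Bochner_Integration.integral_cong) (auto simp: c_def)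
    then show ?thesis by simp
  qed
  have c2: "2 * (2 * pi)\<^sup>2 = 1 / c" by (simp add: c_def)
  define b where "b = (\<beta>inf - 1) / ((m + 1) * pi)"
  show ?thesis
    unfolding log_futaki_def Let_def lambda_zero_def c2_current_def i integral_hpot_scal_diff
        lambda_one_def
      V_def[symmetric] c_def[symmetric] b_def[symmetric]
    unfolding c2 using V c by (simp add: field_simps)
qed

text \<open>A constant curvature equals its average \<open>lambda_one\<close>, so the integrand of
  the formula vanishes on the space of the measure.\<close>

lemma log_futaki_const:
  assumes "\<forall>x\<in>X_reg E. higher_scal E hn f x = k"
  shows "log_futaki E hn m \<beta>0 \<beta>inf f = 0"
proof -
  have "(LINT x | vol. higher_scal E hn f x) = (LINT x | vol. k)"
    by (rule Bochner_Integration.integral_cong) (use assms vol_space in auto)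
  then have "lambda_one E hn f = k"
    using integral_vol_1 by (simp add: lambda_one_def)
  moreover have "(LINT x | vol. hp x * (higher_scal E hn f x - k)) = (LINT x | vol. 0)"
    by (rule Bochner_Integration.integral_cong) (use assms vol_space in auto)
  ultimately show ?thesis by (simp add: log_futaki_formula)
qed

end

text \<open>What it means for the integrals to be well-defined and finite is spelled out: the unique
  existence clauses ensure that the descriptions behind the measures and the curvature denote, and
  the integrability clauses exclude the default value 0 of a Bochner integral.\<close>

theorem theorem7p2:
  fixes E :: "('a::t2_space, 'l) polarized_surface"
    and hn :: "'l \<Rightarrow> real" and f :: "real \<Rightarrow> real" and m \<beta>0 \<beta>inf :: real
  assumes "genus_two_setup E hn"
    and "m > 0" and "\<beta>0 > 0" and "\<beta>inf > 0"
    and "momentum_conical m \<beta>0 \<beta>inf f"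
  shows
    "((\<exists>!M. is_area_measure E M) \<and>
      (\<exists>!M. is_omega_sq_measure E hn f M) \<and>
      (\<forall>x\<in>X_reg E. \<exists>!l. is_higher_scalar_curvature E hn f x l) \<and>
      (\<exists>!M. represents_current E (wedge_S_zero E hn f) M) \<and>
      (\<exists>!M. represents_current E (wedge_S_inf E hn m f) M) \<and>
      continuous_map (X_top E) euclideanreal (hpot E hn f)) \<and>
     (finite_measure (omega_sq_measure E hn f) \<and>
      (LINT x | omega_sq_measure E hn f. (1::real)) > 0 \<and>
      integrable (omega_sq_measure E hn f) (hpot E hn f) \<and>
      integrable (omega_sq_measure E hn f) (higher_scal E hn f) \<and>
      integrable (omega_sq_measure E hn f) (\<lambda>x. hpot E hn f x * higher_scal E hn f x) \<and>
      finite_measure (S_zero_measure E hn f) \<and>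
      integrable (S_zero_measure E hn f) (hpot E hn f) \<and>
      finite_measure (S_inf_measure E hn m f) \<and>
      integrable (S_inf_measure E hn m f) (hpot E hn f)) \<and>
     log_futaki E hn m \<beta>0 \<beta>inf f =
       - (1 / (2 * (2 * pi)\<^sup>2)) *
         (LINT x | omega_sq_measure E hn f.
            hpot E hn f x * (higher_scal E hn f x - lambda_one E hn f)) \<and>
     ((\<exists>k. \<forall>x\<in>X_reg E. higher_scal E hn f x = k) \<longrightarrow> log_futaki E hn m \<beta>0 \<beta>inf f = 0)"
proof -
  interpret conical E hn m \<beta>0 \<beta>inf f
    using assms by unfold_locales
  have fin: "finite_measure (S_zero_measure E hn f)" "finite_measure (S_inf_measure E hn m f)"
    using represents_S_zero represents_S_inf by (simp_all add: represents_current_def)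
  show ?thesis
    by (intro conjI ballI impI area_ex1 vol_ex1 scal_ex1 S_zero_ex1 S_inf_ex1 continuous_hpot
        finite_vol
        integral_vol_1 hpot_integrable scal_integrable hpot_scal_integrable fin
        represents_hpot_integrable[OF represents_S_zero]
            represents_hpot_integrable[OF represents_S_inf]
        log_futaki_formula) (assumption, elim exE, erule log_futaki_const)
qed

end
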